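(* (BDF Serre's Formula) Let $k$ be a field, $\Gamma$ an abelian group, and $R$ a PDCF $\Gamma$-graded $k$-algebra which is an integral domain, such that the graded maximal ideal $R_+=\bigoplus_{q>_Q0}R_q$ is generated by a regular sequence $(r_i\mid i\in\mathbb{N})$ of homogeneous elements of $R$. The binary operation $$[M]\cdot[N]=\sum_{i=0}^\infty(-1)^i[\mathrm{Tor}^R_i(M,N)]$$ (on classes of BDF $\Gamma$-graded $R$-modules, extended biadditively, the series converging in the $Z^G$-adic topology) gives a well-defined commutative ring structure on $G^{\mathrm{BDF}}_{\Gamma,0}(R)$ with multiplicative identity $[R]$, and the group isomorphism $K^{\mathrm{BDF}}_{\Gamma,0}(R)\overset{\sim}{\to}G^{\mathrm{BDF}}_{\Gamma,0}(R)$, $[F]\mapsto[F]$, is a ring map, where $K^{\mathrm{BDF}}_{\Gamma,0}(R)$ carries the product $[F]\cdot[F']=[F\otimes_RF']$.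
   Context: Abelian groups and monoids are written additively. A $\Gamma$-graded $k$-algebra is a commutative $k$-algebra $R$ with $k$-subspaces $R_g$ ($g\in\Gamma$) such that $R=\bigoplus_{g\in\Gamma}R_g$ and $R_gR_h\subseteq R_{g+h}$. A $\Gamma$-graded $R$-module is an $R$-module $M$ with $k$-subspaces $M_g$ such that $M=\bigoplus_{g\in\Gamma}M_g$ and $R_gM_h\subseteq M_{g+h}$; elements of some $M_g$ are called homogeneous. An $R$-linear map $\varphi:M\to N$ is graded if $\varphi(M_g)\subseteq N_g$ for all $g$. Write $\mathrm{Supp}_\Gamma(M)=\{g\in\Gamma\mid M_g\neq 0\}$. Since $R$ is a domain, $Q:=\mathrm{Supp}_\Gamma(R)$ is a submonoid of $\Gamma$ (the image monoid). $Q$ is pointed if $p+q=0$ with $p,q\in Q$ implies $p=q=0$; then $g\le_Q h :\iff h-g\in Q$ is a partial order on $\Gamma$. A subset $U\subseteq\Gamma$ is downward finite if for every $g\in\Gamma$ the set $\{u\in U\mid u\le_Q g\}$ is finite; it is finitely bounded below if there are finitely many $p_1,\dots,p_n\in\Gamma$ such that every $u\in U$ satisfies $p_i\le_Q u$ for some $i$. $R$ is PDCF if $Q$ is pointed and downward finite, $R$ is connected ($R_0=k$), and $\dim_k R_g<\infty$ for all $g\in\Gamma$. A $\Gamma$-graded $R$-module $M$ is BDF if $\mathrm{Supp}_\Gamma(M)$ is finitely bounded below and downward finite and $\dim_k M_g<\infty$ for all $g\in\Gamma$. For BDF modules $M,N$, the BDF module $M\otimes_RN$ is graded with $(M\otimes_RN)_u$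 the $k$-span of the $x\otimes y$ with $x\in M_g$, $y\in N_h$, $g+h=u$. Every BDF module $M$ has a resolution $F_\bullet$ by free BDF $\Gamma$-graded modules with graded maps, and $\mathrm{Tor}^R_i(M,N)=H_i(F_\bullet\otimes_RN)$, a BDF $\Gamma$-graded $R$-module independent of $F_\bullet$ up to graded isomorphism. A family $(r_i\mid i\in\mathbb{N})$ ($\mathbb N=\{1,2,\dots\}$) in $R$ is a regular sequence if $(r_1,r_2,\dots)\neq R$ and for every $n\ge0$ the element $r_{n+1}$ is not a zero divisor on $R/(r_1,\dots,r_n)$. $K^{\mathrm{BDF}}_{\Gamma,0}(R)$ is the Grothendieck group (group completion) of the commutative monoid of graded isomorphism classes of BDF $\Gamma$-graded $R$-modules that are projective as $R$-modules (all such modules are in fact free), with operation $[M]+[N]=[M\oplus N]$; it is a commutative ring under the biadditive extension of $[F]\cdot[F']=[F\otimes_RF']$. $G^{\mathrm{BDF}}_{\Gamma,0}(R)$ is the free abelian group on the set of graded isomorphism classes of all BDF $\Gamma$-graded $R$-modules, modulo the subgroup generated by the expressions $[L]-[M]+[N]$ for all short exact sequences $0\to L\to M\to N\to0$ of BDF $\Gamma$-graded $R$-modules and graded maps. When $R$ is a PDCF $\Gamma$-graded $k$-algebra which is an integral domain and whose graded maximal ideal $R_+=\bigoplus_{q>_Q0}R_q$ is generated by a regular sequence $(r_i\mid i\in\mathbb{N})$ of homogeneous elements of $R$, $[F]\mapsto[F]$ induces a group isomorphism $K^{\mathrm{BDF}}_{\Gamma,0}(R)\to G^{\mathrm{BDF}}_{\Gamma,0}(R)$.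 $Z^G$-adic topology: for a finite subset $U\subseteq\Gamma$ let $(-\infty,U]=\{g\in\Gamma\mid\exists u\in U,\ g\le_Qu\}$, and let $Z^G_U$ be the subgroup of $G^{\mathrm{BDF}}_{\Gamma,0}(R)$ generated by all $[M]$ with $\mathrm{Supp}_\Gamma(M)\cap(-\infty,U]=\emptyset$. The cosets of the subgroups $Z^G_U$ form a base for the topology. A series $\sum_{a\in A}x_a$ converges to $x$ if for every finite $U\subseteq\Gamma$ there is a finite $B\subseteq A$ such that $x-\sum_{c\in C}x_c\in Z^G_U$ for every finite $C$ with $B\subseteq C\subseteq A$. *)

theory Defs
  imports "HOL-Algebra.Module" "HOL-Algebra.QuotRing" "HOL-Algebra.Free_Abelian_Groups"
begin

section \<open>Modules over a commutative ring\<close>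

text \<open>A \<open>\<Gamma>\<close>-grading is recorded by the family of homogeneous components.\<close>

record ('a, 'b, 'g) gmodule = "('a, 'b) module" +
  hcomp :: "'g \<Rightarrow> 'b set"

definition lin_maps ::
    "('a, 'w) ring_scheme \<Rightarrow> ('a, 'b, 'y) module_scheme \<Rightarrow> ('a, 'c, 'z) module_scheme \<Rightarrow> ('b \<Rightarrow> 'c) set"
  where "lin_maps R M N = {f \<in> carrier M \<rightarrow> carrier N.
    (\<forall>x\<in>carrier M. \<forall>y\<in>carrier M. f (x \<oplus>\<^bsub>M\<^esub> y) = f x \<oplus>\<^bsub>N\<^esub> f y) \<and>
    (\<forall>r\<in>carrier R. \<forall>x\<in>carrier M. f (r \<odot>\<^bsub>M\<^esub> x) = r \<odot>\<^bsub>N\<^esub> f x)}"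

definition lin_span :: "('a, 'w) ring_scheme \<Rightarrow> ('a, 'b, 'y) module_scheme \<Rightarrow> 'b set \<Rightarrow> 'b set"
  where "lin_span R M B = \<Inter>{H. submodule H R M \<and> B \<subseteq> H}"

definition finite_dim :: "('k, 'w) ring_scheme \<Rightarrow> ('k, 'b, 'y) module_scheme \<Rightarrow> 'b set \<Rightarrow> bool"
  where "finite_dim k V H \<longleftrightarrow> (\<exists>B. finite B \<and> B \<subseteq> H \<and> lin_span k V B = H)"

text \<open>Fields that play no role in a module (\<open>mult\<close> and \<open>one\<close>) are left \<open>undefined\<close>.\<close>

definition quot_module :: "('a, 'b, 'y) module_scheme \<Rightarrow> 'b set \<Rightarrow> ('a, 'b set) module"
  where "quot_module M H = \<lparr>carrier = a_rcosets\<^bsub>M\<^esub> H, monoid.mult = undefined, one = undefined,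
    ring.zero = H, add = set_add M, smult = (\<lambda>r X. \<Union>x\<in>X. H +>\<^bsub>M\<^esub> (r \<odot>\<^bsub>M\<^esub> x))\<rparr>"

definition free_module :: "('a, 'w) ring_scheme \<Rightarrow> 'x set \<Rightarrow> ('a, 'x \<Rightarrow> 'a) module"
  where "free_module R X = \<lparr>
    carrier = {f. (\<forall>x. f x \<in> carrier R) \<and> finite {x. f x \<noteq> \<zero>\<^bsub>R\<^esub>} \<and> {x. f x \<noteq> \<zero>\<^bsub>R\<^esub>} \<subseteq> X},
    monoid.mult = undefined, one = undefined,
    ring.zero = (\<lambda>x. \<zero>\<^bsub>R\<^esub>), add = (\<lambda>f g x. f x \<oplus>\<^bsub>R\<^esub> g x), smult = (\<lambda>r f x. r \<otimes>\<^bsub>R\<^esub> f x)\<rparr>"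

definition free_gen :: "('a, 'w) ring_scheme \<Rightarrow> 'x \<Rightarrow> 'x \<Rightarrow> 'a"
  where "free_gen R x = (\<lambda>y. if y = x then \<one>\<^bsub>R\<^esub> else \<zero>\<^bsub>R\<^esub>)"

text \<open>\<open>P\<close> is projective iff it is a direct summand of a free module.  Index sets inside the type
  of \<open>P\<close> suffice, since \<open>P\<close> is always a quotient of the free module on \<open>carrier P\<close>.\<close>

definition projective :: "('a, 'w) ring_scheme \<Rightarrow> ('a, 'b, 'y) module_scheme \<Rightarrow> bool"
  where "projective R P \<longleftrightarrow> module R P \<and> (\<exists>(X :: 'b set) i p.
    i \<in> lin_maps R P (free_module R X) \<and> p \<in> lin_maps R (free_module R X) P \<and>
    (\<forall>x\<in>carrier P. p (i x) = x))"

definition tensor_relations ::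
    "('a, 'w) ring_scheme \<Rightarrow> ('a, 'b, 'y) module_scheme \<Rightarrow> ('a, 'c, 'z) module_scheme
      \<Rightarrow> ('b \<times> 'c \<Rightarrow> 'a) set"
  where "tensor_relations R M N = (let F = free_module R (carrier M \<times> carrier N); e = free_gen R in
    {e (x \<oplus>\<^bsub>M\<^esub> x', y) \<ominus>\<^bsub>F\<^esub> (e (x, y) \<oplus>\<^bsub>F\<^esub> e (x', y)) | x x' y.
      x \<in> carrier M \<and> x' \<in> carrier M \<and> y \<in> carrier N} \<union>
    {e (x, y \<oplus>\<^bsub>N\<^esub> y') \<ominus>\<^bsub>F\<^esub> (e (x, y) \<oplus>\<^bsub>F\<^esub> e (x, y')) | x y y'.
      x \<in> carrier M \<and> y \<in> carrier N \<and> y' \<in> carrier N} \<union>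
    {e (r \<odot>\<^bsub>M\<^esub> x, y) \<ominus>\<^bsub>F\<^esub> (r \<odot>\<^bsub>F\<^esub> e (x, y)) | r x y.
      r \<in> carrier R \<and> x \<in> carrier M \<and> y \<in> carrier N} \<union>
    {e (x, r \<odot>\<^bsub>N\<^esub> y) \<ominus>\<^bsub>F\<^esub> (r \<odot>\<^bsub>F\<^esub> e (x, y)) | r x y.
      r \<in> carrier R \<and> x \<in> carrier M \<and> y \<in> carrier N})"

definition tensor_kernel ::
    "('a, 'w) ring_scheme \<Rightarrow> ('a, 'b, 'y) module_scheme \<Rightarrow> ('a, 'c, 'z) module_scheme
      \<Rightarrow> ('b \<times> 'c \<Rightarrow> 'a) set"
  where "tensor_kernel R M N =
    lin_span R (free_module R (carrier M \<times> carrier N)) (tensor_relations R M N)"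

definition tensor_module ::
    "('a, 'w) ring_scheme \<Rightarrow> ('a, 'b, 'y) module_scheme \<Rightarrow> ('a, 'c, 'z) module_scheme
      \<Rightarrow> ('a, ('b \<times> 'c \<Rightarrow> 'a) set) module"
  where "tensor_module R M N =
    quot_module (free_module R (carrier M \<times> carrier N)) (tensor_kernel R M N)"

definition pure_tensor ::
    "('a, 'w) ring_scheme \<Rightarrow> ('a, 'b, 'y) module_scheme \<Rightarrow> ('a, 'c, 'z) module_scheme
      \<Rightarrow> 'b \<Rightarrow> 'c \<Rightarrow> ('b \<times> 'c \<Rightarrow> 'a) set"
  where "pure_tensor R M N x y =
    tensor_kernel R M N +>\<^bsub>free_module R (carrier M \<times> carrier N)\<^esub> free_gen R (x, y)"

section \<open>Graded algebras and graded modules\<close>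

definition restrict_scalars ::
    "('k, 'a, 'w) module_scheme \<Rightarrow> ('a, 'b, 'y) module_scheme \<Rightarrow> ('k, 'b) module"
  where "restrict_scalars R M = \<lparr>carrier = carrier M, monoid.mult = monoid.mult M, one = one M,
    ring.zero = ring.zero M, add = add M, smult = (\<lambda>c x. (c \<odot>\<^bsub>R\<^esub> \<one>\<^bsub>R\<^esub>) \<odot>\<^bsub>M\<^esub> x)\<rparr>"

definition internal_direct_sum :: "('b, 'w) ring_scheme \<Rightarrow> ('g \<Rightarrow> 'b set) \<Rightarrow> bool"
  where "internal_direct_sum M C \<longleftrightarrow> (\<forall>g. C g \<subseteq> carrier M) \<and>
    (\<forall>x\<in>carrier M. \<exists>!f. (\<forall>g. f g \<in> C g) \<and> finite {g. f g \<noteq> \<zero>\<^bsub>M\<^esub>} \<and>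
       x = (\<Oplus>\<^bsub>M\<^esub>g\<in>{g. f g \<noteq> \<zero>\<^bsub>M\<^esub>}. f g))"

locale graded_algebra = algebra k R
  for k (structure) and R :: "('k, 'a, 'g::ab_group_add) gmodule" (structure) +
  assumes hcomp_subspace: "submodule (hcomp R g) k R"
    and direct_sum: "internal_direct_sum R (hcomp R)"
    and hcomp_mult: "\<lbrakk>x \<in> hcomp R g; y \<in> hcomp R h\<rbrakk> \<Longrightarrow> x \<otimes>\<^bsub>R\<^esub> y \<in> hcomp R (g + h)"

locale graded_module = R: graded_algebra k R + module R M
  for k (structure) and R :: "('k, 'a, 'g::ab_group_add) gmodule" (structure)
    and M :: "('a, 'm, 'g) gmodule" (structure) +
  assumes hcomp_subspace: "submodule (hcomp M g) k (restrict_scalars R M)"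
    and direct_sum: "internal_direct_sum M (hcomp M)"
    and hcomp_smult: "\<lbrakk>r \<in> hcomp R g; x \<in> hcomp M h\<rbrakk> \<Longrightarrow> r \<odot>\<^bsub>M\<^esub> x \<in> hcomp M (g + h)"

definition gr_maps ::
    "('a, 'w) ring_scheme \<Rightarrow> ('a, 'b, 'g) gmodule \<Rightarrow> ('a, 'c, 'g) gmodule \<Rightarrow> ('b \<Rightarrow> 'c) set"
  where "gr_maps R M N = {f \<in> lin_maps R M N. \<forall>g. f ` hcomp M g \<subseteq> hcomp N g}"

definition gr_isomorphic ::
    "('a, 'w) ring_scheme \<Rightarrow> ('a, 'b, 'g) gmodule \<Rightarrow> ('a, 'c, 'g) gmodule \<Rightarrow> bool"
  where "gr_isomorphic R M N \<longleftrightarrow> (\<exists>f\<in>gr_maps R M N. bij_betw f (carrier M) (carrier N))"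

definition gr_short_exact ::
    "('a, 'w) ring_scheme \<Rightarrow> ('a, 'b, 'g) gmodule \<Rightarrow> ('a, 'c, 'g) gmodule \<Rightarrow> ('a, 'd, 'g) gmodule
      \<Rightarrow> bool"
  where "gr_short_exact R L M N \<longleftrightarrow> (\<exists>f\<in>gr_maps R L M. \<exists>h\<in>gr_maps R M N.
    inj_on f (carrier L) \<and> f ` carrier L = a_kernel M N h \<and> h ` carrier M = carrier N)"

definition Supp :: "('a, 'b, 'g) gmodule \<Rightarrow> 'g set"
  where "Supp M = {g. hcomp M g \<noteq> {\<zero>\<^bsub>M\<^esub>}}"

definition regular_module :: "('k, 'a, 'g) gmodule \<Rightarrow> ('a, 'a, 'g) gmodule"
  where "regular_module R = \<lparr>carrier = carrier R, monoid.mult = monoid.mult R, one = one R,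
    ring.zero = ring.zero R, add = add R, smult = monoid.mult R, hcomp = hcomp R\<rparr>"

definition zero_gmodule :: "('a, unit, 'g) gmodule"
  where "zero_gmodule = \<lparr>carrier = {()}, monoid.mult = undefined, one = undefined,
    ring.zero = (), add = (\<lambda>_ _. ()), smult = (\<lambda>_ _. ()), hcomp = (\<lambda>_. {()})\<rparr>"

definition sum_gmodule ::
    "('a, 'b, 'g) gmodule \<Rightarrow> ('a, 'c, 'g) gmodule \<Rightarrow> ('a, 'b \<times> 'c, 'g) gmodule"
  where "sum_gmodule M N = \<lparr>carrier = carrier M \<times> carrier N, monoid.mult = undefined, one = undefined,
    ring.zero = (\<zero>\<^bsub>M\<^esub>, \<zero>\<^bsub>N\<^esub>), add = (\<lambda>(x, y) (x', y'). (x \<oplus>\<^bsub>M\<^esub> x', y \<oplus>\<^bsub>N\<^esub> y')),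
    smult = (\<lambda>r (x, y). (r \<odot>\<^bsub>M\<^esub> x, r \<odot>\<^bsub>N\<^esub> y)), hcomp = (\<lambda>g. hcomp M g \<times> hcomp N g)\<rparr>"

definition sub_gmodule :: "('a, 'b, 'g) gmodule \<Rightarrow> 'b set \<Rightarrow> ('a, 'b, 'g) gmodule"
  where "sub_gmodule M H = M\<lparr>carrier := H, hcomp := (\<lambda>g. hcomp M g \<inter> H)\<rparr>"

definition quot_gmodule :: "('a, 'b, 'g) gmodule \<Rightarrow> 'b set \<Rightarrow> ('a, 'b set, 'g) gmodule"
  where "quot_gmodule M H =
    module.extend (quot_module M H) (gmodule.fields (\<lambda>g. (\<lambda>x. H +>\<^bsub>M\<^esub> x) ` hcomp M g))"

definition tensor_gmodule ::
    "('k, 'kw) ring_scheme \<Rightarrow> ('k, 'a, 'g::ab_group_add) gmodule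
      \<Rightarrow> ('a, 'b, 'g) gmodule \<Rightarrow> ('a, 'c, 'g) gmodule \<Rightarrow> ('a, ('b \<times> 'c \<Rightarrow> 'a) set, 'g) gmodule"
  where "tensor_gmodule k R M N = module.extend (tensor_module R M N)
    (gmodule.fields (\<lambda>u. lin_span k (restrict_scalars R (tensor_module R M N))
      {pure_tensor R M N x y | x y g h. x \<in> hcomp M g \<and> y \<in> hcomp N h \<and> g + h = u}))"

text \<open>\<open>f \<otimes> N\<close> for an \<open>R\<close>-linear map \<open>f : M \<rightarrow> M'\<close>.\<close>

definition tensor_map ::
    "('a, 'w) ring_scheme \<Rightarrow> ('a, 'b, 'y) module_scheme \<Rightarrow> ('a, 'b2, 'y2) module_scheme
      \<Rightarrow> ('a, 'c, 'z) module_scheme \<Rightarrow> ('b \<Rightarrow> 'b2)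
      \<Rightarrow> ('b \<times> 'c \<Rightarrow> 'a) set \<Rightarrow> ('b2 \<times> 'c \<Rightarrow> 'a) set"
  where "tensor_map R M M' N f = (THE h.
    h \<in> lin_maps R (tensor_module R M N) (tensor_module R M' N) \<and>
    h \<in> extensional (carrier (tensor_module R M N)) \<and>
    (\<forall>x\<in>carrier M. \<forall>y\<in>carrier N. h (pure_tensor R M N x y) = pure_tensor R M' N (f x) y))"

section \<open>PDCF algebras and BDF modules\<close>

definition pointed :: "'g::ab_group_add set \<Rightarrow> bool"
  where "pointed Q \<longleftrightarrow> (\<forall>p\<in>Q. \<forall>q\<in>Q. p + q = 0 \<longrightarrow> p = 0 \<and> q = 0)"

definition le_monoid :: "'g::ab_group_add set \<Rightarrow> 'g \<Rightarrow> 'g \<Rightarrow> bool"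
  where "le_monoid Q g h \<longleftrightarrow> h - g \<in> Q"

definition downward_finite :: "'g::ab_group_add set \<Rightarrow> 'g set \<Rightarrow> bool"
  where "downward_finite Q U \<longleftrightarrow> (\<forall>g. finite {u \<in> U. le_monoid Q u g})"

definition finitely_bounded_below :: "'g::ab_group_add set \<Rightarrow> 'g set \<Rightarrow> bool"
  where "finitely_bounded_below Q U \<longleftrightarrow>
    (\<exists>P. finite P \<and> (\<forall>u\<in>U. \<exists>p\<in>P. le_monoid Q p u))"

definition connected_algebra ::
    "('k, 'kw) ring_scheme \<Rightarrow> ('k, 'a, 'g::ab_group_add) gmodule \<Rightarrow> bool"
  where "connected_algebra k R \<longleftrightarrow> bij_betw (\<lambda>c. c \<odot>\<^bsub>R\<^esub> \<one>\<^bsub>R\<^esub>) (carrier k) (hcomp R 0)"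

definition PDCF :: "('k, 'kw) ring_scheme \<Rightarrow> ('k, 'a, 'g::ab_group_add) gmodule \<Rightarrow> bool"
  where "PDCF k R \<longleftrightarrow> graded_algebra k R \<and> pointed (Supp R) \<and>
    downward_finite (Supp R) (Supp R) \<and> connected_algebra k R \<and>
    (\<forall>g. finite_dim k R (hcomp R g))"

definition BDF ::
    "('k, 'kw) ring_scheme \<Rightarrow> ('k, 'a, 'g::ab_group_add) gmodule \<Rightarrow> ('a, 'b, 'g) gmodule \<Rightarrow> bool"
  where "BDF k R M \<longleftrightarrow> graded_module k R M \<and>
    finitely_bounded_below (Supp R) (Supp M) \<and> downward_finite (Supp R) (Supp M) \<and>
    (\<forall>g. finite_dim k (restrict_scalars R M) (hcomp M g))"

definition irrelevant_ideal ::
    "('k, 'kw) ring_scheme \<Rightarrow> ('k, 'a, 'g::ab_group_add) gmodule \<Rightarrow> 'a set"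
  where "irrelevant_ideal k R =
    lin_span k R (\<Union>q\<in>{q. le_monoid (Supp R) 0 q \<and> q \<noteq> 0}. hcomp R q)"

text \<open>The sequence is indexed from \<open>0\<close>, i.e. \<open>r n\<close> is the usual \<open>r\<^sub>n\<^sub>+\<^sub>1\<close>.\<close>

definition regular_sequence :: "('a, 'w) ring_scheme \<Rightarrow> (nat \<Rightarrow> 'a) \<Rightarrow> bool"
  where "regular_sequence R r \<longleftrightarrow> range r \<subseteq> carrier R \<and> Idl\<^bsub>R\<^esub> (range r) \<noteq> carrier R \<and>
    (\<forall>n. let I = Idl\<^bsub>R\<^esub> (r ` {..<n}) in
      \<forall>X\<in>carrier (R Quot I). (I +>\<^bsub>R\<^esub> r n) \<otimes>\<^bsub>R Quot I\<^esub> X = \<zero>\<^bsub>R Quot I\<^esub> \<longrightarrow> X = \<zero>\<^bsub>R Quot I\<^esub>)"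

section \<open>Graded isomorphism classes\<close>

text \<open>A BDF module has finite-dimensional components in degrees \<open>'g\<close>, so coordinates of
  homogeneous components embed its carrier into \<open>'g \<times> nat \<Rightarrow> 'k\<close>, and its structure can be
  transported there (lemma \<open>BDF_representable\<close>).  Hence the BDF modules with carrier in that type
  represent all graded isomorphism classes of BDF modules, and the class of a BDF module over any
  type is given by its members over that type.\<close>

lemma restrict_scalars_simps [simp]:
  "carrier (restrict_scalars R M) = carrier M"
  "add (restrict_scalars R M) = add M"
  "ring.zero (restrict_scalars R M) = ring.zero M"
  "smult (restrict_scalars R M) = (\<lambda>c x. (c \<odot>\<^bsub>R\<^esub> \<one>\<^bsub>R\<^esub>) \<odot>\<^bsub>M\<^esub> x)"
  by (simp_all add: restrict_scalars_def)

lemma restrict_scalars_module: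
  assumes "algebra k R" "module R M"
  shows "module k (restrict_scalars R M)"
proof -
  interpret R: algebra k R by (rule assms)
  interpret module R M by (rule assms)
  show ?thesis
  proof (rule moduleI)
    show "cring k" by (rule R.R_cring)
    show "abelian_group (restrict_scalars R M)"
    proof (rule abelian_groupI)
      fix x assume "x \<in> carrier (restrict_scalars R M)"
      then show "\<exists>y\<in>carrier (restrict_scalars R M). y \<oplus>\<^bsub>restrict_scalars R M\<^esub> x = \<zero>\<^bsub>restrict_scalars R M\<^esub>"
        by (intro bexI[of _ "\<ominus>\<^bsub>M\<^esub> x"]) (simp_all add: M.l_neg)
    qed (simp_all add: M.a_ac)
    fix a x assume a: "a \<in> carrier k" and x: "x \<in> carrier (restrict_scalars R M)"
    have aR: "a \<odot>\<^bsub>R\<^esub> \<one>\<^bsub>R\<^esub> \<in> carrier R" using a by simp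
    show "a \<odot>\<^bsub>restrict_scalars R M\<^esub> x \<in> carrier (restrict_scalars R M)"
      using a x by simp
    {
      fix b assume b: "b \<in> carrier k"
      show "(a \<oplus>\<^bsub>k\<^esub> b) \<odot>\<^bsub>restrict_scalars R M\<^esub> x =
        a \<odot>\<^bsub>restrict_scalars R M\<^esub> x \<oplus>\<^bsub>restrict_scalars R M\<^esub> b \<odot>\<^bsub>restrict_scalars R M\<^esub> x"
        using a b x by (simp add: R.smult_l_distr smult_l_distr)
      have "(a \<otimes>\<^bsub>k\<^esub> b) \<odot>\<^bsub>R\<^esub> \<one>\<^bsub>R\<^esub> = (a \<odot>\<^bsub>R\<^esub> \<one>\<^bsub>R\<^esub>) \<otimes>\<^bsub>R\<^esub> (b \<odot>\<^bsub>R\<^esub> \<one>\<^bsub>R\<^esub>)"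
        using a b by (simp add: R.smult_assoc1 R.smult_assoc2)
      then show "(a \<otimes>\<^bsub>k\<^esub> b) \<odot>\<^bsub>restrict_scalars R M\<^esub> x =
        a \<odot>\<^bsub>restrict_scalars R M\<^esub> (b \<odot>\<^bsub>restrict_scalars R M\<^esub> x)"
        using a b x by (simp add: smult_assoc1)
    }
    {
      fix y assume y: "y \<in> carrier (restrict_scalars R M)"
      show "a \<odot>\<^bsub>restrict_scalars R M\<^esub> (x \<oplus>\<^bsub>restrict_scalars R M\<^esub> y) =
        a \<odot>\<^bsub>restrict_scalars R M\<^esub> x \<oplus>\<^bsub>restrict_scalars R M\<^esub> a \<odot>\<^bsub>restrict_scalars R M\<^esub> y"
        using aR x y by (simp add: smult_r_distr)
    }
  next
    fix x assume "x \<in> carrier (restrict_scalars R M)"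
    then show "\<one>\<^bsub>k\<^esub> \<odot>\<^bsub>restrict_scalars R M\<^esub> x = x"
      by simp
  qed
qed

lemma (in module) span_parametrised:
  assumes "finite B" "B \<subseteq> carrier M"
  shows "\<exists>s :: (nat \<Rightarrow> 'a) \<Rightarrow> 'c. lin_span R M B \<subseteq> range s"
proof -
  have "\<exists>s :: (nat \<Rightarrow> 'a) \<Rightarrow> 'c. \<exists>H. submodule H R M \<and> B \<subseteq> H \<and> H \<subseteq> range s"
    using assms
  proof (induction B rule: finite_induct)
    case empty
    have "submodule {\<zero>\<^bsub>M\<^esub>} R M"
      by (rule submoduleI) auto
    then show ?case
      by (intro exI[of _ "\<lambda>_. \<zero>\<^bsub>M\<^esub>"] exI[of _ "{\<zero>\<^bsub>M\<^esub>}"]) auto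
  next
    case (insert b B)
    then obtain s :: "(nat \<Rightarrow> 'a) \<Rightarrow> 'c" and H
      where H: "submodule H R M" "B \<subseteq> H" "H \<subseteq> range s"
      by auto
    have b: "b \<in> carrier M" using insert by auto
    note HE = submoduleE[OF H(1)]
    have zH: "\<zero>\<^bsub>M\<^esub> \<in> H"
      by (metis HE(1,2,3,5) M.r_neg ex_in_conv subsetD)
    define H' where "H' = {c \<odot>\<^bsub>M\<^esub> b \<oplus>\<^bsub>M\<^esub> y | c y. c \<in> carrier R \<and> y \<in> H}"
    have "submodule H' R M"
    proof (rule submoduleI)
      show "H' \<subseteq> carrier M" using HE(1) b by (auto simp: H'_def)
      have "\<zero>\<^bsub>M\<^esub> = \<zero>\<^bsub>R\<^esub> \<odot>\<^bsub>M\<^esub> b \<oplus>\<^bsub>M\<^esub> \<zero>\<^bsub>M\<^esub>" using b by simp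
      then show "\<zero>\<^bsub>M\<^esub> \<in> H'" using zH R.zero_closed unfolding H'_def by blast
    next
      fix a assume "a \<in> H'"
      then obtain c y where a: "a = c \<odot>\<^bsub>M\<^esub> b \<oplus>\<^bsub>M\<^esub> y" "c \<in> carrier R" "y \<in> H"
        by (auto simp: H'_def)
      have "y \<in> carrier M" using a HE(1) by auto
      then have "\<ominus>\<^bsub>M\<^esub> a = (\<ominus>\<^bsub>R\<^esub> c) \<odot>\<^bsub>M\<^esub> b \<oplus>\<^bsub>M\<^esub> (\<ominus>\<^bsub>M\<^esub> y)"
        using a b by (simp add: M.minus_add smult_l_minus)
      then show "\<ominus>\<^bsub>M\<^esub> a \<in> H'" using a HE(3) unfolding H'_def by blast
    next
      fix a a' assume "a \<in> H'" "a' \<in> H'"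
      then obtain c y c' y' where a: "a = c \<odot>\<^bsub>M\<^esub> b \<oplus>\<^bsub>M\<^esub> y" "c \<in> carrier R" "y \<in> H"
        "a' = c' \<odot>\<^bsub>M\<^esub> b \<oplus>\<^bsub>M\<^esub> y'" "c' \<in> carrier R" "y' \<in> H"
        by (auto simp: H'_def)
      have "y \<in> carrier M" "y' \<in> carrier M" using a HE(1) by auto
      then have "a \<oplus>\<^bsub>M\<^esub> a' = (c \<oplus>\<^bsub>R\<^esub> c') \<odot>\<^bsub>M\<^esub> b \<oplus>\<^bsub>M\<^esub> (y \<oplus>\<^bsub>M\<^esub> y')"
        using a b by (simp add: smult_l_distr M.a_ac)
      moreover have "y \<oplus>\<^bsub>M\<^esub> y' \<in> H" using a HE(5) by blast
      ultimately show "a \<oplus>\<^bsub>M\<^esub> a' \<in> H'" using a R.a_closed unfolding H'_def by blast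
    next
      fix r a assume r: "r \<in> carrier R" and "a \<in> H'"
      then obtain c y where a: "a = c \<odot>\<^bsub>M\<^esub> b \<oplus>\<^bsub>M\<^esub> y" "c \<in> carrier R" "y \<in> H"
        by (auto simp: H'_def)
      have "y \<in> carrier M" using a HE(1) by auto
      then have "r \<odot>\<^bsub>M\<^esub> a = (r \<otimes>\<^bsub>R\<^esub> c) \<odot>\<^bsub>M\<^esub> b \<oplus>\<^bsub>M\<^esub> (r \<odot>\<^bsub>M\<^esub> y)"
        using a b r by (simp add: smult_r_distr smult_assoc1)
      moreover have "r \<odot>\<^bsub>M\<^esub> y \<in> H" using a r HE(4) by blast
      ultimately show "r \<odot>\<^bsub>M\<^esub> a \<in> H'" using a r R.m_closed unfolding H'_def by blast
    qed
    moreover have "insert b B \<subseteq> H'"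
    proof -
      have "b = \<one>\<^bsub>R\<^esub> \<odot>\<^bsub>M\<^esub> b \<oplus>\<^bsub>M\<^esub> \<zero>\<^bsub>M\<^esub>" using b by simp
      then have "b \<in> H'" using zH R.one_closed unfolding H'_def by blast
      moreover have "x \<in> H'" if "x \<in> B" for x
      proof -
        have "x = \<zero>\<^bsub>R\<^esub> \<odot>\<^bsub>M\<^esub> b \<oplus>\<^bsub>M\<^esub> x" using b that H HE(1) by auto
        then show ?thesis using that H R.zero_closed unfolding H'_def by blast
      qed
      ultimately show ?thesis by blast
    qed
    moreover have "H' \<subseteq> range (\<lambda>f. f 0 \<odot>\<^bsub>M\<^esub> b \<oplus>\<^bsub>M\<^esub> s (f \<circ> Suc))"
    proof
      fix a assume "a \<in> H'"
      then obtain c y where a: "a = c \<odot>\<^bsub>M\<^esub> b \<oplus>\<^bsub>M\<^esub> y" "y \<in> H" by (auto simp: H'_def)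
      then obtain f where "y = s f" using H by auto
      then have "a = (\<lambda>f. f 0 \<odot>\<^bsub>M\<^esub> b \<oplus>\<^bsub>M\<^esub> s (f \<circ> Suc)) (case_nat c f)"
        using a by (simp add: comp_def)
      then show "a \<in> range (\<lambda>f. f 0 \<odot>\<^bsub>M\<^esub> b \<oplus>\<^bsub>M\<^esub> s (f \<circ> Suc))" by blast
    qed
    ultimately show ?case by blast
  qed
  then show ?thesis unfolding lin_span_def by blast
qed


definition transport :: "('b \<Rightarrow> 'c) \<Rightarrow> ('a, 'b, 'g) gmodule \<Rightarrow> ('a, 'c, 'g) gmodule"
  where "transport \<phi> M = (let \<psi> = inv_into (carrier M) \<phi> in
    \<lparr>carrier = \<phi> ` carrier M, monoid.mult = undefined, one = undefined, ring.zero = \<phi> \<zero>\<^bsub>M\<^esub>,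
     add = (\<lambda>x y. \<phi> (\<psi> x \<oplus>\<^bsub>M\<^esub> \<psi> y)), smult = (\<lambda>r x. \<phi> (r \<odot>\<^bsub>M\<^esub> \<psi> x)),
     hcomp = (\<lambda>g. \<phi> ` hcomp M g)\<rparr>)"

lemma transport_simps [simp]:
  "carrier (transport \<phi> M) = \<phi> ` carrier M"
  "ring.zero (transport \<phi> M) = \<phi> \<zero>\<^bsub>M\<^esub>"
  "hcomp (transport \<phi> M) g = \<phi> ` hcomp M g"
  by (simp_all add: transport_def Let_def)

lemma transport_ops [simp]:
  assumes "inj_on \<phi> (carrier M)" "x \<in> carrier M"
  shows "y \<in> carrier M \<Longrightarrow> \<phi> x \<oplus>\<^bsub>transport \<phi> M\<^esub> \<phi> y = \<phi> (x \<oplus>\<^bsub>M\<^esub> y)"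
    and "r \<odot>\<^bsub>transport \<phi> M\<^esub> \<phi> x = \<phi> (r \<odot>\<^bsub>M\<^esub> x)"
  using assms by (simp_all add: transport_def Let_def)

lemma transport_module:
  assumes "module R M" and inj: "inj_on \<phi> (carrier M)"
  shows "module R (transport \<phi> M)"
proof -
  interpret module R M by (rule assms)
  note [simp] = inj
  show ?thesis
  proof (rule moduleI)
    show "cring R" by (rule R.is_cring)
    show "abelian_group (transport \<phi> M)"
    proof (rule abelian_groupI)
      fix x assume "x \<in> carrier (transport \<phi> M)"
      then obtain x' where "x = \<phi> x'" "x' \<in> carrier M" by auto
      then show "\<exists>y\<in>carrier (transport \<phi> M). y \<oplus>\<^bsub>transport \<phi> M\<^esub> x = \<zero>\<^bsub>transport \<phi> M\<^esub>"
        by (intro bexI[of _ "\<phi> (\<ominus>\<^bsub>M\<^esub> x')"]) (simp_all add: M.l_neg)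
    qed (auto simp: M.a_ac)
  qed (auto simp: smult_l_distr smult_r_distr smult_assoc1)
qed

lemma transport_finsum:
  assumes "module R M" and inj: "inj_on \<phi> (carrier M)"
    and "finite A" "f \<in> A \<rightarrow> carrier M"
  shows "finsum (transport \<phi> M) (\<lambda>a. \<phi> (f a)) A = \<phi> (finsum M f A)"
proof -
  interpret M: module R M by (rule assms)
  interpret N: module R "transport \<phi> M" by (rule transport_module[OF assms(1,2)])
  show ?thesis
    using assms(3,4)
  proof (induction A rule: finite_induct)
    case (insert a A)
    then have "f \<in> A \<rightarrow> carrier M" "f a \<in> carrier M" by auto
    with insert inj show ?case
      by (subst N.finsum_insert) (auto simp: Pi_iff)
  qed simp
qed

lemma transport_submodule:
  assumes "algebra k R" "module R M" and inj: "inj_on \<phi> (carrier M)"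
    and H: "submodule H k (restrict_scalars R M)"
  shows "submodule (\<phi> ` H) k (restrict_scalars R (transport \<phi> M))"
proof -
  let ?V = "restrict_scalars R M" and ?W = "restrict_scalars R (transport \<phi> M)"
  interpret R: algebra k R by (rule assms)
  interpret M: module R M by (rule assms)
  interpret N: module R "transport \<phi> M" by (rule transport_module[OF assms(2,3)])
  interpret V: module k ?V by (rule restrict_scalars_module[OF assms(1,2)])
  interpret W: module k ?W by (rule restrict_scalars_module[OF assms(1) N.module_axioms])
  note HE = V.submoduleE[OF H]
  have HM: "x \<in> carrier M" if "x \<in> H" for x using HE(1) that by auto
  have zero: "\<zero>\<^bsub>M\<^esub> \<in> H"
    using HE(2,3,5) HM V.r_neg by (metis ex_in_conv restrict_scalars_simps(1,3))
  have neg: "\<ominus>\<^bsub>?W\<^esub> (\<phi> x) = \<phi> (\<ominus>\<^bsub>?V\<^esub> x)" if "x \<in> carrier M" for x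
  proof (rule W.minus_equality)
    have "\<ominus>\<^bsub>?V\<^esub> x \<in> carrier M" "\<ominus>\<^bsub>?V\<^esub> x \<oplus>\<^bsub>M\<^esub> x = \<zero>\<^bsub>M\<^esub>"
      using V.a_inv_closed[of x] V.l_neg[of x] that by auto
    then show "\<phi> (\<ominus>\<^bsub>?V\<^esub> x) \<oplus>\<^bsub>?W\<^esub> \<phi> x = \<zero>\<^bsub>?W\<^esub>" "\<phi> (\<ominus>\<^bsub>?V\<^esub> x) \<in> carrier ?W"
      using that inj by auto
  qed (use that in auto)
  show ?thesis
  proof (rule W.submoduleI)
    show "\<phi> ` H \<subseteq> carrier ?W" using HM by auto
    show "\<zero>\<^bsub>?W\<^esub> \<in> \<phi> ` H" using zero by auto
    show "\<ominus>\<^bsub>?W\<^esub> a \<in> \<phi> ` H" if "a \<in> \<phi> ` H" for a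
      using that neg HM HE(3) by auto
    show "a \<oplus>\<^bsub>?W\<^esub> b \<in> \<phi> ` H" if "a \<in> \<phi> ` H" "b \<in> \<phi> ` H" for a b
      using that HM inj HE(5) by auto
    show "r \<odot>\<^bsub>?W\<^esub> a \<in> \<phi> ` H" if "r \<in> carrier k" "a \<in> \<phi> ` H" for r a
      using that HM inj HE(4) by auto
  qed
qed

lemma transport_submodule_vimage:
  assumes "algebra k R" "module R M" and inj: "inj_on \<phi> (carrier M)"
    and H: "submodule H k (restrict_scalars R (transport \<phi> M))"
  shows "submodule {x \<in> carrier M. \<phi> x \<in> H} k (restrict_scalars R M)"
proof -
  let ?V = "restrict_scalars R M" and ?W = "restrict_scalars R (transport \<phi> M)"
  interpret R: algebra k R by (rule assms)
  interpret M: module R M by (rule assms)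
  interpret N: module R "transport \<phi> M" by (rule transport_module[OF assms(2,3)])
  interpret V: module k ?V by (rule restrict_scalars_module[OF assms(1,2)])
  interpret W: module k ?W by (rule restrict_scalars_module[OF assms(1) N.module_axioms])
  note HE = W.submoduleE[OF H]
  have zero: "\<phi> \<zero>\<^bsub>M\<^esub> \<in> H"
    using HE(1,2,3,5) W.r_neg
    by (metis ex_in_conv restrict_scalars_simps(3) subsetD transport_simps(2))
  have neg: "\<ominus>\<^bsub>?W\<^esub> (\<phi> x) = \<phi> (\<ominus>\<^bsub>?V\<^esub> x)" if "x \<in> carrier M" for x
  proof (rule W.minus_equality)
    have "\<ominus>\<^bsub>?V\<^esub> x \<in> carrier M" "\<ominus>\<^bsub>?V\<^esub> x \<oplus>\<^bsub>M\<^esub> x = \<zero>\<^bsub>M\<^esub>"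
      using V.a_inv_closed[of x] V.l_neg[of x] that by auto
    then show "\<phi> (\<ominus>\<^bsub>?V\<^esub> x) \<oplus>\<^bsub>?W\<^esub> \<phi> x = \<zero>\<^bsub>?W\<^esub>" "\<phi> (\<ominus>\<^bsub>?V\<^esub> x) \<in> carrier ?W"
      using that inj by auto
  qed (use that in auto)
  show ?thesis
  proof (rule V.submoduleI)
    show "\<zero>\<^bsub>?V\<^esub> \<in> {x \<in> carrier M. \<phi> x \<in> H}" using zero by auto
    show "\<ominus>\<^bsub>?V\<^esub> a \<in> {x \<in> carrier M. \<phi> x \<in> H}" if "a \<in> {x \<in> carrier M. \<phi> x \<in> H}" for a
      using that neg[of a] HE(3) V.a_inv_closed[of a] by fastforce
    show "a \<oplus>\<^bsub>?V\<^esub> b \<in> {x \<in> carrier M. \<phi> x \<in> H}"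
      if "a \<in> {x \<in> carrier M. \<phi> x \<in> H}" "b \<in> {x \<in> carrier M. \<phi> x \<in> H}" for a b
      using that HE(5)[of "\<phi> a" "\<phi> b"] inj by auto
    show "r \<odot>\<^bsub>?V\<^esub> a \<in> {x \<in> carrier M. \<phi> x \<in> H}"
      if "r \<in> carrier k" "a \<in> {x \<in> carrier M. \<phi> x \<in> H}" for r a
      using that HE(4)[of r "\<phi> a"] inj by auto
  qed auto
qed

lemma transport_finite_dim:
  assumes "algebra k R" "module R M" and inj: "inj_on \<phi> (carrier M)"
    and H: "submodule H k (restrict_scalars R M)"
    and "finite_dim k (restrict_scalars R M) H"
  shows "finite_dim k (restrict_scalars R (transport \<phi> M)) (\<phi> ` H)"
proof -
  let ?W = "restrict_scalars R (transport \<phi> M)"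
  obtain B where B: "finite B" "B \<subseteq> H" "lin_span k (restrict_scalars R M) B = H"
    using assms(5) by (auto simp: finite_dim_def)
  have "H \<subseteq> carrier (restrict_scalars R M)"
    using module.submoduleE(1)[OF restrict_scalars_module[OF assms(1,2)] H] .
  then have HM: "H \<subseteq> carrier M" by simp
  have "lin_span k ?W (\<phi> ` B) \<subseteq> \<phi> ` H"
    using transport_submodule[OF assms(1,2) inj H] B(2) unfolding lin_span_def by blast
  moreover have "\<phi> ` H \<subseteq> H'" if H': "submodule H' k ?W" "\<phi> ` B \<subseteq> H'" for H'
  proof -
    have "B \<subseteq> {x \<in> carrier M. \<phi> x \<in> H'}" using H' B HM by auto
    then have "H \<subseteq> {x \<in> carrier M. \<phi> x \<in> H'}"
      using transport_submodule_vimage[OF assms(1,2) inj H'(1)] B(3) unfolding lin_span_def by blast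
    then show ?thesis by auto
  qed
  ultimately have "lin_span k ?W (\<phi> ` B) = \<phi> ` H"
    unfolding lin_span_def by blast
  then show ?thesis
    using B unfolding finite_dim_def by (intro exI[of _ "\<phi> ` B"]) auto
qed

lemma transport_direct_sum:
  assumes "module R M" and inj: "inj_on \<phi> (carrier M)"
    and "internal_direct_sum M (hcomp M)"
  shows "internal_direct_sum (transport \<phi> M) (hcomp (transport \<phi> M))"
  unfolding internal_direct_sum_def
proof (intro conjI ballI allI)
  interpret M: module R M by (rule assms)
  have hM: "hcomp M g \<subseteq> carrier M" for g
    using assms(3) by (auto simp: internal_direct_sum_def)
  show "hcomp (transport \<phi> M) g \<subseteq> carrier (transport \<phi> M)" for g
    using hM by auto
  fix x assume "x \<in> carrier (transport \<phi> M)"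
  then obtain y where y: "x = \<phi> y" "y \<in> carrier M" by auto
  let ?P = "\<lambda>f. (\<forall>g. f g \<in> hcomp M g) \<and> finite {g. f g \<noteq> \<zero>\<^bsub>M\<^esub>} \<and>
    y = finsum M f {g. f g \<noteq> \<zero>\<^bsub>M\<^esub>}"
  let ?Q = "\<lambda>f. (\<forall>g. f g \<in> hcomp (transport \<phi> M) g) \<and> finite {g. f g \<noteq> \<zero>\<^bsub>transport \<phi> M\<^esub>} \<and>
    x = finsum (transport \<phi> M) f {g. f g \<noteq> \<zero>\<^bsub>transport \<phi> M\<^esub>}"
  have ex1: "\<exists>!f. ?P f"
    using assms(3) y(2) unfolding internal_direct_sum_def by blast
  then obtain f where f: "?P f" by blast
  have PQ: "?Q (\<lambda>g. \<phi> (f g)) \<longleftrightarrow> ?P f" if "\<forall>g. f g \<in> hcomp M g" for f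
  proof -
    have fM: "f g \<in> carrier M" for g using that hM by blast
    have "{g. \<phi> (f g) \<noteq> \<zero>\<^bsub>transport \<phi> M\<^esub>} = {g. f g \<noteq> \<zero>\<^bsub>M\<^esub>}"
      using inj fM by (auto simp: inj_on_def)
    moreover have "x = finsum (transport \<phi> M) (\<lambda>g. \<phi> (f g)) A \<longleftrightarrow> y = finsum M f A"
      if "finite A" for A
    proof -
      have "f \<in> A \<rightarrow> carrier M" using fM by auto
      then have "finsum (transport \<phi> M) (\<lambda>g. \<phi> (f g)) A = \<phi> (finsum M f A)" "finsum M f A \<in> carrier M"
        using transport_finsum[OF assms(1,2) that] by (auto intro: M.finsum_closed)
      then show ?thesis using y inj by (auto simp: inj_on_def)
    qed
    ultimately show ?thesis using that by auto
  qed
  show "\<exists>!f. ?Q f"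
  proof (rule ex1I)
    show "?Q (\<lambda>g. \<phi> (f g))" using PQ f by blast
    fix f' assume f': "?Q f'"
    then have "\<forall>g. \<exists>z. z \<in> hcomp M g \<and> f' g = \<phi> z" by auto
    then obtain f'' where f'': "\<forall>g. f'' g \<in> hcomp M g" "f' = (\<lambda>g. \<phi> (f'' g))"
      by metis
    then have "?P f''" using PQ f' by blast
    then have "f'' = f" using f ex1 by blast
    then show "f' = (\<lambda>g. \<phi> (f g))" using f'' by simp
  qed
qed

lemma transport_BDF:
  assumes M: "BDF k R M" and inj: "inj_on \<phi> (carrier M)"
  shows "BDF k R (transport \<phi> M)" and "gr_isomorphic R M (transport \<phi> M)"
proof -
  interpret graded_module k R M using M by (simp add: BDF_def)
  have hM: "hcomp M g \<subseteq> carrier M" for g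
    using direct_sum by (auto simp: internal_direct_sum_def)
  have gm: "graded_module k R (transport \<phi> M)"
  proof (intro graded_module.intro graded_module_axioms.intro)
    show "graded_algebra k R" by (rule R.graded_algebra_axioms)
    show "module R (transport \<phi> M)" by (rule transport_module[OF module_axioms inj])
    show "submodule (hcomp (transport \<phi> M) g) k (restrict_scalars R (transport \<phi> M))" for g
      using transport_submodule[OF R.algebra_axioms module_axioms inj hcomp_subspace] by simp
    show "internal_direct_sum (transport \<phi> M) (hcomp (transport \<phi> M))"
      by (rule transport_direct_sum[OF module_axioms inj direct_sum])
    show "r \<odot>\<^bsub>transport \<phi> M\<^esub> x \<in> hcomp (transport \<phi> M) (g + h)"
      if rx: "r \<in> hcomp R g" "x \<in> hcomp (transport \<phi> M) h" for r x g h
    proof -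
      obtain z where z: "x = \<phi> z" "z \<in> hcomp M h" using rx(2) by auto
      then have "z \<in> carrier M" using hM by blast
      then show ?thesis using z hcomp_smult[OF rx(1) z(2)] inj by auto
    qed
  qed
  have "Supp (transport \<phi> M) = Supp M"
  proof -
    have "\<phi> ` hcomp M g = {\<phi> \<zero>\<^bsub>M\<^esub>} \<longleftrightarrow> hcomp M g = {\<zero>\<^bsub>M\<^esub>}" for g
      using inj_on_image_eq_iff[OF inj hM[of g], of "{\<zero>\<^bsub>M\<^esub>}"] by simp
    then show ?thesis by (simp add: Supp_def)
  qed
  then show "BDF k R (transport \<phi> M)"
    using M gm transport_finite_dim[OF R.algebra_axioms module_axioms inj hcomp_subspace]
    by (simp add: BDF_def)
  have "\<phi> \<in> gr_maps R M (transport \<phi> M)"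
    using inj by (auto simp: gr_maps_def lin_maps_def)
  moreover have "bij_betw \<phi> (carrier M) (carrier (transport \<phi> M))"
    using inj by (simp add: bij_betw_def)
  ultimately show "gr_isomorphic R M (transport \<phi> M)"
    by (auto simp: gr_isomorphic_def)
qed

lemma BDF_representable:
  fixes k :: "('k, 'kw) ring_scheme" and M :: "('a, 'b, 'g::ab_group_add) gmodule"
  assumes M: "BDF k R M"
  obtains M' :: "('a, 'g \<times> nat \<Rightarrow> 'k, 'g) gmodule" where "BDF k R M'" "gr_isomorphic R M M'"
proof -
  interpret graded_module k R M using M by (simp add: BDF_def)
  interpret V: module k "restrict_scalars R M"
    by (rule restrict_scalars_module[OF R.algebra_axioms module_axioms])
  have hM: "hcomp M g \<subseteq> carrier M" for g
    using direct_sum by (auto simp: internal_direct_sum_def)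
  have "\<exists>s :: (nat \<Rightarrow> 'k) \<Rightarrow> 'b. hcomp M g \<subseteq> range s" for g
  proof -
    obtain B where B: "finite B" "B \<subseteq> hcomp M g" "lin_span k (restrict_scalars R M) B = hcomp M g"
      using M unfolding BDF_def finite_dim_def by blast
    then show ?thesis
      using V.span_parametrised[of B] hM[of g] by auto
  qed
  then obtain s :: "'g \<Rightarrow> (nat \<Rightarrow> 'k) \<Rightarrow> 'b" where s: "hcomp M g \<subseteq> range (s g)" for g
    by metis
  have "\<exists>f. (\<forall>g. f g \<in> hcomp M g) \<and> x = finsum M f {g. f g \<noteq> \<zero>\<^bsub>M\<^esub>}" if "x \<in> carrier M" for x
    using direct_sum that unfolding internal_direct_sum_def by blast
  then obtain c where c: "x \<in> carrier M \<Longrightarrow> c x g \<in> hcomp M g"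
      "x \<in> carrier M \<Longrightarrow> x = finsum M (c x) {g. c x g \<noteq> \<zero>\<^bsub>M\<^esub>}" for x g
    by metis
  define \<phi> where "\<phi> = (\<lambda>x (g, i). inv_into UNIV (s g) (c x g) i)"
  have "inj_on \<phi> (carrier M)"
  proof (rule inj_onI)
    fix x y assume xy: "x \<in> carrier M" "y \<in> carrier M" "\<phi> x = \<phi> y"
    have "c x g = c y g" for g
    proof -
      have "inv_into UNIV (s g) (c x g) i = inv_into UNIV (s g) (c y g) i" for i
        using fun_cong[OF xy(3), of "(g, i)"] by (simp add: \<phi>_def)
      then have "inv_into UNIV (s g) (c x g) = inv_into UNIV (s g) (c y g)" by blast
      moreover have "c x g \<in> range (s g)" "c y g \<in> range (s g)" using c(1) xy s by blast+
      ultimately show ?thesis by (metis f_inv_into_f)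
    qed
    then have "c x = c y" by blast
    then show "x = y" using c(2)[OF xy(1)] c(2)[OF xy(2)] by simp
  qed
  from transport_BDF[OF M this] show ?thesis by (rule that)
qed

type_synonym ('k, 'a, 'g) umodule = "('a, 'g \<times> nat \<Rightarrow> 'k, 'g) gmodule"

definition iso_class ::
    "('k, 'kw) ring_scheme \<Rightarrow> ('k, 'a, 'g::ab_group_add) gmodule \<Rightarrow> ('a, 'b, 'g) gmodule
      \<Rightarrow> ('k, 'a, 'g) umodule set"
  where "iso_class k R M = {M'. BDF k R M' \<and> gr_isomorphic R M M'}"

section \<open>Tor\<close>

definition gr_free ::
    "('k, 'a, 'g::ab_group_add) gmodule \<Rightarrow> ('a, 'b, 'g) gmodule \<Rightarrow> bool"
  where "gr_free R F \<longleftrightarrow> (\<exists>B \<subseteq> (\<Union>g. hcomp F g).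
    \<forall>x\<in>carrier F. \<exists>!c. c \<in> carrier (free_module R B) \<and>
      x = (\<Oplus>\<^bsub>F\<^esub>b\<in>{b. c b \<noteq> \<zero>\<^bsub>R\<^esub>}. c b \<odot>\<^bsub>F\<^esub> b))"

text \<open>\<open>\<cdots> \<rightarrow> F 1 \<rightarrow> F 0 \<rightarrow> M \<rightarrow> 0\<close> with \<open>d i : F (Suc i) \<rightarrow> F i\<close>.\<close>

definition free_resolution ::
    "('k, 'kw) ring_scheme \<Rightarrow> ('k, 'a, 'g::ab_group_add) gmodule \<Rightarrow> ('a, 'b, 'g) gmodule
      \<Rightarrow> (nat \<Rightarrow> ('a, 'f, 'g) gmodule) \<Rightarrow> (nat \<Rightarrow> 'f \<Rightarrow> 'f) \<Rightarrow> bool"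
  where "free_resolution k R M F d \<longleftrightarrow>
    (\<forall>i. BDF k R (F i) \<and> gr_free R (F i)) \<and>
    (\<forall>i. d i \<in> gr_maps R (F (Suc i)) (F i)) \<and>
    (\<forall>i. d (Suc i) ` carrier (F (Suc (Suc i))) = a_kernel (F (Suc i)) (F i) (d i)) \<and>
    (\<exists>\<epsilon>\<in>gr_maps R (F 0) M. \<epsilon> ` carrier (F 0) = carrier M \<and>
      d 0 ` carrier (F 1) = a_kernel (F 0) M \<epsilon>)"

definition homology ::
    "(nat \<Rightarrow> ('a, 'f, 'g) gmodule) \<Rightarrow> (nat \<Rightarrow> 'f \<Rightarrow> 'f) \<Rightarrow> nat \<Rightarrow> ('a, 'f set, 'g) gmodule"
  where "homology C d i = quot_gmodule
    (sub_gmodule (C i) (case i of 0 \<Rightarrow> carrier (C 0) | Suc j \<Rightarrow> a_kernel (C i) (C j) (d j)))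
    (d i ` carrier (C (Suc i)))"

definition Tor ::
    "('k, 'kw) ring_scheme \<Rightarrow> ('k, 'a, 'g::ab_group_add) gmodule \<Rightarrow> nat
      \<Rightarrow> ('a, 'b, 'g) gmodule \<Rightarrow> ('a, 'c, 'g) gmodule
      \<Rightarrow> ('a, (('g \<times> nat \<Rightarrow> 'k) \<times> 'c \<Rightarrow> 'a) set set, 'g) gmodule"
  where "Tor k R i M N =
    (let (F, d) = (SOME (F :: nat \<Rightarrow> ('k, 'a, 'g) umodule, d). free_resolution k R M F d)
     in homology (\<lambda>j. tensor_gmodule k R (F j) N) (\<lambda>j. tensor_map R (F (Suc j)) (F j) N (d j)) i)"

section \<open>The ring \<open>K\<close>\<close>

text \<open>The commutative semiring of isomorphism classes of projective BDF modules.\<close>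

definition proj_semiring ::
    "('k, 'kw) ring_scheme \<Rightarrow> ('k, 'a, 'g::ab_group_add) gmodule \<Rightarrow> ('k, 'a, 'g) umodule set ring"
  where "proj_semiring k R = \<lparr>
    carrier = {iso_class k R F | F :: ('k, 'a, 'g) umodule. BDF k R F \<and> projective R F},
    monoid.mult = (\<lambda>a b. \<Union>F\<in>a. \<Union>F'\<in>b. iso_class k R (tensor_gmodule k R F F')),
    one = iso_class k R (regular_module R),
    ring.zero = iso_class k R zero_gmodule,
    add = (\<lambda>a b. \<Union>F\<in>a. \<Union>F'\<in>b. iso_class k R (sum_gmodule F F'))\<rparr>"

text \<open>Group completion of the additive monoid of a commutative semiring, the class of \<open>(a, b)\<close>
  standing for \<open>a - b\<close>; the product is the biadditive extension of the given one.\<close>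

definition completion_rel :: "('s, 'w) ring_scheme \<Rightarrow> (('s \<times> 's) \<times> ('s \<times> 's)) set"
  where "completion_rel S = {((a, b), (c, d)). a \<in> carrier S \<and> b \<in> carrier S \<and>
    c \<in> carrier S \<and> d \<in> carrier S \<and>
    (\<exists>e\<in>carrier S. a \<oplus>\<^bsub>S\<^esub> d \<oplus>\<^bsub>S\<^esub> e = c \<oplus>\<^bsub>S\<^esub> b \<oplus>\<^bsub>S\<^esub> e)}"

definition group_completion :: "('s, 'w) ring_scheme \<Rightarrow> ('s \<times> 's) set ring"
  where "group_completion S = (let cl = (\<lambda>p. completion_rel S `` {p}) in \<lparr>
    carrier = (carrier S \<times> carrier S) // completion_rel S,
    monoid.mult = (\<lambda>X Y. \<Union>(a, b)\<in>X. \<Union>(c, d)\<in>Y.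
      cl (a \<otimes>\<^bsub>S\<^esub> c \<oplus>\<^bsub>S\<^esub> b \<otimes>\<^bsub>S\<^esub> d, a \<otimes>\<^bsub>S\<^esub> d \<oplus>\<^bsub>S\<^esub> b \<otimes>\<^bsub>S\<^esub> c)),
    one = cl (\<one>\<^bsub>S\<^esub>, \<zero>\<^bsub>S\<^esub>),
    ring.zero = cl (\<zero>\<^bsub>S\<^esub>, \<zero>\<^bsub>S\<^esub>),
    add = (\<lambda>X Y. \<Union>(a, b)\<in>X. \<Union>(c, d)\<in>Y. cl (a \<oplus>\<^bsub>S\<^esub> c, b \<oplus>\<^bsub>S\<^esub> d))\<rparr>)"

definition K_BDF ::
    "('k, 'kw) ring_scheme \<Rightarrow> ('k, 'a, 'g::ab_group_add) gmodule
      \<Rightarrow> (('k, 'a, 'g) umodule set \<times> ('k, 'a, 'g) umodule set) set ring"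
  where "K_BDF k R = group_completion (proj_semiring k R)"

definition K_class ::
    "('k, 'kw) ring_scheme \<Rightarrow> ('k, 'a, 'g::ab_group_add) gmodule \<Rightarrow> ('a, 'b, 'g) gmodule
      \<Rightarrow> (('k, 'a, 'g) umodule set \<times> ('k, 'a, 'g) umodule set) set"
  where "K_class k R F =
    completion_rel (proj_semiring k R) `` {(iso_class k R F, \<zero>\<^bsub>proj_semiring k R\<^esub>)}"

section \<open>The group \<open>G\<close> and its topology\<close>

text \<open>As \<open>free_Abelian_group\<close> and \<open>Mod\<close> produce multiplicative monoid records, the abelian group
  \<open>G\<close> is written multiplicatively until it is made into a ring.\<close>

definition free_on_classes ::
    "('k, 'kw) ring_scheme \<Rightarrow> ('k, 'a, 'g::ab_group_add) gmodule
      \<Rightarrow> (('k, 'a, 'g) umodule set \<Rightarrow>\<^sub>0 int) monoid"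
  where "free_on_classes k R =
    free_Abelian_group {iso_class k R M | M :: ('k, 'a, 'g) umodule. BDF k R M}"

definition exact_relations ::
    "('k, 'kw) ring_scheme \<Rightarrow> ('k, 'a, 'g::ab_group_add) gmodule
      \<Rightarrow> (('k, 'a, 'g) umodule set \<Rightarrow>\<^sub>0 int) set"
  where "exact_relations k R = generate (free_on_classes k R)
    {frag_of (iso_class k R L) - frag_of (iso_class k R M) + frag_of (iso_class k R N) |
      (L :: ('k, 'a, 'g) umodule) (M :: ('k, 'a, 'g) umodule) (N :: ('k, 'a, 'g) umodule).
      BDF k R L \<and> BDF k R M \<and> BDF k R N \<and> gr_short_exact R L M N}"

definition G_BDF ::
    "('k, 'kw) ring_scheme \<Rightarrow> ('k, 'a, 'g::ab_group_add) gmodule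
      \<Rightarrow> (('k, 'a, 'g) umodule set \<Rightarrow>\<^sub>0 int) set monoid"
  where "G_BDF k R = free_on_classes k R Mod exact_relations k R"

definition G_class ::
    "('k, 'kw) ring_scheme \<Rightarrow> ('k, 'a, 'g::ab_group_add) gmodule \<Rightarrow> ('a, 'b, 'g) gmodule
      \<Rightarrow> (('k, 'a, 'g) umodule set \<Rightarrow>\<^sub>0 int) set"
  where "G_class k R M =
    exact_relations k R #>\<^bsub>free_on_classes k R\<^esub> frag_of (iso_class k R M)"

definition down_closure :: "'g::ab_group_add set \<Rightarrow> 'g set \<Rightarrow> 'g set"
  where "down_closure Q U = {g. \<exists>u\<in>U. le_monoid Q g u}"

definition Z_subgroup ::
    "('k, 'kw) ring_scheme \<Rightarrow> ('k, 'a, 'g::ab_group_add) gmodule \<Rightarrow> 'g set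
      \<Rightarrow> (('k, 'a, 'g) umodule set \<Rightarrow>\<^sub>0 int) set set"
  where "Z_subgroup k R U = generate (G_BDF k R)
    {G_class k R M | M :: ('k, 'a, 'g) umodule.
      BDF k R M \<and> Supp M \<inter> down_closure (Supp R) U = {}}"

definition Z_sums ::
    "('k, 'kw) ring_scheme \<Rightarrow> ('k, 'a, 'g::ab_group_add) gmodule
      \<Rightarrow> ('i \<Rightarrow> (('k, 'a, 'g) umodule set \<Rightarrow>\<^sub>0 int) set) \<Rightarrow> 'i set
      \<Rightarrow> (('k, 'a, 'g) umodule set \<Rightarrow>\<^sub>0 int) set \<Rightarrow> bool"
  where "Z_sums k R x A s \<longleftrightarrow> (\<forall>U. finite U \<longrightarrow> (\<exists>B. finite B \<and> B \<subseteq> A \<and>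
    (\<forall>C. finite C \<and> B \<subseteq> C \<and> C \<subseteq> A \<longrightarrow>
      s \<otimes>\<^bsub>G_BDF k R\<^esub> inv\<^bsub>G_BDF k R\<^esub> (finprod (G_BDF k R) x C) \<in> Z_subgroup k R U)))"

section \<open>The Serre product\<close>

definition serre_term ::
    "('k, 'kw) ring_scheme \<Rightarrow> ('k, 'a, 'g::ab_group_add) gmodule
      \<Rightarrow> ('a, 'b, 'g) gmodule \<Rightarrow> ('a, 'c, 'g) gmodule \<Rightarrow> nat
      \<Rightarrow> (('k, 'a, 'g) umodule set \<Rightarrow>\<^sub>0 int) set"
  where "serre_term k R M N i = G_class k R (Tor k R i M N) [^]\<^bsub>G_BDF k R\<^esub> ((-1 :: int) ^ i)"

text \<open>\<open>m\<close> is a biadditive operation on \<open>G\<close> such that, for all BDF modules \<open>M\<close> and \<open>N\<close>, the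
  alternating sum of the classes of the \<open>Tor\<close> modules converges, its limit is unique, and this
  limit is \<open>m [M] [N]\<close>.\<close>

definition serre_product ::
    "('k, 'kw) ring_scheme \<Rightarrow> ('k, 'a, 'g::ab_group_add) gmodule
      \<Rightarrow> ((('k, 'a, 'g) umodule set \<Rightarrow>\<^sub>0 int) set \<Rightarrow> (('k, 'a, 'g) umodule set \<Rightarrow>\<^sub>0 int) set
        \<Rightarrow> (('k, 'a, 'g) umodule set \<Rightarrow>\<^sub>0 int) set) \<Rightarrow> bool"
  where "serre_product k R m \<longleftrightarrow>
    (let G = G_BDF k R in
      m \<in> carrier G \<rightarrow>\<^sub>E (carrier G \<rightarrow>\<^sub>E carrier G) \<and>
      (\<forall>x\<in>carrier G. \<forall>y\<in>carrier G. \<forall>z\<in>carrier G.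
        m (x \<otimes>\<^bsub>G\<^esub> y) z = m x z \<otimes>\<^bsub>G\<^esub> m y z \<and> m x (y \<otimes>\<^bsub>G\<^esub> z) = m x y \<otimes>\<^bsub>G\<^esub> m x z) \<and>
      (\<forall>(M :: ('k, 'a, 'g) umodule) (N :: ('k, 'a, 'g) umodule). BDF k R M \<and> BDF k R N \<longrightarrow>
        (\<forall>s\<in>carrier G. Z_sums k R (serre_term k R M N) UNIV s \<longleftrightarrow>
          s = m (G_class k R M) (G_class k R N))))"

definition G_ring ::
    "('k, 'kw) ring_scheme \<Rightarrow> ('k, 'a, 'g::ab_group_add) gmodule
      \<Rightarrow> ((('k, 'a, 'g) umodule set \<Rightarrow>\<^sub>0 int) set \<Rightarrow> (('k, 'a, 'g) umodule set \<Rightarrow>\<^sub>0 int) set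
        \<Rightarrow> (('k, 'a, 'g) umodule set \<Rightarrow>\<^sub>0 int) set)
      \<Rightarrow> (('k, 'a, 'g) umodule set \<Rightarrow>\<^sub>0 int) set ring"
  where "G_ring k R m = \<lparr>carrier = carrier (G_BDF k R), monoid.mult = m,
    one = G_class k R (regular_module R),
    ring.zero = one (G_BDF k R), add = monoid.mult (G_BDF k R)\<rparr>"

end

theory Submission
  imports Defs "HOL-Library.Function_Algebras"
begin

text \<open>Counting dimensions degree by degree, every BDF module \<open>M\<close> has a unique integer function
  \<open>chr M\<close> with support bounded below whose convolution with the Hilbert function of \<open>R\<close> is the
  Hilbert function of \<open>M\<close>: it is the alternating sum of the ranks in a minimal free resolution, which is
  finite in each degree because the degrees of the generators of successive syzygies strictly increase.
  By Nakayama a projective BDF module is free, hence determined by \<open>chr\<close>, and an Eilenberg swindle along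
  a resolution writes each class in \<open>G\<close> as a difference of classes of free modules. So \<open>chr\<close> identifies
  both \<open>K\<close> and \<open>G\<close> with the ring of such functions under convolution, and \<open>Z\<close>-neighbourhoods
  of zero with the functions vanishing on a set \<open>(-\<infinity>, U]\<close>. Finally, dimension shifting along the syzygies of
  \<open>N\<close> shows that in each degree only finitely many \<open>chr (Tor i M N)\<close> are nonzero and that their
  alternating sum is the convolution of \<open>chr M\<close> and \<open>chr N\<close>.\<close>

section \<open>Convolution of functions with bounded support\<close>

text \<open>Resolutions over \<open>R\<close> may be infinite, so every alternating sum has to be
  cut off degree by degree; the cut-off is the number of possible degrees below a given one.
  \<open>Tor\<close> is computed from a resolution of \<open>M\<close> that is merely some chosen
  one. This is why minimal syzygies are taken of \<open>N\<close>: the higher Tor modules of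
  \<open>M\<close> and \<open>N\<close> have the dimensions of Tor_1 of \<open>M\<close> with a
  syzygy of \<open>N\<close>, and these vanish in every degree that the degrees of the late syzygies
  can no longer reach. As \<open>chr\<close> only sees Hilbert functions, dimension counts take the
  place of connecting homomorphisms. Convolution with the Hilbert function of \<open>R\<close> can
  be cancelled because that function is 1 in degree 0 and its other degrees are strictly larger, so
  a minimal degree of a function survives. This works on each down-closed set separately, and so
  yields both the uniqueness of \<open>chr\<close> and the description of the topology. The swindle
  rests on infinite direct sums being BDF when their supports have a common bound below and each
  degree meets finitely many summands.\<close>

definition supp :: "('g \<Rightarrow> 'b::zero) \<Rightarrow> 'g set"
  where "supp f = {g. f g \<noteq> 0}"

text \<open>This is the product of formal series with exponents in the group of degrees. The index
  set is finite as soon as both supports are finitely bounded below; over an infinite index set the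
  sum would be 0 by convention.\<close>

definition conv :: "('g::ab_group_add \<Rightarrow> int) \<Rightarrow> ('g \<Rightarrow> int) \<Rightarrow> 'g \<Rightarrow> int"
  where "conv f h g = (\<Sum>a\<in>{a. f a \<noteq> 0 \<and> h (g - a) \<noteq> 0}. f a * h (g - a))"

definition unit_fun :: "'g::zero \<Rightarrow> int"
  where "unit_fun g = (if g = 0 then 1 else 0)"

lemma conv_eq:
  assumes "finite S" "\<And>a. f a \<noteq> 0 \<Longrightarrow> h (g - a) \<noteq> 0 \<Longrightarrow> a \<in> S"
  shows "conv f h g = (\<Sum>a\<in>S. f a * h (g - a))"
  unfolding conv_def using assms by (intro sum.mono_neutral_left) auto

lemma conv_unit: "conv unit_fun f = f"
proof
  fix g show "conv unit_fun f g = f g"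
    by (subst conv_eq[of "{0}"]) (auto simp: unit_fun_def split: if_splits)
qed

lemma conv_comm: "conv f h = conv h f"
proof
  fix g
  show "conv f h g = conv h f g"
    unfolding conv_def
    by (rule sum.reindex_bij_witness[of _ "\<lambda>a. g - a" "\<lambda>a. g - a"]) auto
qed

lemma conv_zero: "conv 0 f = 0"
  by (auto simp: conv_def)

lemma conv_uminus: "conv (- f) h = - conv f h"
  by (rule ext) (simp add: conv_def sum_negf)

text \<open>The monoid of degrees on its own, without \<open>R\<close>: all finiteness of sums and
  all minimality arguments take place at this level.\<close>

locale pointed_monoid =
  fixes Q :: "'g::ab_group_add set"
  assumes zero_mem: "0 \<in> Q" and add_mem: "p \<in> Q \<Longrightarrow> q \<in> Q \<Longrightarrow> p + q \<in> Q"
    and pointed: "pointed Q" and downward_finite: "downward_finite Q Q"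
begin

abbreviation bounded :: "'g set \<Rightarrow> bool"
  where "bounded \<equiv> finitely_bounded_below Q"

lemma le_refl: "le_monoid Q g g"
  by (simp add: le_monoid_def zero_mem)

lemma le_trans: "le_monoid Q f g \<Longrightarrow> le_monoid Q g h \<Longrightarrow> le_monoid Q f h"
proof -
  have "h - f = (g - f) + (h - g)" by simp
  then show "le_monoid Q f g \<Longrightarrow> le_monoid Q g h \<Longrightarrow> le_monoid Q f h"
    using add_mem by (simp only: le_monoid_def)
qed

lemma le_antisym: "le_monoid Q f g \<Longrightarrow> le_monoid Q g f \<Longrightarrow> f = g"
proof -
  assume "le_monoid Q f g" "le_monoid Q g f"
  then have "g - f = 0"
    using pointed[unfolded pointed_def, rule_format, THEN conjunct1, of "g - f" "f - g"]
    unfolding le_monoid_def by simp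
  then show ?thesis by simp
qed

lemma bounded_subset: "bounded U \<Longrightarrow> V \<subseteq> U \<Longrightarrow> bounded V"
  unfolding finitely_bounded_below_def by blast

lemma bounded_Un:
  assumes "bounded U" "bounded V" shows "bounded (U \<union> V)"
proof -
  obtain P P' where "finite P" "\<forall>u\<in>U. \<exists>p\<in>P. le_monoid Q p u" "finite P'" "\<forall>u\<in>V. \<exists>p\<in>P'. le_monoid Q p u"
    using assms unfolding finitely_bounded_below_def by auto
  then show ?thesis unfolding finitely_bounded_below_def
    by (intro exI[of _ "P \<union> P'"]) auto
qed

lemma bounded_finite: "finite U \<Longrightarrow> bounded U"
  unfolding finitely_bounded_below_def using le_refl by (intro exI[of _ U]) auto

lemma bounded_monoid: "bounded Q"
  unfolding finitely_bounded_below_def by (intro exI[of _ "{0}"]) (auto simp: le_monoid_def)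

lemma bounded_plus:
  assumes "bounded U" "bounded V" shows "bounded {u + v | u v. u \<in> U \<and> v \<in> V}"
proof -
  obtain P P' where P: "finite P" "\<forall>u\<in>U. \<exists>p\<in>P. le_monoid Q p u" "finite P'" "\<forall>u\<in>V. \<exists>p\<in>P'. le_monoid Q p u"
    using assms unfolding finitely_bounded_below_def by auto
  have "\<exists>p\<in>(\<lambda>(p, p'). p + p') ` (P \<times> P'). le_monoid Q p (u + v)" if "u \<in> U" "v \<in> V" for u v
  proof -
    obtain p where p: "p \<in> P" "le_monoid Q p u" using P(2) \<open>u \<in> U\<close> by blast
    obtain p' where "p' \<in> P'" "le_monoid Q p' v" using P(4) \<open>v \<in> V\<close> by blast
    note pp = p(1) this(1)
    note p(2) \<open>le_monoid Q p' v\<close>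
    moreover have "p + p' \<in> (\<lambda>(p, p'). p + p') ` (P \<times> P')" using pp by (intro image_eqI[of _ _ "(p, p')"]) simp_all
    moreover have "u + v - (p + p') = (u - p) + (v - p')" by simp
    ultimately show ?thesis
      using add_mem[of "u - p" "v - p'"] unfolding le_monoid_def
      by (intro bexI[of _ "p + p'"]) (simp_all only:)
  qed
  then show ?thesis
    unfolding finitely_bounded_below_def using P(1,3)
    by (intro exI[of _ "(\<lambda>(p, p'). p + p') ` (P \<times> P')"]) auto
qed

text \<open>The elements of \<open>U\<close> that lie above a bound \<open>p\<close> and below
  \<open>g\<close> form a translate of elements of \<open>Q\<close> below \<open>g - p\<close>, of
  which there are finitely many.\<close>

lemma bounded_down_finite:
  assumes "bounded U" shows "finite {u\<in>U. le_monoid Q u g}"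
proof -
  obtain P where P: "finite P" "\<forall>u\<in>U. \<exists>p\<in>P. le_monoid Q p u"
    using assms unfolding finitely_bounded_below_def by auto
  have "{u\<in>U. le_monoid Q u g} \<subseteq> (\<Union>p\<in>P. (\<lambda>q. p + q) ` {q\<in>Q. le_monoid Q q (g - p)})"
  proof
    fix u assume u: "u \<in> {u\<in>U. le_monoid Q u g}"
    then obtain p where "p \<in> P" "le_monoid Q p u" using P by blast
    then show "u \<in> (\<Union>p\<in>P. (\<lambda>q. p + q) ` {q\<in>Q. le_monoid Q q (g - p)})"
      using u by (auto simp: le_monoid_def intro!: bexI[of _ p] image_eqI[of _ _ "u - p"])
  qed
  moreover have "finite \<dots>"
    using P(1) downward_finite by (auto simp: downward_finite_def)
  ultimately show ?thesis by (rule finite_subset)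
qed

lemma bounded_downward_finite: "bounded U \<Longrightarrow> downward_finite Q U"
  using bounded_down_finite by (simp add: downward_finite_def)

text \<open>If \<open>g - u\<close> lies above a bound \<open>p\<close> of \<open>V\<close>, then
  \<open>u\<close> lies below \<open>g - p\<close>. This is the finiteness of the index set of a
  convolution.\<close>

lemma bounded_interval:
  assumes "bounded U" "bounded V" shows "finite {u\<in>U. g - u \<in> V}"
proof -
  obtain P where P: "finite P" "\<forall>v\<in>V. \<exists>p\<in>P. le_monoid Q p v"
    using assms unfolding finitely_bounded_below_def by auto
  have "{u\<in>U. g - u \<in> V} \<subseteq> (\<Union>p\<in>P. {u\<in>U. le_monoid Q u (g - p)})"
  proof
    fix u assume u: "u \<in> {u\<in>U. g - u \<in> V}"
    then obtain p where "p \<in> P" "le_monoid Q p (g - u)" using P(2) by blast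
    moreover have "g - u - p = g - p - u" by simp
    ultimately show "u \<in> (\<Union>p\<in>P. {u\<in>U. le_monoid Q u (g - p)})"
      using u unfolding le_monoid_def by auto
  qed
  moreover have "finite \<dots>" using P(1) bounded_down_finite[OF assms(1)] by auto
  ultimately show ?thesis by (rule finite_subset)
qed

lemma conv_sum:
  assumes "bounded (supp f)" "bounded (supp h)" "supp f \<subseteq> U" "supp h \<subseteq> V" "bounded U" "bounded V"
  shows "conv f h g = (\<Sum>a\<in>{a\<in>U. g - a \<in> V}. f a * h (g - a))"
  using assms by (intro conv_eq bounded_interval) (auto simp: supp_def)

lemma supp_conv: "supp (conv f h) \<subseteq> {u + v | u v. u \<in> supp f \<and> v \<in> supp h}"
proof
  fix g assume "g \<in> supp (conv f h)"
  then have "{a. f a \<noteq> 0 \<and> h (g - a) \<noteq> 0} \<noteq> {}" by (force simp: supp_def conv_def)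
  then obtain a where "f a \<noteq> 0" "h (g - a) \<noteq> 0" by auto
  then show "g \<in> {u + v | u v. u \<in> supp f \<and> v \<in> supp h}"
    unfolding supp_def by (intro CollectI exI[of _ a] exI[of _ "g - a"]) simp
qed

lemma bounded_conv: "bounded (supp f) \<Longrightarrow> bounded (supp h) \<Longrightarrow> bounded (supp (conv f h))"
  by (rule bounded_subset[OF bounded_plus supp_conv])

lemma bounded_add: "bounded (supp f) \<Longrightarrow> bounded (supp h) \<Longrightarrow> bounded (supp (f + h :: 'g \<Rightarrow> int))"
  by (rule bounded_subset[OF bounded_Un[of "supp f" "supp h"]]) (auto simp: supp_def)

lemma supp_uminus: "supp (- f :: 'g \<Rightarrow> int) = supp f"
  by (auto simp: supp_def)

lemma bounded_diff: "bounded (supp f) \<Longrightarrow> bounded (supp h) \<Longrightarrow> bounded (supp (f - h :: 'g \<Rightarrow> int))"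
  using bounded_add[of f "- h"] by (simp add: supp_uminus)

lemma conv_add:
  assumes "bounded (supp f)" "bounded (supp f')" "bounded (supp h)"
  shows "conv (f + f') h = conv f h + conv f' h"
proof
  fix g
  let ?U = "supp f \<union> supp f'"
  have U: "bounded ?U" using assms bounded_Un by blast
  show "conv (f + f') h g = (conv f h + conv f' h) g"
  proof -
    have "supp (f + f') \<subseteq> ?U" by (auto simp: supp_def)
    then have "conv (f + f') h g = (\<Sum>a\<in>{a \<in> ?U. g - a \<in> supp h}. (f + f') a * h (g - a))"
      using U assms by (intro conv_sum bounded_add) auto
    moreover have "conv f h g = (\<Sum>a\<in>{a \<in> ?U. g - a \<in> supp h}. f a * h (g - a))"
      "conv f' h g = (\<Sum>a\<in>{a \<in> ?U. g - a \<in> supp h}. f' a * h (g - a))"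
      using U assms conv_sum[of f h ?U "supp h"] conv_sum[of f' h ?U "supp h"] by auto
    ultimately show ?thesis by (simp add: distrib_right sum.distrib)
  qed
qed

lemma conv_diff:
  assumes "bounded (supp f)" "bounded (supp f')" "bounded (supp h)"
  shows "conv (f - f') h = conv f h - conv f' h"
  using conv_add[of f "- f'" h] assms by (simp add: supp_uminus conv_uminus)

lemma conv_assoc:
  assumes f: "bounded (supp f)" and h: "bounded (supp h)" and l: "bounded (supp l)"
  shows "conv (conv f h) l = conv f (conv h l)"
proof
  fix g
  let ?FH = "{u + v | u v. u \<in> supp f \<and> v \<in> supp h}" and ?HL = "{u + v | u v. u \<in> supp h \<and> v \<in> supp l}"
  \<comment> \<open>\<open>S\<close> collects the degrees that \<open>f\<close> can contribute,
    \<open>T\<close> the degrees that the product of \<open>f\<close> and \<open>h\<close> can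
    contribute. Both sides become one double sum over \<open>S\<close> and \<open>T\<close>; the
    additional terms are zero.\<close>
  define S where "S = {a \<in> supp f. g - a \<in> ?HL}"
  define T where "T = {b \<in> ?FH. g - b \<in> supp l}"
  have fin: "finite S" "finite T" unfolding S_def T_def
    using bounded_interval[OF f bounded_plus[OF h l]] bounded_interval[OF bounded_plus[OF f h] l] by auto
  have 1: "conv f h b * l (g - b) = (\<Sum>a\<in>S. f a * h (b - a) * l (g - b))" for b
  proof (cases "l (g - b) = 0")
    case False
    have "conv f h b = (\<Sum>a\<in>S. f a * h (b - a))"
    proof (rule conv_eq[OF fin(1)])
      fix a assume "f a \<noteq> 0" "h (b - a) \<noteq> 0"
      moreover have "g - a = (b - a) + (g - b)" by simp
      ultimately show "a \<in> S" using False unfolding S_def supp_def by blast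
    qed
    then show ?thesis by (simp add: sum_distrib_right)
  qed simp
  have 2: "f a * conv h l (g - a) = (\<Sum>b\<in>T. f a * h (b - a) * l (g - b))" for a
  proof (cases "f a = 0")
    case False
    have "conv h l (g - a) = (\<Sum>c\<in>(\<lambda>b. b - a) ` T. h c * l (g - a - c))"
    proof (rule conv_eq)
      fix c assume "h c \<noteq> 0" "l (g - a - c) \<noteq> 0"
      then have "a + c \<in> T" using False by (auto simp: T_def supp_def algebra_simps)
      then show "c \<in> (\<lambda>b. b - a) ` T" by force
    qed (use fin in simp)
    also have "\<dots> = (\<Sum>b\<in>T. h (b - a) * l (g - b))"
      by (subst sum.reindex) (auto simp: inj_on_def)
    finally show ?thesis by (simp add: sum_distrib_left mult.assoc)
  qed simp
  have "conv (conv f h) l g = (\<Sum>b\<in>T. conv f h b * l (g - b))"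
    by (rule conv_eq[OF fin(2)]) (use supp_conv[of f h] in \<open>auto simp: T_def supp_def\<close>)
  also have "\<dots> = (\<Sum>a\<in>S. \<Sum>b\<in>T. f a * h (b - a) * l (g - b))"
    unfolding 1 by (rule sum.swap)
  also have "\<dots> = conv f (conv h l) g"
    unfolding 2[symmetric]
    by (rule conv_eq[OF fin(1), symmetric]) (use supp_conv[of h l] in \<open>auto simp: S_def supp_def\<close>)
  finally show "conv (conv f h) l g = conv f (conv h l) g" .
qed

text \<open>Each term of the convolution at \<open>g\<close> contains a factor
  \<open>f (g - v)\<close> with \<open>h v \<noteq> 0\<close>.\<close>

lemma conv_vanish_on_down_set:
  assumes "\<And>g v. g \<in> D \<Longrightarrow> h v \<noteq> 0 \<Longrightarrow> f (g - v) = 0" "g \<in> D"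
  shows "conv f h g = 0"
proof -
  have "{a. f a \<noteq> 0 \<and> h (g - a) \<noteq> 0} = {}"
    using assms(1)[OF assms(2), of "g - _"] by fastforce
  then show ?thesis by (simp only: conv_def sum.empty)
qed

text \<open>In a minimal degree \<open>m\<close> of the support of \<open>f\<close> below
  \<open>g\<close>, the only term of the convolution that remains is \<open>H 0 * f m = f m\<close>,
  because all degrees of \<open>H\<close> lie in \<open>Q\<close>. Down-closedness of
  \<open>D\<close> keeps \<open>m\<close> in the set on which the convolution is known to
  vanish.\<close>

lemma conv_cancel_on_down_set:
  assumes H: "supp H \<subseteq> Q" "H 0 = 1" and f: "bounded (supp f)"
    and D: "\<And>g h. h \<in> D \<Longrightarrow> le_monoid Q g h \<Longrightarrow> g \<in> D"
    and 0: "\<And>g. g \<in> D \<Longrightarrow> conv H f g = 0" and g: "g \<in> D"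
  shows "f g = 0"
proof (rule ccontr)
  assume "f g \<noteq> 0"
  define U where "U = {u \<in> supp f. le_monoid Q u g}"
  have "finite U" "U \<noteq> {}"
    using bounded_down_finite[OF f] \<open>f g \<noteq> 0\<close> le_refl by (auto simp: U_def supp_def)
  \<comment> \<open>The order is only partial, so a minimal degree is found by minimising the number
    of elements of \<open>U\<close> below it.\<close>
  then obtain m where m1: "m \<in> U"
      "\<And>u. u \<in> U \<Longrightarrow> card {v \<in> U. le_monoid Q v m} \<le> card {v \<in> U. le_monoid Q v u}"
    using ex_has_least_nat[of "\<lambda>u. u \<in> U" _ "\<lambda>u. card {v \<in> U. le_monoid Q v u}"] by blast
  have m: "m \<in> U" "\<And>u. u \<in> U \<Longrightarrow> le_monoid Q u m \<Longrightarrow> u = m"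
  proof -
    show "m \<in> U" by (rule m1)
    fix u assume u: "u \<in> U" "le_monoid Q u m"
    have sub: "{v \<in> U. le_monoid Q v u} \<subseteq> {v \<in> U. le_monoid Q v m}" using le_trans u by blast
    then have "{v \<in> U. le_monoid Q v u} = {v \<in> U. le_monoid Q v m}"
      using card_subset_eq[OF _ sub] card_mono[OF _ sub] m1(2)[OF u(1)] \<open>finite U\<close> by simp
    then have "le_monoid Q m u" using m1(1) le_refl by blast
    then show "u = m" using le_antisym u by blast
  qed
  have "m \<in> D" using D[OF g] m(1) by (auto simp: U_def)
  have "conv H f m = (\<Sum>a\<in>{0}. H a * f (m - a))"
  proof (rule conv_eq)
    fix a assume "H a \<noteq> 0" "f (m - a) \<noteq> 0"
    moreover then have "le_monoid Q (m - a) m" using H by (auto simp: supp_def le_monoid_def)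
    ultimately have "m - a = m" using m le_trans by (auto simp: U_def supp_def)
    then show "a \<in> {0}" by simp
  qed simp
  then show False using 0[OF \<open>m \<in> D\<close>] H m(1) by (auto simp: U_def supp_def)
qed

end

section \<open>Dimension of subspaces\<close>

definition adjoin :: "('k, 'kw) ring_scheme \<Rightarrow> ('k, 'v, 'vw) module_scheme \<Rightarrow> 'v set \<Rightarrow> 'v \<Rightarrow> 'v set"
  where "adjoin k V S v = {s \<oplus>\<^bsub>V\<^esub> c \<odot>\<^bsub>V\<^esub> v | s c. s \<in> S \<and> c \<in> carrier k}"

text \<open>A chain of subspaces from 0 to \<open>S\<close> that grows by one vector at each step;
  its length is the dimension. Dimension theory then becomes induction along chains, without
  choosing bases.\<close>

inductive flag :: "('k, 'kw) ring_scheme \<Rightarrow> ('k, 'v, 'vw) module_scheme \<Rightarrow> 'v set \<Rightarrow> nat \<Rightarrow> bool"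
  for k V where
  zero: "flag k V {\<zero>\<^bsub>V\<^esub>} 0"
| step: "flag k V S n \<Longrightarrow> v \<in> carrier V \<Longrightarrow> v \<notin> S \<Longrightarrow> flag k V (adjoin k V S v) (Suc n)"

definition fin_dim :: "('k, 'kw) ring_scheme \<Rightarrow> ('k, 'v, 'vw) module_scheme \<Rightarrow> 'v set \<Rightarrow> bool"
  where "fin_dim k V S \<longleftrightarrow> (\<exists>n. flag k V S n)"

definition dim :: "('k, 'kw) ring_scheme \<Rightarrow> ('k, 'v, 'vw) module_scheme \<Rightarrow> 'v set \<Rightarrow> nat"
  where "dim k V S = (THE n. flag k V S n)"

lemma (in module) submodule_zero:
  assumes "submodule H R M" shows "\<zero>\<^bsub>M\<^esub> \<in> H"
  using submoduleE[OF assms] by (metis M.r_neg ex_in_conv subsetD)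

locale vspace = module k V + field k for k :: "('k, 'kw) ring_scheme" and V :: "('k, 'v, 'vw) module_scheme" (structure)
begin

abbreviation "sub S \<equiv> submodule S k V"

lemma subD:
  assumes "sub S"
  shows "x \<in> S \<Longrightarrow> x \<in> carrier V" "\<zero> \<in> S" "x \<in> S \<Longrightarrow> y \<in> S \<Longrightarrow> x \<oplus> y \<in> S"
    "c \<in> carrier k \<Longrightarrow> x \<in> S \<Longrightarrow> c \<odot> x \<in> S" "x \<in> S \<Longrightarrow> \<ominus> x \<in> S" "x \<in> S \<Longrightarrow> y \<in> S \<Longrightarrow> x \<ominus> y \<in> S"
  using submoduleE[OF assms] submodule_zero[OF assms] by (auto simp: a_minus_def)

lemma sub_smult_iff:
  assumes "sub S" "c \<in> carrier k" "c \<noteq> \<zero>\<^bsub>k\<^esub>" "x \<in> carrier V"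
  shows "c \<odot> x \<in> S \<longleftrightarrow> x \<in> S"
proof
  assume "c \<odot> x \<in> S"
  moreover have c: "c \<in> Units k" using assms field_Units by auto
  ultimately have "inv\<^bsub>k\<^esub> c \<odot> (c \<odot> x) \<in> S" using subD(4)[OF assms(1)] by auto
  then show "x \<in> S" using c assms by (simp add: smult_assoc1[symmetric])
qed (use subD(4)[OF assms(1)] assms in auto)

lemma sub_add_iff:
  assumes "sub S" "x \<in> S" "y \<in> carrier V"
  shows "x \<oplus> y \<in> S \<longleftrightarrow> y \<in> S"
proof
  assume "x \<oplus> y \<in> S"
  then have "\<ominus> x \<oplus> (x \<oplus> y) \<in> S" using subD[OF assms(1)] assms by auto
  then show "y \<in> S" using assms subD(1)[OF assms(1)] by (simp add: M.r_neg1)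
qed (use subD(3)[OF assms(1)] assms in auto)

lemma adjoin_sub:
  assumes S: "sub S" and v: "v \<in> carrier V"
  shows "sub (adjoin k V S v)"
proof (rule submoduleI)
  note S' = subD[OF S]
  show "adjoin k V S v \<subseteq> carrier V" using S' v by (auto simp: adjoin_def)
  show "\<zero> \<in> adjoin k V S v"
    unfolding adjoin_def using S'(2) v by (intro CollectI exI[of _ "\<zero>"] exI[of _ "\<zero>\<^bsub>k\<^esub>"]) auto
  fix a assume "a \<in> adjoin k V S v"
  then obtain s c where a: "a = s \<oplus> c \<odot> v" "s \<in> S" "c \<in> carrier k" by (auto simp: adjoin_def)
  have "\<ominus> a = \<ominus> s \<oplus> (\<ominus>\<^bsub>k\<^esub> c) \<odot> v" using a v S' by (simp add: M.minus_add smult_l_minus)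
  then show "\<ominus> a \<in> adjoin k V S v" using a S' unfolding adjoin_def by blast
  {
    fix b assume "b \<in> adjoin k V S v"
    then obtain s' c' where b: "b = s' \<oplus> c' \<odot> v" "s' \<in> S" "c' \<in> carrier k" by (auto simp: adjoin_def)
    have "a \<oplus> b = (s \<oplus> s') \<oplus> (c \<oplus>\<^bsub>k\<^esub> c') \<odot> v" using a b v S' by (simp add: smult_l_distr M.a_ac)
    then show "a \<oplus> b \<in> adjoin k V S v" using a b S' unfolding adjoin_def by blast
  }
  fix r assume r: "r \<in> carrier k"
  have "r \<odot> a = r \<odot> s \<oplus> (r \<otimes>\<^bsub>k\<^esub> c) \<odot> v" using a r v S' by (simp add: smult_r_distr smult_assoc1)
  then show "r \<odot> a \<in> adjoin k V S v" using a r S' unfolding adjoin_def by blast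
qed

lemma adjoin_superset:
  assumes S: "sub S" and v: "v \<in> carrier V"
  shows "S \<subseteq> adjoin k V S v" "v \<in> adjoin k V S v"
proof -
  note S' = subD[OF S]
  have "s = s \<oplus> \<zero>\<^bsub>k\<^esub> \<odot> v" if "s \<in> S" for s using that S' v by simp
  then show "S \<subseteq> adjoin k V S v" unfolding adjoin_def by blast
  have "v = \<zero> \<oplus> \<one>\<^bsub>k\<^esub> \<odot> v" using v by simp
  then show "v \<in> adjoin k V S v" unfolding adjoin_def using S' by blast
qed

lemma adjoin_minimal:
  assumes "sub T" "S \<subseteq> T" "v \<in> T" shows "adjoin k V S v \<subseteq> T"
proof
  fix x assume "x \<in> adjoin k V S v"
  then obtain s c where "x = s \<oplus> c \<odot> v" "s \<in> S" "c \<in> carrier k" by (auto simp: adjoin_def)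
  then show "x \<in> T" using subD(3,4)[OF assms(1)] assms(2,3) by blast
qed

text \<open>Steinitz exchange for a single vector: in \<open>w = s + c v\<close> the scalar
  \<open>c\<close> is nonzero because \<open>w\<close> lies outside \<open>S\<close>, so
  \<open>v\<close> can be recovered from \<open>w\<close>.\<close>

lemma adjoin_exchange:
  assumes S: "sub S" and v: "v \<in> carrier V" and w: "w \<in> adjoin k V S v" "w \<notin> S"
  shows "adjoin k V S w = adjoin k V S v"
proof
  obtain s c where sc: "w = s \<oplus> c \<odot> v" "s \<in> S" "c \<in> carrier k" using w by (auto simp: adjoin_def)
  have wV: "w \<in> carrier V" using w subD(1)[OF adjoin_sub[OF S v]] by blast
  have sV: "s \<in> carrier V" using sc subD(1)[OF S] by blast
  show "adjoin k V S w \<subseteq> adjoin k V S v"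
    by (rule adjoin_minimal[OF adjoin_sub[OF S v] adjoin_superset(1)[OF S v] w(1)])
  have c0: "c \<noteq> \<zero>\<^bsub>k\<^esub>" using w(2) sc v sV by auto
  have "\<ominus> s \<oplus> w \<in> adjoin k V S w"
    using subD(3)[OF adjoin_sub[OF S wV] subsetD[OF adjoin_superset(1)[OF S wV] subD(5)[OF S sc(2)]]
      adjoin_superset(2)[OF S wV]] .
  then have "c \<odot> v \<in> adjoin k V S w" using sc v sV by (simp add: M.r_neg1)
  then have "v \<in> adjoin k V S w" using sub_smult_iff[OF adjoin_sub[OF S wV] sc(3) c0 v] by simp
  then show "adjoin k V S v \<subseteq> adjoin k V S w"
    by (intro adjoin_minimal adjoin_sub S wV adjoin_superset)
qed

text \<open>By exchange \<open>v\<close> may be replaced by \<open>t \<in> T\<close>. Subtracting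
  the multiple of \<open>t\<close> from an element of \<open>T\<close> then leaves its part in
  \<open>S\<close>, which still belongs to \<open>T\<close>.\<close>

lemma adjoin_decompose:
  assumes S: "sub S" and v: "v \<in> carrier V" and T: "sub T" "T \<subseteq> adjoin k V S v" and t: "t \<in> T" "t \<notin> S"
  shows "T = adjoin k V (T \<inter> S) t"
proof
  have tV: "t \<in> carrier V" using t subD(1)[OF T(1)] by blast
  show "T \<subseteq> adjoin k V (T \<inter> S) t"
  proof
    fix x assume x: "x \<in> T"
    then have "x \<in> adjoin k V S t" using adjoin_exchange[OF S v] t T by blast
    then obtain s c where sc: "x = s \<oplus> c \<odot> t" "s \<in> S" "c \<in> carrier k" by (auto simp: adjoin_def)
    have "s \<in> carrier V" using sc subD(1)[OF S] by blast
    then have "c \<odot> t \<oplus> s \<in> T" using x sc tV by (simp add: M.a_comm)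
    then have "s \<in> T"
      using sub_add_iff[OF T(1) subD(4)[OF T(1) sc(3) t(1)] \<open>s \<in> carrier V\<close>] by simp
    then show "x \<in> adjoin k V (T \<inter> S) t" using sc by (auto simp: adjoin_def)
  qed
  show "adjoin k V (T \<inter> S) t \<subseteq> T" by (rule adjoin_minimal[OF T(1)]) (use t in auto)
qed

lemma sub_zero: "sub {\<zero>}"
  by (rule submoduleI) auto

lemma sub_Int: "sub S \<Longrightarrow> sub T \<Longrightarrow> sub (S \<inter> T)"
  by (rule submoduleI) (use subD[of S] subD[of T] in \<open>auto simp: \<close>)

lemma flag_sub: "flag k V S n \<Longrightarrow> sub S"
  by (induction rule: flag.induct) (auto intro: sub_zero adjoin_sub)

text \<open>The core of the invariance of dimension: if \<open>S\<close> is at most a hyperplane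
  away from containing \<open>T\<close>, then cutting \<open>T\<close> down to \<open>S\<close>
  costs no step or exactly one step of the flag.\<close>

lemma flag_hyperplane:
  assumes "flag k V T m" and S: "sub S" and v: "v \<in> carrier V" and "T \<subseteq> adjoin k V S v"
  shows "T \<subseteq> S \<or> (\<exists>n. m = Suc n \<and> flag k V (T \<inter> S) n)"
  using assms(1,4)
proof (induction rule: flag.induct)
  case zero
  then show ?case using subD(2)[OF S] by auto
next
  case (step T m w)
  have T: "sub T" using flag_sub step by blast
  note Tw = adjoin_superset[OF T step(2)]
  have subTw: "sub (adjoin k V T w)" by (rule adjoin_sub[OF T step(2)])
  have *: "flag k V (adjoin k V T w \<inter> S) m" if "T \<subseteq> S" "w \<notin> S"
  proof -
    have "x \<in> T" if x: "x \<in> adjoin k V T w" "x \<in> S" for x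
    proof -
      obtain t c where tc: "x = t \<oplus> c \<odot> w" "t \<in> T" "c \<in> carrier k" using x by (auto simp: adjoin_def)
      have "c \<odot> w \<in> S" using sub_add_iff[OF S, of t "c \<odot> w"] tc x \<open>T \<subseteq> S\<close> step(2) by auto
      then have "c = \<zero>\<^bsub>k\<^esub>" using sub_smult_iff[OF S tc(3) _ step(2)] \<open>w \<notin> S\<close> by blast
      then show "x \<in> T" using tc step(2) subD(1)[OF T] by auto
    qed
    then have "adjoin k V T w \<inter> S = T" using that(1) Tw(1) by blast
    then show ?thesis using step.hyps by simp
  qed
  from step consider "T \<subseteq> S" | n where "m = Suc n" "flag k V (T \<inter> S) n" "\<not> T \<subseteq> S"
    using Tw by blast
  then show ?case
  proof cases
    case 1
    then show ?thesis using * adjoin_minimal[OF S 1] by blast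
  next
    case 2
    \<comment> \<open>The vector \<open>s\<close> is what is left of \<open>w\<close> along
      \<open>S\<close> after removing a multiple of \<open>t \<in> T\<close>. As \<open>w\<close>
      and \<open>s\<close> differ by an element of \<open>T\<close>, adjoining either of them to
      \<open>T\<close> gives the same space, and the part of that space in \<open>S\<close> is
      \<open>T \<inter> S\<close> with \<open>s\<close> adjoined.\<close>
    then obtain t where t: "t \<in> T" "t \<notin> S" by blast
    have wv: "w \<in> adjoin k V S v" using step Tw by blast
    have "t \<in> adjoin k V S v" using step Tw t by blast
    then have "w \<in> adjoin k V S t" using adjoin_exchange[OF S v _ t(2)] wv by simp
    then obtain s c where sc: "w = s \<oplus> c \<odot> t" "s \<in> S" "c \<in> carrier k" by (auto simp: adjoin_def)
    have tV: "t \<in> carrier V" and sV: "s \<in> carrier V" using t sc subD(1) T S by auto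
    have ct: "c \<odot> t \<in> T" using t sc subD(4)[OF T] by auto
    have w_eq: "w = c \<odot> t \<oplus> s" using sc tV sV by (simp add: M.a_comm)
    then have "s \<notin> T" using step(3) subD(3)[OF T ct] by auto
    have sTw: "s \<in> adjoin k V T w"
      using sub_add_iff[OF subTw, of "c \<odot> t" s] ct Tw sV w_eq by auto
    have "adjoin k V T w = adjoin k V T s"
      using adjoin_exchange[OF T step(2) sTw \<open>s \<notin> T\<close>] by simp
    have "adjoin k V T w \<inter> S = adjoin k V (T \<inter> S) s"
    proof
      show "adjoin k V (T \<inter> S) s \<subseteq> adjoin k V T w \<inter> S"
        by (intro adjoin_minimal sub_Int subTw S) (use Tw sTw sc in auto)
      show "adjoin k V T w \<inter> S \<subseteq> adjoin k V (T \<inter> S) s"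
      proof
        fix x assume x: "x \<in> adjoin k V T w \<inter> S"
        then have "x \<in> adjoin k V T s" using \<open>adjoin k V T w = adjoin k V T s\<close> by blast
        then obtain u d where ud: "x = u \<oplus> d \<odot> s" "u \<in> T" "d \<in> carrier k"
          by (auto simp: adjoin_def)
        have "u \<in> carrier V" using ud subD(1)[OF T] by blast
        then have "d \<odot> s \<oplus> u \<in> S" using x ud sV by (simp add: M.a_comm)
        then have "u \<in> S" using sub_add_iff[OF S subD(4)[OF S ud(3) sc(2)] \<open>u \<in> carrier V\<close>] by simp
        then show "x \<in> adjoin k V (T \<inter> S) s" using ud by (auto simp: adjoin_def)
      qed
    qed
    moreover have "flag k V (adjoin k V (T \<inter> S) s) (Suc n)"
      using 2 sV \<open>s \<notin> T\<close> by (intro flag.step) auto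
    ultimately show ?thesis using 2 by auto
  qed
qed

text \<open>Intersecting the second flag with the hyperplane \<open>S\<close> shortens it by exactly
  one step, which makes the induction hypothesis applicable.\<close>

lemma flag_unique: "flag k V S n \<Longrightarrow> flag k V S m \<Longrightarrow> n = m"
proof (induction arbitrary: m rule: flag.induct)
  case zero
  from zero show ?case
  proof cases
    case (step T n v)
    have "v \<in> adjoin k V T v" "\<zero> \<in> T"
      using adjoin_superset(2)[OF flag_sub step(4)] step(3) subD(2)[OF flag_sub[OF step(3)]] by auto
    then have "v = \<zero>" using step(1)[symmetric] by simp
    then show ?thesis using \<open>\<zero> \<in> T\<close> step by simp
  qed simp
next
  case (step S n v)
  have S: "sub S" using flag_sub step by blast
  note Sv = adjoin_superset[OF S step(2)]
  have "\<not> adjoin k V S v \<subseteq> S" using Sv step by blast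
  then obtain m' where "m = Suc m'" "flag k V (adjoin k V S v \<inter> S) m'"
    using flag_hyperplane[OF step(5) S step(2)] by blast
  moreover have "adjoin k V S v \<inter> S = S" using Sv by blast
  ultimately show ?case using step.IH by simp
qed

lemma dim_eqI: "flag k V S n \<Longrightarrow> dim k V S = n"
  unfolding dim_def using flag_unique by blast

lemma flag_dim: "fin_dim k V S \<longleftrightarrow> flag k V S (dim k V S)"
  unfolding fin_dim_def using dim_eqI by metis

lemma dim_zero: "fin_dim k V {\<zero>}" "dim k V {\<zero>} = 0"
  using flag.zero[of k V] dim_eqI by (auto simp: fin_dim_def)

lemma dim_eq_0: "fin_dim k V S \<Longrightarrow> dim k V S = 0 \<longleftrightarrow> S = {\<zero>}"
  using dim_zero flag_dim by (metis flag.cases nat.distinct(1))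

text \<open>The flag of \<open>S\<close> is restricted to \<open>T\<close>, dropping the steps at
  which \<open>T\<close> does not grow. The case of equal lengths is carried along so that equal
  dimensions force equal spaces.\<close>

lemma flag_mono:
  assumes "flag k V S n" and T: "sub T" "T \<subseteq> S"
  shows "\<exists>m\<le>n. flag k V T m \<and> (m = n \<longrightarrow> T = S)"
  using assms
proof (induction arbitrary: T rule: flag.induct)
  case zero
  then have "T = {\<zero>}" using subD(2) by blast
  then show ?case using flag.zero by blast
next
  case (step S n v)
  have S: "sub S" using flag_sub step by blast
  note Sv = adjoin_superset[OF S step(2)]
  obtain m where m: "m \<le> n" "flag k V (T \<inter> S) m" "m = n \<longrightarrow> T \<inter> S = S"
    using step.IH[of "T \<inter> S"] sub_Int[OF step.prems(1) S] by blast
  show ?case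
  proof (cases "T \<subseteq> S")
    case True
    then have "T \<inter> S = T" by blast
    then show ?thesis using m(1,2) by (intro exI[of _ m]) simp
  next
    case False
    then obtain t where t: "t \<in> T" "t \<notin> S" by blast
    have tV: "t \<in> carrier V" using t subD(1)[OF step.prems(1)] by blast
    note dec = adjoin_decompose[OF S step(2) step.prems t]
    have "flag k V T (Suc m)"
      by (subst dec, rule flag.step) (use m t tV in auto)
    moreover have "T = adjoin k V S v" if "m = n"
      using adjoin_exchange[OF S step(2), of t] dec m that t step.prems by auto
    ultimately show ?thesis using m(1) by (intro exI[of _ "Suc m"]) auto
  qed
qed

lemma fin_dim_mono:
  assumes "fin_dim k V S" "sub T" "T \<subseteq> S"
  shows "fin_dim k V T" "dim k V T \<le> dim k V S" "dim k V T = dim k V S \<Longrightarrow> T = S"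
proof -
  obtain m where m: "m \<le> dim k V S" "flag k V T m" "m = dim k V S \<longrightarrow> T = S"
    using flag_mono[OF assms(1)[unfolded flag_dim] assms(2,3)] by blast
  with dim_eqI[OF m(2)] show "fin_dim k V T" "dim k V T \<le> dim k V S" "dim k V T = dim k V S \<Longrightarrow> T = S"
    by (auto simp: fin_dim_def)
qed

lemma lin_span_least: "sub H \<Longrightarrow> B \<subseteq> H \<Longrightarrow> lin_span k V B \<subseteq> H"
  by (auto simp: lin_span_def)

lemma lin_span_sub: assumes "B \<subseteq> carrier V" shows "sub (lin_span k V B)" "B \<subseteq> lin_span k V B"
proof -
  have "sub (carrier V)" by (rule carrier_is_submodule)
  then show "sub (lin_span k V B)"
    using assms by (intro submoduleI) (auto simp: lin_span_def intro: subD(2-5))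
  show "B \<subseteq> lin_span k V B" by (auto simp: lin_span_def)
qed

text \<open>Adjoining the generators of a finite spanning set one at a time produces a flag,
  provided that a generator already in the span is skipped; conversely the vectors adjoined along a
  flag span.\<close>

lemma finite_dim_iff:
  assumes "sub S" shows "finite_dim k V S \<longleftrightarrow> fin_dim k V S"
proof
  assume "finite_dim k V S"
  then obtain B where B: "finite B" "B \<subseteq> S" "lin_span k V B = S" by (auto simp: finite_dim_def)
  have "B \<subseteq> carrier V" using B subD(1)[OF assms] by blast
  with B(1) have "fin_dim k V (lin_span k V B)"
  proof (induction B rule: finite_induct)
    case empty
    have "lin_span k V {} = {\<zero>}"
      using lin_span_least[OF sub_zero, of "{}"] subD(2)[OF lin_span_sub(1)[of "{}"]] by auto
    then show ?case using dim_zero by simp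
  next
    case (insert b B)
    note lB = lin_span_sub[of B] and lbB = lin_span_sub[of "insert b B"]
    have "lin_span k V (insert b B) = adjoin k V (lin_span k V B) b"
    proof
      show "lin_span k V (insert b B) \<subseteq> adjoin k V (lin_span k V B) b"
        by (rule lin_span_least[OF adjoin_sub]) (use adjoin_superset[of "lin_span k V B" b] lB insert in auto)
      show "adjoin k V (lin_span k V B) b \<subseteq> lin_span k V (insert b B)"
        by (rule adjoin_minimal[OF _ lin_span_least]) (use lbB insert in auto)
    qed
    moreover have "adjoin k V S b = S" if "b \<in> S" "sub S" for S
      using adjoin_minimal[of S S b] adjoin_superset[of S b] that subD(1) by blast
    moreover obtain n where "flag k V (lin_span k V B) n" using insert by (auto simp: fin_dim_def)
    ultimately show ?case using insert lB flag.step[of k V "lin_span k V B" n b]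
      unfolding fin_dim_def by (cases "b \<in> lin_span k V B") auto
  qed
  then show "fin_dim k V S" using B by simp
next
  assume "fin_dim k V S"
  then obtain n where "flag k V S n" by (auto simp: fin_dim_def)
  then show "finite_dim k V S"
  proof (induction rule: flag.induct)
    case zero
    have "lin_span k V {} = {\<zero>}"
      using lin_span_least[OF sub_zero, of "{}"] subD(2)[OF lin_span_sub(1)[of "{}"]] by auto
    then show ?case unfolding finite_dim_def by blast
  next
    case (step S n v)
    then obtain B where B: "finite B" "B \<subseteq> S" "lin_span k V B = S" by (auto simp: finite_dim_def)
    have S: "sub S" using flag_sub step by blast
    note Sv = adjoin_superset[OF S step(2)] and vS = adjoin_sub[OF S step(2)]
    have BV: "insert v B \<subseteq> carrier V" using B subD(1)[OF S] step by blast
    note l = lin_span_sub[OF BV]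
    have "lin_span k V (insert v B) = adjoin k V S v"
    proof
      show "lin_span k V (insert v B) \<subseteq> adjoin k V S v"
        using B Sv by (intro lin_span_least[OF vS]) auto
      have "S \<subseteq> lin_span k V (insert v B)" using l B lin_span_least by blast
      then show "adjoin k V S v \<subseteq> lin_span k V (insert v B)"
        using l by (intro adjoin_minimal) auto
    qed
    then show ?case unfolding finite_dim_def using B Sv by (intro exI[of _ "insert v B"]) auto
  qed
qed

text \<open>The vectors \<open>b 0\<close>, ..., \<open>b (m - 1)\<close> of \<open>T\<close>
  represent a basis of the quotient of \<open>T\<close> by \<open>S\<close>, expressed without
  forming the quotient.\<close>

definition rel_basis :: "'v set \<Rightarrow> 'v set \<Rightarrow> (nat \<Rightarrow> 'v) \<Rightarrow> nat \<Rightarrow> bool"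
  where "rel_basis S T b m \<longleftrightarrow> (\<forall>i<m. b i \<in> T) \<and>
    (\<forall>t\<in>T. \<exists>s\<in>S. \<exists>c\<in>{..<m} \<rightarrow> carrier k. t = s \<oplus> (\<Oplus>i\<in>{..<m}. c i \<odot> b i)) \<and>
    (\<forall>c\<in>{..<m} \<rightarrow> carrier k. (\<Oplus>i\<in>{..<m}. c i \<odot> b i) \<in> S \<longrightarrow> (\<forall>i<m. c i = \<zero>\<^bsub>k\<^esub>))"

text \<open>Induction on the codimension: a vector \<open>v\<close> of \<open>T\<close> outside
  \<open>S\<close> enlarges \<open>S\<close>, and a basis of \<open>T\<close> modulo the larger
  space is completed by \<open>v\<close>.\<close>

lemma rel_basis_exists:
  assumes "fin_dim k V T" "sub T" "sub S" "S \<subseteq> T"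
  shows "\<exists>b m. rel_basis S T b m"
  using assms(3,4)
proof (induction "dim k V T - dim k V S" arbitrary: S rule: less_induct)
  case (less S)
  note S = less(2) and T = assms(2)
  show ?case
  proof (cases "S = T")
    case True
    have "rel_basis S T b 0" for b
      using subD[OF T] True by (auto simp: rel_basis_def intro!: bexI)
    then show ?thesis by blast
  next
    case False
    then obtain v where v: "v \<in> T" "v \<notin> S" using less by blast
    have vV: "v \<in> carrier V" using v subD(1)[OF T] by blast
    define S' where "S' = adjoin k V S v"
    have S': "sub S'" "S' \<subseteq> T" "S \<subseteq> S'" "v \<in> S'"
      unfolding S'_def using adjoin_sub[OF S vV] adjoin_superset[OF S vV] adjoin_minimal[OF T less(3) v(1)] by auto
    have fd: "fin_dim k V S'" "fin_dim k V S" "dim k V S' \<le> dim k V T"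
      using fin_dim_mono[OF assms(1) S'(1,2)] fin_dim_mono[OF assms(1) S less(3)] by auto
    then have "dim k V S' = Suc (dim k V S)"
      unfolding S'_def using v vV flag_dim by (intro dim_eqI flag.step) auto
    then obtain b m where bm: "rel_basis S' T b m"
      using less(1)[of S'] S' diff_less_mono2[of "dim k V S" "dim k V S'" "dim k V T"] fd(3) by auto
    have bV: "b i \<in> carrier V" if "i < m" for i using bm that subD(1)[OF T] by (auto simp: rel_basis_def)
    have eq: "(\<Oplus>i\<in>{..<Suc m}. c i \<odot> (b(m := v)) i) = (\<Oplus>i\<in>{..<m}. c i \<odot> b i) \<oplus> c m \<odot> v"
      and sumV: "(\<Oplus>i\<in>{..<m}. c i \<odot> b i) \<in> carrier V"
      if c: "c \<in> {..<Suc m} \<rightarrow> carrier k" for c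
    proof -
      have cm: "c i \<in> carrier k" if "i < m" for i using c that by auto
      show s: "(\<Oplus>i\<in>{..<m}. c i \<odot> b i) \<in> carrier V" using cm bV by (intro M.finsum_closed) auto
      have "(\<Oplus>i\<in>{..<m}. c i \<odot> (b(m := v)) i) = (\<Oplus>i\<in>{..<m}. c i \<odot> b i)"
        using cm bV by (intro M.finsum_cong') auto
      moreover have "(\<Oplus>i\<in>{..<Suc m}. c i \<odot> (b(m := v)) i) = c m \<odot> v \<oplus> (\<Oplus>i\<in>{..<m}. c i \<odot> (b(m := v)) i)"
        unfolding lessThan_Suc using cm bV c vV by (subst M.finsum_insert) auto
      ultimately show "(\<Oplus>i\<in>{..<Suc m}. c i \<odot> (b(m := v)) i) = (\<Oplus>i\<in>{..<m}. c i \<odot> b i) \<oplus> c m \<odot> v"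
        using s c vV by (simp add: M.a_comm Pi_iff)
    qed
    have "rel_basis S T (b(m := v)) (Suc m)"
      unfolding rel_basis_def
    proof (intro conjI allI impI ballI)
      show "(b(m := v)) i \<in> T" if "i < Suc m" for i using that v bm by (auto simp: rel_basis_def)
    next
      fix t assume "t \<in> T"
      then obtain s' c where sc: "s' \<in> S'" "c \<in> {..<m} \<rightarrow> carrier k" "t = s' \<oplus> (\<Oplus>i\<in>{..<m}. c i \<odot> b i)"
        using bm by (auto simp: rel_basis_def)
      obtain s d where sd: "s \<in> S" "d \<in> carrier k" "s' = s \<oplus> d \<odot> v"
        using sc(1) by (auto simp: S'_def adjoin_def)
      define c' where "c' = c(m := d)"
      have c': "c' \<in> {..<Suc m} \<rightarrow> carrier k" using sc sd by (auto simp: c'_def less_Suc_eq)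
      have "(\<Oplus>i\<in>{..<m}. c' i \<odot> b i) = (\<Oplus>i\<in>{..<m}. c i \<odot> b i)"
        using c' bV sc by (intro M.finsum_cong') (auto simp: c'_def)
      then have "t = s \<oplus> (\<Oplus>i\<in>{..<Suc m}. c' i \<odot> (b(m := v)) i)"
        unfolding eq[OF c'] using sumV[OF c'] sc sd subD(1)[OF S sd(1)] vV
        by (simp add: c'_def M.a_ac)
      then show "\<exists>s\<in>S. \<exists>c\<in>{..<Suc m} \<rightarrow> carrier k. t = s \<oplus> (\<Oplus>i\<in>{..<Suc m}. c i \<odot> (b(m := v)) i)"
        using sd c' by blast
    next
      fix c i assume c: "c \<in> {..<Suc m} \<rightarrow> carrier k"
        and *: "(\<Oplus>i\<in>{..<Suc m}. c i \<odot> (b(m := v)) i) \<in> S" and i: "i < Suc m"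
      have cm: "c m \<in> carrier k" "c \<in> {..<m} \<rightarrow> carrier k" using c by auto
      let ?x = "(\<Oplus>i\<in>{..<m}. c i \<odot> b i)"
      have "c m \<odot> v \<oplus> ?x \<in> S'" using * S'(3) unfolding eq[OF c] using sumV[OF c] cm vV by (auto simp: M.a_comm)
      then have "?x \<in> S'" using sub_add_iff[OF S'(1) subD(4)[OF S'(1) cm(1) S'(4)] sumV[OF c]] by simp
      then have c0: "\<forall>i<m. c i = \<zero>\<^bsub>k\<^esub>" using bm cm(2) unfolding rel_basis_def by blast
      then have "?x = (\<Oplus>i\<in>{..<m}. \<zero>)" using bV by (intro M.finsum_cong') auto
      then have "c m \<odot> v \<in> S" using * unfolding eq[OF c] using cm vV by simp
      then have "c m = \<zero>\<^bsub>k\<^esub>" using sub_smult_iff[OF S cm(1) _ vV] v by blast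
      then show "c i = \<zero>\<^bsub>k\<^esub>" using c0 i by (cases "i = m") auto
    qed
    then show ?thesis by blast
  qed
qed

end

section \<open>Linear maps, rank and nullity\<close>

locale lin_map = V: module k V + W: module k W
  for k :: "('k, 'kw) ring_scheme" and V :: "('k, 'v, 'vw) module_scheme" and W :: "('k, 'w, 'ww) module_scheme" +
  fixes f assumes f: "f \<in> lin_maps k V W"
begin

lemma map_simps [simp]:
  "x \<in> carrier V \<Longrightarrow> f x \<in> carrier W" "x \<in> carrier V \<Longrightarrow> y \<in> carrier V \<Longrightarrow> f (x \<oplus>\<^bsub>V\<^esub> y) = f x \<oplus>\<^bsub>W\<^esub> f y"
  "c \<in> carrier k \<Longrightarrow> x \<in> carrier V \<Longrightarrow> f (c \<odot>\<^bsub>V\<^esub> x) = c \<odot>\<^bsub>W\<^esub> f x"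
  using f by (auto simp: lin_maps_def)

lemma map_zero [simp]: "f \<zero>\<^bsub>V\<^esub> = \<zero>\<^bsub>W\<^esub>"
  using map_simps(3)[of "\<zero>\<^bsub>k\<^esub>" "\<zero>\<^bsub>V\<^esub>"] map_simps(1)[of "\<zero>\<^bsub>V\<^esub>"] by simp

lemma map_neg [simp]: "x \<in> carrier V \<Longrightarrow> f (\<ominus>\<^bsub>V\<^esub> x) = \<ominus>\<^bsub>W\<^esub> f x"
  using map_simps(3)[of "\<ominus>\<^bsub>k\<^esub> \<one>\<^bsub>k\<^esub>" x] map_simps(1)[of x] by (simp add: V.smult_l_minus W.smult_l_minus)

lemma inj_onI_kernel:
  assumes "\<And>x. x \<in> carrier V \<Longrightarrow> f x = \<zero>\<^bsub>W\<^esub> \<Longrightarrow> x = \<zero>\<^bsub>V\<^esub>"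
  shows "inj_on f (carrier V)"
proof (rule inj_onI)
  fix x y assume xy: "x \<in> carrier V" "y \<in> carrier V" "f x = f y"
  then have "f (x \<ominus>\<^bsub>V\<^esub> y) = \<zero>\<^bsub>W\<^esub>" by (simp add: a_minus_def W.r_neg)
  then have "x \<ominus>\<^bsub>V\<^esub> y = \<zero>\<^bsub>V\<^esub>" using xy assms by simp
  then show "x = y" using xy by (metis V.add.inv_solve_right V.l_zero V.zero_closed a_minus_def)
qed

end

locale vspace_map = V: vspace k V + W: vspace k W + lin_map k V W f
  for k :: "('k, 'kw) ring_scheme" and V :: "('k, 'v, 'vw) module_scheme" and W :: "('k, 'w, 'ww) module_scheme"
    and f
begin

lemma image_sub: assumes "V.sub S" shows "W.sub (f ` S)"
proof (rule W.submoduleI)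
  note S = V.subD[OF assms]
  show "f ` S \<subseteq> carrier W" using S map_simps by auto
  show "\<zero>\<^bsub>W\<^esub> \<in> f ` S" using S map_zero by (metis image_eqI)
  show "\<ominus>\<^bsub>W\<^esub> a \<in> f ` S" if "a \<in> f ` S" for a
    using that S by (auto simp del: map_neg simp: map_neg[symmetric])
  show "a \<oplus>\<^bsub>W\<^esub> b \<in> f ` S" if "a \<in> f ` S" "b \<in> f ` S" for a b
    using that S by (auto simp del: map_simps simp: map_simps(2)[symmetric])
  show "c \<odot>\<^bsub>W\<^esub> a \<in> f ` S" if "c \<in> carrier k" "a \<in> f ` S" for c a
    using that S by (auto simp del: map_simps simp: map_simps(3)[symmetric])
qed

lemma preimage_sub: assumes "V.sub S" "W.sub T" shows "V.sub {x \<in> S. f x \<in> T}"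
  by (rule V.submoduleI)
    (use V.subD[OF assms(1)] W.subD[OF assms(2)] in \<open>auto simp: map_simps map_zero map_neg\<close>)

lemma image_adjoin:
  assumes "V.sub S" "v \<in> carrier V"
  shows "f ` adjoin k V S v = adjoin k W (f ` S) (f v)"
proof
  note S = V.subD[OF assms(1)]
  show "f ` adjoin k V S v \<subseteq> adjoin k W (f ` S) (f v)"
  proof
    fix y assume "y \<in> f ` adjoin k V S v"
    then obtain s c where "s \<in> S" "c \<in> carrier k" "y = f (s \<oplus>\<^bsub>V\<^esub> c \<odot>\<^bsub>V\<^esub> v)" by (auto simp: adjoin_def)
    then have "y = f s \<oplus>\<^bsub>W\<^esub> c \<odot>\<^bsub>W\<^esub> f v" using S(1) assms(2) by (simp add: map_simps)
    then show "y \<in> adjoin k W (f ` S) (f v)"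
      using \<open>s \<in> S\<close> \<open>c \<in> carrier k\<close> unfolding adjoin_def by blast
  qed
  show "adjoin k W (f ` S) (f v) \<subseteq> f ` adjoin k V S v"
  proof
    fix y assume "y \<in> adjoin k W (f ` S) (f v)"
    then obtain s c where "s \<in> S" "c \<in> carrier k" "y = f s \<oplus>\<^bsub>W\<^esub> c \<odot>\<^bsub>W\<^esub> f v" by (auto simp: adjoin_def)
    then have "y = f (s \<oplus>\<^bsub>V\<^esub> c \<odot>\<^bsub>V\<^esub> v)" "s \<oplus>\<^bsub>V\<^esub> c \<odot>\<^bsub>V\<^esub> v \<in> adjoin k V S v"
      using S assms by (auto simp: map_simps adjoin_def)
    then show "y \<in> f ` adjoin k V S v" by blast
  qed
qed

text \<open>Each new vector \<open>v\<close> of the flag enlarges either the image or the kernel. If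
  \<open>f v\<close> is new, the kernel is unchanged; if \<open>f v = f s\<close> with
  \<open>s\<close> in the earlier space, then \<open>v - s\<close> is a new element of the
  kernel.\<close>

lemma flag_rank_nullity:
  assumes "flag k V S n"
  shows "\<exists>a b. flag k W (f ` S) a \<and> flag k V {x \<in> S. f x = \<zero>\<^bsub>W\<^esub>} b \<and> a + b = n"
  using assms
proof (induction rule: flag.induct)
  case zero
  have "f ` {\<zero>\<^bsub>V\<^esub>} = {\<zero>\<^bsub>W\<^esub>}" "{x \<in> {\<zero>\<^bsub>V\<^esub>}. f x = \<zero>\<^bsub>W\<^esub>} = {\<zero>\<^bsub>V\<^esub>}" using map_zero by auto
  then show ?case using flag.zero[of k V] flag.zero[of k W] by fastforce
next
  case (step S n v)
  let ?K = "\<lambda>S. {x \<in> S. f x = \<zero>\<^bsub>W\<^esub>}"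
  obtain a b where ab: "flag k W (f ` S) a" "flag k V (?K S) b" "a + b = n" using step by blast
  have S: "V.sub S" using V.flag_sub step by blast
  note S' = V.subD[OF S] and Sv = V.adjoin_superset[OF S step(2)]
  have subSv: "V.sub (adjoin k V S v)" by (rule V.adjoin_sub[OF S step(2)])
  have fS: "W.sub (f ` S)" by (rule image_sub[OF S])
  have K: "V.sub (?K T)" if "V.sub T" for T using preimage_sub[OF that W.sub_zero] by simp
  show ?case
  proof (cases "f v \<in> f ` S")
    case False
    have "?K (adjoin k V S v) = ?K S"
    proof (intro equalityI subsetI)
      fix x assume x: "x \<in> ?K (adjoin k V S v)"
      then obtain s c where sc: "x = s \<oplus>\<^bsub>V\<^esub> c \<odot>\<^bsub>V\<^esub> v" "s \<in> S" "c \<in> carrier k" by (auto simp: adjoin_def)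
      have "f s \<oplus>\<^bsub>W\<^esub> c \<odot>\<^bsub>W\<^esub> f v \<in> f ` S"
        using x sc step(2) S' W.subD(2)[OF fS] by (auto simp: map_simps)
      then have "c \<odot>\<^bsub>W\<^esub> f v \<in> f ` S"
        using W.sub_add_iff[OF fS, of "f s" "c \<odot>\<^bsub>W\<^esub> f v"] sc step(2) by (auto simp: map_simps)
      then have "c = \<zero>\<^bsub>k\<^esub>" using W.sub_smult_iff[OF fS sc(3)] False step(2) map_simps(1) by blast
      then show "x \<in> ?K S" using x sc S' step(2) by auto
    qed (use Sv in auto)
    moreover have "flag k W (f ` adjoin k V S v) (Suc a)"
      unfolding image_adjoin[OF S step(2)] using ab False step(2) map_simps by (intro flag.step) auto
    ultimately show ?thesis using ab by (intro exI[of _ "Suc a"] exI[of _ b]) auto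
  next
    case True
    then obtain s where s: "s \<in> S" "f v = f s" by blast
    define w where "w = \<ominus>\<^bsub>V\<^esub> s \<oplus>\<^bsub>V\<^esub> v"
    have wV: "w \<in> carrier V" using s step(2) S' by (auto simp: w_def)
    have "f w = \<zero>\<^bsub>W\<^esub>" using s step(2) S' by (auto simp: w_def map_simps map_neg W.l_neg)
    have wSv: "w \<in> adjoin k V S v"
      using V.subD(3)[OF subSv] Sv S'(5)[OF s(1)] unfolding w_def by blast
    have "w \<notin> S" using V.sub_add_iff[OF S S'(5)[OF s(1)] step(2)] step(3) by (simp add: w_def)
    have "?K (adjoin k V S v) = adjoin k V (?K (adjoin k V S v) \<inter> S) w"
      by (rule V.adjoin_decompose[OF S step(2) K[OF subSv]]) (use wSv \<open>f w = _\<close> \<open>w \<notin> S\<close> in auto)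
    moreover have "?K (adjoin k V S v) \<inter> S = ?K S" using Sv by blast
    ultimately have "flag k V (?K (adjoin k V S v)) (Suc b)"
      using flag.step[OF ab(2) wV] \<open>w \<notin> S\<close> by auto
    moreover have "f ` adjoin k V S v = f ` S"
      unfolding image_adjoin[OF S step(2)]
      using W.adjoin_minimal[OF fS subset_refl True] W.adjoin_superset(1)[OF fS] map_simps(1)[OF step(2)] by blast
    ultimately show ?thesis using ab by (intro exI[of _ a] exI[of _ "Suc b"]) auto
  qed
qed

lemma dim_rank_nullity:
  assumes "fin_dim k V S"
  shows "fin_dim k W (f ` S)" "fin_dim k V {x \<in> S. f x = \<zero>\<^bsub>W\<^esub>}"
    "dim k V S = dim k W (f ` S) + dim k V {x \<in> S. f x = \<zero>\<^bsub>W\<^esub>}"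
proof -
  obtain a b where "flag k W (f ` S) a" "flag k V {x \<in> S. f x = \<zero>\<^bsub>W\<^esub>} b" "a + b = dim k V S"
    using flag_rank_nullity assms V.flag_dim by blast
  then show "fin_dim k W (f ` S)" "fin_dim k V {x \<in> S. f x = \<zero>\<^bsub>W\<^esub>}"
    "dim k V S = dim k W (f ` S) + dim k V {x \<in> S. f x = \<zero>\<^bsub>W\<^esub>}"
    using V.dim_eqI W.dim_eqI by (auto simp: fin_dim_def)
qed

text \<open>The preimages of the steps of a flag of the image form a flag that starts at the
  kernel.\<close>

lemma fin_dim_extension:
  assumes S: "V.sub S" and K: "fin_dim k V {x \<in> S. f x = \<zero>\<^bsub>W\<^esub>}" and I: "fin_dim k W (f ` S)"
  shows "fin_dim k V S"
proof -
  have "fin_dim k V {x \<in> S. f x \<in> T}" if "flag k W T n" "T \<subseteq> f ` S" for T n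
    using that
  proof (induction rule: flag.induct)
    case zero
    then show ?case using K by simp
  next
    case (step T n w)
    have T: "W.sub T" using W.flag_sub step by blast
    note Tw = W.adjoin_superset[OF T step(2)]
    obtain x where x: "x \<in> S" "w = f x" using step Tw by blast
    have xV: "x \<in> carrier V" using x V.subD(1)[OF S] by blast
    let ?P = "{x \<in> S. f x \<in> T}"
    have P: "V.sub ?P" by (rule preimage_sub[OF S T])
    have "{x \<in> S. f x \<in> adjoin k W T w} = adjoin k V ?P x"
    proof (intro equalityI subsetI)
      fix y assume y: "y \<in> {x \<in> S. f x \<in> adjoin k W T w}"
      then obtain t c where tc: "f y = t \<oplus>\<^bsub>W\<^esub> c \<odot>\<^bsub>W\<^esub> w" "t \<in> T" "c \<in> carrier k" by (auto simp: adjoin_def)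
      have yV: "y \<in> carrier V" and tW: "t \<in> carrier W" using y V.subD(1)[OF S] tc W.subD(1)[OF T] by auto
      let ?z = "y \<ominus>\<^bsub>V\<^esub> c \<odot>\<^bsub>V\<^esub> x"
      have "?z \<in> S" using y x tc V.subD(4,6)[OF S] by blast
      moreover have "f ?z = t"
        using yV xV tW tc x by (simp add: a_minus_def map_simps map_neg W.a_assoc W.r_neg)
      ultimately have "?z \<in> ?P" using tc by simp
      moreover have "y = ?z \<oplus>\<^bsub>V\<^esub> c \<odot>\<^bsub>V\<^esub> x" using yV xV tc by (simp add: a_minus_def V.a_assoc V.l_neg)
      ultimately show "y \<in> adjoin k V ?P x" using tc unfolding adjoin_def by blast
    next
      fix y assume "y \<in> adjoin k V ?P x"
      then obtain z c where "y = z \<oplus>\<^bsub>V\<^esub> c \<odot>\<^bsub>V\<^esub> x" "z \<in> S" "f z \<in> T" "c \<in> carrier k" by (auto simp: adjoin_def)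
      then show "y \<in> {x \<in> S. f x \<in> adjoin k W T w}"
        using x V.subD[OF S] xV by (auto simp: adjoin_def map_simps)
    qed
    moreover have "fin_dim k V ?P" using step Tw by blast
    ultimately show ?case using flag.step[of k V ?P _ x] xV x step(3) by (auto simp: fin_dim_def)
  qed
  moreover have "{x \<in> S. f x \<in> f ` S} = S" by blast
  ultimately show ?thesis using I unfolding fin_dim_def[of k W] by fastforce
qed

lemma dim_inj:
  assumes "fin_dim k V S" "V.sub S" "\<And>x. x \<in> S \<Longrightarrow> f x = \<zero>\<^bsub>W\<^esub> \<Longrightarrow> x = \<zero>\<^bsub>V\<^esub>"
  shows "dim k W (f ` S) = dim k V S"
proof -
  have "{x \<in> S. f x = \<zero>\<^bsub>W\<^esub>} = {\<zero>\<^bsub>V\<^esub>}"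
    using assms(3) V.subD(2)[OF assms(2)] map_zero by blast
  then show ?thesis using dim_rank_nullity(3)[OF assms(1)] V.dim_zero by simp
qed

end

section \<open>Graded modules\<close>

lemma a_kernel_eq: "a_kernel M N h = {x \<in> carrier M. h x = \<zero>\<^bsub>N\<^esub>}"
  by (simp add: a_kernel_def kernel_def)

lemma gr_mapsD: "f \<in> gr_maps R M N \<Longrightarrow> f \<in> lin_maps R M N"
  "f \<in> gr_maps R M N \<Longrightarrow> x \<in> hcomp M g \<Longrightarrow> f x \<in> hcomp N g"
  by (auto simp: gr_maps_def)

lemma lin_maps_comp: "f \<in> lin_maps R L M \<Longrightarrow> h \<in> lin_maps R M N \<Longrightarrow> (\<lambda>x. h (f x)) \<in> lin_maps R L N"
  by (auto simp: lin_maps_def Pi_iff)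

lemma gr_maps_comp: "f \<in> gr_maps R L M \<Longrightarrow> h \<in> gr_maps R M N \<Longrightarrow> (\<lambda>x. h (f x)) \<in> gr_maps R L N"
  unfolding gr_maps_def using lin_maps_comp by fastforce

lemma lin_maps_inv:
  assumes "module R M" "module R N" "f \<in> lin_maps R M N" "bij_betw f (carrier M) (carrier N)"
  shows "inv_into (carrier M) f \<in> lin_maps R N M"
proof -
  interpret lin_map R M N f by (intro lin_map.intro lin_map_axioms.intro assms)
  have inj: "inj_on f (carrier M)" and im: "f ` carrier M = carrier N"
    using assms(4) by (auto simp: bij_betw_def)
  have inv: "inv_into (carrier M) f y = x" if "x \<in> carrier M" "f x = y" for x y
    using that inj by auto
  have c: "inv_into (carrier M) f y \<in> carrier M" "f (inv_into (carrier M) f y) = y" if "y \<in> carrier N" for y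
    using that im by (auto simp: inv_into_into f_inv_into_f)
  show ?thesis
    unfolding lin_maps_def using c by (auto intro!: inv)
qed

definition hproj :: "('a, 'b, 'g) gmodule \<Rightarrow> 'g \<Rightarrow> 'b \<Rightarrow> 'b"
  where "hproj M g x = (THE f. (\<forall>g. f g \<in> hcomp M g) \<and> finite {g. f g \<noteq> \<zero>\<^bsub>M\<^esub>} \<and>
    x = (\<Oplus>\<^bsub>M\<^esub>g\<in>{g. f g \<noteq> \<zero>\<^bsub>M\<^esub>}. f g)) g"

text \<open>Unlike \<open>gr_isomorphic\<close>, this names the map and demands equality on each
  component. Hence the inverse is graded even when one side is not yet known to be a graded
  module.\<close>

definition gr_isomorphism ::
    "('a, 'w) ring_scheme \<Rightarrow> ('a, 'b, 'g) gmodule \<Rightarrow> ('a, 'c, 'g) gmodule \<Rightarrow> ('b \<Rightarrow> 'c) \<Rightarrow> bool"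
  where "gr_isomorphism R M N f \<longleftrightarrow> f \<in> gr_maps R M N \<and> bij_betw f (carrier M) (carrier N) \<and>
    (\<forall>g. f ` hcomp M g = hcomp N g)"

definition homogeneous_submodule :: "('a, 'w) ring_scheme \<Rightarrow> ('a, 'b, 'g) gmodule \<Rightarrow> 'b set \<Rightarrow> bool"
  where "homogeneous_submodule R M H \<longleftrightarrow> submodule H R M \<and> (\<forall>x\<in>H. \<forall>g. hproj M g x \<in> H)"

locale pdcf =
  fixes k :: "('k, 'kw) ring_scheme" and R :: "('k, 'a, 'g::ab_group_add) gmodule"
  assumes field: "field k" and PDCF: "PDCF k R" and domain: "domain R"
begin

abbreviation "scal M \<equiv> restrict_scalars R M"
abbreviation "gm M \<equiv> graded_module k R M"
abbreviation "bdf M \<equiv> BDF k R M"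

lemma graded_algebra: "graded_algebra k R"
  using PDCF by (simp add: PDCF_def)

sublocale k: field k by (rule field)
sublocale A: graded_algebra k R by (rule graded_algebra)

lemma scalar_hcomp: "c \<in> carrier k \<Longrightarrow> c \<odot>\<^bsub>R\<^esub> \<one>\<^bsub>R\<^esub> \<in> hcomp R 0" and one_hcomp: "\<one>\<^bsub>R\<^esub> \<in> hcomp R 0"
proof -
  have *: "bij_betw (\<lambda>c. c \<odot>\<^bsub>R\<^esub> \<one>\<^bsub>R\<^esub>) (carrier k) (hcomp R 0)"
    using PDCF by (simp add: PDCF_def connected_algebra_def)
  then have "c \<odot>\<^bsub>R\<^esub> \<one>\<^bsub>R\<^esub> \<in> hcomp R 0" if "c \<in> carrier k" for c using that by (auto simp: bij_betw_def)
  from this this[OF k.one_closed]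
  show "c \<in> carrier k \<Longrightarrow> c \<odot>\<^bsub>R\<^esub> \<one>\<^bsub>R\<^esub> \<in> hcomp R 0" "\<one>\<^bsub>R\<^esub> \<in> hcomp R 0" by simp_all
qed

lemma hcomp_zero_scalar: "r \<in> hcomp R 0 \<Longrightarrow> \<exists>c\<in>carrier k. r = c \<odot>\<^bsub>R\<^esub> \<one>\<^bsub>R\<^esub>"
  using PDCF by (auto simp: PDCF_def connected_algebra_def bij_betw_def)

lemma scal_inv [simp]: "\<ominus>\<^bsub>scal M\<^esub> x = \<ominus>\<^bsub>M\<^esub> x"
  by (simp add: a_inv_def m_inv_def restrict_scalars_def)

lemma scal_finsum: "finsum (scal M) f S = finsum M f S"
  by (simp add: finsum_def finprod_def restrict_scalars_def)

lemma vspace_scal: "module R M \<Longrightarrow> vspace k (scal M)"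
  using restrict_scalars_module[OF A.algebra_axioms] field by (intro vspace.intro)

lemma lin_map_scal: "module R M \<Longrightarrow> module R N \<Longrightarrow> f \<in> lin_maps R M N \<Longrightarrow> vspace_map k (scal M) (scal N) f"
  by (intro vspace_map.intro lin_map.intro lin_map_axioms.intro vspace_scal vspace.axioms(1)[OF vspace_scal])
    (auto simp: lin_maps_def)

lemma gm_module: "gm M \<Longrightarrow> module R M"
  by (auto simp: graded_module_def)

lemma lin_mapI: "module R M \<Longrightarrow> module R N \<Longrightarrow> f \<in> lin_maps R M N \<Longrightarrow> lin_map R M N f"
  by (intro lin_map.intro lin_map_axioms.intro)

lemma lin_map_gr: "gm M \<Longrightarrow> gm N \<Longrightarrow> f \<in> gr_maps R M N \<Longrightarrow> lin_map R M N f"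
  by (intro lin_mapI gm_module gr_mapsD)

lemma hcomp_sub: "gm M \<Longrightarrow> submodule (hcomp M g) k (scal M)"
  by (auto simp: graded_module_def graded_module_axioms_def)

lemma hcompD:
  assumes "gm M"
  shows "x \<in> hcomp M g \<Longrightarrow> x \<in> carrier M" "\<zero>\<^bsub>M\<^esub> \<in> hcomp M g"
    "x \<in> hcomp M g \<Longrightarrow> y \<in> hcomp M g \<Longrightarrow> x \<oplus>\<^bsub>M\<^esub> y \<in> hcomp M g"
    "x \<in> hcomp M g \<Longrightarrow> \<ominus>\<^bsub>M\<^esub> x \<in> hcomp M g"
    "r \<in> hcomp R h \<Longrightarrow> x \<in> hcomp M g \<Longrightarrow> r \<odot>\<^bsub>M\<^esub> x \<in> hcomp M (h + g)"
    "c \<in> carrier k \<Longrightarrow> x \<in> hcomp M g \<Longrightarrow> (c \<odot>\<^bsub>R\<^esub> \<one>\<^bsub>R\<^esub>) \<odot>\<^bsub>M\<^esub> x \<in> hcomp M g"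
proof -
  interpret V: vspace k "scal M" by (rule vspace_scal[OF gm_module[OF assms]])
  note s = V.subD[OF hcomp_sub[OF assms, of g]]
  show "x \<in> hcomp M g \<Longrightarrow> x \<in> carrier M" "\<zero>\<^bsub>M\<^esub> \<in> hcomp M g"
    "x \<in> hcomp M g \<Longrightarrow> y \<in> hcomp M g \<Longrightarrow> x \<oplus>\<^bsub>M\<^esub> y \<in> hcomp M g"
    "x \<in> hcomp M g \<Longrightarrow> \<ominus>\<^bsub>M\<^esub> x \<in> hcomp M g"
    "c \<in> carrier k \<Longrightarrow> x \<in> hcomp M g \<Longrightarrow> (c \<odot>\<^bsub>R\<^esub> \<one>\<^bsub>R\<^esub>) \<odot>\<^bsub>M\<^esub> x \<in> hcomp M g"
    using s(1)[of x] s(2) s(3)[of x y] s(5)[of x] s(4)[of c x] by auto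
  show "r \<in> hcomp R h \<Longrightarrow> x \<in> hcomp M g \<Longrightarrow> r \<odot>\<^bsub>M\<^esub> x \<in> hcomp M (h + g)"
    using assms by (auto simp: graded_module_def graded_module_axioms_def)
qed

lemma finsum_supp:
  assumes "module R M" "finite S" "f \<in> S \<rightarrow> carrier M" "{g. f g \<noteq> \<zero>\<^bsub>M\<^esub>} \<subseteq> S"
  shows "finsum M f {g. f g \<noteq> \<zero>\<^bsub>M\<^esub>} = finsum M f S"
proof -
  interpret M: module R M by (rule assms)
  show ?thesis using assms by (intro M.add.finprod_mono_neutral_cong_left) auto
qed

lemma hproj_ex1:
  assumes "gm M" "x \<in> carrier M"
  shows "\<exists>!f. (\<forall>g. f g \<in> hcomp M g) \<and> finite {g. f g \<noteq> \<zero>\<^bsub>M\<^esub>} \<and> x = (\<Oplus>\<^bsub>M\<^esub>g\<in>{g. f g \<noteq> \<zero>\<^bsub>M\<^esub>}. f g)"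
proof -
  have "internal_direct_sum M (hcomp M)" using assms(1) by (simp add: graded_module_def graded_module_axioms_def)
  then show ?thesis unfolding internal_direct_sum_def using assms(2) by blast
qed

lemma hproj:
  assumes "gm M" "x \<in> carrier M"
  shows "hproj M g x \<in> hcomp M g" "hproj M g x \<in> carrier M" "finite {g. hproj M g x \<noteq> \<zero>\<^bsub>M\<^esub>}"
    "x = (\<Oplus>\<^bsub>M\<^esub>g\<in>{g. hproj M g x \<noteq> \<zero>\<^bsub>M\<^esub>}. hproj M g x)"
proof -
  let ?P = "\<lambda>f. (\<forall>g. f g \<in> hcomp M g) \<and> finite {g. f g \<noteq> \<zero>\<^bsub>M\<^esub>} \<and> x = (\<Oplus>\<^bsub>M\<^esub>g\<in>{g. f g \<noteq> \<zero>\<^bsub>M\<^esub>}. f g)"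
  have "?P (\<lambda>g. hproj M g x)" using theI'[OF hproj_ex1[OF assms]] unfolding hproj_def .
  then show "hproj M g x \<in> hcomp M g" "finite {g. hproj M g x \<noteq> \<zero>\<^bsub>M\<^esub>}"
    "x = (\<Oplus>\<^bsub>M\<^esub>g\<in>{g. hproj M g x \<noteq> \<zero>\<^bsub>M\<^esub>}. hproj M g x)" by auto
  then show "hproj M g x \<in> carrier M" using hcompD(1)[OF assms(1)] by blast
qed

lemma hproj_eqI:
  assumes M: "gm M" and f: "\<And>g. f g \<in> hcomp M g" "finite S" "\<And>g. g \<notin> S \<Longrightarrow> f g = \<zero>\<^bsub>M\<^esub>"
    and x: "x = (\<Oplus>\<^bsub>M\<^esub>g\<in>S. f g)"
  shows "hproj M g x = f g"
proof -
  interpret M: module R M by (rule gm_module[OF M])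
  have fM: "f g \<in> carrier M" for g using f(1) hcompD(1)[OF M] by blast
  have xM: "x \<in> carrier M" unfolding x using fM by (intro M.finsum_closed) auto
  have S: "{g. f g \<noteq> \<zero>\<^bsub>M\<^esub>} \<subseteq> S" using f(3) by blast
  have "finsum M f {g. f g \<noteq> \<zero>\<^bsub>M\<^esub>} = finsum M f S"
    using fM by (intro finsum_supp gm_module M f S) auto
  then have "(\<lambda>g. hproj M g x) = f"
    using x f(1) finite_subset[OF S f(2)] hproj[OF M xM]
    by (intro Uniq_D[OF ex1_iff_ex_Uniq[THEN iffD1, THEN conjunct2, OF hproj_ex1[OF M xM]]]) auto
  then show ?thesis by metis
qed

lemma hproj_homogeneous:
  assumes "gm M" "x \<in> hcomp M g"
  shows "hproj M h x = (if h = g then x else \<zero>\<^bsub>M\<^esub>)"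
proof -
  interpret M: module R M by (rule gm_module[OF assms(1)])
  note c = hcompD[OF assms(1)]
  show ?thesis
    by (rule hproj_eqI[OF assms(1), of _ "{g}"]) (use assms(2) c in auto)
qed

lemma hproj_add:
  assumes "gm M" "x \<in> carrier M" "y \<in> carrier M"
  shows "hproj M g (x \<oplus>\<^bsub>M\<^esub> y) = hproj M g x \<oplus>\<^bsub>M\<^esub> hproj M g y"
proof -
  interpret M: module R M by (rule gm_module[OF assms(1)])
  note px = hproj[OF assms(1,2)] and py = hproj[OF assms(1,3)]
  let ?S = "{g. hproj M g x \<noteq> \<zero>\<^bsub>M\<^esub>} \<union> {g. hproj M g y \<noteq> \<zero>\<^bsub>M\<^esub>}"
  have fin: "finite ?S" using px py by simp
  have sx: "x = (\<Oplus>\<^bsub>M\<^esub>g\<in>?S. hproj M g x)"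
    using finsum_supp[OF gm_module[OF assms(1)] fin, of "\<lambda>g. hproj M g x"] px by auto
  have sy: "y = (\<Oplus>\<^bsub>M\<^esub>g\<in>?S. hproj M g y)"
    using finsum_supp[OF gm_module[OF assms(1)] fin, of "\<lambda>g. hproj M g y"] py by auto
  show ?thesis
  proof (rule hproj_eqI[OF assms(1) _ fin])
    show "hproj M g x \<oplus>\<^bsub>M\<^esub> hproj M g y \<in> hcomp M g" for g using px(1) py(1) hcompD(3)[OF assms(1)] by blast
    show "x \<oplus>\<^bsub>M\<^esub> y = (\<Oplus>\<^bsub>M\<^esub>g\<in>?S. hproj M g x \<oplus>\<^bsub>M\<^esub> hproj M g y)"
      using px(2) py(2) sx sy by (simp add: M.finsum_addf)
  qed auto
qed

lemma graded_induct [consumes 2, case_names zero homogeneous add]: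
  assumes "gm M" "x \<in> carrier M" and z: "P \<zero>\<^bsub>M\<^esub>" and h: "\<And>g x. x \<in> hcomp M g \<Longrightarrow> P x"
    and a: "\<And>x y. x \<in> carrier M \<Longrightarrow> y \<in> carrier M \<Longrightarrow> P x \<Longrightarrow> P y \<Longrightarrow> P (x \<oplus>\<^bsub>M\<^esub> y)"
  shows "P x"
proof -
  interpret M: module R M by (rule gm_module[OF assms(1)])
  have "finsum M f S \<in> carrier M \<and> P (finsum M f S)" if "finite S" "\<And>g. f g \<in> hcomp M g" for f S
    using that(1)
  proof (induction S rule: finite_induct)
    case (insert g S)
    have "f g \<in> carrier M" for g using hcompD(1)[OF assms(1) that(2)] .
    with insert that(2) h a[of "f g" "finsum M f S"] show ?case by (auto simp: Pi_iff)
  qed (use z in simp)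
  then show ?thesis using hproj[OF assms(1,2)] by metis
qed

lemma hproj_smult:
  assumes "gm M" "x \<in> carrier M" "r \<in> hcomp R h"
  shows "hproj M (h + g) (r \<odot>\<^bsub>M\<^esub> x) = r \<odot>\<^bsub>M\<^esub> hproj M g x"
  using assms(1,2)
proof (induction rule: graded_induct)
  interpret M: module R M by (rule gm_module[OF assms(1)])
  note c = hcompD[OF assms(1)]
  have r: "r \<in> carrier R" using assms(3) A.direct_sum by (auto simp: internal_direct_sum_def)
  {
    case zero
    show ?case using hproj_homogeneous[OF assms(1) c(2)] r by simp
  next
    case (homogeneous u x)
    then have "r \<odot>\<^bsub>M\<^esub> x \<in> hcomp M (h + u)" using c assms by blast
    then show ?case using hproj_homogeneous[OF assms(1)] homogeneous r by auto
  next
    case (add x y)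
    then show ?case using r hproj_add[OF assms(1)] hproj(2)[OF assms(1)] by (simp add: M.smult_r_distr)
  }
qed

lemma hproj_map:
  assumes "gm M" "gm N" "f \<in> gr_maps R M N" "x \<in> carrier M"
  shows "hproj N g (f x) = f (hproj M g x)"
  using assms(1,4)
proof (induction rule: graded_induct)
  interpret lin_map R M N f by (rule lin_map_gr[OF assms(1-3)])
  {
    case zero
    show ?case using hproj_homogeneous[OF assms(1) hcompD(2)[OF assms(1)]]
        hproj_homogeneous[OF assms(2) hcompD(2)[OF assms(2)]] by simp
  next
    case (homogeneous u x)
    then show ?case using hproj_homogeneous[OF assms(1) homogeneous]
        hproj_homogeneous[OF assms(2) gr_mapsD(2)[OF assms(3) homogeneous]] by simp
  next
    case (add x y)
    then show ?case using hproj_add[OF assms(1)] hproj_add[OF assms(2)] hproj(2)[OF assms(1)] by simp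
  }
qed

lemma hproj_zero_imp:
  assumes "gm M" "x \<in> carrier M" "\<And>g. hproj M g x = \<zero>\<^bsub>M\<^esub>"
  shows "x = \<zero>\<^bsub>M\<^esub>"
proof -
  interpret M: module R M by (rule gm_module[OF assms(1)])
  show ?thesis using hproj(4)[OF assms(1,2)] assms(3) by simp
qed

text \<open>A grading is established from candidates \<open>p\<close> for the projections. The
  element \<open>x\<close> and the sum of all \<open>p g x\<close> have the same projections, so
  they agree because the projections are jointly injective; applying \<open>p\<close> to any other
  decomposition shows uniqueness.\<close>

lemma graded_moduleI:
  assumes M: "module R M"
    and h: "\<And>g x. x \<in> hcomp M g \<Longrightarrow> x \<in> carrier M" "\<And>g. \<zero>\<^bsub>M\<^esub> \<in> hcomp M g"
      "\<And>g x y. x \<in> hcomp M g \<Longrightarrow> y \<in> hcomp M g \<Longrightarrow> x \<oplus>\<^bsub>M\<^esub> y \<in> hcomp M g"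
      "\<And>g h r x. r \<in> hcomp R h \<Longrightarrow> x \<in> hcomp M g \<Longrightarrow> r \<odot>\<^bsub>M\<^esub> x \<in> hcomp M (h + g)"
    and p: "\<And>g x. x \<in> carrier M \<Longrightarrow> p g x \<in> hcomp M g"
      "\<And>x. x \<in> carrier M \<Longrightarrow> finite {g. p g x \<noteq> \<zero>\<^bsub>M\<^esub>}"
      "\<And>g x y. x \<in> carrier M \<Longrightarrow> y \<in> carrier M \<Longrightarrow> p g (x \<oplus>\<^bsub>M\<^esub> y) = p g x \<oplus>\<^bsub>M\<^esub> p g y"
      "\<And>g h x. x \<in> hcomp M g \<Longrightarrow> p h x = (if h = g then x else \<zero>\<^bsub>M\<^esub>)"
      "\<And>x. x \<in> carrier M \<Longrightarrow> (\<And>g. p g x = \<zero>\<^bsub>M\<^esub>) \<Longrightarrow> x = \<zero>\<^bsub>M\<^esub>"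
  shows "gm M" "x \<in> carrier M \<Longrightarrow> hproj M g x = p g x"
proof -
  interpret M: module R M by (rule M)
  interpret V: vspace k "scal M" by (rule vspace_scal[OF M])
  have sc: "c \<odot>\<^bsub>scal M\<^esub> x \<in> hcomp M g" if "c \<in> carrier k" "x \<in> hcomp M g" for c x g
    using h(4)[OF scalar_hcomp[OF that(1)] that(2)] by simp
  \<comment> \<open>Negation is multiplication by the scalar -1, which sits in degree 0 of
    \<open>R\<close>.\<close>
  have neg: "\<ominus>\<^bsub>M\<^esub> x \<in> hcomp M g" if "x \<in> hcomp M g" for x g
    using sc[of "\<ominus>\<^bsub>k\<^esub> \<one>\<^bsub>k\<^esub>" x g] that h(1)[OF that] V.smult_l_minus[of "\<one>\<^bsub>k\<^esub>" x] V.smult_one[of x] by simp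
  have sub: "submodule (hcomp M g) k (scal M)" for g
    by (rule V.submoduleI) (use h sc neg in auto)
  have psum: "p h (finsum M f S) = (if h \<in> S then f h else \<zero>\<^bsub>M\<^esub>)" if "finite S" "\<And>g. f g \<in> hcomp M g" for h f S
    using that(1)
  proof (induction S rule: finite_induct)
    case empty
    show ?case using p(4)[OF h(2)] by simp
  next
    case (insert g S)
    have fM: "f g \<in> carrier M" for g using that(2) h(1) by blast
    have "finsum M f (insert g S) = f g \<oplus>\<^bsub>M\<^esub> finsum M f S" using insert fM by simp
    moreover have "finsum M f S \<in> carrier M" using fM by (intro M.finsum_closed) auto
    ultimately show ?case using insert p(3)[OF fM, of "finsum M f S" h] p(4)[OF that(2)] fM by auto
  qed
  have decomp: "x = (\<Oplus>\<^bsub>M\<^esub>g\<in>{g. p g x \<noteq> \<zero>\<^bsub>M\<^esub>}. p g x)" if x: "x \<in> carrier M" for x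
  proof -
    let ?y = "\<Oplus>\<^bsub>M\<^esub>g\<in>{g. p g x \<noteq> \<zero>\<^bsub>M\<^esub>}. p g x"
    have yM: "?y \<in> carrier M" using p(1)[OF x] h(1) by (intro M.finsum_closed) auto
    have py: "p h ?y = p h x" for h using psum[OF p(2)[OF x], of "\<lambda>g. p g x" h] p(1)[OF x] by auto
    have m0: "p h (x \<ominus>\<^bsub>M\<^esub> ?y) = \<zero>\<^bsub>M\<^esub>" for h
    proof -
      have "p h x = p h ((x \<ominus>\<^bsub>M\<^esub> ?y) \<oplus>\<^bsub>M\<^esub> ?y)" using x yM by (simp add: a_minus_def M.a_assoc M.l_neg)
      also have "\<dots> = p h (x \<ominus>\<^bsub>M\<^esub> ?y) \<oplus>\<^bsub>M\<^esub> p h x" using p(3)[of "x \<ominus>\<^bsub>M\<^esub> ?y" ?y h] x yM py by simp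
      finally show ?thesis
        using M.add.r_cancel_one'[of "p h x" "p h (x \<ominus>\<^bsub>M\<^esub> ?y)"] p(1)[OF x, of h, THEN h(1)]
          p(1)[of "x \<ominus>\<^bsub>M\<^esub> ?y" h, THEN h(1)] x yM by simp
    qed
    have "x \<ominus>\<^bsub>M\<^esub> ?y = \<zero>\<^bsub>M\<^esub>" by (rule p(5)) (use m0 x yM in auto)
    then show ?thesis using x yM by (metis M.add.inv_solve_right M.l_zero M.zero_closed a_minus_def)
  qed
  have "internal_direct_sum M (hcomp M)"
    unfolding internal_direct_sum_def
  proof (intro conjI allI ballI)
    fix x assume x: "x \<in> carrier M"
    show "\<exists>!f. (\<forall>g. f g \<in> hcomp M g) \<and> finite {g. f g \<noteq> \<zero>\<^bsub>M\<^esub>} \<and> x = (\<Oplus>\<^bsub>M\<^esub>g\<in>{g. f g \<noteq> \<zero>\<^bsub>M\<^esub>}. f g)"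
    proof (intro ex1I[of _ "\<lambda>g. p g x"] conjI)
      fix f assume f: "(\<forall>g. f g \<in> hcomp M g) \<and> finite {g. f g \<noteq> \<zero>\<^bsub>M\<^esub>} \<and> x = (\<Oplus>\<^bsub>M\<^esub>g\<in>{g. f g \<noteq> \<zero>\<^bsub>M\<^esub>}. f g)"
      show "f = (\<lambda>g. p g x)"
      proof
        fix g show "f g = p g x" using f psum[of "{g. f g \<noteq> \<zero>\<^bsub>M\<^esub>}" f g] by auto
      qed
    qed (use p x decomp in auto)
  qed (use h in auto)
  then show M': "gm M"
    using sub h(4) by (intro graded_module.intro graded_module_axioms.intro graded_algebra M) auto
  show "hproj M g x = p g x" if x: "x \<in> carrier M"
    by (rule hproj_eqI[OF M' _ p(2)[OF x] _ decomp[OF x]]) (use p x in auto)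
qed

lemma carrier_hcomp: "r \<in> hcomp R g \<Longrightarrow> r \<in> carrier R"
  using A.direct_sum by (auto simp: internal_direct_sum_def)

lemma regular_module_simps [simp]:
  "carrier (regular_module R) = carrier R" "add (regular_module R) = add R"
  "ring.zero (regular_module R) = \<zero>\<^bsub>R\<^esub>" "smult (regular_module R) = monoid.mult R"
  "hcomp (regular_module R) = hcomp R"
  by (simp_all add: regular_module_def)

lemma regular_module: "module R (regular_module R)"
proof (rule moduleI)
  show "abelian_group (regular_module R)"
  proof (rule abelian_groupI)
    fix x assume "x \<in> carrier (regular_module R)"
    then show "\<exists>y\<in>carrier (regular_module R). y \<oplus>\<^bsub>regular_module R\<^esub> x = \<zero>\<^bsub>regular_module R\<^esub>"
      by (intro bexI[of _ "\<ominus>\<^bsub>R\<^esub> x"]) (auto simp: A.l_neg)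
  qed (auto simp: A.a_ac)
qed (auto simp: A.M_cring A.l_distr A.r_distr A.m_ac)

lemma gm_regular: "gm (regular_module R)"
proof (intro graded_module.intro graded_module_axioms.intro graded_algebra regular_module)
  interpret V: vspace k "scal (regular_module R)" by (rule vspace_scal[OF regular_module])
  note s = A.submoduleE[OF A.hcomp_subspace] and s0 = A.submodule_zero[OF A.hcomp_subspace]
  have ai: "\<ominus>\<^bsub>regular_module R\<^esub> x = \<ominus>\<^bsub>R\<^esub> x" for x by (simp add: a_inv_def m_inv_def regular_module_def)
  show "submodule (hcomp (regular_module R) g) k (scal (regular_module R))" for g
  proof (rule V.submoduleI)
    fix c x assume "c \<in> carrier k" "x \<in> hcomp (regular_module R) g"
    then have "c \<odot>\<^bsub>R\<^esub> x \<in> hcomp R g" "c \<odot>\<^bsub>R\<^esub> x = (c \<odot>\<^bsub>R\<^esub> \<one>\<^bsub>R\<^esub>) \<otimes>\<^bsub>R\<^esub> x"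
      using s(4)[of c x g] carrier_hcomp by (auto simp: A.smult_assoc2)
    then show "c \<odot>\<^bsub>scal (regular_module R)\<^esub> x \<in> hcomp (regular_module R) g" by simp
  qed (use s s0 ai in auto)
  show "internal_direct_sum (regular_module R) (hcomp (regular_module R))"
  proof -
    have "finsum (regular_module R) f S = finsum R f S" for f :: "'g \<Rightarrow> 'a" and S
      by (simp add: finsum_def finprod_def regular_module_def)
    then show ?thesis using A.direct_sum by (simp add: internal_direct_sum_def)
  qed
qed (use A.hcomp_mult in auto)

lemma regular_Supp: "Supp (regular_module R) = Supp R"
  by (simp add: Supp_def)

end

lemma (in pdcf) gm_SuppE:
  assumes "gm M" "g \<in> Supp M" obtains x where "x \<in> hcomp M g" "x \<noteq> \<zero>\<^bsub>M\<^esub>"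
  using assms hcompD(2)[OF assms(1), of g] by (auto simp: Supp_def)

lemma SuppI: "x \<in> hcomp M g \<Longrightarrow> x \<noteq> \<zero>\<^bsub>M\<^esub> \<Longrightarrow> g \<in> Supp M"
  by (auto simp: Supp_def)

text \<open>Closure of \<open>Supp R\<close> under addition is the absence of zero divisors: the
  product of two nonzero homogeneous elements is a nonzero element of the sum of their
  degrees.\<close>

sublocale pdcf \<subseteq> Q: pointed_monoid "Supp R"
proof
  interpret dom: domain R by (rule domain)
  show "0 \<in> Supp R" using SuppI[OF one_hcomp] dom.one_not_zero by auto
  show "p + q \<in> Supp R" if "p \<in> Supp R" "q \<in> Supp R" for p q
  proof -
    obtain x y where x: "x \<in> hcomp R p" "x \<noteq> \<zero>\<^bsub>R\<^esub>" and y: "y \<in> hcomp R q" "y \<noteq> \<zero>\<^bsub>R\<^esub>"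
    proof -
      obtain x where "x \<in> hcomp R p" "x \<noteq> \<zero>\<^bsub>R\<^esub>"
        using gm_SuppE[OF gm_regular, of p] \<open>p \<in> Supp R\<close> unfolding regular_Supp regular_module_simps by blast
      moreover obtain y where "y \<in> hcomp R q" "y \<noteq> \<zero>\<^bsub>R\<^esub>"
        using gm_SuppE[OF gm_regular, of q] \<open>q \<in> Supp R\<close> unfolding regular_Supp regular_module_simps by blast
      ultimately show ?thesis by (rule that)
    qed
    then have "x \<otimes>\<^bsub>R\<^esub> y \<noteq> \<zero>\<^bsub>R\<^esub>" using dom.integral_iff carrier_hcomp by blast
    then show ?thesis using SuppI[OF A.hcomp_mult[OF x(1) y(1)]] by blast
  qed
qed (use PDCF in \<open>auto simp: PDCF_def\<close>)

context pdcf
begin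

abbreviation "bounded \<equiv> finitely_bounded_below (Supp R)"

definition hilb :: "('a, 'b, 'g) gmodule \<Rightarrow> 'g \<Rightarrow> int"
  where "hilb M g = int (dim k (scal M) (hcomp M g))"

text \<open>From here on dimensions are measured by flags. Downward finiteness of the support comes
  from its lower bounds and the downward finiteness of \<open>Supp R\<close>.\<close>

lemma bdf_iff: "bdf M \<longleftrightarrow> gm M \<and> bounded (Supp M) \<and> (\<forall>g. fin_dim k (scal M) (hcomp M g))"
  using vspace.finite_dim_iff[OF vspace_scal[OF gm_module] hcomp_sub] Q.bounded_downward_finite[of "Supp M"]
  by (auto simp: BDF_def)

lemma bdfD: "bdf M \<Longrightarrow> gm M" "bdf M \<Longrightarrow> bounded (Supp M)" "bdf M \<Longrightarrow> fin_dim k (scal M) (hcomp M g)"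
  by (auto simp: bdf_iff)

lemma hilb_eq_0: "bdf M \<Longrightarrow> hilb M g = 0 \<longleftrightarrow> g \<notin> Supp M"
  using vspace.dim_eq_0[OF vspace_scal[OF gm_module[OF bdfD(1)]] bdfD(3)]
  by (simp add: hilb_def Supp_def)

lemma supp_hilb: "bdf M \<Longrightarrow> supp (hilb M) = Supp M"
  using hilb_eq_0 by (auto simp: supp_def)

lemma hilb_nonneg: "hilb M g \<ge> 0"
  by (simp add: hilb_def)

text \<open>The scalars act on \<open>R\<close> directly as on an algebra, and through
  multiplication by \<open>c 1\<close> when \<open>R\<close> is a module over itself. Since
  \<open>c x = (c 1) x\<close>, both actions have the same subspaces, so the finite spanning sets
  carry over.\<close>

lemma bdf_regular: "bdf (regular_module R)"
proof -
  have "finite_dim k (scal (regular_module R)) (hcomp (regular_module R) g)" for g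
  proof -
    obtain B where B: "finite B" "B \<subseteq> hcomp R g" "lin_span k R B = hcomp R g"
      using PDCF unfolding PDCF_def finite_dim_def by blast
    interpret V: vspace k "scal (regular_module R)" by (rule vspace_scal[OF regular_module])
    have ai: "\<ominus>\<^bsub>regular_module R\<^esub> x = \<ominus>\<^bsub>R\<^esub> x" for x by (simp add: a_inv_def m_inv_def regular_module_def)
    have *: "c \<odot>\<^bsub>R\<^esub> x = (c \<odot>\<^bsub>R\<^esub> \<one>\<^bsub>R\<^esub>) \<otimes>\<^bsub>R\<^esub> x" if "c \<in> carrier k" "x \<in> carrier R" for c x
      using that by (simp add: A.smult_assoc2)
    have "submodule H k R \<longleftrightarrow> submodule H k (scal (regular_module R))" for H
    proof
      assume H: "submodule H k R"
      note s = A.submoduleE[OF H] and s0 = A.submodule_zero[OF H]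
      show "submodule H k (scal (regular_module R))"
      proof (rule V.submoduleI)
        fix c x assume "c \<in> carrier k" "x \<in> H"
        then show "c \<odot>\<^bsub>scal (regular_module R)\<^esub> x \<in> H" using *[of c x] s(4)[of c x] s(1) by auto
      qed (use s s0 ai in auto)
    next
      assume H: "submodule H k (scal (regular_module R))"
      note s = V.subD[OF H]
      show "submodule H k R"
      proof (rule A.submoduleI)
        fix c x assume "c \<in> carrier k" "x \<in> H"
        then show "c \<odot>\<^bsub>R\<^esub> x \<in> H" using *[of c x] s(4)[of c x] s(1)[of x] by auto
      qed (use s ai in auto)
    qed
    then have "lin_span k (scal (regular_module R)) B = lin_span k R B"
      by (simp add: lin_span_def)
    then show ?thesis using B by (auto simp: finite_dim_def)
  qed
  then show ?thesis
    unfolding BDF_def regular_Supp using gm_regular Q.bounded_monoid Q.downward_finite by blast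
qed

lemma hcomp_regular_zero: "hcomp R 0 = {c \<odot>\<^bsub>R\<^esub> \<one>\<^bsub>R\<^esub> | c. c \<in> carrier k}"
  using hcomp_zero_scalar scalar_hcomp by auto

text \<open>By connectedness the degree 0 part of \<open>R\<close> is the line spanned by the unit.
  This value 1 is what makes convolution with the Hilbert function of \<open>R\<close>
  cancellable.\<close>

lemma hilb_regular_zero: "hilb (regular_module R) 0 = 1"
proof -
  interpret dom: domain R by (rule domain)
  interpret V: vspace k "scal (regular_module R)" by (rule vspace_scal[OF regular_module])
  have "flag k (scal (regular_module R)) (adjoin k (scal (regular_module R)) {\<zero>\<^bsub>scal (regular_module R)\<^esub>} \<one>\<^bsub>R\<^esub>) (Suc 0)"
    by (intro flag.step flag.zero) auto
  moreover have "adjoin k (scal (regular_module R)) {\<zero>\<^bsub>scal (regular_module R)\<^esub>} \<one>\<^bsub>R\<^esub> = hcomp R 0"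
  proof -
    have "\<zero>\<^bsub>R\<^esub> \<oplus>\<^bsub>R\<^esub> (c \<odot>\<^bsub>R\<^esub> \<one>\<^bsub>R\<^esub>) \<otimes>\<^bsub>R\<^esub> \<one>\<^bsub>R\<^esub> = c \<odot>\<^bsub>R\<^esub> \<one>\<^bsub>R\<^esub>" if "c \<in> carrier k" for c using that by simp
    then show ?thesis unfolding adjoin_def hcomp_regular_zero by force
  qed
  ultimately show ?thesis unfolding hilb_def using V.dim_eqI by simp
qed

lemma supp_hilb_regular: "supp (hilb (regular_module R)) = Supp R"
  using supp_hilb[OF bdf_regular] regular_Supp by simp

subsection \<open>Graded maps and isomorphisms\<close>

lemma hproj_neg:
  assumes "gm M" "x \<in> carrier M"
  shows "hproj M g (\<ominus>\<^bsub>M\<^esub> x) = \<ominus>\<^bsub>M\<^esub> hproj M g x"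
proof -
  interpret M: module R M by (rule gm_module[OF assms(1)])
  have "hproj M g (\<ominus>\<^bsub>M\<^esub> x) \<oplus>\<^bsub>M\<^esub> hproj M g x = hproj M g \<zero>\<^bsub>M\<^esub>"
    using hproj_add[OF assms(1), of "\<ominus>\<^bsub>M\<^esub> x" x g] assms(2) by (simp add: M.l_neg)
  also have "\<dots> = \<zero>\<^bsub>M\<^esub>" using hproj_homogeneous[OF assms(1) hcompD(2)[OF assms(1)]] by simp
  finally show ?thesis using hproj(2)[OF assms(1)] assms(2) by (metis M.a_inv_closed M.minus_equality)
qed

lemma hproj_minus:
  assumes "gm M" "x \<in> carrier M" "y \<in> carrier M"
  shows "hproj M g (x \<ominus>\<^bsub>M\<^esub> y) = hproj M g x \<ominus>\<^bsub>M\<^esub> hproj M g y"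
proof -
  interpret M: module R M by (rule gm_module[OF assms(1)])
  show ?thesis using assms by (simp add: a_minus_def hproj_add hproj_neg)
qed

text \<open>A homogeneous element of the image is also the image of the component of any preimage in
  that degree.\<close>

lemma image_hcomp:
  assumes "gm L" "gm M" "f \<in> gr_maps R L M"
  shows "f ` carrier L \<inter> hcomp M g = f ` hcomp L g"
proof
  show "f ` carrier L \<inter> hcomp M g \<subseteq> f ` hcomp L g"
  proof
    fix y assume y: "y \<in> f ` carrier L \<inter> hcomp M g"
    then obtain x where x: "x \<in> carrier L" "y = f x" by blast
    have "y = hproj M g y" using hproj_homogeneous[OF assms(2), of y g g] y by simp
    also have "\<dots> = f (hproj L g x)" using hproj_map[OF assms x(1)] x by simp
    finally show "y \<in> f ` hcomp L g" using hproj(1)[OF assms(1) x(1)] by blast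
  qed
  show "f ` hcomp L g \<subseteq> f ` carrier L \<inter> hcomp M g"
    using hcompD(1)[OF assms(1)] gr_mapsD(2)[OF assms(3)] by blast
qed

lemma surj_hcomp:
  assumes "gm L" "gm M" "f \<in> gr_maps R L M" "f ` carrier L = carrier M"
  shows "f ` hcomp L g = hcomp M g"
proof -
  have "hcomp M g \<subseteq> carrier M" using hcompD(1)[OF assms(2)] by (rule subsetI)
  then show ?thesis using image_hcomp[OF assms(1-3), of g] assms(4) by (simp add: Int_absorb1)
qed

lemma gr_isomorphicE:
  assumes "gr_isomorphic R M N" "gm M" "gm N"
  obtains f where "gr_isomorphism R M N f"
proof -
  obtain f where f: "f \<in> gr_maps R M N" "bij_betw f (carrier M) (carrier N)"
    using assms(1) by (auto simp: gr_isomorphic_def)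
  then have "gr_isomorphism R M N f"
    using surj_hcomp[OF assms(2,3) f(1)] by (auto simp: gr_isomorphism_def bij_betw_def)
  then show ?thesis by (rule that)
qed

lemma gr_isomorphismI:
  assumes "f \<in> lin_maps R M N" "bij_betw f (carrier M) (carrier N)" "\<And>g. f ` hcomp M g = hcomp N g"
  shows "gr_isomorphism R M N f"
  using assms by (auto simp: gr_isomorphism_def gr_maps_def)

lemma gr_isomorphismD:
  assumes "gr_isomorphism R M N f"
  shows "f \<in> gr_maps R M N" "f \<in> lin_maps R M N" "bij_betw f (carrier M) (carrier N)" "f ` hcomp M g = hcomp N g"
    "inj_on f (carrier M)" "f ` carrier M = carrier N"
  using assms by (auto simp: gr_isomorphism_def gr_maps_def bij_betw_def)

lemma gr_isomorphism_isomorphic: "gr_isomorphism R M N f \<Longrightarrow> gr_isomorphic R M N"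
  by (auto simp: gr_isomorphism_def gr_isomorphic_def)

lemma gr_isomorphism_inv:
  assumes f: "gr_isomorphism R M N f" and "module R M" "module R N" "\<And>g. hcomp M g \<subseteq> carrier M"
  shows "gr_isomorphism R N M (inv_into (carrier M) f)"
proof (rule gr_isomorphismI)
  note f' = gr_isomorphismD[OF f]
  show "inv_into (carrier M) f \<in> lin_maps R N M" by (rule lin_maps_inv[OF assms(2,3) f'(2,3)])
  show "bij_betw (inv_into (carrier M) f) (carrier N) (carrier M)" by (rule bij_betw_inv_into[OF f'(3)])
  show "inv_into (carrier M) f ` hcomp N g = hcomp M g" for g
    using f'(4)[of g] f'(5) assms(4)[of g] by (metis inv_into_image_cancel)
qed

lemma gr_isomorphism_comp:
  assumes "gr_isomorphism R L M f" "gr_isomorphism R M N h"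
  shows "gr_isomorphism R L N (\<lambda>x. h (f x))"
proof (rule gr_isomorphismI)
  note f = gr_isomorphismD[OF assms(1)] and h = gr_isomorphismD[OF assms(2)]
  show "(\<lambda>x. h (f x)) \<in> lin_maps R L N" by (rule lin_maps_comp[OF f(2) h(2)])
  show "bij_betw (\<lambda>x. h (f x)) (carrier L) (carrier N)"
    using bij_betw_trans[OF f(3) h(3)] by (simp add: comp_def)
  show "(\<lambda>x. h (f x)) ` hcomp L g = hcomp N g" for g
    using f(4)[of g] h(4)[of g] by (metis image_image)
qed

lemma hcomp_carrier: "gm M \<Longrightarrow> hcomp M g \<subseteq> carrier M"
  by (rule subsetI) (rule hcompD(1))

lemma gr_isomorphic_sym: "gr_isomorphic R M N \<Longrightarrow> gm M \<Longrightarrow> gm N \<Longrightarrow> gr_isomorphic R N M"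
  by (metis gr_isomorphicE gr_isomorphism_inv gm_module hcomp_carrier gr_isomorphism_isomorphic)

lemma gr_isomorphic_trans: "gr_isomorphic R L M \<Longrightarrow> gr_isomorphic R M N \<Longrightarrow> gm L \<Longrightarrow> gm M \<Longrightarrow> gm N \<Longrightarrow> gr_isomorphic R L N"
  by (metis gr_isomorphicE gr_isomorphism_comp gr_isomorphism_isomorphic)

context
  fixes M :: "('a, 'b, 'g) gmodule" and N :: "('a, 'c, 'g) gmodule" and f
  assumes iso: "gr_isomorphism R M N f" and M: "module R M" and hM: "\<And>g. hcomp M g \<subseteq> carrier M"
begin

text \<open>Here \<open>M\<close> is only a module with a family of subsets, and its projections are
  pulled back along the isomorphism. This is how tensor products become graded: their components are
  defined as spans, and directness of the sum is inherited from a direct sum of shifts.\<close>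

lemma gm_iso: assumes N: "gm N" shows "gm M"
proof -
  interpret lin_map R M N f by (rule lin_mapI[OF M gm_module[OF N] gr_isomorphismD(2)[OF iso]])
  define \<psi> where "\<psi> = inv_into (carrier M) f"
  have \<psi>: "gr_isomorphism R N M \<psi>" unfolding \<psi>_def by (rule gr_isomorphism_inv[OF iso M gm_module[OF N] hM])
  interpret inv: lin_map R N M \<psi> by (rule lin_mapI[OF gm_module[OF N] M gr_isomorphismD(2)[OF \<psi>]])
  have \<psi>f: "\<psi> (f x) = x" if "x \<in> carrier M" for x
    using that gr_isomorphismD(5)[OF iso] by (simp add: \<psi>_def)
  have fh: "f x \<in> hcomp N g" if "x \<in> hcomp M g" for x g using gr_mapsD(2)[OF gr_isomorphismD(1)[OF iso] that] .
  have \<psi>h: "\<psi> x \<in> hcomp M g" if "x \<in> hcomp N g" for x g using gr_mapsD(2)[OF gr_isomorphismD(1)[OF \<psi>] that] .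
  have pull: "x \<in> hcomp M g" if "x \<in> carrier M" "f x \<in> hcomp N g" for x g using \<psi>h[OF that(2)] \<psi>f that by simp
  have z: "f x = \<zero>\<^bsub>N\<^esub> \<longleftrightarrow> x = \<zero>\<^bsub>M\<^esub>" if "x \<in> carrier M" for x using \<psi>f[OF that] by (metis inv.map_zero map_zero)
  note c = hcompD[OF N]
  show ?thesis
  proof (rule graded_moduleI[OF M, where p = "\<lambda>g x. \<psi> (hproj N g (f x))"])
    show "x \<oplus>\<^bsub>M\<^esub> y \<in> hcomp M g" if "x \<in> hcomp M g" "y \<in> hcomp M g" for x y g
      by (rule pull) (use that hM fh c(3) map_simps(2) in \<open>auto simp: subset_iff\<close>)
    show "r \<odot>\<^bsub>M\<^esub> x \<in> hcomp M (h + g)" if "r \<in> hcomp R h" "x \<in> hcomp M g" for r x g h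
      by (rule pull) (use that hM fh c(5) carrier_hcomp in \<open>auto simp: subset_iff\<close>)
    fix x assume x: "x \<in> carrier M"
    note p = hproj[OF N, of "f x"]
    show "\<psi> (hproj N g (f x)) \<in> hcomp M g" for g using \<psi>h p x by simp
    show "finite {g. \<psi> (hproj N g (f x)) \<noteq> \<zero>\<^bsub>M\<^esub>}"
      by (rule finite_subset[of _ "{g. hproj N g (f x) \<noteq> \<zero>\<^bsub>N\<^esub>}"]) (use p x in auto)
    show "\<psi> (hproj N g (f (x \<oplus>\<^bsub>M\<^esub> y))) = \<psi> (hproj N g (f x)) \<oplus>\<^bsub>M\<^esub> \<psi> (hproj N g (f y))" if "y \<in> carrier M" for g y
      using x that hproj(2)[OF N] by (simp add: hproj_add[OF N])
    assume *: "\<And>g. \<psi> (hproj N g (f x)) = \<zero>\<^bsub>M\<^esub>"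
    have f\<psi>: "f (\<psi> y) = y" if "y \<in> carrier N" for y
      using that gr_isomorphismD(6)[OF iso] unfolding \<psi>_def by (simp add: f_inv_into_f)
    have "hproj N g (f x) = \<zero>\<^bsub>N\<^esub>" for g using *[of g] f\<psi>[of "hproj N g (f x)"] p x by simp
    then have "f x = \<zero>\<^bsub>N\<^esub>" using hproj_zero_imp[OF N] x by simp
    then show "x = \<zero>\<^bsub>M\<^esub>" using z x by simp
  next
    show "\<psi> (hproj N h (f x)) = (if h = g then x else \<zero>\<^bsub>M\<^esub>)" if "x \<in> hcomp M g" for x g h
      using that hM hproj_homogeneous[OF N fh[OF that]] \<psi>f by auto
  next
    show "\<zero>\<^bsub>M\<^esub> \<in> hcomp M g" for g by (rule pull) (use c in auto)
  qed (use hM in auto)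
qed

lemma bdf_iso: assumes N: "bdf N" shows "bdf M" "hilb M = hilb N"
proof -
  note N' = bdfD[OF N]
  have gM: "gm M" by (rule gm_iso[OF N'(1)])
  define \<psi> where "\<psi> = inv_into (carrier M) f"
  have \<psi>: "gr_isomorphism R N M \<psi>" unfolding \<psi>_def by (rule gr_isomorphism_inv[OF iso M gm_module[OF N'(1)] hM])
  interpret vspace_map k "scal N" "scal M" \<psi>
    by (rule lin_map_scal[OF gm_module[OF N'(1)] M gr_isomorphismD(2)[OF \<psi>]])
  have inj: "x = \<zero>\<^bsub>scal N\<^esub>" if "x \<in> hcomp N g" "\<psi> x = \<zero>\<^bsub>scal M\<^esub>" for x g
    using gr_isomorphismD(5)[OF \<psi>] that hcomp_carrier[OF N'(1), of g] map_zero
    by (metis V.zero_closed inj_onD restrict_scalars_simps(1,3) subsetD)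
  have fd: "fin_dim k (scal M) (hcomp M g)" for g
    using dim_rank_nullity(1)[OF N'(3)[of g]] gr_isomorphismD(4)[OF \<psi>] by simp
  have d: "dim k (scal M) (hcomp M g) = dim k (scal N) (hcomp N g)" for g
    using dim_inj[OF N'(3)[of g] hcomp_sub[OF N'(1)] inj] gr_isomorphismD(4)[OF \<psi>] by simp
  then show h: "hilb M = hilb N" by (auto simp: hilb_def)
  have "Supp M = Supp N"
    using V.dim_eq_0[OF N'(3)] W.dim_eq_0[OF fd] d by (auto simp: Supp_def)
  then show "bdf M" using gM fd N' by (simp add: bdf_iff)
qed

end

lemma hilb_iso: "gr_isomorphic R M N \<Longrightarrow> bdf M \<Longrightarrow> bdf N \<Longrightarrow> hilb M = hilb N"
  using bdf_iso(2) bdfD(1) gm_module hcomp_carrier by (metis gr_isomorphicE)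

subsection \<open>Homogeneous submodules and quotients\<close>

lemma kernel_homogeneous:
  assumes "gm M" "gm N" "f \<in> gr_maps R M N"
  shows "homogeneous_submodule R M (a_kernel M N f)"
proof -
  interpret lin_map R M N f by (rule lin_map_gr[OF assms])
  have "submodule {x \<in> carrier M. f x = \<zero>\<^bsub>N\<^esub>} R M"
    by (rule V.submoduleI) auto
  then show ?thesis
    unfolding homogeneous_submodule_def a_kernel_eq using hproj_map[OF assms, symmetric] hproj(2)[OF assms(1)]
      hproj_homogeneous[OF assms(2) hcompD(2)[OF assms(2)], of _ undefined] by auto
qed

lemma image_homogeneous:
  assumes "gm M" "gm N" "f \<in> gr_maps R M N"
  shows "homogeneous_submodule R N (f ` carrier M)"
proof -
  interpret lin_map R M N f by (rule lin_map_gr[OF assms])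
  have "submodule (f ` carrier M) R N"
  proof (rule W.submoduleI)
    show "\<zero>\<^bsub>N\<^esub> \<in> f ` carrier M" using map_zero V.zero_closed by (metis image_eqI)
  qed (auto simp del: map_simps(2,3) map_neg simp: map_simps(2,3)[symmetric] map_neg[symmetric])
  then show ?thesis
    unfolding homogeneous_submodule_def using hproj_map[OF assms] hproj(2)[OF assms(1)] by auto
qed

lemma carrier_homogeneous: "gm M \<Longrightarrow> homogeneous_submodule R M (carrier M)"
  unfolding homogeneous_submodule_def by (intro conjI ballI allI module.carrier_is_submodule gm_module hproj(2))

lemma sub_gmodule_simps [simp]:
  "carrier (sub_gmodule M H) = H" "add (sub_gmodule M H) = add M" "ring.zero (sub_gmodule M H) = \<zero>\<^bsub>M\<^esub>"
  "smult (sub_gmodule M H) = smult M" "hcomp (sub_gmodule M H) = (\<lambda>g. hcomp M g \<inter> H)"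
  by (simp_all add: sub_gmodule_def)

lemma sub_gmodule_incl:
  assumes "homogeneous_submodule R M H" "module R M"
  shows "(\<lambda>x. x) \<in> gr_maps R (sub_gmodule M H) M"
  using module.submoduleE(1)[OF assms(2)] assms(1) by (auto simp: gr_maps_def lin_maps_def homogeneous_submodule_def)

lemma sub_gmodule_module:
  assumes "submodule H R M" "module R M" shows "module R (sub_gmodule M H)"
proof -
  interpret M: module R M by (rule assms)
  note H = M.submoduleE[OF assms(1)] M.submodule_zero[OF assms(1)]
  have HM: "x \<in> carrier M" if "x \<in> H" for x using H that by blast
  show ?thesis
  proof (rule moduleI)
    show "abelian_group (sub_gmodule M H)"
    proof (rule abelian_groupI)
      fix x assume "x \<in> carrier (sub_gmodule M H)"
      then show "\<exists>y\<in>carrier (sub_gmodule M H). y \<oplus>\<^bsub>sub_gmodule M H\<^esub> x = \<zero>\<^bsub>sub_gmodule M H\<^esub>"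
        using H(3) HM by (intro bexI[of _ "\<ominus>\<^bsub>M\<^esub> x"]) (auto simp: M.l_neg)
    qed (use H HM in \<open>auto simp: M.a_ac\<close>)
  qed (use H HM in \<open>auto simp: A.M_cring M.smult_l_distr M.smult_r_distr M.smult_assoc1\<close>)
qed

lemma gm_sub:
  assumes H: "homogeneous_submodule R M H" and M: "gm M"
  shows "gm (sub_gmodule M H)"
proof -
  interpret M: module R M by (rule gm_module[OF M])
  have sub: "submodule H R M" using H by (simp add: homogeneous_submodule_def)
  note H' = M.submoduleE[OF sub] M.submodule_zero[OF sub] and c = hcompD[OF M] and p = hproj[OF M]
  have HM: "x \<in> carrier M" if "x \<in> H" for x using H' that by blast
  show ?thesis
  proof (rule graded_moduleI[where p = "hproj M", OF sub_gmodule_module[OF sub M.module_axioms]])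
    show "hproj M g x \<in> hcomp (sub_gmodule M H) g" if "x \<in> carrier (sub_gmodule M H)" for g x
      using that p(1)[OF HM] H by (auto simp: homogeneous_submodule_def)
    show "hproj M h x = (if h = g then x else \<zero>\<^bsub>sub_gmodule M H\<^esub>)" if "x \<in> hcomp (sub_gmodule M H) g" for g h x
      using that hproj_homogeneous[OF M, of x g] by simp
    show "r \<odot>\<^bsub>sub_gmodule M H\<^esub> x \<in> hcomp (sub_gmodule M H) (h + g)"
      if "r \<in> hcomp R h" "x \<in> hcomp (sub_gmodule M H) g" for r x h g
      using that c(5) H'(4) carrier_hcomp by auto
    show "x \<oplus>\<^bsub>sub_gmodule M H\<^esub> y \<in> hcomp (sub_gmodule M H) g"
      if "x \<in> hcomp (sub_gmodule M H) g" "y \<in> hcomp (sub_gmodule M H) g" for x y g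
      using that c(3) H'(5) by auto
    show "finite {g. hproj M g x \<noteq> \<zero>\<^bsub>sub_gmodule M H\<^esub>}" if "x \<in> carrier (sub_gmodule M H)" for x
      using p(3)[OF HM] that by simp
    show "hproj M g (x \<oplus>\<^bsub>sub_gmodule M H\<^esub> y) = hproj M g x \<oplus>\<^bsub>sub_gmodule M H\<^esub> hproj M g y"
      if "x \<in> carrier (sub_gmodule M H)" "y \<in> carrier (sub_gmodule M H)" for x y g
      using that hproj_add[OF M] HM by simp
    show "x = \<zero>\<^bsub>sub_gmodule M H\<^esub>"
      if "x \<in> carrier (sub_gmodule M H)" "\<And>g. hproj M g x = \<zero>\<^bsub>sub_gmodule M H\<^esub>" for x
      using that hproj_zero_imp[OF M, of x] HM by simp
    show "\<zero>\<^bsub>sub_gmodule M H\<^esub> \<in> hcomp (sub_gmodule M H) g" for g using c(2) H' by simp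
  qed simp
qed

lemma hcomp_sub_space: "homogeneous_submodule R M H \<Longrightarrow> gm M \<Longrightarrow> submodule (hcomp M g \<inter> H) k (scal M)"
proof -
  assume H: "homogeneous_submodule R M H" and M: "gm M"
  interpret V: vspace k "scal M" by (rule vspace_scal[OF gm_module[OF M]])
  interpret M: module R M by (rule gm_module[OF M])
  have sub: "submodule H R M" using H by (simp add: homogeneous_submodule_def)
  have "submodule H k (scal M)"
    by (rule V.submoduleI) (use M.submoduleE[OF sub] M.submodule_zero[OF sub] in auto)
  then show ?thesis by (rule V.sub_Int[OF hcomp_sub[OF M]])
qed

lemma bdf_sub:
  assumes H: "homogeneous_submodule R M H" and M: "bdf M"
  shows "bdf (sub_gmodule M H)" "hilb (sub_gmodule M H) g = int (dim k (scal M) (hcomp M g \<inter> H))"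
proof -
  note M' = bdfD[OF M]
  have sub: "submodule H R M" using H by (simp add: homogeneous_submodule_def)
  note gs = gm_sub[OF H M'(1)]
  interpret vspace_map k "scal (sub_gmodule M H)" "scal M" "\<lambda>x. x"
    by (rule lin_map_scal[OF gm_module[OF gs] gm_module[OF M'(1)]
          gr_mapsD(1)[OF sub_gmodule_incl[OF H gm_module[OF M'(1)]]]])
  have fd: "fin_dim k (scal (sub_gmodule M H)) (hcomp (sub_gmodule M H) g)" for g
  proof (rule fin_dim_extension[OF hcomp_sub[OF gs]])
    show "fin_dim k (scal M) ((\<lambda>x. x) ` hcomp (sub_gmodule M H) g)"
      using W.fin_dim_mono(1)[OF M'(3)[of g] hcomp_sub_space[OF H M'(1), of g]] by simp
    have "{x \<in> hcomp (sub_gmodule M H) g. x = \<zero>\<^bsub>scal M\<^esub>} = {\<zero>\<^bsub>scal (sub_gmodule M H)\<^esub>}"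
      using hcompD(2)[OF gs] by auto
    then show "fin_dim k (scal (sub_gmodule M H)) {x \<in> hcomp (sub_gmodule M H) g. x = \<zero>\<^bsub>scal M\<^esub>}"
      using V.dim_zero by simp
  qed
  have "Supp (sub_gmodule M H) \<subseteq> Supp M"
    using hcompD(2)[OF M'(1)] hcompD(2)[OF gs] by (auto simp: Supp_def)
  then show "bdf (sub_gmodule M H)"
    using gs fd Q.bounded_subset[OF M'(2)] by (simp add: bdf_iff)
  show "hilb (sub_gmodule M H) g = int (dim k (scal M) (hcomp M g \<inter> H))"
    unfolding hilb_def using dim_inj[OF fd[of g] hcomp_sub[OF gs]] by simp
qed

end

lemma quot_module_simps [simp]:
  "carrier (quot_module M H) = a_rcosets\<^bsub>M\<^esub> H" "add (quot_module M H) = set_add M" "ring.zero (quot_module M H) = H"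
  by (simp_all add: quot_module_def)

lemma quot_gmodule_simps [simp]:
  "carrier (quot_gmodule M H) = a_rcosets\<^bsub>M\<^esub> H" "add (quot_gmodule M H) = set_add M"
  "ring.zero (quot_gmodule M H) = H" "smult (quot_gmodule M H) = smult (quot_module M H)"
  "hcomp (quot_gmodule M H) g = (\<lambda>x. H +>\<^bsub>M\<^esub> x) ` hcomp M g"
  by (simp_all add: quot_gmodule_def quot_module_def module.extend_def gmodule.fields_def)

locale quotient = M: module R M + H: submodule H R M
  for R :: "('a, 'w) ring_scheme" and M :: "('a, 'b, 'y) module_scheme" and H
begin

abbreviation "cls \<equiv> \<lambda>x. H +>\<^bsub>M\<^esub> x"

sublocale S: abelian_subgroup H M
  by (rule abelian_subgroupI3[OF additive_subgroup.intro M.M.abelian_group_axioms]) (rule H.subgroup_axioms)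

lemma carrier_eq: "a_rcosets\<^bsub>M\<^esub> H = cls ` carrier M"
  by (auto simp: A_RCOSETS_def')

lemma cls_add: "x \<in> carrier M \<Longrightarrow> y \<in> carrier M \<Longrightarrow> set_add M (cls x) (cls y) = cls (x \<oplus>\<^bsub>M\<^esub> y)"
  by (rule S.a_rcos_sum)

lemma cls_zero_iff: "x \<in> carrier M \<Longrightarrow> cls x = H \<longleftrightarrow> x \<in> H"
  using S.a_rcos_self S.a_rcos_const by blast

lemma cls_neg_add: "x \<in> carrier M \<Longrightarrow> set_add M (cls (\<ominus>\<^bsub>M\<^esub> x)) (cls x) = H"
  using cls_add[of "\<ominus>\<^bsub>M\<^esub> x" x] cls_zero_iff[of "\<zero>\<^bsub>M\<^esub>"] M.submodule_zero[OF H.submodule_axioms] by (simp add: M.M.l_neg)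

lemma cls_eq_iff:
  assumes "x \<in> carrier M" "y \<in> carrier M"
  shows "cls x = cls y \<longleftrightarrow> x \<ominus>\<^bsub>M\<^esub> y \<in> H"
proof -
  have e: "set_add M (cls (x \<ominus>\<^bsub>M\<^esub> y)) (cls y) = cls x"
    using cls_add[of "x \<ominus>\<^bsub>M\<^esub> y" y] assms by (simp add: a_minus_def M.M.a_assoc M.M.l_neg)
  have z: "set_add M H (cls y) = cls y"
    using cls_add[of "\<zero>\<^bsub>M\<^esub>" y] cls_zero_iff[of "\<zero>\<^bsub>M\<^esub>"] M.submodule_zero[OF H.submodule_axioms] assms by simp
  have "set_add M (cls x) (cls (\<ominus>\<^bsub>M\<^esub> y)) = cls (x \<ominus>\<^bsub>M\<^esub> y)"
    using cls_add[of x "\<ominus>\<^bsub>M\<^esub> y"] assms by (simp add: a_minus_def)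
  moreover have "set_add M (cls y) (cls (\<ominus>\<^bsub>M\<^esub> y)) = H"
    using cls_add[of y "\<ominus>\<^bsub>M\<^esub> y"] cls_zero_iff[of "\<zero>\<^bsub>M\<^esub>"] M.submodule_zero[OF H.submodule_axioms] assms
    by (simp add: M.M.r_neg)
  ultimately show ?thesis using e z cls_zero_iff[of "x \<ominus>\<^bsub>M\<^esub> y"] assms by auto
qed

text \<open>The action on cosets is defined as a union over all representatives, and each of them
  contributes the same coset.\<close>

lemma cls_smult:
  assumes "r \<in> carrier R" "x \<in> carrier M"
  shows "r \<odot>\<^bsub>quot_module M H\<^esub> cls x = cls (r \<odot>\<^bsub>M\<^esub> x)"
proof -
  have "cls (r \<odot>\<^bsub>M\<^esub> y) = cls (r \<odot>\<^bsub>M\<^esub> x)" if y: "y \<in> cls x" for y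
  proof -
    obtain h where h: "h \<in> H" "y = h \<oplus>\<^bsub>M\<^esub> x" using y by (auto simp: a_r_coset_def')
    have hM: "h \<in> carrier M" using h M.submoduleE(1)[OF H.submodule_axioms] by blast
    have rh: "r \<odot>\<^bsub>M\<^esub> h \<in> H" using h assms by simp
    have "r \<odot>\<^bsub>M\<^esub> y \<ominus>\<^bsub>M\<^esub> r \<odot>\<^bsub>M\<^esub> x = r \<odot>\<^bsub>M\<^esub> h"
      using h hM assms by (simp add: M.smult_r_distr a_minus_def M.M.a_assoc M.M.r_neg)
    then show ?thesis using cls_eq_iff[of "r \<odot>\<^bsub>M\<^esub> y" "r \<odot>\<^bsub>M\<^esub> x"] rh h hM assms by simp
  qed
  moreover have "x \<in> cls x" by (rule S.a_rcos_self[OF assms(2)])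
  ultimately have "(\<Union>y\<in>cls x. cls (r \<odot>\<^bsub>M\<^esub> y)) = cls (r \<odot>\<^bsub>M\<^esub> x)" by (intro UN_constant_eq ballI)
  then show ?thesis by (simp add: quot_module_def)
qed

lemma quot_module: "module R (quot_module M H)"
proof (rule moduleI)
  show "abelian_group (quot_module M H)"
  proof (rule abelian_groupI)
    fix X assume "X \<in> carrier (quot_module M H)"
    then obtain x where x: "X = cls x" "x \<in> carrier M" by (auto simp: carrier_eq)
    then show "\<exists>Y\<in>carrier (quot_module M H). Y \<oplus>\<^bsub>quot_module M H\<^esub> X = \<zero>\<^bsub>quot_module M H\<^esub>"
      using cls_neg_add by (intro bexI[of _ "cls (\<ominus>\<^bsub>M\<^esub> x)"]) (auto simp: carrier_eq)
    show "\<zero>\<^bsub>quot_module M H\<^esub> \<oplus>\<^bsub>quot_module M H\<^esub> X = X"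
      using cls_add[of "\<zero>\<^bsub>M\<^esub>" x] cls_zero_iff[of "\<zero>\<^bsub>M\<^esub>"] M.submodule_zero[OF H.submodule_axioms] x by simp
  next
    show "\<zero>\<^bsub>quot_module M H\<^esub> \<in> carrier (quot_module M H)"
      using cls_zero_iff[of "\<zero>\<^bsub>M\<^esub>"] M.submodule_zero[OF H.submodule_axioms]
      by (auto simp: carrier_eq intro!: image_eqI[of _ _ "\<zero>\<^bsub>M\<^esub>"])
  qed (auto simp: carrier_eq cls_add M.M.a_ac)
qed (auto simp: carrier_eq cls_add cls_smult M.smult_l_distr M.smult_r_distr M.smult_assoc1 M.R.is_cring)

lemma cls_lin_map: "cls \<in> lin_maps R M (quot_module M H)"
  by (auto simp: lin_maps_def carrier_eq cls_add cls_smult)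

end

context pdcf
begin

lemma quot_gmodule_module:
  assumes "submodule H R M" "module R M" shows "module R (quot_gmodule M H)"
proof -
  interpret quotient R M H using assms by (simp add: quotient_def)
  interpret q: module R "quot_module M H" by (rule quot_module)
  show ?thesis
  proof (rule moduleI)
    show "abelian_group (quot_gmodule M H)"
    proof (rule abelian_groupI)
      fix x assume "x \<in> carrier (quot_gmodule M H)"
      then show "\<exists>y\<in>carrier (quot_gmodule M H). y \<oplus>\<^bsub>quot_gmodule M H\<^esub> x = \<zero>\<^bsub>quot_gmodule M H\<^esub>"
        using q.l_neg[of x] q.a_inv_closed[of x] by (intro bexI[of _ "\<ominus>\<^bsub>quot_module M H\<^esub> x"]) auto
    qed (use q.a_closed q.zero_closed q.a_assoc q.a_comm q.l_zero in auto)
  qed (use q.smult_closed q.smult_l_distr q.smult_r_distr q.smult_assoc1 q.smult_one A.M_cring in auto)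
qed

lemma gm_quot:
  assumes H: "homogeneous_submodule R M H" and M: "gm M"
  shows "gm (quot_gmodule M H)" "(\<lambda>x. H +>\<^bsub>M\<^esub> x) \<in> gr_maps R M (quot_gmodule M H)"
proof -
  have sub: "submodule H R M" using H by (simp add: homogeneous_submodule_def)
  interpret quotient R M H using sub gm_module[OF M] by (simp add: quotient_def)
  note c = hcompD[OF M] and p = hproj[OF M]
  have op: "set_add M (cls x) (cls y) = cls (x \<oplus>\<^bsub>M\<^esub> y)" if "x \<in> carrier M" "y \<in> carrier M" for x y
    by (rule cls_add[OF that])
  \<comment> \<open>The projection of a coset is taken on a chosen representative; since
    \<open>H\<close> is closed under taking components, the resulting coset does not depend on the
    choice (\<open>hp\<close>).\<close>
  define rep where "rep X = (SOME x. x \<in> carrier M \<and> X = cls x)" for X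
  have rep: "rep X \<in> carrier M" "X = cls (rep X)" if "X \<in> cls ` carrier M" for X
    using someI_ex[of "\<lambda>x. x \<in> carrier M \<and> X = cls x"] that unfolding rep_def by blast+
  have hp: "cls (hproj M g (rep (cls x))) = cls (hproj M g x)" if x: "x \<in> carrier M" for x g
  proof -
    have r: "rep (cls x) \<in> carrier M" "cls x = cls (rep (cls x))" using rep[of "cls x"] x by auto
    then have "x \<ominus>\<^bsub>M\<^esub> rep (cls x) \<in> H" using cls_eq_iff[OF x r(1)] by simp
    then have "hproj M g (x \<ominus>\<^bsub>M\<^esub> rep (cls x)) \<in> H" using H by (simp add: homogeneous_submodule_def)
    then show ?thesis using cls_eq_iff[OF p(2)[OF x] p(2)[OF r(1)]] hproj_minus[OF M x r(1)] by metis
  qed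
  have zH: "cls \<zero>\<^bsub>M\<^esub> = H" using cls_zero_iff[of "\<zero>\<^bsub>M\<^esub>"] M.submodule_zero[OF sub] by simp
  show gq: "gm (quot_gmodule M H)"
  proof (rule graded_moduleI[where p = "\<lambda>g X. cls (hproj M g (rep X))", OF quot_gmodule_module[OF sub gm_module[OF M]]])
    show "\<zero>\<^bsub>quot_gmodule M H\<^esub> \<in> hcomp (quot_gmodule M H) g" for g
      using zH c(2) by (auto intro!: image_eqI[of _ _ "\<zero>\<^bsub>M\<^esub>"])
    show "x \<in> carrier (quot_gmodule M H)" if "x \<in> hcomp (quot_gmodule M H) g" for x g
      using that c(1) by (auto simp: carrier_eq)
    show "X \<oplus>\<^bsub>quot_gmodule M H\<^esub> Y \<in> hcomp (quot_gmodule M H) g"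
      if X: "X \<in> hcomp (quot_gmodule M H) g" "Y \<in> hcomp (quot_gmodule M H) g" for X Y g
    proof -
      obtain x y where "X = cls x" "Y = cls y" "x \<in> hcomp M g" "y \<in> hcomp M g" using X by auto
      then show ?thesis using op c(1,3) by auto
    qed
    show "r \<odot>\<^bsub>quot_gmodule M H\<^esub> X \<in> hcomp (quot_gmodule M H) (h + g)"
      if X: "r \<in> hcomp R h" "X \<in> hcomp (quot_gmodule M H) g" for r X h g
    proof -
      obtain x where "X = cls x" "x \<in> hcomp M g" using X by auto
      then show ?thesis using cls_smult[OF carrier_hcomp[OF X(1)]] c(1) c(5)[OF X(1)] by auto
    qed
    fix X assume "X \<in> carrier (quot_gmodule M H)"
    then obtain x where x: "x \<in> carrier M" "X = cls x" by (auto simp: carrier_eq)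
    show "cls (hproj M g (rep X)) \<in> hcomp (quot_gmodule M H) g" for g
      using hp[OF x(1)] p(1)[OF x(1)] x by simp
    show "finite {g. cls (hproj M g (rep X)) \<noteq> \<zero>\<^bsub>quot_gmodule M H\<^esub>}"
      by (rule finite_subset[OF _ p(3)[OF x(1)]]) (use hp[OF x(1)] x zH in auto)
    show "cls (hproj M g (rep (X \<oplus>\<^bsub>quot_gmodule M H\<^esub> Y))) =
        cls (hproj M g (rep X)) \<oplus>\<^bsub>quot_gmodule M H\<^esub> cls (hproj M g (rep Y))"
      if Y: "Y \<in> carrier (quot_gmodule M H)" for g Y
    proof -
      obtain y where y: "y \<in> carrier M" "Y = cls y" using Y by (auto simp: carrier_eq)
      show ?thesis using x y hp[OF x(1)] hp[OF y(1)] hp[of "x \<oplus>\<^bsub>M\<^esub> y" g] op p(2) hproj_add[OF M] by simp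
    qed
    assume *: "\<And>g. cls (hproj M g (rep X)) = \<zero>\<^bsub>quot_gmodule M H\<^esub>"
    have pH: "hproj M g x \<in> H" for g using *[of g] hp[OF x(1)] x cls_zero_iff[OF p(2)[OF x(1)]] by simp
    have "finsum M (\<lambda>g. hproj M g x) S \<in> H" if "finite S" for S
      using that
    proof (induction S rule: finite_induct)
      case empty
      show ?case using M.submodule_zero[OF sub] by simp
    next
      case (insert g S)
      then show ?case using pH p(2)[OF x(1)] M.submoduleE(5)[OF sub] by (simp add: Pi_iff)
    qed
    then have "x \<in> H" using p(3,4)[OF x(1)] by metis
    then show "X = \<zero>\<^bsub>quot_gmodule M H\<^esub>" using x cls_zero_iff by simp
  next
    show "cls (hproj M h (rep X)) = (if h = g then X else \<zero>\<^bsub>quot_gmodule M H\<^esub>)"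
      if X: "X \<in> hcomp (quot_gmodule M H) g" for X g h
    proof -
      obtain x where x: "X = cls x" "x \<in> hcomp M g" using X by auto
      show ?thesis using hp[OF c(1)[OF x(2)]] hproj_homogeneous[OF M x(2), of h] x zH by simp
    qed
  qed
  have "cls \<in> lin_maps R M (quot_gmodule M H)"
    using cls_lin_map by (simp add: lin_maps_def)
  then show "cls \<in> gr_maps R M (quot_gmodule M H)" by (auto simp: gr_maps_def)
qed

lemma bdf_quot:
  assumes H: "homogeneous_submodule R M H" and M: "bdf M"
  shows "bdf (quot_gmodule M H)"
    "hilb (quot_gmodule M H) g = hilb M g - int (dim k (scal M) (hcomp M g \<inter> H))"
proof -
  note M' = bdfD[OF M] and q = gm_quot[OF H bdfD(1)[OF M]]
  have sub: "submodule H R M" using H by (simp add: homogeneous_submodule_def)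
  interpret quotient R M H using sub gm_module[OF M'(1)] by (simp add: quotient_def)
  interpret vspace_map k "scal M" "scal (quot_gmodule M H)" cls
    by (rule lin_map_scal[OF gm_module[OF M'(1)] gm_module[OF q(1)] gr_mapsD(1)[OF q(2)]])
  have im: "cls ` hcomp M g = hcomp (quot_gmodule M H) g" for g by simp
  have ker: "{x \<in> hcomp M g. cls x = \<zero>\<^bsub>scal (quot_gmodule M H)\<^esub>} = hcomp M g \<inter> H" for g
    using cls_zero_iff hcompD(1)[OF M'(1)] by auto
  note d = dim_rank_nullity[OF M'(3), unfolded im ker]
  have "Supp (quot_gmodule M H) \<subseteq> Supp M"
  proof
    fix g assume "g \<in> Supp (quot_gmodule M H)"
    then obtain X where X: "X \<in> hcomp (quot_gmodule M H) g" "X \<noteq> \<zero>\<^bsub>quot_gmodule M H\<^esub>"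
      using gm_SuppE[OF q(1)] by blast
    then obtain x where x: "x \<in> hcomp M g" "X = cls x" by auto
    then have "x \<noteq> \<zero>\<^bsub>M\<^esub>" using X cls_zero_iff[of x] M.submodule_zero[OF sub] hcompD(1)[OF M'(1)] by auto
    then show "g \<in> Supp M" by (rule SuppI[OF x(1)])
  qed
  then show "bdf (quot_gmodule M H)"
    using q d(1) Q.bounded_subset[OF M'(2)] by (simp add: bdf_iff)
  show "hilb (quot_gmodule M H) g = hilb M g - int (dim k (scal M) (hcomp M g \<inter> H))"
    using d(3)[of g] by (simp add: hilb_def)
qed

lemma hilb_short_exact:
  assumes "gr_short_exact R L M N" "bdf L" "bdf M" "bdf N"
  shows "hilb M = hilb L + hilb N"
proof
  fix g
  obtain f h where f: "f \<in> gr_maps R L M" and h: "h \<in> gr_maps R M N" and inj: "inj_on f (carrier L)"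
    and ex: "f ` carrier L = a_kernel M N h" and surj: "h ` carrier M = carrier N"
    using assms(1) by (auto simp: gr_short_exact_def)
  note gL = bdfD[OF assms(2)] and gM = bdfD[OF assms(3)] and gN = bdfD[OF assms(4)]
  interpret F: vspace_map k "scal L" "scal M" f
    by (rule lin_map_scal[OF gm_module[OF gL(1)] gm_module[OF gM(1)] gr_mapsD(1)[OF f]])
  interpret H: vspace_map k "scal M" "scal N" h
    by (rule lin_map_scal[OF gm_module[OF gM(1)] gm_module[OF gN(1)] gr_mapsD(1)[OF h]])
  have "{x \<in> hcomp M g. h x = \<zero>\<^bsub>scal N\<^esub>} = f ` carrier L \<inter> hcomp M g"
    unfolding ex a_kernel_eq using hcompD(1)[OF gM(1)] by auto
  also have "\<dots> = f ` hcomp L g" by (rule image_hcomp[OF gL(1) gM(1) f])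
  finally have ker: "{x \<in> hcomp M g. h x = \<zero>\<^bsub>scal N\<^esub>} = f ` hcomp L g" .
  have "dim k (scal M) (f ` hcomp L g) = dim k (scal L) (hcomp L g)"
  proof (rule F.dim_inj[OF gL(3) hcomp_sub[OF gL(1)]])
    fix x assume "x \<in> hcomp L g" "f x = \<zero>\<^bsub>scal M\<^esub>"
    then show "x = \<zero>\<^bsub>scal L\<^esub>"
      using inj_onD[OF inj, of x "\<zero>\<^bsub>L\<^esub>"] F.map_zero hcompD(1,2)[OF gL(1)] by simp
  qed
  then show "hilb M g = (hilb L + hilb N) g"
    using H.dim_rank_nullity(3)[OF gM(3)[of g]] surj_hcomp[OF gM(1) gN(1) h surj, of g]
    unfolding ker by (simp add: hilb_def)
qed

end

section \<open>Direct sums of graded modules\<close>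

text \<open>The elements are functions on the whole index type that vanish outside \<open>I\<close>.
  In this form a free module of the kind \<open>free_module\<close> is literally a direct sum of
  copies of \<open>R\<close>.\<close>

definition gsum :: "'i set \<Rightarrow> ('i \<Rightarrow> ('a, 'b, 'g) gmodule) \<Rightarrow> ('a, 'i \<Rightarrow> 'b, 'g) gmodule"
  where "gsum I M = (let C = {x. (\<forall>i. x i \<in> carrier (M i)) \<and> {i. x i \<noteq> \<zero>\<^bsub>M i\<^esub>} \<subseteq> I \<and> finite {i. x i \<noteq> \<zero>\<^bsub>M i\<^esub>}} in
    \<lparr>carrier = C, monoid.mult = undefined, one = undefined, ring.zero = (\<lambda>i. \<zero>\<^bsub>M i\<^esub>),
     add = (\<lambda>x y i. x i \<oplus>\<^bsub>M i\<^esub> y i), smult = (\<lambda>r x i. r \<odot>\<^bsub>M i\<^esub> x i),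
     hcomp = (\<lambda>g. {x \<in> C. \<forall>i. x i \<in> hcomp (M i) g})\<rparr>)"

text \<open>The two maps are parameters, so that they can be passed on to direct sums and tensor
  products.\<close>

definition ses ::
    "('a, 'w) ring_scheme \<Rightarrow> ('a, 'b, 'g) gmodule \<Rightarrow> ('a, 'c, 'g) gmodule \<Rightarrow> ('a, 'd, 'g) gmodule
      \<Rightarrow> ('b \<Rightarrow> 'c) \<Rightarrow> ('c \<Rightarrow> 'd) \<Rightarrow> bool"
  where "ses R L M N f h \<longleftrightarrow> f \<in> gr_maps R L M \<and> h \<in> gr_maps R M N \<and>
    inj_on f (carrier L) \<and> f ` carrier L = a_kernel M N h \<and> h ` carrier M = carrier N"

lemma ses_short_exact: "ses R L M N f h \<Longrightarrow> gr_short_exact R L M N"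
  unfolding ses_def gr_short_exact_def by blast

text \<open>The usual M(-s): a generator of degree 0 is moved to degree \<open>s\<close>.\<close>

definition shift :: "'g::ab_group_add \<Rightarrow> ('a, 'b, 'g) gmodule \<Rightarrow> ('a, 'b, 'g) gmodule"
  where "shift s M = M\<lparr>hcomp := \<lambda>g. hcomp M (g - s)\<rparr>"

definition gsingle :: "('i \<Rightarrow> ('a, 'b, 'g) gmodule) \<Rightarrow> 'i \<Rightarrow> 'b \<Rightarrow> 'i \<Rightarrow> 'b"
  where "gsingle M i m = (\<lambda>j. if j = i then m else \<zero>\<^bsub>M j\<^esub>)"

definition gsum_lift ::
    "('i \<Rightarrow> ('a, 'b, 'g) gmodule) \<Rightarrow> ('a, 'c, 'y) module_scheme \<Rightarrow> ('i \<Rightarrow> 'b \<Rightarrow> 'c) \<Rightarrow> ('i \<Rightarrow> 'b) \<Rightarrow> 'c"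
  where "gsum_lift M N \<phi> x = (\<Oplus>\<^bsub>N\<^esub>i\<in>{i. x i \<noteq> \<zero>\<^bsub>M i\<^esub>}. \<phi> i (x i))"

lemma gsum_simps:
  "carrier (gsum I M) = {x. (\<forall>i. x i \<in> carrier (M i)) \<and> {i. x i \<noteq> \<zero>\<^bsub>M i\<^esub>} \<subseteq> I \<and> finite {i. x i \<noteq> \<zero>\<^bsub>M i\<^esub>}}"
  "hcomp (gsum I M) g = {x \<in> carrier (gsum I M). \<forall>i. x i \<in> hcomp (M i) g}"
  by (simp_all add: gsum_def)

lemma gsum_ops [simp]:
  "\<zero>\<^bsub>gsum I M\<^esub> = (\<lambda>i. \<zero>\<^bsub>M i\<^esub>)" "x \<oplus>\<^bsub>gsum I M\<^esub> y = (\<lambda>i. x i \<oplus>\<^bsub>M i\<^esub> y i)" "r \<odot>\<^bsub>gsum I M\<^esub> x = (\<lambda>i. r \<odot>\<^bsub>M i\<^esub> x i)"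
  by (simp_all add: gsum_def)

lemma gsum_memD:
  "x \<in> carrier (gsum I M) \<Longrightarrow> x i \<in> carrier (M i)" "x \<in> carrier (gsum I M) \<Longrightarrow> finite {i. x i \<noteq> \<zero>\<^bsub>M i\<^esub>}"
  "x \<in> carrier (gsum I M) \<Longrightarrow> i \<notin> I \<Longrightarrow> x i = \<zero>\<^bsub>M i\<^esub>"
  by (auto simp: gsum_simps)

lemma gsum_memI:
  assumes "\<And>i. x i \<in> carrier (M i)" "\<And>i. x i \<noteq> \<zero>\<^bsub>M i\<^esub> \<Longrightarrow> i \<in> S" "finite S" "\<And>i. i \<notin> I \<Longrightarrow> x i = \<zero>\<^bsub>M i\<^esub>"
  shows "x \<in> carrier (gsum I M)"
proof -
  have "{i. x i \<noteq> \<zero>\<^bsub>M i\<^esub>} \<subseteq> S" using assms(2) by auto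
  then show ?thesis using assms finite_subset[OF _ assms(3)] by (auto simp: gsum_simps)
qed

lemma gsum_module:
  assumes M: "\<And>i. module R (M i)" shows "module R (gsum I M)"
proof -
  interpret M: module R "M u" for u by (rule M)
  have add: "(\<lambda>i. x i \<oplus>\<^bsub>M i\<^esub> y i) \<in> carrier (gsum I M)" if "x \<in> carrier (gsum I M)" "y \<in> carrier (gsum I M)" for x y
    by (rule gsum_memI[where S = "{i. x i \<noteq> \<zero>\<^bsub>M i\<^esub>} \<union> {i. y i \<noteq> \<zero>\<^bsub>M i\<^esub>}"])
      (use gsum_memD[OF that(1)] gsum_memD[OF that(2)] in auto)
  have neg: "(\<lambda>i. \<ominus>\<^bsub>M i\<^esub> x i) \<in> carrier (gsum I M)" if "x \<in> carrier (gsum I M)" for x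
    by (rule gsum_memI[where S = "{i. x i \<noteq> \<zero>\<^bsub>M i\<^esub>}"]) (use gsum_memD[OF that] in auto)
  have smult: "(\<lambda>i. r \<odot>\<^bsub>M i\<^esub> x i) \<in> carrier (gsum I M)" if "r \<in> carrier R" "x \<in> carrier (gsum I M)" for r x
    by (rule gsum_memI[where S = "{i. x i \<noteq> \<zero>\<^bsub>M i\<^esub>}"]) (use gsum_memD[OF that(2)] that in auto)
  have zero: "(\<lambda>i. \<zero>\<^bsub>M i\<^esub>) \<in> carrier (gsum I M)" by (rule gsum_memI[where S = "{}"]) auto
  show ?thesis
  proof (rule moduleI)
    show "abelian_group (gsum I M)"
    proof (rule abelian_groupI)
      fix x assume "x \<in> carrier (gsum I M)"
      then show "\<exists>y\<in>carrier (gsum I M). y \<oplus>\<^bsub>gsum I M\<^esub> x = \<zero>\<^bsub>gsum I M\<^esub>"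
        using neg gsum_memD(1)[of x I M] by (intro bexI[of _ "\<lambda>i. \<ominus>\<^bsub>M i\<^esub> x i"]) (auto simp: M.l_neg)
    next
      fix x y z assume "x \<in> carrier (gsum I M)" "y \<in> carrier (gsum I M)" "z \<in> carrier (gsum I M)"
      note m = this[THEN gsum_memD(1)]
      show "(x \<oplus>\<^bsub>gsum I M\<^esub> y) \<oplus>\<^bsub>gsum I M\<^esub> z = x \<oplus>\<^bsub>gsum I M\<^esub> (y \<oplus>\<^bsub>gsum I M\<^esub> z)" using m by (simp add: M.M.a_assoc)
    next
      fix x y assume "x \<in> carrier (gsum I M)" "y \<in> carrier (gsum I M)"
      note m = this[THEN gsum_memD(1)]
      show "x \<oplus>\<^bsub>gsum I M\<^esub> y = y \<oplus>\<^bsub>gsum I M\<^esub> x" using m by (simp add: M.M.a_comm)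
    next
      fix x assume "x \<in> carrier (gsum I M)"
      note m = this[THEN gsum_memD(1)]
      show "\<zero>\<^bsub>gsum I M\<^esub> \<oplus>\<^bsub>gsum I M\<^esub> x = x" using m by simp
    qed (use add zero in auto)
  next
    fix a x y assume "a \<in> carrier R" "x \<in> carrier (gsum I M)" "y \<in> carrier (gsum I M)"
    note m = this(1) this(2,3)[THEN gsum_memD(1)]
    show "a \<odot>\<^bsub>gsum I M\<^esub> (x \<oplus>\<^bsub>gsum I M\<^esub> y) = a \<odot>\<^bsub>gsum I M\<^esub> x \<oplus>\<^bsub>gsum I M\<^esub> a \<odot>\<^bsub>gsum I M\<^esub> y"
      using m by (simp add: M.smult_r_distr)
  next
    fix a b x assume "a \<in> carrier R" "b \<in> carrier R" "x \<in> carrier (gsum I M)"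
    note m = this(1,2) this(3)[THEN gsum_memD(1)]
    show "(a \<oplus>\<^bsub>R\<^esub> b) \<odot>\<^bsub>gsum I M\<^esub> x = a \<odot>\<^bsub>gsum I M\<^esub> x \<oplus>\<^bsub>gsum I M\<^esub> b \<odot>\<^bsub>gsum I M\<^esub> x"
      "(a \<otimes>\<^bsub>R\<^esub> b) \<odot>\<^bsub>gsum I M\<^esub> x = a \<odot>\<^bsub>gsum I M\<^esub> (b \<odot>\<^bsub>gsum I M\<^esub> x)"
      using m by (simp_all add: M.smult_l_distr M.smult_assoc1)
  next
    fix x assume "x \<in> carrier (gsum I M)"
    note m = this[THEN gsum_memD(1)]
    show "\<one>\<^bsub>R\<^esub> \<odot>\<^bsub>gsum I M\<^esub> x = x" using m by simp
  qed (use smult M.R.is_cring in auto)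
qed

lemma gsingle_simps [simp]: "gsingle M i m i = m" "j \<noteq> i \<Longrightarrow> gsingle M i m j = \<zero>\<^bsub>M j\<^esub>"
  by (simp_all add: gsingle_def)

lemma gsingle_mem:
  assumes "\<And>i. module R (M i)" "i \<in> I" "m \<in> carrier (M i)"
  shows "gsingle M i m \<in> carrier (gsum I M)"
proof -
  interpret M: module R "M u" for u by (rule assms)
  show ?thesis
  proof (rule gsum_memI[where S = "{i}"])
    show "gsingle M i m j \<in> carrier (M j)" for j using assms by (cases "j = i") auto
    show "j \<in> {i}" if "gsingle M i m j \<noteq> \<zero>\<^bsub>M j\<^esub>" for j using that by (cases "j = i") auto
    show "gsingle M i m j = \<zero>\<^bsub>M j\<^esub>" if "j \<notin> I" for j using that assms by (cases "j = i") auto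
  qed simp
qed

lemma gsum_induct [consumes 2, case_names zero single add]:
  assumes M: "\<And>i. module R (M i)" and x: "x \<in> carrier (gsum I M)" and z: "P (\<lambda>i. \<zero>\<^bsub>M i\<^esub>)"
    and s: "\<And>i m. i \<in> I \<Longrightarrow> m \<in> carrier (M i) \<Longrightarrow> P (gsingle M i m)"
    and a: "\<And>x y. x \<in> carrier (gsum I M) \<Longrightarrow> y \<in> carrier (gsum I M) \<Longrightarrow> P x \<Longrightarrow> P y \<Longrightarrow> P (\<lambda>i. x i \<oplus>\<^bsub>M i\<^esub> y i)"
  shows "P x"
proof -
  interpret M: module R "M u" for u by (rule M)
  have "P x" if "finite S" "x \<in> carrier (gsum I M)" "{i. x i \<noteq> \<zero>\<^bsub>M i\<^esub>} \<subseteq> S" for S x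
    using that
  proof (induction S arbitrary: x rule: finite_induct)
    case empty
    then have "x = (\<lambda>i. \<zero>\<^bsub>M i\<^esub>)" by auto
    then show ?case using z by simp
  next
    case (insert i S)
    show ?case
    proof (cases "i \<in> I")
      case False
      then have "x i = \<zero>\<^bsub>M i\<^esub>" using gsum_memD(3)[OF insert.prems(1)] by simp
      then show ?thesis using insert by blast
    next
      case True
      let ?y = "x(i := \<zero>\<^bsub>M i\<^esub>)"
      note xm = gsum_memD[OF insert.prems(1)]
      have y: "?y \<in> carrier (gsum I M)"
        by (rule gsum_memI[where S = "{i. x i \<noteq> \<zero>\<^bsub>M i\<^esub>}"]) (use xm in \<open>auto split: if_splits\<close>)
      have "{j. ?y j \<noteq> \<zero>\<^bsub>M j\<^esub>} \<subseteq> S" using insert.prems(2) by (auto split: if_splits)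
      then have "P ?y" by (rule insert.IH[OF y])
      moreover have "gsingle M i (x i) \<in> carrier (gsum I M)" by (rule gsingle_mem[OF M True xm(1)])
      ultimately have "P (\<lambda>j. ?y j \<oplus>\<^bsub>M j\<^esub> gsingle M i (x i) j)" using y a s True xm(1) by blast
      moreover have "(\<lambda>j. ?y j \<oplus>\<^bsub>M j\<^esub> gsingle M i (x i) j) = x" using xm(1) by (auto simp: gsingle_def)
      ultimately show ?thesis by simp
    qed
  qed
  then show ?thesis using x gsum_memD(2) by blast
qed

lemma gsum_lift_eq:
  assumes M: "\<And>i. module R (M i)" and N: "module R N" and \<phi>: "\<And>i. i \<in> I \<Longrightarrow> \<phi> i \<in> lin_maps R (M i) N"
    and x: "x \<in> carrier (gsum I M)" and S: "finite S" "{i. x i \<noteq> \<zero>\<^bsub>M i\<^esub>} \<subseteq> S" "S \<subseteq> I"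
  shows "gsum_lift M N \<phi> x = (\<Oplus>\<^bsub>N\<^esub>i\<in>S. \<phi> i (x i))"
proof -
  interpret N: module R N by (rule N)
  have l: "lin_map R (M i) N (\<phi> i)" if "i \<in> I" for i
    using M N \<phi>[OF that] by (intro lin_map.intro lin_map_axioms.intro)
  show ?thesis unfolding gsum_lift_def
  proof (rule N.add.finprod_mono_neutral_cong_left[OF S(1,2)])
    show "\<phi> i (x i) = \<zero>\<^bsub>N\<^esub>" if "i \<in> S - {i. x i \<noteq> \<zero>\<^bsub>M i\<^esub>}" for i
      using that S lin_map.map_zero[OF l] by auto
    show "(\<lambda>i. \<phi> i (x i)) \<in> S \<rightarrow> carrier N"
      using S lin_map.map_simps(1)[OF l] gsum_memD(1)[OF x] by auto
  qed simp
qed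

lemma gsum_lift:
  assumes M: "\<And>i. module R (M i)" and N: "module R N" and \<phi>: "\<And>i. i \<in> I \<Longrightarrow> \<phi> i \<in> lin_maps R (M i) N"
  shows "gsum_lift M N \<phi> \<in> lin_maps R (gsum I M) N"
    and "i \<in> I \<Longrightarrow> m \<in> carrier (M i) \<Longrightarrow> gsum_lift M N \<phi> (gsingle M i m) = \<phi> i m"
proof -
  interpret N: module R N by (rule N)
  interpret M: module R "M u" for u by (rule M)
  interpret D: module R "gsum I M" by (rule gsum_module[OF M])
  have l: "lin_map R (M i) N (\<phi> i)" if "i \<in> I" for i
    using M N \<phi>[OF that] by (intro lin_map.intro lin_map_axioms.intro)
  have eq: "gsum_lift M N \<phi> x = (\<Oplus>\<^bsub>N\<^esub>i\<in>S. \<phi> i (x i))"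
    if "x \<in> carrier (gsum I M)" "finite S" "{i. x i \<noteq> \<zero>\<^bsub>M i\<^esub>} \<subseteq> S" "S \<subseteq> I" for x S
    by (rule gsum_lift_eq[OF M N \<phi>]) (use that in auto)
  show "gsum_lift M N \<phi> \<in> lin_maps R (gsum I M) N"
    unfolding lin_maps_def
  proof (intro CollectI conjI ballI funcsetI)
    fix x assume x: "x \<in> carrier (gsum I M)"
    note xm = gsum_memD[OF x]
    let ?S = "{i. x i \<noteq> \<zero>\<^bsub>M i\<^esub>}"
    have S: "finite ?S" "?S \<subseteq> I" using xm by auto
    have ex: "gsum_lift M N \<phi> x = (\<Oplus>\<^bsub>N\<^esub>i\<in>?S. \<phi> i (x i))" by (simp add: gsum_lift_def)
    have c: "(\<lambda>i. \<phi> i (x i)) \<in> ?S \<rightarrow> carrier N" using S lin_map.map_simps(1)[OF l] xm(1) by auto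
    then show "gsum_lift M N \<phi> x \<in> carrier N" unfolding ex by (rule N.finsum_closed)
    show "gsum_lift M N \<phi> (r \<odot>\<^bsub>gsum I M\<^esub> x) = r \<odot>\<^bsub>N\<^esub> gsum_lift M N \<phi> x" if r: "r \<in> carrier R" for r
    proof -
      have "gsum_lift M N \<phi> (r \<odot>\<^bsub>gsum I M\<^esub> x) = (\<Oplus>\<^bsub>N\<^esub>i\<in>?S. \<phi> i (r \<odot>\<^bsub>M i\<^esub> x i))"
      proof -
        have "{i. (r \<odot>\<^bsub>gsum I M\<^esub> x) i \<noteq> \<zero>\<^bsub>M i\<^esub>} \<subseteq> ?S" using r by auto
        from eq[OF D.smult_closed[OF r x] S(1) this S(2)] show ?thesis by simp
      qed
      also have "\<dots> = (\<Oplus>\<^bsub>N\<^esub>i\<in>?S. r \<odot>\<^bsub>N\<^esub> \<phi> i (x i))"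
        using S c r lin_map.map_simps(3)[OF l] xm(1) by (intro N.finsum_cong') auto
      finally show ?thesis unfolding ex using N.finsum_smult_ldistr[OF S(1) r c] by simp
    qed
    fix y assume y: "y \<in> carrier (gsum I M)"
    note ym = gsum_memD[OF y]
    let ?T = "?S \<union> {i. y i \<noteq> \<zero>\<^bsub>M i\<^esub>}"
    have T: "finite ?T" "?T \<subseteq> I" using xm ym by auto
    have cT: "(\<lambda>i. \<phi> i (x i)) \<in> ?T \<rightarrow> carrier N" "(\<lambda>i. \<phi> i (y i)) \<in> ?T \<rightarrow> carrier N"
      using T lin_map.map_simps(1)[OF l] xm(1) ym(1) by auto
    have "gsum_lift M N \<phi> (x \<oplus>\<^bsub>gsum I M\<^esub> y) = (\<Oplus>\<^bsub>N\<^esub>i\<in>?T. \<phi> i (x i \<oplus>\<^bsub>M i\<^esub> y i))"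
    proof -
      have "{i. (x \<oplus>\<^bsub>gsum I M\<^esub> y) i \<noteq> \<zero>\<^bsub>M i\<^esub>} \<subseteq> ?T" by auto
      from eq[OF D.a_closed[OF x y] T(1) this T(2)] show ?thesis by simp
    qed
    also have "\<dots> = (\<Oplus>\<^bsub>N\<^esub>i\<in>?T. \<phi> i (x i) \<oplus>\<^bsub>N\<^esub> \<phi> i (y i))"
      using T cT lin_map.map_simps(2)[OF l] xm(1) ym(1) by (intro N.finsum_cong') auto
    also have "\<dots> = (\<Oplus>\<^bsub>N\<^esub>i\<in>?T. \<phi> i (x i)) \<oplus>\<^bsub>N\<^esub> (\<Oplus>\<^bsub>N\<^esub>i\<in>?T. \<phi> i (y i))" by (rule N.finsum_addf[OF cT])
    also have "\<dots> = gsum_lift M N \<phi> x \<oplus>\<^bsub>N\<^esub> gsum_lift M N \<phi> y"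
      using eq[OF x T(1) _ T(2)] eq[OF y T(1) _ T(2)] by auto
    finally show "gsum_lift M N \<phi> (x \<oplus>\<^bsub>gsum I M\<^esub> y) = gsum_lift M N \<phi> x \<oplus>\<^bsub>N\<^esub> gsum_lift M N \<phi> y" .
  qed
  assume i: "i \<in> I" and m: "m \<in> carrier (M i)"
  have "gsum_lift M N \<phi> (gsingle M i m) = (\<Oplus>\<^bsub>N\<^esub>j\<in>{i}. \<phi> j (gsingle M i m j))"
  proof (rule eq[OF gsingle_mem[where M = M and i = i and R = R, OF M i m]])
    show "{j. gsingle M i m j \<noteq> \<zero>\<^bsub>M j\<^esub>} \<subseteq> {i}" by (auto simp: gsingle_def split: if_splits)
  qed (use i in auto)
  then show "gsum_lift M N \<phi> (gsingle M i m) = \<phi> i m"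
    using lin_map.map_simps(1)[OF l[OF i] m] by simp
qed

lemma lin_maps_eqI_gsum:
  assumes M: "\<And>i. module R (M i)" and N: "module R N"
    and f: "f \<in> lin_maps R (gsum I M) N" and h: "h \<in> lin_maps R (gsum I M) N"
    and eq: "\<And>i m. i \<in> I \<Longrightarrow> m \<in> carrier (M i) \<Longrightarrow> f (gsingle M i m) = h (gsingle M i m)"
    and x: "x \<in> carrier (gsum I M)"
  shows "f x = h x"
proof -
  interpret D: module R "gsum I M" by (rule gsum_module[OF M])
  interpret f: lin_map R "gsum I M" N f by (intro lin_map.intro lin_map_axioms.intro D.module_axioms N f)
  interpret h: lin_map R "gsum I M" N h by (intro lin_map.intro lin_map_axioms.intro D.module_axioms N h)
  show ?thesis using M x
  proof (induction rule: gsum_induct)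
    case zero
    show ?case using f.map_zero h.map_zero by simp
  next
    case (add x y)
    then show ?case using f.map_simps(2)[of x y] h.map_simps(2)[of x y] by simp
  qed (rule eq)
qed

lemma gsum_eval_lin: "(\<lambda>x. x i) \<in> lin_maps R (gsum I M) (M i)"
  by (auto simp: lin_maps_def gsum_simps)

lemma gsum_neg:
  assumes M: "\<And>i. module R (M i)" and x: "x \<in> carrier (gsum I M)"
  shows "(\<ominus>\<^bsub>gsum I M\<^esub> x) i = \<ominus>\<^bsub>M i\<^esub> x i"
  using lin_map.map_neg[OF lin_map.intro[OF gsum_module[OF M] M lin_map_axioms.intro[OF gsum_eval_lin]] x] .

lemma shift_simps [simp]:
  "carrier (shift s M) = carrier M" "add (shift s M) = add M" "ring.zero (shift s M) = ring.zero M"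
  "smult (shift s M) = smult M" "hcomp (shift s M) g = hcomp M (g - s)"
  by (simp_all add: shift_def)

lemma shift_module:
  assumes "module R M" shows "module R (shift s M)"
proof -
  interpret M: module R M by (rule assms)
  show ?thesis
  proof (rule moduleI)
    show "abelian_group (shift s M)"
    proof (rule abelian_groupI)
      fix x assume "x \<in> carrier (shift s M)"
      then show "\<exists>y\<in>carrier (shift s M). y \<oplus>\<^bsub>shift s M\<^esub> x = \<zero>\<^bsub>shift s M\<^esub>"
        by (intro bexI[of _ "\<ominus>\<^bsub>M\<^esub> x"]) (auto simp: M.l_neg)
    qed (auto simp: M.a_ac)
  qed (auto simp: M.R.is_cring M.smult_l_distr M.smult_r_distr M.smult_assoc1)
qed

context pdcf
begin

lemma gm_shift: assumes M: "gm M" shows "gm (shift s M)"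
proof (rule graded_moduleI[where p = "\<lambda>g. hproj M (g - s)", OF shift_module[OF gm_module[OF M]]])
  note c = hcompD[OF M] and p = hproj[OF M]
  show "r \<odot>\<^bsub>shift s M\<^esub> x \<in> hcomp (shift s M) (h + g)" if "r \<in> hcomp R h" "x \<in> hcomp (shift s M) g" for r h x g
    using c(5)[OF that(1), of x "g - s"] that(2) by (simp add: algebra_simps)
  show "finite {g. hproj M (g - s) x \<noteq> \<zero>\<^bsub>shift s M\<^esub>}" if "x \<in> carrier (shift s M)" for x
  proof -
    have "{g. hproj M (g - s) x \<noteq> \<zero>\<^bsub>M\<^esub>} \<subseteq> (\<lambda>g. g + s) ` {g. hproj M g x \<noteq> \<zero>\<^bsub>M\<^esub>}"
      by (auto intro!: image_eqI[of _ _ "_ - s"])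
    then show ?thesis using finite_subset[OF _ finite_imageI[OF p(3)]] that by auto
  qed
  show "x = \<zero>\<^bsub>shift s M\<^esub>" if "x \<in> carrier (shift s M)" "\<And>g. hproj M (g - s) x = \<zero>\<^bsub>shift s M\<^esub>" for x
  proof -
    have "hproj M g x = \<zero>\<^bsub>M\<^esub>" for g using that(2)[of "g + s"] by simp
    then show ?thesis using hproj_zero_imp[OF M] that(1) by simp
  qed
  show "hproj M (h - s) x = (if h = g then x else \<zero>\<^bsub>shift s M\<^esub>)" if "x \<in> hcomp (shift s M) g" for x g h
    using hproj_homogeneous[OF M, of x "g - s" "h - s"] that by simp
qed (use hcompD[OF M] hproj[OF M] hproj_add[OF M] in auto)

lemma scal_shift: "scal (shift s M) = scal M"
  by (simp add: restrict_scalars_def shift_def)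

lemma Supp_shift: "Supp (shift s M) = {g. g - s \<in> Supp M}"
  by (auto simp: Supp_def)

lemma bdf_shift: assumes "bdf M" shows "bdf (shift s M)"
proof -
  have "{g. g - s \<in> Supp M} \<subseteq> {u + v | u v. u \<in> Supp M \<and> v \<in> {s}}"
  proof
    fix g assume "g \<in> {g. g - s \<in> Supp M}"
    then show "g \<in> {u + v | u v. u \<in> Supp M \<and> v \<in> {s}}" by (intro CollectI exI[of _ "g - s"] exI[of _ s]) auto
  qed
  moreover have "bounded {u + v | u v. u \<in> Supp M \<and> v \<in> {s}}"
    by (rule Q.bounded_plus[OF bdfD(2)[OF assms] Q.bounded_finite]) simp
  ultimately have "bounded {g. g - s \<in> Supp M}" by (rule Q.bounded_subset[rotated])
  then show ?thesis using assms gm_shift[of M s] by (simp add: bdf_iff Supp_shift scal_shift)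
qed

lemma hilb_shift: "hilb (shift s M) g = hilb M (g - s)"
  by (simp add: hilb_def scal_shift)

lemma hcomp_gsum_mem: "x \<in> hcomp (gsum I M) g \<Longrightarrow> x \<in> carrier (gsum I M)" "x \<in> hcomp (gsum I M) g \<Longrightarrow> x i \<in> hcomp (M i) g"
  by (auto simp: gsum_simps(2))

lemma gm_gsum:
  assumes M: "\<And>i. gm (M i)" shows "gm (gsum I M)"
proof -
  have Mm: "module R (M i)" for i by (rule gm_module[OF M])
  interpret M: module R "M u" for u by (rule Mm)
  interpret D: module R "gsum I M" by (rule gsum_module[OF Mm])
  note c = hcompD[OF M] and p = hproj[OF M]
  show ?thesis
  proof (rule graded_moduleI[where p = "\<lambda>g x i. hproj (M i) g (x i)", OF D.module_axioms])
    show "\<zero>\<^bsub>gsum I M\<^esub> \<in> hcomp (gsum I M) g" for g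
      using D.zero_closed c(2) by (auto simp: gsum_simps(2))
    show "x \<oplus>\<^bsub>gsum I M\<^esub> y \<in> hcomp (gsum I M) g" if "x \<in> hcomp (gsum I M) g" "y \<in> hcomp (gsum I M) g" for x y g
      using that D.a_closed[of x y] c(3) by (auto simp: gsum_simps(2))
    show "r \<odot>\<^bsub>gsum I M\<^esub> x \<in> hcomp (gsum I M) (h + g)" if "r \<in> hcomp R h" "x \<in> hcomp (gsum I M) g" for r x h g
      using that D.smult_closed[OF carrier_hcomp[OF that(1)], of x] c(5) by (auto simp: gsum_simps(2))
    fix x assume x: "x \<in> carrier (gsum I M)"
    note xm = gsum_memD[OF x]
    have z: "hproj (M i) g (x i) = \<zero>\<^bsub>M i\<^esub>" if "x i = \<zero>\<^bsub>M i\<^esub>" for i g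
      using hproj_homogeneous[OF M c(2), of i g g] that by simp
    have "(\<lambda>i. hproj (M i) g (x i)) \<in> carrier (gsum I M)" for g
      by (rule gsum_memI[where S = "{i. x i \<noteq> \<zero>\<^bsub>M i\<^esub>}"]) (use xm p z in auto)
    then show "(\<lambda>i. hproj (M i) g (x i)) \<in> hcomp (gsum I M) g" for g
      using p(1)[OF xm(1)] by (auto simp: gsum_simps(2))
    have "{g. (\<lambda>i. hproj (M i) g (x i)) \<noteq> \<zero>\<^bsub>gsum I M\<^esub>} \<subseteq> (\<Union>i\<in>{i. x i \<noteq> \<zero>\<^bsub>M i\<^esub>}. {g. hproj (M i) g (x i) \<noteq> \<zero>\<^bsub>M i\<^esub>})"
      by (auto simp: fun_eq_iff) (metis z)
    then show "finite {g. (\<lambda>i. hproj (M i) g (x i)) \<noteq> \<zero>\<^bsub>gsum I M\<^esub>}"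
      by (rule finite_subset) (use xm p(3) in auto)
    show "(\<lambda>i. hproj (M i) g ((x \<oplus>\<^bsub>gsum I M\<^esub> y) i)) = (\<lambda>i. hproj (M i) g (x i)) \<oplus>\<^bsub>gsum I M\<^esub> (\<lambda>i. hproj (M i) g (y i))"
      if "y \<in> carrier (gsum I M)" for g y
      using xm(1) gsum_memD(1)[OF that] by (simp add: hproj_add[OF M])
    assume *: "\<And>g. (\<lambda>i. hproj (M i) g (x i)) = \<zero>\<^bsub>gsum I M\<^esub>"
    have "x i = \<zero>\<^bsub>M i\<^esub>" for i
      by (rule hproj_zero_imp[OF M xm(1)]) (use fun_cong[OF *, of i] in simp)
    then show "x = \<zero>\<^bsub>gsum I M\<^esub>" by auto
  next
    show "(\<lambda>i. hproj (M i) h (x i)) = (if h = g then x else \<zero>\<^bsub>gsum I M\<^esub>)" if "x \<in> hcomp (gsum I M) g" for x g h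
      using hproj_homogeneous[OF M hcomp_gsum_mem(2)[OF that], where h = h] by auto
  qed (auto simp: gsum_simps(2))
qed

lemma bdf_gsum:
  assumes M: "\<And>i. bdf (M i)" and b: "bounded (\<Union>i\<in>I. Supp (M i))" and f: "\<And>g. finite {i \<in> I. g \<in> Supp (M i)}"
  shows "bdf (gsum I M)" "hilb (gsum I M) g = (\<Sum>i\<in>{i \<in> I. g \<in> Supp (M i)}. hilb (M i) g)"
proof -
  have gM: "gm (M i)" and Mm: "module R (M i)" for i using bdfD(1)[OF M] gm_module by auto
  interpret M: module R "M u" for u by (rule Mm)
  interpret D: module R "gsum I M" by (rule gsum_module[OF Mm])
  have gD: "gm (gsum I M)" by (rule gm_gsum[OF gM])
  interpret V: vspace k "scal (gsum I M)" by (rule vspace_scal[OF D.module_axioms])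
  \<comment> \<open>\<open>S J g\<close> is the part of degree \<open>g\<close> supported on the
    indices in \<open>J\<close>. Evaluation at a new index \<open>j\<close> maps
    \<open>S (insert j J) g\<close> onto the component of \<open>M j\<close>, with kernel
    \<open>S J g\<close>, so that dimensions add up. In each degree finitely many indices
    suffice.\<close>
  define S where "S J g = {x \<in> hcomp (gsum I M) g. \<forall>i. i \<notin> J \<longrightarrow> x i = \<zero>\<^bsub>M i\<^esub>}" for J g
  have subS: "submodule (S J g) k (scal (gsum I M))" for J g
    by (rule V.submoduleI)
      (use V.subD[OF hcomp_sub[OF gD, of g]] in \<open>auto simp: S_def scalar_hcomp carrier_hcomp intro!: M.smult_r_null carrier_hcomp[OF scalar_hcomp]\<close>,
       use V.subD(5)[OF hcomp_sub[OF gD, of g]] gsum_neg[of R M, OF Mm hcomp_gsum_mem(1)] in \<open>auto simp: S_def\<close>)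
  have ind: "fin_dim k (scal (gsum I M)) (S J g) \<and> int (dim k (scal (gsum I M)) (S J g)) = (\<Sum>i\<in>J. hilb (M i) g)"
    if "finite J" "J \<subseteq> I" for J g
    using that
  proof (induction J rule: finite_induct)
    case empty
    have "S {} g = {\<zero>\<^bsub>scal (gsum I M)\<^esub>}" using hcompD(2)[OF gD, of g] by (auto simp: S_def)
    then show ?case using V.dim_zero by simp
  next
    case (insert j J)
    have jI: "j \<in> I" using insert by simp
    interpret e: vspace_map k "scal (gsum I M)" "scal (M j)" "\<lambda>x. x j"
      by (rule lin_map_scal[OF D.module_axioms Mm gsum_eval_lin])
    have ker: "{x \<in> S (insert j J) g. x j = \<zero>\<^bsub>scal (M j)\<^esub>} = S J g" by (auto simp: S_def) (use insert in auto)
    have im: "(\<lambda>x. x j) ` S (insert j J) g = hcomp (M j) g"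
    proof
      show "(\<lambda>x. x j) ` S (insert j J) g \<subseteq> hcomp (M j) g" by (auto simp: S_def gsum_simps(2))
      show "hcomp (M j) g \<subseteq> (\<lambda>x. x j) ` S (insert j J) g"
      proof
        fix m assume m: "m \<in> hcomp (M j) g"
        have "gsingle M j m \<in> carrier (gsum I M)"
          by (rule gsingle_mem[where M = M and i = j, OF Mm jI hcompD(1)[OF gM m]])
        then have "gsingle M j m \<in> S (insert j J) g"
          using m hcompD(2)[OF gM] by (auto simp: S_def gsum_simps(2) gsingle_def)
        then show "m \<in> (\<lambda>x. x j) ` S (insert j J) g" by (intro image_eqI[of _ _ "gsingle M j m"]) auto
      qed
    qed
    have IH: "fin_dim k (scal (gsum I M)) (S J g)" "int (dim k (scal (gsum I M)) (S J g)) = (\<Sum>i\<in>J. hilb (M i) g)"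
      using insert by auto
    have fd: "fin_dim k (scal (gsum I M)) (S (insert j J) g)"
      by (rule e.fin_dim_extension[OF subS]) (use ker im IH bdfD(3)[OF M] in auto)
    show ?case using fd e.dim_rank_nullity(3)[OF fd] ker im IH insert by (simp add: hilb_def)
  qed
  have J: "hcomp (gsum I M) g = S {i \<in> I. g \<in> Supp (M i)} g" for g
  proof -
    have "x i = \<zero>\<^bsub>M i\<^esub>" if x: "x \<in> hcomp (gsum I M) g" and i: "\<not> (i \<in> I \<and> g \<in> Supp (M i))" for x i
      using gsum_memD(3)[OF hcomp_gsum_mem(1)[OF x]] hcomp_gsum_mem(2)[OF x, of i] i by (auto simp: Supp_def)
    then show ?thesis unfolding S_def by auto
  qed
  show "hilb (gsum I M) g = (\<Sum>i\<in>{i \<in> I. g \<in> Supp (M i)}. hilb (M i) g)"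
    using ind[OF f[of g]] unfolding hilb_def[of "gsum I M"] J by auto
  have "Supp (gsum I M) \<subseteq> (\<Union>i\<in>I. Supp (M i))"
  proof
    fix g assume "g \<in> Supp (gsum I M)"
    then obtain x where x: "x \<in> hcomp (gsum I M) g" "x \<noteq> \<zero>\<^bsub>gsum I M\<^esub>" using gm_SuppE[OF gD] by blast
    then obtain i where i: "x i \<noteq> \<zero>\<^bsub>M i\<^esub>" by auto
    moreover have "i \<in> I" using gsum_memD(3)[OF hcomp_gsum_mem(1)[OF x(1)]] i by blast
    ultimately show "g \<in> (\<Union>i\<in>I. Supp (M i))" using SuppI[OF hcomp_gsum_mem(2)[OF x(1)]] by blast
  qed
  then show "bdf (gsum I M)"
    using gD Q.bounded_subset[OF b] ind[OF f] by (simp add: bdf_iff J)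
qed

lemma gsum_map_gr:
  assumes M: "\<And>i. gm (M i)" and N: "\<And>i. gm (N i)" and \<phi>: "\<And>i. \<phi> i \<in> gr_maps R (M i) (N i)"
  shows "(\<lambda>x i. \<phi> i (x i)) \<in> gr_maps R (gsum I M) (gsum I N)"
proof -
  have l: "lin_map R (M i) (N i) (\<phi> i)" for i by (rule lin_map_gr[OF M N \<phi>])
  have c: "(\<lambda>i. \<phi> i (x i)) \<in> carrier (gsum I N)" if "x \<in> carrier (gsum I M)" for x
    by (rule gsum_memI[where S = "{i. x i \<noteq> \<zero>\<^bsub>M i\<^esub>}"])
      (use gsum_memD[OF that] lin_map.map_simps(1)[OF l] lin_map.map_zero[OF l] in \<open>auto intro: ccontr\<close>)
  show ?thesis
    unfolding gr_maps_def lin_maps_def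
  proof (intro CollectI conjI ballI allI funcsetI subsetI)
    fix x assume x: "x \<in> carrier (gsum I M)"
    note m = gsum_memD(1)[OF x]
    show "(\<lambda>i. \<phi> i (x i)) \<in> carrier (gsum I N)" by (rule c[OF x])
    show "(\<lambda>i. \<phi> i ((r \<odot>\<^bsub>gsum I M\<^esub> x) i)) = r \<odot>\<^bsub>gsum I N\<^esub> (\<lambda>i. \<phi> i (x i))" if "r \<in> carrier R" for r
    proof -
      have "\<phi> i (r \<odot>\<^bsub>M i\<^esub> x i) = r \<odot>\<^bsub>N i\<^esub> \<phi> i (x i)" for i by (rule lin_map.map_simps(3)[OF l that m])
      then show ?thesis by simp
    qed
    fix y assume y: "y \<in> carrier (gsum I M)"
    have "\<phi> i (x i \<oplus>\<^bsub>M i\<^esub> y i) = \<phi> i (x i) \<oplus>\<^bsub>N i\<^esub> \<phi> i (y i)" for i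
      by (rule lin_map.map_simps(2)[OF l m gsum_memD(1)[OF y]])
    then show "(\<lambda>i. \<phi> i ((x \<oplus>\<^bsub>gsum I M\<^esub> y) i)) = (\<lambda>i. \<phi> i (x i)) \<oplus>\<^bsub>gsum I N\<^esub> (\<lambda>i. \<phi> i (y i))" by simp
  next
    fix g y assume "y \<in> (\<lambda>x i. \<phi> i (x i)) ` hcomp (gsum I M) g"
    then show "y \<in> hcomp (gsum I N) g" using c gr_mapsD(2)[OF \<phi>] by (auto simp: gsum_simps(2))
  qed
qed

lemma gsum_iso:
  assumes M: "\<And>i. gm (M i)" and N: "\<And>i. gm (N i)" and \<phi>: "\<And>i. gr_isomorphism R (M i) (N i) (\<phi> i)"
  shows "gr_isomorphism R (gsum I M) (gsum I N) (\<lambda>x i. \<phi> i (x i))"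
proof -
  define \<psi> where "\<psi> i = inv_into (carrier (M i)) (\<phi> i)" for i
  have \<psi>: "gr_isomorphism R (N i) (M i) (\<psi> i)" for i
    unfolding \<psi>_def by (intro gr_isomorphism_inv \<phi> gm_module M N hcomp_carrier)
  have \<psi>\<phi>: "\<psi> i (\<phi> i x) = x" if "x \<in> carrier (M i)" for i x
    using that gr_isomorphismD(5)[OF \<phi>] by (simp add: \<psi>_def)
  have \<phi>\<psi>: "\<phi> i (\<psi> i x) = x" if "x \<in> carrier (N i)" for i x
    using that gr_isomorphismD(6)[OF \<phi>, of i] unfolding \<psi>_def by (simp add: f_inv_into_f)
  have F: "(\<lambda>x i. \<phi> i (x i)) \<in> gr_maps R (gsum I M) (gsum I N)"
    by (rule gsum_map_gr[OF M N gr_isomorphismD(1)[OF \<phi>]])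
  have G: "(\<lambda>x i. \<psi> i (x i)) \<in> gr_maps R (gsum I N) (gsum I M)"
    by (rule gsum_map_gr[OF N M gr_isomorphismD(1)[OF \<psi>]])
  have "bij_betw (\<lambda>x i. \<phi> i (x i)) (carrier (gsum I M)) (carrier (gsum I N))"
  proof (rule bij_betw_byWitness[where f' = "\<lambda>x i. \<psi> i (x i)"])
    show "\<forall>x\<in>carrier (gsum I M). (\<lambda>i. \<psi> i (\<phi> i (x i))) = x"
      by (intro ballI ext \<psi>\<phi> gsum_memD(1)[where M = M and I = I])
    show "\<forall>x\<in>carrier (gsum I N). (\<lambda>i. \<phi> i (\<psi> i (x i))) = x"
      by (intro ballI ext \<phi>\<psi> gsum_memD(1)[where M = N and I = I])
  qed (use F G in \<open>auto simp: gr_maps_def lin_maps_def\<close>)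
  then show ?thesis
    using F surj_hcomp[OF gm_gsum[OF M] gm_gsum[OF N] F] by (simp add: gr_isomorphism_def bij_betw_def)
qed

lemma gsum_map_image:
  assumes M: "\<And>i. gm (M i)" and N: "\<And>i. gm (N i)" and \<phi>: "\<And>i. \<phi> i \<in> gr_maps R (M i) (N i)"
  shows "(\<lambda>x i. \<phi> i (x i)) ` carrier (gsum I M) = {y \<in> carrier (gsum I N). \<forall>i. y i \<in> \<phi> i ` carrier (M i)}"
proof
  have l: "lin_map R (M i) (N i) (\<phi> i)" for i by (rule lin_map_gr[OF M N \<phi>])
  have F: "(\<lambda>x i. \<phi> i (x i)) \<in> gr_maps R (gsum I M) (gsum I N)" by (rule gsum_map_gr[OF M N \<phi>])
  show "(\<lambda>x i. \<phi> i (x i)) ` carrier (gsum I M) \<subseteq> {y \<in> carrier (gsum I N). \<forall>i. y i \<in> \<phi> i ` carrier (M i)}"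
    using F gsum_memD(1)[where I = I and M = M] by (auto simp: gr_maps_def lin_maps_def)
  show "{y \<in> carrier (gsum I N). \<forall>i. y i \<in> \<phi> i ` carrier (M i)} \<subseteq> (\<lambda>x i. \<phi> i (x i)) ` carrier (gsum I M)"
  proof
    fix y assume "y \<in> {y \<in> carrier (gsum I N). \<forall>i. y i \<in> \<phi> i ` carrier (M i)}"
    then have y: "y \<in> carrier (gsum I N)" "\<And>i. y i \<in> \<phi> i ` carrier (M i)" by auto
    note ym = gsum_memD[OF y(1)]
    have zM: "\<zero>\<^bsub>M i\<^esub> \<in> carrier (M i)" for i using hcompD(1,2)[OF M] by blast
    \<comment> \<open>A preimage is chosen only where \<open>y\<close> is nonzero; elsewhere
      \<open>x\<close> is set to zero, which keeps its support finite.\<close>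
    define x where "x i = (if y i = \<zero>\<^bsub>N i\<^esub> then \<zero>\<^bsub>M i\<^esub> else inv_into (carrier (M i)) (\<phi> i) (y i))" for i
    have e: "inv_into (carrier (M i)) (\<phi> i) (y i) \<in> carrier (M i)" "\<phi> i (inv_into (carrier (M i)) (\<phi> i) (y i)) = y i" for i
      using y(2)[of i] by (auto simp: inv_into_into f_inv_into_f)
    have "x \<in> carrier (gsum I M)"
      by (rule gsum_memI[where S = "{i. y i \<noteq> \<zero>\<^bsub>N i\<^esub>}"]) (use e zM ym in \<open>auto simp: x_def\<close>)
    moreover have "y = (\<lambda>i. \<phi> i (x i))" using e(2) lin_map.map_zero[OF l] by (auto simp: x_def)
    ultimately show "y \<in> (\<lambda>x i. \<phi> i (x i)) ` carrier (gsum I M)" by blast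
  qed
qed

lemma gsum_ses:
  assumes L: "\<And>i. gm (L i)" and M: "\<And>i. gm (M i)" and N: "\<And>i. gm (N i)"
    and ex: "\<And>i. ses R (L i) (M i) (N i) (f i) (h i)"
  shows "ses R (gsum I L) (gsum I M) (gsum I N) (\<lambda>x i. f i (x i)) (\<lambda>x i. h i (x i))"
proof -
  have f: "f i \<in> gr_maps R (L i) (M i)" and h: "h i \<in> gr_maps R (M i) (N i)"
    and inj: "inj_on (f i) (carrier (L i))" and ker: "f i ` carrier (L i) = a_kernel (M i) (N i) (h i)"
    and surj: "h i ` carrier (M i) = carrier (N i)" for i
    using ex[of i] by (auto simp: ses_def)
  let ?F = "\<lambda>x i. f i (x i)" and ?H = "\<lambda>x i. h i (x i)"
  have F: "?F \<in> gr_maps R (gsum I L) (gsum I M)" by (rule gsum_map_gr[OF L M f])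
  have H: "?H \<in> gr_maps R (gsum I M) (gsum I N)" by (rule gsum_map_gr[OF M N h])
  have "inj_on ?F (carrier (gsum I L))"
  proof (rule inj_onI)
    fix x y assume "x \<in> carrier (gsum I L)" "y \<in> carrier (gsum I L)" and e: "?F x = ?F y"
    note m = this(1,2)[THEN gsum_memD(1)]
    show "x = y"
    proof
      fix i show "x i = y i" using inj_onD[OF inj fun_cong[OF e, of i] m(1)[of i] m(2)[of i]] .
    qed
  qed
  moreover have "?F ` carrier (gsum I L) = a_kernel (gsum I M) (gsum I N) ?H"
    unfolding gsum_map_image[OF L M f] ker a_kernel_eq
    using gsum_memD(1)[where I = I and M = M] by (auto simp: fun_eq_iff)
  moreover have "?H ` carrier (gsum I M) = carrier (gsum I N)"
    unfolding gsum_map_image[OF M N h] surj using gsum_memD(1)[where I = I and M = N] by blast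
  ultimately show ?thesis unfolding ses_def using F H by blast
qed

end

subsection \<open>Sums of shifts and free modules\<close>

text \<open>The number of generators in each degree. An infinite fibre would count as 0;
  \<open>graded_index\<close> excludes this case.\<close>

definition rank :: "'i set \<Rightarrow> ('i \<Rightarrow> 'g) \<Rightarrow> 'g \<Rightarrow> int"
  where "rank I deg g = int (card {i \<in> I. deg i = g})"

definition free_gmodule :: "('k, 'a, 'g::ab_group_add) gmodule \<Rightarrow> 'i set \<Rightarrow> ('i \<Rightarrow> 'g) \<Rightarrow> ('a, 'i \<Rightarrow> 'a, 'g) gmodule"
  where "free_gmodule R I deg = gsum I (\<lambda>i. shift (deg i) (regular_module R))"

context pdcf
begin

abbreviation "twist N I deg \<equiv> gsum I (\<lambda>i. shift (deg i) N)"
abbreviation "free \<equiv> free_gmodule R"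

definition graded_index :: "'i set \<Rightarrow> ('i \<Rightarrow> 'g) \<Rightarrow> bool"
  where "graded_index I deg \<longleftrightarrow> bounded (deg ` I) \<and> (\<forall>g. finite {i \<in> I. deg i = g})"

lemma supp_rank: "graded_index I deg \<Longrightarrow> supp (rank I deg) = deg ` I"
  by (auto simp: supp_def rank_def graded_index_def card_eq_0_iff)

lemma gm_twist: "gm N \<Longrightarrow> gm (twist N I deg)"
  by (intro gm_gsum gm_shift)

text \<open>The summands are sorted by their degree \<open>d\<close>: there are
  \<open>rank I deg d\<close> copies of the module shifted by \<open>d\<close>, and adding up their
  Hilbert functions is a convolution.\<close>

lemma bdf_twist:
  assumes N: "bdf N" and I: "graded_index I deg"
  shows "bdf (twist N I deg)" "hilb (twist N I deg) = conv (rank I deg) (hilb N)"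
proof -
  have bd: "bounded (deg ` I)" and fib: "finite {i \<in> I. deg i = g}" for g
    using I by (auto simp: graded_index_def)
  let ?D = "\<lambda>g. {d \<in> deg ` I. g - d \<in> Supp N}" and ?J = "\<lambda>g. {i \<in> I. g - deg i \<in> Supp N}"
  have fD: "finite (?D g)" for g by (rule Q.bounded_interval[OF bd bdfD(2)[OF N]])
  have "?J g = (\<Union>d\<in>?D g. {i \<in> I. deg i = d})" for g by auto
  then have fJ: "finite (?J g)" for g using fD fib by auto
  have bU: "bounded (\<Union>i\<in>I. Supp (shift (deg i) N))"
  proof (rule Q.bounded_subset[OF Q.bounded_plus[OF bd bdfD(2)[OF N]]])
    show "(\<Union>i\<in>I. Supp (shift (deg i) N)) \<subseteq> {u + v |u v. u \<in> deg ` I \<and> v \<in> Supp N}"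
    proof
      fix g assume "g \<in> (\<Union>i\<in>I. Supp (shift (deg i) N))"
      then obtain i where "i \<in> I" "g - deg i \<in> Supp N" by (auto simp: Supp_shift)
      then show "g \<in> {u + v |u v. u \<in> deg ` I \<and> v \<in> Supp N}"
        by (intro CollectI exI[of _ "deg i"] exI[of _ "g - deg i"]) auto
    qed
  qed
  have fS: "finite {i \<in> I. g \<in> Supp (shift (deg i) N)}" for g using fJ by (simp add: Supp_shift)
  note b = bdf_gsum[of "\<lambda>i. shift (deg i) N", OF bdf_shift[OF N] bU fS]
  show "bdf (twist N I deg)" by (rule b(1))
  show "hilb (twist N I deg) = conv (rank I deg) (hilb N)"
  proof
    fix g
    have "hilb (twist N I deg) g = (\<Sum>i\<in>?J g. hilb N (g - deg i))"
      using b(2)[of g] by (simp add: Supp_shift hilb_shift)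
    also have "\<dots> = (\<Sum>d\<in>deg ` ?J g. \<Sum>i\<in>{i \<in> ?J g. deg i = d}. hilb N (g - deg i))"
      by (rule sum.image_gen[OF fJ])
    also have "\<dots> = (\<Sum>d\<in>?D g. rank I deg d * hilb N (g - d))"
    proof (rule sum.cong)
      show "deg ` ?J g = ?D g" by auto
      fix d assume d: "d \<in> ?D g"
      then have "{i \<in> ?J g. deg i = d} = {i \<in> I. deg i = d}" by auto
      then show "(\<Sum>i\<in>{i \<in> ?J g. deg i = d}. hilb N (g - deg i)) = rank I deg d * hilb N (g - d)"
        by (simp add: rank_def)
    qed
    also have "\<dots> = conv (rank I deg) (hilb N) g"
    proof (rule conv_eq[OF fD, symmetric])
      fix a assume "rank I deg a \<noteq> 0" "hilb N (g - a) \<noteq> 0"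
      then show "a \<in> ?D g" using supp_rank[OF I] hilb_eq_0[OF N] by (auto simp: supp_def)
    qed
    finally show "hilb (twist N I deg) g = conv (rank I deg) (hilb N) g" .
  qed
qed

lemma twist_pullback:
  assumes N: "gm N" and \<sigma>: "bij_betw \<sigma> A B" and ab: "\<And>i. i \<in> A \<Longrightarrow> b (\<sigma> i) = a i"
  shows "(\<lambda>x i. if i \<in> A then x (\<sigma> i) else \<zero>\<^bsub>N\<^esub>) \<in> gr_maps R (twist N B b) (twist N A a)"
proof -
  interpret N: module R N by (rule gm_module[OF N])
  have cl: "(\<lambda>i. if i \<in> A then x (\<sigma> i) else \<zero>\<^bsub>N\<^esub>) \<in> carrier (twist N A a)" if x: "x \<in> carrier (twist N B b)" for x
  proof (rule gsum_memI[where S = "inv_into A \<sigma> ` {j. x j \<noteq> \<zero>\<^bsub>N\<^esub>}"])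
    note m = gsum_memD[OF x]
    show "(if i \<in> A then x (\<sigma> i) else \<zero>\<^bsub>N\<^esub>) \<in> carrier (shift (a i) N)" for i using m(1)[of "\<sigma> i"] by simp
    show "finite (inv_into A \<sigma> ` {j. x j \<noteq> \<zero>\<^bsub>N\<^esub>})" using m(2) by simp
    show "i \<in> inv_into A \<sigma> ` {j. x j \<noteq> \<zero>\<^bsub>N\<^esub>}" if "(if i \<in> A then x (\<sigma> i) else \<zero>\<^bsub>N\<^esub>) \<noteq> \<zero>\<^bsub>shift (a i) N\<^esub>" for i
      using that bij_betw_inv_into_left[OF \<sigma>] by (auto split: if_splits intro!: image_eqI[of _ _ "\<sigma> i"])
  qed simp
  have "(\<lambda>i. if i \<in> A then x (\<sigma> i) else \<zero>\<^bsub>N\<^esub>) \<in> hcomp (twist N A a) g" if x: "x \<in> hcomp (twist N B b) g" for x g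
  proof -
    have "x (\<sigma> i) \<in> hcomp N (g - a i)" if "i \<in> A" for i
      using hcomp_gsum_mem(2)[OF x, of "\<sigma> i"] ab[OF that] by simp
    then show ?thesis using cl[OF hcomp_gsum_mem(1)[OF x]] hcompD(2)[OF N] unfolding gsum_simps(2) by auto
  qed
  then show ?thesis
    unfolding gr_maps_def lin_maps_def using cl by (auto simp: fun_eq_iff)
qed

lemma twist_reindex_map:
  assumes N: "gm N" and \<beta>: "bij_betw \<beta> I J" and d: "\<And>i. i \<in> I \<Longrightarrow> e (\<beta> i) = d i"
  shows "(\<lambda>x i. if i \<in> I then x (\<beta> i) else \<zero>\<^bsub>N\<^esub>) \<in> gr_maps R (twist N J e) (twist N I d)"
    "bij_betw (\<lambda>x i. if i \<in> I then x (\<beta> i) else \<zero>\<^bsub>N\<^esub>) (carrier (twist N J e)) (carrier (twist N I d))"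
proof -
  interpret N: module R N by (rule gm_module[OF N])
  note c = hcompD[OF N]
  define \<gamma> where "\<gamma> = inv_into I \<beta>"
  have \<gamma>: "bij_betw \<gamma> J I" "\<And>j. j \<in> J \<Longrightarrow> d (\<gamma> j) = e j" "\<And>i. i \<in> I \<Longrightarrow> \<gamma> (\<beta> i) = i" "\<And>j. j \<in> J \<Longrightarrow> \<beta> (\<gamma> j) = j"
    using \<beta> d bij_betw_inv_into[OF \<beta>] unfolding \<gamma>_def
    by (auto simp: bij_betw_def f_inv_into_f inv_into_into)
  let ?f = "\<lambda>x i. if i \<in> I then x (\<beta> i) else \<zero>\<^bsub>N\<^esub>" and ?h = "\<lambda>x j. if j \<in> J then x (\<gamma> j) else \<zero>\<^bsub>N\<^esub>"
  have f: "?f \<in> gr_maps R (twist N J e) (twist N I d)" by (rule twist_pullback[where \<sigma> = \<beta> and A = I and B = J and b = e and a = d, OF N \<beta> d])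
  have h: "?h \<in> gr_maps R (twist N I d) (twist N J e)" by (rule twist_pullback[where \<sigma> = \<gamma> and A = J and B = I and b = d and a = e, OF N \<gamma>(1,2)])
  show "?f \<in> gr_maps R (twist N J e) (twist N I d)" by (rule f)
  show "bij_betw ?f (carrier (twist N J e)) (carrier (twist N I d))"
  proof (rule bij_betw_byWitness[where f' = ?h])
    show "\<forall>x\<in>carrier (twist N J e). ?h (?f x) = x"
      using \<gamma> bij_betwE[OF \<gamma>(1)] gsum_memD(3)[of _ J "\<lambda>j. shift (e j) N"] by (auto simp: fun_eq_iff)
    show "\<forall>x\<in>carrier (twist N I d). ?f (?h x) = x"
      using \<gamma> bij_betwE[OF \<beta>] gsum_memD(3)[of _ I "\<lambda>i. shift (d i) N"] by (auto simp: fun_eq_iff)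
  qed (use f h in \<open>auto simp: gr_maps_def lin_maps_def\<close>)
qed

lemma free_gmodule_simps:
  "carrier (free I d) = carrier (free_module R I)" "x \<oplus>\<^bsub>free I d\<^esub> y = x \<oplus>\<^bsub>free_module R I\<^esub> y"
  "r \<odot>\<^bsub>free I d\<^esub> x = r \<odot>\<^bsub>free_module R I\<^esub> x" "\<zero>\<^bsub>free I d\<^esub> = \<zero>\<^bsub>free_module R I\<^esub>"
  by (auto simp: free_gmodule_def gsum_simps free_module_def)

lemma free_carrier:
  "carrier (free I d) = {x. (\<forall>i. x i \<in> carrier R) \<and> {i. x i \<noteq> \<zero>\<^bsub>R\<^esub>} \<subseteq> I \<and> finite {i. x i \<noteq> \<zero>\<^bsub>R\<^esub>}}"
  "hcomp (free I d) g = {x \<in> carrier (free I d). \<forall>i. x i \<in> hcomp R (g - d i)}"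
  by (auto simp: free_gmodule_def gsum_simps)

lemma free_ops: "\<zero>\<^bsub>free I d\<^esub> = (\<lambda>i. \<zero>\<^bsub>R\<^esub>)" "x \<oplus>\<^bsub>free I d\<^esub> y = (\<lambda>i. x i \<oplus>\<^bsub>R\<^esub> y i)" "r \<odot>\<^bsub>free I d\<^esub> x = (\<lambda>i. r \<otimes>\<^bsub>R\<^esub> x i)"
  by (simp_all add: free_gmodule_def)

lemma gm_free: "gm (free I d)"
  unfolding free_gmodule_def by (rule gm_twist[OF gm_regular])

lemma bdf_free:
  assumes "graded_index I d"
  shows "bdf (free I d)" "hilb (free I d) = conv (rank I d) (hilb (regular_module R))"
  unfolding free_gmodule_def by (rule bdf_twist[OF bdf_regular assms])+

text \<open>A direct sum of shifted free modules is free on the pairs of indices, with degrees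
  added. This yields freeness of tensor products of free modules and of the infinite sums in the
  swindle.\<close>

lemma curry_iso:
  "gr_isomorphism R (free (Sigma I J) (\<lambda>(i, j). s i + d i j)) (gsum I (\<lambda>i. shift (s i) (free (J i) (d i)))) curry"
proof (rule gr_isomorphismI)
  let ?S = "free (Sigma I J) (\<lambda>(i, j). s i + d i j)" and ?T = "gsum I (\<lambda>i. shift (s i) (free (J i) (d i)))"
  have c: "curry x \<in> carrier ?T" if x: "x \<in> carrier ?S" for x
  proof (rule gsum_memI[where S = "fst ` {p. x p \<noteq> \<zero>\<^bsub>R\<^esub>}"])
    have fin: "finite {p. x p \<noteq> \<zero>\<^bsub>R\<^esub>}" and sub: "{p. x p \<noteq> \<zero>\<^bsub>R\<^esub>} \<subseteq> Sigma I J" and xR: "\<And>p. x p \<in> carrier R"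
      using x by (auto simp: free_carrier)
    show "finite (fst ` {p. x p \<noteq> \<zero>\<^bsub>R\<^esub>})" using fin by simp
    show "curry x i \<in> carrier (shift (s i) (free (J i) (d i)))" for i
    proof -
      have "{j. curry x i j \<noteq> \<zero>\<^bsub>R\<^esub>} \<subseteq> snd ` {p. x p \<noteq> \<zero>\<^bsub>R\<^esub>}" by (force simp: curry_def)
      then have "finite {j. curry x i j \<noteq> \<zero>\<^bsub>R\<^esub>}" using fin finite_subset by blast
      then show ?thesis using sub xR by (auto simp: free_carrier curry_def)
    qed
    show "i \<in> fst ` {p. x p \<noteq> \<zero>\<^bsub>R\<^esub>}" if "curry x i \<noteq> \<zero>\<^bsub>shift (s i) (free (J i) (d i))\<^esub>" for i
      using that by (force simp: free_ops curry_def fun_eq_iff)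
    show "curry x i = \<zero>\<^bsub>shift (s i) (free (J i) (d i))\<^esub>" if "i \<notin> I" for i
      using that sub by (auto simp: free_ops curry_def fun_eq_iff)
  qed
  have u: "case_prod y \<in> carrier ?S" if y: "y \<in> carrier ?T" for y
  proof -
    note m = gsum_memD[OF y]
    have fin: "finite {i. y i \<noteq> (\<lambda>j. \<zero>\<^bsub>R\<^esub>)}" using m(2) by (simp add: free_ops)
    have yi: "y i \<in> carrier (free (J i) (d i))" for i using m(1)[of i] by simp
    have y0: "i \<notin> I \<Longrightarrow> y i = (\<lambda>j. \<zero>\<^bsub>R\<^esub>)" for i using m(3)[of i] by (simp add: free_ops)
    have "{p. case_prod y p \<noteq> \<zero>\<^bsub>R\<^esub>} \<subseteq> Sigma {i. y i \<noteq> (\<lambda>j. \<zero>\<^bsub>R\<^esub>)} (\<lambda>i. {j. y i j \<noteq> \<zero>\<^bsub>R\<^esub>})" by auto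
    moreover have "finite \<dots>" using fin yi by (intro finite_SigmaI) (auto simp: free_carrier)
    ultimately have "finite {p. case_prod y p \<noteq> \<zero>\<^bsub>R\<^esub>}" by (rule finite_subset)
    moreover have "{p. case_prod y p \<noteq> \<zero>\<^bsub>R\<^esub>} \<subseteq> Sigma I J"
    proof
      fix p assume p: "p \<in> {p. case_prod y p \<noteq> \<zero>\<^bsub>R\<^esub>}"
      then have "fst p \<in> I" using y0[of "fst p"] by (cases p) fastforce
      moreover have "snd p \<in> J (fst p)" using yi[of "fst p"] p by (cases p) (auto simp: free_carrier)
      ultimately show "p \<in> Sigma I J" by (cases p) auto
    qed
    ultimately show ?thesis using yi by (auto simp: free_carrier)
  qed
  show "curry \<in> lin_maps R ?S ?T"
    using c by (auto simp: lin_maps_def free_ops curry_def)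
  show b: "bij_betw curry (carrier ?S) (carrier ?T)"
    by (rule bij_betw_byWitness[where f' = case_prod]) (use c u in auto)
  have h: "curry x \<in> hcomp ?T g \<longleftrightarrow> x \<in> hcomp ?S g" if x: "x \<in> carrier ?S" for x g
  proof -
    have "curry x \<in> hcomp ?T g \<longleftrightarrow> (\<forall>i j. x (i, j) \<in> hcomp R (g - s i - d i j))"
      using c[OF x] gsum_memD(1)[OF c[OF x]] by (simp add: gsum_simps(2) free_carrier(2) curry_def)
    also have "\<dots> \<longleftrightarrow> x \<in> hcomp ?S g"
      using x by (auto simp: free_carrier(2) diff_diff_eq)
    finally show ?thesis .
  qed
  show "curry ` hcomp ?S g = hcomp ?T g" for g
  proof
    show "curry ` hcomp ?S g \<subseteq> hcomp ?T g" using h free_carrier(2) by blast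
    show "hcomp ?T g \<subseteq> curry ` hcomp ?S g"
    proof
      fix y assume y: "y \<in> hcomp ?T g"
      have "case_prod y \<in> carrier ?S" by (rule u[OF hcomp_gsum_mem(1)[OF y]])
      then have "case_prod y \<in> hcomp ?S g" using h[of "case_prod y" g] y by simp
      then show "y \<in> curry ` hcomp ?S g" by (intro image_eqI[of _ _ "case_prod y"]) auto
    qed
  qed
qed

lemma sum_iso:
  fixes I :: "'e set" and J :: "'f set"
  shows "gr_isomorphism R (sum_gmodule (free I d) (free J e)) (free (I <+> J) (case_sum d e)) (\<lambda>(x, y). case_sum x y)"
proof (rule gr_isomorphismI)
  let ?S = "sum_gmodule (free I d) (free J e)" and ?T = "free (I <+> J) (case_sum d e)" and ?f = "\<lambda>(x, y). case_sum x y"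
  have supp: "{p. case_sum x y p \<noteq> \<zero>\<^bsub>R\<^esub>} = Inl ` {i. x i \<noteq> \<zero>\<^bsub>R\<^esub>} \<union> Inr ` {j. y j \<noteq> \<zero>\<^bsub>R\<^esub>}" for x :: "'e \<Rightarrow> 'a" and y :: "'f \<Rightarrow> 'a"
    by (auto split: sum.splits) (metis (mono_tags, lifting) image_eqI mem_Collect_eq sum.case sum.exhaust)+
  have fin: "finite {p. case_sum x y p \<noteq> \<zero>\<^bsub>R\<^esub>} \<longleftrightarrow> finite {i. x i \<noteq> \<zero>\<^bsub>R\<^esub>} \<and> finite {j. y j \<noteq> \<zero>\<^bsub>R\<^esub>}" for x :: "'e \<Rightarrow> 'a" and y :: "'f \<Rightarrow> 'a"
    unfolding supp by (simp add: finite_image_iff)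
  have sb: "{p. case_sum x y p \<noteq> \<zero>\<^bsub>R\<^esub>} \<subseteq> I <+> J \<longleftrightarrow> {i. x i \<noteq> \<zero>\<^bsub>R\<^esub>} \<subseteq> I \<and> {j. y j \<noteq> \<zero>\<^bsub>R\<^esub>} \<subseteq> J" for x y
    unfolding supp by auto
  have al: "(\<forall>p. case_sum x y p \<in> carrier R) \<longleftrightarrow> (\<forall>i. x i \<in> carrier R) \<and> (\<forall>j. y j \<in> carrier R)" for x :: "'e \<Rightarrow> 'a" and y :: "'f \<Rightarrow> 'a"
    by (auto split: sum.splits)
  have c: "case_sum x y \<in> carrier ?T \<longleftrightarrow> x \<in> carrier (free I d) \<and> y \<in> carrier (free J e)" for x y
    unfolding free_carrier mem_Collect_eq fin sb al by blast
  have h: "case_sum x y \<in> hcomp ?T g \<longleftrightarrow> x \<in> hcomp (free I d) g \<and> y \<in> hcomp (free J e) g" for x y g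
    unfolding free_carrier(2) mem_Collect_eq c by (auto split: sum.splits)
  have split: "z = case_sum (\<lambda>i. z (Inl i)) (\<lambda>j. z (Inr j))" for z :: "'e + 'f \<Rightarrow> 'a"
    by (auto split: sum.splits)
  show "?f \<in> lin_maps R ?S ?T"
    using c by (auto simp: lin_maps_def sum_gmodule_def free_ops fun_eq_iff split: sum.splits)
  show "bij_betw ?f (carrier ?S) (carrier ?T)"
  proof (rule bij_betw_byWitness[where f' = "\<lambda>z. (\<lambda>i. z (Inl i), \<lambda>j. z (Inr j))"])
    show "\<forall>z\<in>carrier ?T. ?f (\<lambda>i. z (Inl i), \<lambda>j. z (Inr j)) = z" using split[symmetric] by simp
    show "(\<lambda>z. (\<lambda>i. z (Inl i), \<lambda>j. z (Inr j))) ` carrier ?T \<subseteq> carrier ?S"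
    proof
      fix w assume "w \<in> (\<lambda>z. (\<lambda>i. z (Inl i), \<lambda>j. z (Inr j))) ` carrier ?T"
      then obtain z where z: "z \<in> carrier ?T" "w = (\<lambda>i. z (Inl i), \<lambda>j. z (Inr j))" by blast
      then show "w \<in> carrier ?S"
        using c[of "\<lambda>i. z (Inl i)" "\<lambda>j. z (Inr j)"] split[of z] by (simp add: sum_gmodule_def)
    qed
  qed (use c in \<open>auto simp: sum_gmodule_def\<close>)
  show "?f ` hcomp ?S g = hcomp ?T g" for g
  proof
    show "?f ` hcomp ?S g \<subseteq> hcomp ?T g" using h by (auto simp: sum_gmodule_def)
    show "hcomp ?T g \<subseteq> ?f ` hcomp ?S g"
    proof
      fix z assume "z \<in> hcomp ?T g"
      then have "(\<lambda>i. z (Inl i), \<lambda>j. z (Inr j)) \<in> hcomp ?S g"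
        using h[of "\<lambda>i. z (Inl i)" "\<lambda>j. z (Inr j)" g] split[of z] by (simp add: sum_gmodule_def)
      then show "z \<in> ?f ` hcomp ?S g" using split[of z] by (intro image_eqI) auto
    qed
  qed
qed

lemma zero_iso: "gr_isomorphism R zero_gmodule (free {} d) (\<lambda>_ _. \<zero>\<^bsub>R\<^esub>)"
  by (rule gr_isomorphismI)
    (auto simp: lin_maps_def zero_gmodule_def free_carrier free_ops bij_betw_def hcompD(2)[OF gm_regular, simplified])

lemma regular_iso: "gr_isomorphism R (regular_module R) (free {()} (\<lambda>_. 0)) (\<lambda>r _. r)"
proof (rule gr_isomorphismI)
  show "(\<lambda>r _. r) ` hcomp (regular_module R) g = hcomp (free {()} (\<lambda>_. 0)) g" for g
  proof (intro equalityI subsetI)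
    fix x assume "x \<in> hcomp (free {()} (\<lambda>_. 0)) g"
    then have "x () \<in> hcomp R g" by (simp add: free_carrier(2))
    moreover have "x = (\<lambda>_. x ())" by auto
    ultimately show "x \<in> (\<lambda>r _. r) ` hcomp (regular_module R) g" by (intro image_eqI[of _ _ "x ()"]) simp_all
  qed (auto simp: free_carrier carrier_hcomp)
  show "bij_betw (\<lambda>r _. r) (carrier (regular_module R)) (carrier (free {()} (\<lambda>_. 0)))"
    by (rule bij_betw_byWitness[where f' = "\<lambda>x. x ()"]) (auto simp: free_carrier)
qed (auto simp: lin_maps_def free_carrier free_ops)

lemma graded_index_Plus:
  assumes "graded_index I d" "graded_index J e"
  shows "graded_index (I <+> J) (case_sum d e)" "rank (I <+> J) (case_sum d e) = rank I d + rank J e"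
proof -
  have "case_sum d e ` (I <+> J) = d ` I \<union> e ` J" by (auto simp: Plus_def image_Un image_image)
  moreover have fib: "{p \<in> I <+> J. case_sum d e p = g} = {i \<in> I. d i = g} <+> {j \<in> J. e j = g}" for g
    by (auto simp: Plus_def)
  ultimately show "graded_index (I <+> J) (case_sum d e)"
    using assms Q.bounded_Un by (simp add: graded_index_def)
  show "rank (I <+> J) (case_sum d e) = rank I d + rank J e"
    using assms by (auto simp: rank_def fib card_Plus graded_index_def)
qed

text \<open>With \<open>fst\<close> as the degree, this index set has \<open>f g\<close> points in
  degree \<open>g\<close>; it provides a standard free module for every rank function.\<close>

definition fib :: "('g \<Rightarrow> nat) \<Rightarrow> ('g \<times> nat) set"
  where "fib f = {(g, n). n < f g}"

lemma graded_index_fib: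
  assumes "bounded (supp f)"
  shows "graded_index (fib f) fst" "rank (fib f) fst = (\<lambda>g. int (f g))"
proof -
  have e: "{p \<in> fib f. fst p = g} = (\<lambda>n. (g, n)) ` {..<f g}" for g by (auto simp: fib_def)
  have "fst ` fib f \<subseteq> supp f" by (auto simp: fib_def supp_def)
  then show "graded_index (fib f) fst"
    using Q.bounded_subset[OF assms] by (simp add: graded_index_def e)
  show "rank (fib f) fst = (\<lambda>g. int (f g))" by (rule ext) (simp add: rank_def e card_image inj_on_def)
qed

end

section \<open>Tensor products\<close>

lemma module_cong:
  assumes M: "module R M" and c: "carrier N = carrier M" "ring.zero N = \<zero>\<^bsub>M\<^esub>"
    and a: "\<And>x y. x \<in> carrier M \<Longrightarrow> y \<in> carrier M \<Longrightarrow> x \<oplus>\<^bsub>N\<^esub> y = x \<oplus>\<^bsub>M\<^esub> y"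
    and s: "\<And>r x. r \<in> carrier R \<Longrightarrow> x \<in> carrier M \<Longrightarrow> r \<odot>\<^bsub>N\<^esub> x = r \<odot>\<^bsub>M\<^esub> x"
  shows "module R N"
proof -
  interpret M: module R M by (rule M)
  show ?thesis
  proof (rule moduleI)
    show "abelian_group N"
    proof (rule abelian_groupI)
      fix x assume "x \<in> carrier N"
      then show "\<exists>y\<in>carrier N. y \<oplus>\<^bsub>N\<^esub> x = \<zero>\<^bsub>N\<^esub>" using c a by (intro bexI[of _ "\<ominus>\<^bsub>M\<^esub> x"]) (auto simp: M.l_neg)
    qed (use c a in \<open>auto simp: M.a_ac\<close>)
  qed (use c a s in \<open>auto simp: M.R.is_cring M.smult_l_distr M.smult_r_distr M.smult_assoc1\<close>)
qed

definition bilinear ::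
    "('a, 'w) ring_scheme \<Rightarrow> ('a, 'b, 'x) module_scheme \<Rightarrow> ('a, 'c, 'y) module_scheme \<Rightarrow> ('a, 'd, 'z) module_scheme
      \<Rightarrow> ('b \<Rightarrow> 'c \<Rightarrow> 'd) \<Rightarrow> bool"
  where "bilinear R M N T \<beta> \<longleftrightarrow>
    (\<forall>y\<in>carrier N. (\<lambda>x. \<beta> x y) \<in> lin_maps R M T) \<and> (\<forall>x\<in>carrier M. \<beta> x \<in> lin_maps R N T)"

lemma bilinearD:
  assumes "bilinear R M N T \<beta>"
  shows "x \<in> carrier M \<Longrightarrow> y \<in> carrier N \<Longrightarrow> \<beta> x y \<in> carrier T"
    "x \<in> carrier M \<Longrightarrow> x' \<in> carrier M \<Longrightarrow> y \<in> carrier N \<Longrightarrow> \<beta> (x \<oplus>\<^bsub>M\<^esub> x') y = \<beta> x y \<oplus>\<^bsub>T\<^esub> \<beta> x' y"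
    "x \<in> carrier M \<Longrightarrow> y \<in> carrier N \<Longrightarrow> y' \<in> carrier N \<Longrightarrow> \<beta> x (y \<oplus>\<^bsub>N\<^esub> y') = \<beta> x y \<oplus>\<^bsub>T\<^esub> \<beta> x y'"
    "r \<in> carrier R \<Longrightarrow> x \<in> carrier M \<Longrightarrow> y \<in> carrier N \<Longrightarrow> \<beta> (r \<odot>\<^bsub>M\<^esub> x) y = r \<odot>\<^bsub>T\<^esub> \<beta> x y"
    "r \<in> carrier R \<Longrightarrow> x \<in> carrier M \<Longrightarrow> y \<in> carrier N \<Longrightarrow> \<beta> x (r \<odot>\<^bsub>N\<^esub> y) = r \<odot>\<^bsub>T\<^esub> \<beta> x y"
  using assms by (auto simp: bilinear_def lin_maps_def Pi_iff)

lemma bilinearI: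
  assumes "\<And>x y. x \<in> carrier M \<Longrightarrow> y \<in> carrier N \<Longrightarrow> \<beta> x y \<in> carrier T"
    "\<And>x x' y. x \<in> carrier M \<Longrightarrow> x' \<in> carrier M \<Longrightarrow> y \<in> carrier N \<Longrightarrow> \<beta> (x \<oplus>\<^bsub>M\<^esub> x') y = \<beta> x y \<oplus>\<^bsub>T\<^esub> \<beta> x' y"
    "\<And>x y y'. x \<in> carrier M \<Longrightarrow> y \<in> carrier N \<Longrightarrow> y' \<in> carrier N \<Longrightarrow> \<beta> x (y \<oplus>\<^bsub>N\<^esub> y') = \<beta> x y \<oplus>\<^bsub>T\<^esub> \<beta> x y'"
    "\<And>r x y. r \<in> carrier R \<Longrightarrow> x \<in> carrier M \<Longrightarrow> y \<in> carrier N \<Longrightarrow> \<beta> (r \<odot>\<^bsub>M\<^esub> x) y = r \<odot>\<^bsub>T\<^esub> \<beta> x y"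
    "\<And>r x y. r \<in> carrier R \<Longrightarrow> x \<in> carrier M \<Longrightarrow> y \<in> carrier N \<Longrightarrow> \<beta> x (r \<odot>\<^bsub>N\<^esub> y) = r \<odot>\<^bsub>T\<^esub> \<beta> x y"
  shows "bilinear R M N T \<beta>"
  using assms by (auto simp: bilinear_def lin_maps_def Pi_iff)

lemma (in quotient) quot_lift:
  assumes N: "module R N" and h: "h \<in> lin_maps R M N" and 0: "\<And>x. x \<in> H \<Longrightarrow> h x = \<zero>\<^bsub>N\<^esub>"
  obtains h' where "h' \<in> lin_maps R (quot_module M H) N" "\<And>x. x \<in> carrier M \<Longrightarrow> h' (cls x) = h x"
proof -
  interpret l: lin_map R M N h by (intro lin_map.intro lin_map_axioms.intro M.module_axioms N h)
  define h' where "h' X = h (SOME x. x \<in> X)" for X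
  have e: "h' (cls x) = h x" if x: "x \<in> carrier M" for x
  proof -
    have "(SOME y. y \<in> cls x) \<in> cls x" using S.a_rcos_self[OF x] by (rule someI)
    then obtain u where u: "u \<in> H" "(SOME y. y \<in> cls x) = u \<oplus>\<^bsub>M\<^esub> x" by (auto simp: a_r_coset_def')
    then show ?thesis using 0[OF u(1)] x M.submoduleE(1)[OF H.submodule_axioms] by (auto simp: h'_def subset_iff)
  qed
  have "h' \<in> lin_maps R (quot_module M H) N"
    unfolding lin_maps_def using e by (auto simp: carrier_eq cls_add cls_smult)
  then show ?thesis using e that by blast
qed

section \<open>Universal properties of free modules and tensor products\<close>

context pdcf
begin

lemma free_module_module: "module R (free_module R X)"
  by (rule module_cong[OF gm_module[OF gm_free[of X "\<lambda>_. 0"]]]) (simp_all add: free_gmodule_simps)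

lemma lin_maps_free: "lin_maps R (free_module R X) N = lin_maps R (free X d) N"
  "lin_maps R N (free_module R X) = lin_maps R N (free X d)"
  by (simp_all add: lin_maps_def free_gmodule_simps)

lemma free_gen_eq: "free_gen R x = gsingle (\<lambda>i. shift (d i) (regular_module R)) x \<one>\<^bsub>R\<^esub>"
  by (auto simp: free_gen_def gsingle_def)

lemma free_gen_closed: "x \<in> X \<Longrightarrow> free_gen R x \<in> carrier (free_module R X)"
  by (auto simp: free_gen_def free_module_def split: if_splits)

lemma regular_lin: "module R N \<Longrightarrow> n \<in> carrier N \<Longrightarrow> (\<lambda>r. r \<odot>\<^bsub>N\<^esub> n) \<in> lin_maps R (shift s (regular_module R)) N"
  by (auto simp: lin_maps_def module.smult_l_distr module.smult_assoc1 module.smult_closed)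

lemma free_lift:
  assumes N: "module R N" and g: "\<And>x. x \<in> X \<Longrightarrow> g x \<in> carrier N"
  obtains h where "h \<in> lin_maps R (free_module R X) N" "\<And>x. x \<in> X \<Longrightarrow> h (free_gen R x) = g x"
    "\<And>z. z \<in> carrier (free_module R X) \<Longrightarrow> h z = (\<Oplus>\<^bsub>N\<^esub>x\<in>{x. z x \<noteq> \<zero>\<^bsub>R\<^esub>}. z x \<odot>\<^bsub>N\<^esub> g x)"
proof -
  let ?M = "\<lambda>i. shift 0 (regular_module R)" and ?\<phi> = "\<lambda>x r. r \<odot>\<^bsub>N\<^esub> g x"
  have M: "module R (?M i)" for i :: 'b by (rule shift_module[OF regular_module])
  have \<phi>: "?\<phi> x \<in> lin_maps R (?M x) N" if "x \<in> X" for x by (rule regular_lin[OF N g[OF that]])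
  note l = gsum_lift[where M = ?M and I = X and \<phi> = ?\<phi>, OF M N \<phi>]
  interpret N: module R N by (rule N)
  have "gsum_lift ?M N ?\<phi> \<in> lin_maps R (free_module R X) N"
    using l(1) unfolding lin_maps_free(1)[of X N "\<lambda>_. 0"] free_gmodule_def by simp
  moreover have "gsum_lift ?M N ?\<phi> (free_gen R x) = g x" if "x \<in> X" for x
    unfolding free_gen_eq[where d = "\<lambda>_. 0"] using l(2)[OF _ that, of "\<one>\<^bsub>R\<^esub>"] g[OF that] by simp
  ultimately show ?thesis by (rule that) (simp_all add: gsum_lift_def)
qed

lemma free_lin_eqI:
  assumes N: "module R N" and f: "f \<in> lin_maps R (free_module R X) N" and h: "h \<in> lin_maps R (free_module R X) N"
    and eq: "\<And>x. x \<in> X \<Longrightarrow> f (free_gen R x) = h (free_gen R x)" and z: "z \<in> carrier (free_module R X)"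
  shows "f z = h z"
proof -
  let ?M = "\<lambda>i. shift 0 (regular_module R)"
  have M: "module R (?M i)" for i :: 'b by (rule shift_module[OF regular_module])
  note fr = free_gmodule_def[of R X "\<lambda>_. 0"]
  interpret f: lin_map R "free_module R X" N f by (rule lin_mapI[OF free_module_module N f])
  interpret h: lin_map R "free_module R X" N h by (rule lin_mapI[OF free_module_module N h])
  show ?thesis
  proof (rule lin_maps_eqI_gsum[where M = ?M and I = X and R = R, OF M N])
    show "f \<in> lin_maps R (gsum X ?M) N" "h \<in> lin_maps R (gsum X ?M) N" "z \<in> carrier (gsum X ?M)"
      using f h z unfolding lin_maps_free(1)[of X N "\<lambda>_. 0"] free_gmodule_simps(1)[of X "\<lambda>_. 0", symmetric] fr by simp_all
    fix i r assume i: "i \<in> X" and r: "r \<in> carrier (shift 0 (regular_module R))"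
    have "gsingle ?M i r = r \<odot>\<^bsub>free_module R X\<^esub> free_gen R i"
      using r by (auto simp: gsingle_def free_module_def free_gen_def)
    then show "f (gsingle ?M i r) = h (gsingle ?M i r)" using eq[OF i] r free_gen_closed[OF i] by simp
  qed
qed

context
  fixes M :: "('a, 'b, 'x) module_scheme" and N :: "('a, 'c, 'y) module_scheme"
  assumes M: "module R M" and N: "module R N"
begin

abbreviation "FM \<equiv> free_module R (carrier M \<times> carrier N)"
abbreviation "TK \<equiv> tensor_kernel R M N"
abbreviation "pt \<equiv> pure_tensor R M N"

interpretation M: module R M by (rule M)
interpretation N: module R N by (rule N)
interpretation FM: module R FM by (rule free_module_module)

lemma lin_span_submodule:
  assumes "module R V" "B \<subseteq> carrier V"
  shows "submodule (lin_span R V B) R V" "B \<subseteq> lin_span R V B"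
proof -
  interpret V: module R V by (rule assms)
  have d: "H \<subseteq> carrier V \<and> \<zero>\<^bsub>V\<^esub> \<in> H \<and> (\<forall>x\<in>H. \<ominus>\<^bsub>V\<^esub> x \<in> H) \<and> (\<forall>x\<in>H. \<forall>y\<in>H. x \<oplus>\<^bsub>V\<^esub> y \<in> H) \<and> (\<forall>r\<in>carrier R. \<forall>x\<in>H. r \<odot>\<^bsub>V\<^esub> x \<in> H)"
    if "submodule H R V" for H
    using V.submoduleE[OF that] V.submodule_zero[OF that] by blast
  show "submodule (lin_span R V B) R V"
  proof (rule V.submoduleI)
    show "lin_span R V B \<subseteq> carrier V" using V.carrier_is_submodule assms(2) by (auto simp: lin_span_def)
    show "\<zero>\<^bsub>V\<^esub> \<in> lin_span R V B" using d by (auto simp: lin_span_def)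
    show "\<ominus>\<^bsub>V\<^esub> x \<in> lin_span R V B" if "x \<in> lin_span R V B" for x using d that unfolding lin_span_def by blast
    show "x \<oplus>\<^bsub>V\<^esub> y \<in> lin_span R V B" if "x \<in> lin_span R V B" "y \<in> lin_span R V B" for x y
      using d that unfolding lin_span_def by blast
    show "r \<odot>\<^bsub>V\<^esub> x \<in> lin_span R V B" if "r \<in> carrier R" "x \<in> lin_span R V B" for r x
      using d that unfolding lin_span_def by blast
  qed
  show "B \<subseteq> lin_span R V B" by (auto simp: lin_span_def)
qed

lemma rel_carrier: "tensor_relations R M N \<subseteq> carrier FM"
  unfolding tensor_relations_def Let_def
  by (auto intro!: FM.minus_closed FM.a_closed FM.smult_closed free_gen_closed)

lemma TK_submodule: "submodule TK R FM" "tensor_relations R M N \<subseteq> TK"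
  unfolding tensor_kernel_def using lin_span_submodule[OF free_module_module rel_carrier] by auto

interpretation T: quotient R FM TK
  by (intro quotient.intro free_module_module TK_submodule)

lemma tensor_module: "module R (tensor_module R M N)"
  unfolding tensor_module_def by (rule T.quot_module)

lemma pure_eq: "pt x y = T.cls (free_gen R (x, y))"
  by (simp add: pure_tensor_def)

lemma pure_bilinear: "bilinear R M N (tensor_module R M N) pt"
proof -
  let ?e = "free_gen R"
  have cl: "?e (x, y) \<in> carrier FM" if "x \<in> carrier M" "y \<in> carrier N" for x y
    by (rule free_gen_closed) (use that in simp)
  have add: "T.cls u = T.cls v \<oplus>\<^bsub>tensor_module R M N\<^esub> T.cls w"
    if "u \<in> carrier FM" "v \<in> carrier FM" "w \<in> carrier FM" "u \<ominus>\<^bsub>FM\<^esub> (v \<oplus>\<^bsub>FM\<^esub> w) \<in> tensor_relations R M N" for u v w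
    using T.cls_eq_iff[of u "v \<oplus>\<^bsub>FM\<^esub> w"] T.cls_add[of v w] that TK_submodule(2) by (auto simp: tensor_module_def)
  have sm: "T.cls u = r \<odot>\<^bsub>tensor_module R M N\<^esub> T.cls v"
    if "r \<in> carrier R" "u \<in> carrier FM" "v \<in> carrier FM" "u \<ominus>\<^bsub>FM\<^esub> (r \<odot>\<^bsub>FM\<^esub> v) \<in> tensor_relations R M N" for u v r
    using T.cls_eq_iff[of u "r \<odot>\<^bsub>FM\<^esub> v"] T.cls_smult[of r v] that TK_submodule(2) by (auto simp: tensor_module_def)
  show ?thesis
  proof (rule bilinearI, unfold pure_eq)
    show "T.cls (?e (x, y)) \<in> carrier (tensor_module R M N)" if "x \<in> carrier M" "y \<in> carrier N" for x y
      using cl[OF that] by (auto simp: tensor_module_def T.carrier_eq)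
    show "T.cls (?e (x \<oplus>\<^bsub>M\<^esub> x', y)) = T.cls (?e (x, y)) \<oplus>\<^bsub>tensor_module R M N\<^esub> T.cls (?e (x', y))"
      if "x \<in> carrier M" "x' \<in> carrier M" "y \<in> carrier N" for x x' y
      by (intro add cl) (use that in \<open>auto simp: tensor_relations_def Let_def\<close>)
    show "T.cls (?e (x, y \<oplus>\<^bsub>N\<^esub> y')) = T.cls (?e (x, y)) \<oplus>\<^bsub>tensor_module R M N\<^esub> T.cls (?e (x, y'))"
      if "x \<in> carrier M" "y \<in> carrier N" "y' \<in> carrier N" for x y y'
      by (intro add cl) (use that in \<open>auto simp: tensor_relations_def Let_def\<close>)
    show "T.cls (?e (r \<odot>\<^bsub>M\<^esub> x, y)) = r \<odot>\<^bsub>tensor_module R M N\<^esub> T.cls (?e (x, y))"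
      if "r \<in> carrier R" "x \<in> carrier M" "y \<in> carrier N" for r x y
      by (intro sm cl) (use that in \<open>auto simp: tensor_relations_def Let_def\<close>)
    show "T.cls (?e (x, r \<odot>\<^bsub>N\<^esub> y)) = r \<odot>\<^bsub>tensor_module R M N\<^esub> T.cls (?e (x, y))"
      if "r \<in> carrier R" "x \<in> carrier M" "y \<in> carrier N" for r x y
      by (intro sm cl) (use that in \<open>auto simp: tensor_relations_def Let_def\<close>)
  qed
qed

text \<open>The bilinear map extends linearly to the free module on pairs, and bilinearity puts
  every defining relation into the kernel of the extension.\<close>

lemma tensor_lift:
  assumes T: "module R T" and \<beta>: "bilinear R M N T \<beta>"
  obtains h where "h \<in> lin_maps R (tensor_module R M N) T"
    "\<And>x y. x \<in> carrier M \<Longrightarrow> y \<in> carrier N \<Longrightarrow> h (pt x y) = \<beta> x y"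
proof -
  interpret TT: module R T by (rule T)
  note b = bilinearD[OF \<beta>]
  obtain h0 where h0: "h0 \<in> lin_maps R FM T" "\<And>p. p \<in> carrier M \<times> carrier N \<Longrightarrow> h0 (free_gen R p) = \<beta> (fst p) (snd p)"
  proof -
    have g: "\<beta> (fst p) (snd p) \<in> carrier T" if "p \<in> carrier M \<times> carrier N" for p
      using b(1) that by auto
    show ?thesis
      by (rule free_lift[where X = "carrier M \<times> carrier N" and g = "\<lambda>p. \<beta> (fst p) (snd p)", OF T g]) (assumption, rule that)
  qed
  interpret h0: lin_map R FM T h0 by (rule lin_mapI[OF free_module_module T h0(1)])
  have e: "h0 (free_gen R (x, y)) = \<beta> x y" if "x \<in> carrier M" "y \<in> carrier N" for x y using h0(2) that by auto
  have sub: "submodule {z \<in> carrier FM. h0 z = \<zero>\<^bsub>T\<^esub>} R FM"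
    by (rule FM.submoduleI) auto
  have z: "\<beta> x y \<ominus>\<^bsub>T\<^esub> \<beta> x y = \<zero>\<^bsub>T\<^esub>" if "x \<in> carrier M" "y \<in> carrier N" for x y
    using b(1)[OF that] by (simp add: a_minus_def TT.r_neg)
  have cl: "free_gen R (x, y) \<in> carrier FM" if "x \<in> carrier M" "y \<in> carrier N" for x y
    by (rule free_gen_closed) (use that in simp)
  have "tensor_relations R M N \<subseteq> {z \<in> carrier FM. h0 z = \<zero>\<^bsub>T\<^esub>}"
    unfolding tensor_relations_def Let_def
    by (auto simp: cl e b a_minus_def TT.r_neg)
  then have k0: "h0 z = \<zero>\<^bsub>T\<^esub>" if "z \<in> TK" for z
    using sub that unfolding tensor_kernel_def lin_span_def by blast
  obtain h where "h \<in> lin_maps R (quot_module FM TK) T" "\<And>x. x \<in> carrier FM \<Longrightarrow> h (T.cls x) = h0 x"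
    using T.quot_lift[OF T h0(1) k0] by blast
  then show ?thesis using that e cl by (simp add: tensor_module_def pure_eq)
qed

lemma pure_closed:
  assumes "x \<in> carrier M" "y \<in> carrier N"
  shows "pure_tensor R M N x y \<in> carrier (tensor_module R M N)"
  using bilinearD(1)[OF pure_bilinear assms] .

text \<open>Coefficients are absorbed into the left factor, since r (x \<otimes> y) = (r x)
  \<otimes> y. Hence sums of pure tensors exhaust the tensor product.\<close>

lemma tensor_induct [consumes 1, case_names zero pure add]:
  assumes t: "t \<in> carrier (tensor_module R M N)" and z: "P \<zero>\<^bsub>tensor_module R M N\<^esub>"
    and p: "\<And>x y. x \<in> carrier M \<Longrightarrow> y \<in> carrier N \<Longrightarrow> P (pt x y)"
    and a: "\<And>s t. s \<in> carrier (tensor_module R M N) \<Longrightarrow> t \<in> carrier (tensor_module R M N) \<Longrightarrow> P s \<Longrightarrow> P t \<Longrightarrow>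
      P (s \<oplus>\<^bsub>tensor_module R M N\<^esub> t)"
  shows "P t"
proof -
  obtain f where f: "f \<in> carrier FM" "t = T.cls f" using t by (auto simp: tensor_module_def T.carrier_eq)
  let ?M = "\<lambda>i. shift 0 (regular_module R)" and ?X = "carrier M \<times> carrier N"
  have M': "module R (?M i)" for i :: "'b \<times> 'c" by (rule shift_module[OF regular_module])
  have fr: "carrier (gsum ?X ?M) = carrier FM"
    using free_gmodule_simps(1)[of ?X "\<lambda>_. 0"] unfolding free_gmodule_def by simp
  have ad: "(\<lambda>i. x i \<oplus>\<^bsub>?M i\<^esub> y i) = x \<oplus>\<^bsub>FM\<^esub> y" for x y by (simp add: free_module_def)
  have zr: "(\<lambda>i. \<zero>\<^bsub>?M i\<^esub>) = \<zero>\<^bsub>FM\<^esub>" by (simp add: free_module_def)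
  have "f \<in> carrier (gsum ?X ?M)" using f fr by simp
  with M' have "P (T.cls f)"
  proof (induction rule: gsum_induct)
    case zero
    have "T.cls \<zero>\<^bsub>FM\<^esub> = TK" using T.cls_zero_iff[of "\<zero>\<^bsub>FM\<^esub>"] FM.submodule_zero[OF TK_submodule(1)] by simp
    then show ?case using z unfolding zr by (simp add: tensor_module_def)
  next
    case (single i r)
    then obtain x y where i: "i = (x, y)" "x \<in> carrier M" "y \<in> carrier N" and r: "r \<in> carrier R" by auto
    have "gsingle ?M i r = r \<odot>\<^bsub>FM\<^esub> free_gen R i"
      using r by (auto simp: gsingle_def free_module_def free_gen_def)
    then have "T.cls (gsingle ?M i r) = r \<odot>\<^bsub>tensor_module R M N\<^esub> pt x y"
      using T.cls_smult[OF r free_gen_closed[of i ?X]] i unfolding pure_eq tensor_module_def by auto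
    also have "\<dots> = pt (r \<odot>\<^bsub>M\<^esub> x) y" using bilinearD(4)[OF pure_bilinear r i(2,3)] by simp
    finally show ?case using p[of "r \<odot>\<^bsub>M\<^esub> x" y] i r by simp
  next
    case (add x y)
    have "T.cls x \<in> carrier (tensor_module R M N)" "T.cls y \<in> carrier (tensor_module R M N)"
      using add(1,2) unfolding fr by (auto simp: tensor_module_def T.carrier_eq)
    from a[OF this add(3,4)] show ?case
      using T.cls_add[of x y] add(1,2) unfolding ad fr by (simp add: tensor_module_def)
  qed
  then show ?thesis using f by simp
qed

lemma tensor_lin_eqI:
  assumes T: "module R T" and f: "f \<in> lin_maps R (tensor_module R M N) T" and h: "h \<in> lin_maps R (tensor_module R M N) T"
    and eq: "\<And>x y. x \<in> carrier M \<Longrightarrow> y \<in> carrier N \<Longrightarrow> f (pt x y) = h (pt x y)"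
    and t: "t \<in> carrier (tensor_module R M N)"
  shows "f t = h t"
proof -
  interpret f: lin_map R "tensor_module R M N" T f by (rule lin_mapI[OF tensor_module T f])
  interpret h: lin_map R "tensor_module R M N" T h by (rule lin_mapI[OF tensor_module T h])
  show ?thesis using t by (induction rule: tensor_induct) (simp_all add: eq)
qed

end

text \<open>The definite description in \<open>tensor_map\<close> is resolved here: existence is the
  universal property, and uniqueness holds because the map is determined on pure tensors and is
  required to be extensional outside the carrier.\<close>

lemma tensor_map:
  assumes M: "module R M" and M': "module R M'" and N: "module R N" and f: "f \<in> lin_maps R M M'"
  shows "tensor_map R M M' N f \<in> lin_maps R (tensor_module R M N) (tensor_module R M' N)"
    and "x \<in> carrier M \<Longrightarrow> y \<in> carrier N \<Longrightarrow> tensor_map R M M' N f (pure_tensor R M N x y) = pure_tensor R M' N (f x) y"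
proof -
  interpret f: lin_map R M M' f by (rule lin_mapI[OF M M' f])
  note b = bilinearD[OF pure_bilinear[OF M' N]]
  have "bilinear R M N (tensor_module R M' N) (\<lambda>x y. pure_tensor R M' N (f x) y)"
    by (rule bilinearI) (simp_all add: b)
  then obtain h where h: "h \<in> lin_maps R (tensor_module R M N) (tensor_module R M' N)"
      "\<And>x y. x \<in> carrier M \<Longrightarrow> y \<in> carrier N \<Longrightarrow> h (pure_tensor R M N x y) = pure_tensor R M' N (f x) y"
    using tensor_lift[OF M N tensor_module[OF M' N]] by blast
  let ?C = "carrier (tensor_module R M N)"
  let ?P = "\<lambda>h. h \<in> lin_maps R (tensor_module R M N) (tensor_module R M' N) \<and> h \<in> extensional ?C \<and>
    (\<forall>x\<in>carrier M. \<forall>y\<in>carrier N. h (pure_tensor R M N x y) = pure_tensor R M' N (f x) y)"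
  interpret T: module R "tensor_module R M N" by (rule tensor_module[OF M N])
  have ex: "?P (restrict h ?C)"
    using h pure_closed[OF M N] by (auto simp: lin_maps_def)
  have uniq: "h' = restrict h ?C" if "?P h'" for h'
  proof
    fix t show "h' t = restrict h ?C t"
    proof (cases "t \<in> ?C")
      case True
      then show ?thesis using tensor_lin_eqI[OF M N tensor_module[OF M' N], of h' h t] that h by auto
    next
      case False
      then show ?thesis using that by (auto simp: extensional_def)
    qed
  qed
  have "?P (tensor_map R M M' N f)"
    unfolding tensor_map_def by (rule theI[of ?P, OF ex uniq])
  then show "tensor_map R M M' N f \<in> lin_maps R (tensor_module R M N) (tensor_module R M' N)"
    "x \<in> carrier M \<Longrightarrow> y \<in> carrier N \<Longrightarrow> tensor_map R M M' N f (pure_tensor R M N x y) = pure_tensor R M' N (f x) y"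
    by auto
qed

end

section \<open>Gradings on tensor products and tensoring with a free module\<close>

context pdcf
begin

abbreviation "tens M N \<equiv> tensor_gmodule k R M N"

lemma tensor_gmodule_simps:
  "carrier (tens M N) = carrier (tensor_module R M N)" "\<zero>\<^bsub>tens M N\<^esub> = \<zero>\<^bsub>tensor_module R M N\<^esub>"
  "add (tens M N) = add (tensor_module R M N)" "smult (tens M N) = smult (tensor_module R M N)"
  "hcomp (tens M N) u = lin_span k (scal (tensor_module R M N))
    {pure_tensor R M N x y | x y g h. x \<in> hcomp M g \<and> y \<in> hcomp N h \<and> g + h = u}"
  by (simp_all add: tensor_gmodule_def module.extend_def gmodule.fields_def)

lemma scal_tensor: "scal (tens M N) = scal (tensor_module R M N)"
  by (simp add: restrict_scalars_def tensor_gmodule_def module.extend_def)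

lemma lin_maps_tens: "lin_maps R (tens M N) T = lin_maps R (tensor_module R M N) T"
  "lin_maps R T (tens M N) = lin_maps R T (tensor_module R M N)"
  by (simp_all add: lin_maps_def tensor_gmodule_simps)

lemma tens_module: "module R M \<Longrightarrow> module R N \<Longrightarrow> module R (tens M N)"
  by (rule module_cong[OF tensor_module]) (simp_all add: tensor_gmodule_simps)

lemma hcomp_tens:
  assumes M: "gm M" and N: "gm N"
  shows "submodule (hcomp (tens M N) u) k (scal (tens M N))" "hcomp (tens M N) u \<subseteq> carrier (tens M N)"
    "x \<in> hcomp M g \<Longrightarrow> y \<in> hcomp N h \<Longrightarrow> pure_tensor R M N x y \<in> hcomp (tens M N) (g + h)"
    "submodule H k (scal (tens M N)) \<Longrightarrow>
      (\<And>x y g h. x \<in> hcomp M g \<Longrightarrow> y \<in> hcomp N h \<Longrightarrow> g + h = u \<Longrightarrow> pure_tensor R M N x y \<in> H) \<Longrightarrow> hcomp (tens M N) u \<subseteq> H"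
proof -
  note Mm = gm_module[OF M] gm_module[OF N]
  interpret V: vspace k "scal (tensor_module R M N)" by (rule vspace_scal[OF tensor_module[OF Mm]])
  let ?S = "\<lambda>u. {pure_tensor R M N x y | x y g h. x \<in> hcomp M g \<and> y \<in> hcomp N h \<and> g + h = u}"
  have S: "?S u \<subseteq> carrier (scal (tensor_module R M N))" for u
    using pure_closed[OF Mm] hcompD(1)[OF M] hcompD(1)[OF N] by auto
  show s: "submodule (hcomp (tens M N) u) k (scal (tens M N))" for u
    using V.lin_span_sub(1)[OF S] by (simp add: tensor_gmodule_simps(5) scal_tensor)
  show "hcomp (tens M N) u \<subseteq> carrier (tens M N)"
    using V.submoduleE(1)[OF V.lin_span_sub(1)[OF S]] by (simp add: tensor_gmodule_simps)
  show "pure_tensor R M N x y \<in> hcomp (tens M N) (g + h)" if "x \<in> hcomp M g" "y \<in> hcomp N h"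
  proof -
    have "pure_tensor R M N x y \<in> ?S (g + h)" using that by blast
    then show ?thesis using V.lin_span_sub(2)[OF S] unfolding tensor_gmodule_simps(5) by blast
  qed
  show "hcomp (tens M N) u \<subseteq> H" if H: "submodule H k (scal (tens M N))"
    and p: "\<And>x y g h. x \<in> hcomp M g \<Longrightarrow> y \<in> hcomp N h \<Longrightarrow> g + h = u \<Longrightarrow> pure_tensor R M N x y \<in> H"
  proof -
    have "?S u \<subseteq> H" using p by blast
    then show ?thesis using V.lin_span_least H unfolding tensor_gmodule_simps(5) scal_tensor by blast
  qed
qed

text \<open>The preimage of a component of \<open>T\<close> is a subspace, so pure tensors of
  homogeneous elements suffice. Only subspace components are asked of \<open>T\<close>, because
  \<open>T\<close> may itself be a tensor product whose grading is not yet established.\<close>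

lemma tens_gr_map:
  assumes M: "gm M" and N: "gm N" and T: "module R T" "\<And>u. submodule (hcomp T u) k (scal T)"
    and fl: "f \<in> lin_maps R (tens M N) T"
    and p: "\<And>x y g h. x \<in> hcomp M g \<Longrightarrow> y \<in> hcomp N h \<Longrightarrow> f (pure_tensor R M N x y) \<in> hcomp T (g + h)"
  shows "f \<in> gr_maps R (tens M N) T"
proof -
  note Mm = gm_module[OF M] gm_module[OF N]
  interpret vspace_map k "scal (tens M N)" "scal T" f
    by (rule lin_map_scal[OF tens_module[OF Mm] T(1) fl])
  have "hcomp (tens M N) u \<subseteq> {t \<in> carrier (scal (tens M N)). f t \<in> hcomp T u}" for u
    by (rule hcomp_tens(4)[OF M N preimage_sub[OF V.carrier_is_submodule T(2)]])
      (use p pure_closed[OF Mm] hcompD(1)[OF M] hcompD(1)[OF N] in \<open>auto simp: tensor_gmodule_simps\<close>)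
  then show ?thesis using fl by (auto simp: gr_maps_def)
qed

lemma free_gen_hcomp: "i \<in> I \<Longrightarrow> free_gen R i \<in> hcomp (free I d) (d i)"
  using free_gen_closed[of i I] hcompD(2)[OF gm_regular] one_hcomp
  by (auto simp: free_carrier(2) free_gmodule_simps(1) free_gen_def)

text \<open>For a free module with basis e_i, the tensor x \<otimes> y goes to the family of
  products of the coordinates of \<open>x\<close> with \<open>y\<close>. The inverse sends
  \<open>n\<close> in the summand \<open>i\<close> to e_i \<otimes> n.\<close>

lemma tens_free_left:
  assumes F: "gm F" and N: "gm N" and \<alpha>: "gr_isomorphism R F (free I d) \<alpha>"
  obtains \<kappa> where "gr_isomorphism R (tens F N) (twist N I d) \<kappa>"
    "\<And>x y. x \<in> carrier F \<Longrightarrow> y \<in> carrier N \<Longrightarrow> \<kappa> (pure_tensor R F N x y) = (\<lambda>i. \<alpha> x i \<odot>\<^bsub>N\<^esub> y)"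
proof -
  note Fm = gm_module[OF F] and Nm = gm_module[OF N]
  let ?D = "twist N I d" and ?pt = "pure_tensor R F N"
  interpret N: module R N by (rule Nm)
  have sm: "module R (shift (d i) N)" for i by (rule shift_module[OF Nm])
  have Dm: "module R ?D" by (rule gsum_module[OF sm])
  interpret a: lin_map R F "free I d" \<alpha> by (rule lin_map_gr[OF F gm_free gr_isomorphismD(1)[OF \<alpha>]])
  have \<alpha>x: "\<alpha> x i \<in> carrier R" "finite {i. \<alpha> x i \<noteq> \<zero>\<^bsub>R\<^esub>}" "i \<notin> I \<Longrightarrow> \<alpha> x i = \<zero>\<^bsub>R\<^esub>" if "x \<in> carrier F" for x i
    using a.map_simps(1)[OF that] by (auto simp: free_carrier)
  have cl: "(\<lambda>i. \<alpha> x i \<odot>\<^bsub>N\<^esub> y) \<in> carrier ?D" if "x \<in> carrier F" "y \<in> carrier N" for x y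
    by (rule gsum_memI[where S = "{i. \<alpha> x i \<noteq> \<zero>\<^bsub>R\<^esub>}"]) (use \<alpha>x[OF that(1)] that in auto)
  have "bilinear R F N ?D (\<lambda>x y i. \<alpha> x i \<odot>\<^bsub>N\<^esub> y)"
  proof (rule bilinearI)
    show "(\<lambda>i. \<alpha> (x \<oplus>\<^bsub>F\<^esub> x') i \<odot>\<^bsub>N\<^esub> y) = (\<lambda>i. \<alpha> x i \<odot>\<^bsub>N\<^esub> y) \<oplus>\<^bsub>?D\<^esub> (\<lambda>i. \<alpha> x' i \<odot>\<^bsub>N\<^esub> y)"
      if "x \<in> carrier F" "x' \<in> carrier F" "y \<in> carrier N" for x x' y
      using that \<alpha>x(1) by (simp add: free_ops N.smult_l_distr)
    show "(\<lambda>i. \<alpha> x i \<odot>\<^bsub>N\<^esub> (y \<oplus>\<^bsub>N\<^esub> y')) = (\<lambda>i. \<alpha> x i \<odot>\<^bsub>N\<^esub> y) \<oplus>\<^bsub>?D\<^esub> (\<lambda>i. \<alpha> x i \<odot>\<^bsub>N\<^esub> y')"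
      if "x \<in> carrier F" "y \<in> carrier N" "y' \<in> carrier N" for x y y'
      using that \<alpha>x(1) by (simp add: N.smult_r_distr)
    show "(\<lambda>i. \<alpha> (r \<odot>\<^bsub>F\<^esub> x) i \<odot>\<^bsub>N\<^esub> y) = r \<odot>\<^bsub>?D\<^esub> (\<lambda>i. \<alpha> x i \<odot>\<^bsub>N\<^esub> y)"
      if "r \<in> carrier R" "x \<in> carrier F" "y \<in> carrier N" for r x y
      using that \<alpha>x(1) by (simp add: free_ops N.smult_assoc1)
    show "(\<lambda>i. \<alpha> x i \<odot>\<^bsub>N\<^esub> (r \<odot>\<^bsub>N\<^esub> y)) = r \<odot>\<^bsub>?D\<^esub> (\<lambda>i. \<alpha> x i \<odot>\<^bsub>N\<^esub> y)"
      if "r \<in> carrier R" "x \<in> carrier F" "y \<in> carrier N" for r x y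
    proof -
      have "\<alpha> x i \<odot>\<^bsub>N\<^esub> (r \<odot>\<^bsub>N\<^esub> y) = r \<odot>\<^bsub>N\<^esub> (\<alpha> x i \<odot>\<^bsub>N\<^esub> y)" for i
        using that \<alpha>x(1)[OF that(2)] by (metis N.smult_assoc1 A.m_comm)
      then show ?thesis by simp
    qed
  qed (rule cl)
  then obtain \<kappa> where \<kappa>: "\<kappa> \<in> lin_maps R (tensor_module R F N) ?D"
      "\<And>x y. x \<in> carrier F \<Longrightarrow> y \<in> carrier N \<Longrightarrow> \<kappa> (?pt x y) = (\<lambda>i. \<alpha> x i \<odot>\<^bsub>N\<^esub> y)"
    using tensor_lift[OF Fm Nm Dm] by blast
  define \<psi> where "\<psi> = inv_into (carrier F) \<alpha>"
  have \<psi>: "gr_isomorphism R (free I d) F \<psi>"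
    unfolding \<psi>_def by (rule gr_isomorphism_inv[OF \<alpha> Fm gm_module[OF gm_free] hcomp_carrier[OF F]])
  interpret p: lin_map R "free I d" F \<psi> by (rule lin_map_gr[OF gm_free F gr_isomorphismD(1)[OF \<psi>]])
  have \<psi>\<alpha>: "\<psi> (\<alpha> x) = x" if "x \<in> carrier F" for x using that gr_isomorphismD(5)[OF \<alpha>] by (simp add: \<psi>_def)
  have \<alpha>\<psi>: "\<alpha> (\<psi> z) = z" if "z \<in> carrier (free I d)" for z
    using that gr_isomorphismD(6)[OF \<alpha>] by (simp add: \<psi>_def f_inv_into_f)
  define e where "e i = \<psi> (free_gen R i)" for i
  have fg: "free_gen R i \<in> carrier (free I d)" if "i \<in> I" for i
    using free_gen_closed[OF that] by (simp add: free_gmodule_simps)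
  have eh: "e i \<in> hcomp F (d i)" if "i \<in> I" for i
    unfolding e_def by (rule gr_mapsD(2)[OF gr_isomorphismD(1)[OF \<psi>] free_gen_hcomp[OF that]])
  have ec: "e i \<in> carrier F" if "i \<in> I" for i using eh[OF that] hcompD(1)[OF F] by blast
  have \<alpha>e: "\<alpha> (e i) = free_gen R i" if "i \<in> I" for i unfolding e_def by (rule \<alpha>\<psi>[OF fg[OF that]])
  note b = bilinearD[OF pure_bilinear[OF Fm Nm]]
  interpret T: module R "tensor_module R F N" by (rule tensor_module[OF Fm Nm])
  define \<Psi> where "\<Psi> = gsum_lift (\<lambda>i. shift (d i) N) (tensor_module R F N) (\<lambda>i n. ?pt (e i) n)"
  have \<phi>: "(\<lambda>n. ?pt (e i) n) \<in> lin_maps R (shift (d i) N) (tensor_module R F N)" if "i \<in> I" for i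
    using b ec[OF that] by (auto simp: lin_maps_def)
  note l = gsum_lift[where M = "\<lambda>i. shift (d i) N" and I = I and \<phi> = "\<lambda>i n. ?pt (e i) n", OF sm T.module_axioms \<phi>, folded \<Psi>_def]
  interpret P: lin_map R ?D "tensor_module R F N" \<Psi> by (rule lin_mapI[OF Dm T.module_axioms l(1)])
  interpret K: lin_map R "tensor_module R F N" ?D \<kappa> by (rule lin_mapI[OF T.module_axioms Dm \<kappa>(1)])
  have \<Psi>K: "\<Psi> (\<kappa> t) = t" if t: "t \<in> carrier (tensor_module R F N)" for t
  proof (rule tensor_lin_eqI[where f = "\<lambda>t. \<Psi> (\<kappa> t)" and h = "\<lambda>t. t", OF Fm Nm T.module_axioms _ _ _ t])
    show "(\<lambda>t. \<Psi> (\<kappa> t)) \<in> lin_maps R (tensor_module R F N) (tensor_module R F N)"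
      by (rule lin_maps_comp[OF \<kappa>(1) l(1)])
    show "(\<lambda>t. t) \<in> lin_maps R (tensor_module R F N) (tensor_module R F N)" by (auto simp: lin_maps_def)
    fix x y assume x: "x \<in> carrier F" and y: "y \<in> carrier N"
    \<comment> \<open>Both sides are linear in the coordinate vector \<open>z\<close> of
      \<open>x\<close>, so it is enough to compare them on unit vectors.\<close>
    have "\<Psi> (\<lambda>i. z i \<odot>\<^bsub>N\<^esub> y) = ?pt (\<psi> z) y" if z: "z \<in> carrier (free I d)" for z
    proof (rule free_lin_eqI[where f = "\<lambda>z. \<Psi> (\<lambda>i. z i \<odot>\<^bsub>N\<^esub> y)" and h = "\<lambda>z. ?pt (\<psi> z) y" and X = I and z = z, OF T.module_axioms])
      have "(\<lambda>i. z i \<odot>\<^bsub>N\<^esub> y) \<in> carrier ?D" if "z \<in> carrier (free I d)" for z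
        using cl[OF p.map_simps(1)[OF that] y] \<alpha>\<psi>[OF that] by simp
      note zy = this
      have "(\<lambda>z i. z i \<odot>\<^bsub>N\<^esub> y) \<in> lin_maps R (free I d) ?D"
        using zy y by (auto simp: lin_maps_def free_ops free_carrier N.smult_l_distr N.smult_assoc1)
      from lin_maps_comp[OF this l(1)]
      show "(\<lambda>z. \<Psi> (\<lambda>i. z i \<odot>\<^bsub>N\<^esub> y)) \<in> lin_maps R (free_module R I) (tensor_module R F N)"
        unfolding lin_maps_free(1)[of I _ d] .
      have "(\<lambda>x. ?pt x y) \<in> lin_maps R F (tensor_module R F N)"
        using pure_bilinear[OF Fm Nm] y by (simp add: bilinear_def)
      from lin_maps_comp[OF gr_isomorphismD(2)[OF \<psi>] this]
      show "(\<lambda>z. ?pt (\<psi> z) y) \<in> lin_maps R (free_module R I) (tensor_module R F N)"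
        unfolding lin_maps_free(1)[of I _ d] .
      show "z \<in> carrier (free_module R I)" using z by (simp add: free_gmodule_simps)
      fix i assume i: "i \<in> I"
      have "(\<lambda>j. free_gen R i j \<odot>\<^bsub>N\<^esub> y) = gsingle (\<lambda>i. shift (d i) N) i y"
        using y by (auto simp: free_gen_def gsingle_def)
      then show "\<Psi> (\<lambda>j. free_gen R i j \<odot>\<^bsub>N\<^esub> y) = ?pt (\<psi> (free_gen R i)) y"
        using l(2)[OF _ i, of y] y by (simp add: e_def)
    qed
    from this[OF a.map_simps(1)[OF x]] show "\<Psi> (\<kappa> (?pt x y)) = ?pt x y" using \<kappa>(2)[OF x y] \<psi>\<alpha>[OF x] by simp
  qed
  have K\<Psi>: "\<kappa> (\<Psi> z) = z" if z: "z \<in> carrier ?D" for z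
  proof (rule lin_maps_eqI_gsum[where M = "\<lambda>i. shift (d i) N" and R = R and f = "\<lambda>z. \<kappa> (\<Psi> z)" and h = "\<lambda>z. z", OF sm Dm _ _ _ z])
    show "(\<lambda>z. \<kappa> (\<Psi> z)) \<in> lin_maps R ?D ?D" by (rule lin_maps_comp[OF l(1) \<kappa>(1)])
    show "(\<lambda>z. z) \<in> lin_maps R ?D ?D" by (auto simp: lin_maps_def)
    fix i n assume i: "i \<in> I" and n: "n \<in> carrier (shift (d i) N)"
    have "\<kappa> (\<Psi> (gsingle (\<lambda>i. shift (d i) N) i n)) = (\<lambda>j. free_gen R i j \<odot>\<^bsub>N\<^esub> n)"
      using l(2)[OF _ i n] \<kappa>(2)[OF ec[OF i], of n] \<alpha>e[OF i] n by simp
    also have "\<dots> = gsingle (\<lambda>i. shift (d i) N) i n" using n by (auto simp: free_gen_def gsingle_def)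
    finally show "\<kappa> (\<Psi> (gsingle (\<lambda>i. shift (d i) N) i n)) = gsingle (\<lambda>i. shift (d i) N) i n" .
  qed
  have gD: "gm ?D" by (rule gm_twist[OF N])
  have \<kappa>g: "\<kappa> \<in> gr_maps R (tens F N) ?D"
  proof (rule tens_gr_map[OF F N Dm hcomp_sub[OF gD]])
    show "\<kappa> \<in> lin_maps R (tens F N) ?D" using \<kappa> by (simp add: lin_maps_tens)
    fix x y g h assume x: "x \<in> hcomp F g" and y: "y \<in> hcomp N h"
    have "\<alpha> x i \<in> hcomp R (g - d i)" for i
      using gr_mapsD(2)[OF gr_isomorphismD(1)[OF \<alpha>] x] by (simp add: free_carrier(2))
    then have "\<alpha> x i \<odot>\<^bsub>N\<^esub> y \<in> hcomp N (g + h - d i)" for i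
      using hcompD(5)[OF N _ y, of "\<alpha> x i" "g - d i"] by (simp add: algebra_simps)
    then show "\<kappa> (?pt x y) \<in> hcomp ?D (g + h)"
      using cl hcompD(1)[OF F x] hcompD(1)[OF N y] \<kappa>(2) by (simp add: gsum_simps(2))
  qed
  \<comment> \<open>Preservation of components by the inverse is checked by hand, on each piece e_i
    \<otimes> z_i: that \<open>tens F N\<close> is graded becomes known only as a consequence of the
    isomorphism.\<close>
  have \<Psi>h: "\<Psi> z \<in> hcomp (tens F N) u" if z: "z \<in> hcomp ?D u" for z u
  proof -
    interpret V: vspace k "scal (tens F N)" by (rule vspace_scal[OF tens_module[OF Fm Nm]])
    note s = V.subD[OF hcomp_tens(1)[OF F N]]
    note zm = gsum_memD[OF hcomp_gsum_mem(1)[OF z]]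
    have piece: "?pt (e i) (z i) \<in> hcomp (tens F N) u" if "i \<in> I" for i
      using hcomp_tens(3)[OF F N eh[OF that], of "z i" "u - d i"] hcomp_gsum_mem(2)[OF z, of i] by simp
    have "finsum (tensor_module R F N) (\<lambda>i. ?pt (e i) (z i)) S \<in> hcomp (tens F N) u" if "finite S" "S \<subseteq> I" for S
      using that
    proof (induction S rule: finite_induct)
      case empty
      show ?case using s(2) by (simp add: tensor_gmodule_simps(2))
    next
      case (insert i S)
      have "?pt (e j) (z j) \<in> carrier (tensor_module R F N)" if "j \<in> I" for j
        using b(1)[OF ec[OF that], of "z j"] zm(1)[of j] by simp
      then show ?case using insert piece s(3)
        by (subst T.finsum_insert) (auto simp: tensor_gmodule_simps(3))
    qed
    moreover have "{i. z i \<noteq> \<zero>\<^bsub>N\<^esub>} \<subseteq> I" using zm(3) by auto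
    ultimately show ?thesis using zm(2) unfolding \<Psi>_def gsum_lift_def by simp
  qed
  have "gr_isomorphism R (tens F N) ?D \<kappa>"
  proof (rule gr_isomorphismI)
    show "\<kappa> \<in> lin_maps R (tens F N) ?D" by (rule gr_mapsD(1)[OF \<kappa>g])
    show "bij_betw \<kappa> (carrier (tens F N)) (carrier ?D)"
      by (rule bij_betw_byWitness[where f' = \<Psi>]) (use \<Psi>K K\<Psi> in \<open>auto simp: tensor_gmodule_simps(1)\<close>)
    show "\<kappa> ` hcomp (tens F N) u = hcomp ?D u" for u
    proof
      show "\<kappa> ` hcomp (tens F N) u \<subseteq> hcomp ?D u" using gr_mapsD(2)[OF \<kappa>g] by blast
      show "hcomp ?D u \<subseteq> \<kappa> ` hcomp (tens F N) u"
      proof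
        fix z assume z: "z \<in> hcomp ?D u"
        show "z \<in> \<kappa> ` hcomp (tens F N) u"
          using K\<Psi>[OF hcomp_gsum_mem(1)[OF z]] \<Psi>h[OF z] by (intro image_eqI[of _ _ "\<Psi> z"]) simp_all
      qed
    qed
  qed
  then show ?thesis using \<kappa>(2) that by blast
qed

lemma tens_swap_map:
  assumes M: "gm M" and N: "gm N"
  obtains \<sigma> where "\<sigma> \<in> gr_maps R (tens M N) (tens N M)"
    "\<And>x y. x \<in> carrier M \<Longrightarrow> y \<in> carrier N \<Longrightarrow> \<sigma> (pure_tensor R M N x y) = pure_tensor R N M y x"
proof -
  note Mm = gm_module[OF M] and Nm = gm_module[OF N]
  note b = bilinearD[OF pure_bilinear[OF Nm Mm]]
  have "bilinear R M N (tensor_module R N M) (\<lambda>x y. pure_tensor R N M y x)"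
    by (rule bilinearI) (simp_all add: b)
  then obtain \<sigma> where \<sigma>: "\<sigma> \<in> lin_maps R (tensor_module R M N) (tensor_module R N M)"
      "\<And>x y. x \<in> carrier M \<Longrightarrow> y \<in> carrier N \<Longrightarrow> \<sigma> (pure_tensor R M N x y) = pure_tensor R N M y x"
    using tensor_lift[OF Mm Nm tensor_module[OF Nm Mm]] by blast
  have "\<sigma> \<in> gr_maps R (tens M N) (tens N M)"
  proof (rule tens_gr_map[OF M N tens_module[OF Nm Mm] hcomp_tens(1)[OF N M]])
    show "\<sigma> \<in> lin_maps R (tens M N) (tens N M)" using \<sigma>(1) by (simp add: lin_maps_tens)
    show "\<sigma> (pure_tensor R M N x y) \<in> hcomp (tens N M) (g + h)" if "x \<in> hcomp M g" "y \<in> hcomp N h" for x y g h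
      using hcomp_tens(3)[OF N M that(2,1)] \<sigma>(2)[OF hcompD(1)[OF M that(1)] hcompD(1)[OF N that(2)]]
      by (simp add: add.commute)
  qed
  then show ?thesis using \<sigma>(2) that by blast
qed

lemma tens_swap:
  assumes M: "gm M" and N: "gm N"
  obtains \<sigma> where "gr_isomorphism R (tens M N) (tens N M) \<sigma>"
    "\<And>x y. x \<in> carrier M \<Longrightarrow> y \<in> carrier N \<Longrightarrow> \<sigma> (pure_tensor R M N x y) = pure_tensor R N M y x"
proof -
  note Mm = gm_module[OF M] and Nm = gm_module[OF N]
  obtain \<sigma> where \<sigma>: "\<sigma> \<in> gr_maps R (tens M N) (tens N M)"
      "\<And>x y. x \<in> carrier M \<Longrightarrow> y \<in> carrier N \<Longrightarrow> \<sigma> (pure_tensor R M N x y) = pure_tensor R N M y x"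
    using tens_swap_map[OF M N] by blast
  obtain \<tau> where \<tau>: "\<tau> \<in> gr_maps R (tens N M) (tens M N)"
      "\<And>x y. x \<in> carrier N \<Longrightarrow> y \<in> carrier M \<Longrightarrow> \<tau> (pure_tensor R N M x y) = pure_tensor R M N y x"
    using tens_swap_map[OF N M] by blast
  have \<sigma>\<tau>: "\<tau> (\<sigma> t) = t" if "t \<in> carrier (tens M N)" for t
  proof (rule tensor_lin_eqI[where f = "\<lambda>t. \<tau> (\<sigma> t)" and h = "\<lambda>t. t", OF Mm Nm tens_module[OF Mm Nm]])
    show "(\<lambda>t. \<tau> (\<sigma> t)) \<in> lin_maps R (tensor_module R M N) (tens M N)"
      using lin_maps_comp[OF gr_mapsD(1)[OF \<sigma>(1)] gr_mapsD(1)[OF \<tau>(1)]] by (simp add: lin_maps_tens)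
    show "(\<lambda>t. t) \<in> lin_maps R (tensor_module R M N) (tens M N)" by (auto simp: lin_maps_def tensor_gmodule_simps)
  qed (use that \<sigma>(2) \<tau>(2) in \<open>simp_all add: tensor_gmodule_simps\<close>)
  have \<tau>\<sigma>: "\<sigma> (\<tau> t) = t" if "t \<in> carrier (tens N M)" for t
  proof (rule tensor_lin_eqI[where f = "\<lambda>t. \<sigma> (\<tau> t)" and h = "\<lambda>t. t", OF Nm Mm tens_module[OF Nm Mm]])
    show "(\<lambda>t. \<sigma> (\<tau> t)) \<in> lin_maps R (tensor_module R N M) (tens N M)"
      using lin_maps_comp[OF gr_mapsD(1)[OF \<tau>(1)] gr_mapsD(1)[OF \<sigma>(1)]] by (simp add: lin_maps_tens)
    show "(\<lambda>t. t) \<in> lin_maps R (tensor_module R N M) (tens N M)" by (auto simp: lin_maps_def tensor_gmodule_simps)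
  qed (use that \<sigma>(2) \<tau>(2) in \<open>simp_all add: tensor_gmodule_simps\<close>)
  have "gr_isomorphism R (tens M N) (tens N M) \<sigma>"
  proof (rule gr_isomorphismI[OF gr_mapsD(1)[OF \<sigma>(1)]])
    show "bij_betw \<sigma> (carrier (tens M N)) (carrier (tens N M))"
      by (rule bij_betw_byWitness[where f' = \<tau>]) (use \<sigma>\<tau> \<tau>\<sigma> \<sigma>(1) \<tau>(1) in \<open>auto simp: gr_maps_def lin_maps_def\<close>)
    show "\<sigma> ` hcomp (tens M N) u = hcomp (tens N M) u" for u
    proof
      show "\<sigma> ` hcomp (tens M N) u \<subseteq> hcomp (tens N M) u" using gr_mapsD(2)[OF \<sigma>(1)] by blast
      show "hcomp (tens N M) u \<subseteq> \<sigma> ` hcomp (tens M N) u"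
      proof
        fix t assume t: "t \<in> hcomp (tens N M) u"
        then have "t \<in> carrier (tens N M)" using hcomp_tens(2)[OF N M] by blast
        then show "t \<in> \<sigma> ` hcomp (tens M N) u"
          using \<tau>\<sigma> gr_mapsD(2)[OF \<tau>(1) t] by (intro image_eqI[of _ _ "\<tau> t"]) simp_all
      qed
    qed
  qed
  then show ?thesis using \<sigma>(2) that by blast
qed

lemma tens_free_right:
  assumes F: "gm F" and N: "gm N" and \<alpha>: "gr_isomorphism R F (free I d) \<alpha>"
  obtains \<kappa> where "gr_isomorphism R (tens N F) (twist N I d) \<kappa>"
    "\<And>x y. x \<in> carrier F \<Longrightarrow> y \<in> carrier N \<Longrightarrow> \<kappa> (pure_tensor R N F y x) = (\<lambda>i. \<alpha> x i \<odot>\<^bsub>N\<^esub> y)"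
proof -
  obtain \<kappa> where \<kappa>: "gr_isomorphism R (tens F N) (twist N I d) \<kappa>"
      "\<And>x y. x \<in> carrier F \<Longrightarrow> y \<in> carrier N \<Longrightarrow> \<kappa> (pure_tensor R F N x y) = (\<lambda>i. \<alpha> x i \<odot>\<^bsub>N\<^esub> y)"
    using tens_free_left[OF F N \<alpha>] by blast
  obtain \<sigma> where \<sigma>: "gr_isomorphism R (tens N F) (tens F N) \<sigma>"
      "\<And>x y. x \<in> carrier N \<Longrightarrow> y \<in> carrier F \<Longrightarrow> \<sigma> (pure_tensor R N F x y) = pure_tensor R F N y x"
    using tens_swap[OF N F] by blast
  show ?thesis by (rule that[OF gr_isomorphism_comp[OF \<sigma>(1) \<kappa>(1)]]) (simp add: \<kappa>(2) \<sigma>(2))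
qed

lemma bdf_tens_free:
  assumes F: "gm F" and N: "bdf N" and \<alpha>: "gr_isomorphism R F (free I d) \<alpha>" and I: "graded_index I d"
  shows "bdf (tens F N)" "hilb (tens F N) = conv (rank I d) (hilb N)"
proof -
  note N' = bdfD(1)[OF N]
  obtain \<kappa> where \<kappa>: "gr_isomorphism R (tens F N) (twist N I d) \<kappa>" using tens_free_left[OF F N' \<alpha>] by blast
  note b = bdf_iso[OF \<kappa> tens_module[OF gm_module[OF F] gm_module[OF N']] hcomp_tens(2)[OF F N'] bdf_twist(1)[OF N I]]
  show "bdf (tens F N)" by (rule b)
  show "hilb (tens F N) = conv (rank I d) (hilb N)" using b(2) bdf_twist(2)[OF N I] by simp
qed

lemma tensor_map_gr:
  assumes M: "gm M" and M': "gm M'" and N: "gm N" and f: "f \<in> gr_maps R M M'"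
  shows "tensor_map R M M' N f \<in> gr_maps R (tens M N) (tens M' N)"
proof -
  note m = gm_module[OF M] gm_module[OF M'] gm_module[OF N]
  note t = tensor_map[OF m gr_mapsD(1)[OF f]]
  show ?thesis
  proof (rule tens_gr_map[OF M N tens_module[OF m(2,3)] hcomp_tens(1)[OF M' N]])
    show "tensor_map R M M' N f \<in> lin_maps R (tens M N) (tens M' N)" using t(1) by (simp add: lin_maps_tens)
    show "tensor_map R M M' N f (pure_tensor R M N x y) \<in> hcomp (tens M' N) (g + h)"
      if "x \<in> hcomp M g" "y \<in> hcomp N h" for x y g h
      using t(2)[OF hcompD(1)[OF M that(1)] hcompD(1)[OF N that(2)]]
        hcomp_tens(3)[OF M' N gr_mapsD(2)[OF f that(1)] that(2)] by simp
  qed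
qed

lemma tensor_right_map:
  assumes M: "gm M" and N: "gm N" and N': "gm N'" and f: "f \<in> gr_maps R N N'"
  obtains h where "h \<in> gr_maps R (tens M N) (tens M N')"
    "\<And>x y. x \<in> carrier M \<Longrightarrow> y \<in> carrier N \<Longrightarrow> h (pure_tensor R M N x y) = pure_tensor R M N' x (f y)"
proof -
  note m = gm_module[OF M] gm_module[OF N] gm_module[OF N']
  interpret f: lin_map R N N' f by (rule lin_map_gr[OF N N' f])
  note b = bilinearD[OF pure_bilinear[OF m(1,3)]]
  have "bilinear R M N (tensor_module R M N') (\<lambda>x y. pure_tensor R M N' x (f y))"
    by (rule bilinearI) (simp_all add: b)
  then obtain h where h: "h \<in> lin_maps R (tensor_module R M N) (tensor_module R M N')"
      "\<And>x y. x \<in> carrier M \<Longrightarrow> y \<in> carrier N \<Longrightarrow> h (pure_tensor R M N x y) = pure_tensor R M N' x (f y)"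
    using tensor_lift[OF m(1,2) tensor_module[OF m(1,3)]] by blast
  have "h \<in> gr_maps R (tens M N) (tens M N')"
  proof (rule tens_gr_map[OF M N tens_module[OF m(1,3)] hcomp_tens(1)[OF M N']])
    show "h \<in> lin_maps R (tens M N) (tens M N')" using h(1) by (simp add: lin_maps_tens)
    show "h (pure_tensor R M N x y) \<in> hcomp (tens M N') (g + u)"
      if "x \<in> hcomp M g" "y \<in> hcomp N u" for x y g u
      using h(2)[OF hcompD(1)[OF M that(1)] hcompD(1)[OF N that(2)]]
        hcomp_tens(3)[OF M N' that(1) gr_mapsD(2)[OF f that(2)]] by simp
  qed
  then show ?thesis using h(2) that by blast
qed

end

section \<open>Free covers and syzygies\<close>

context pdcf
begin

lemma hproj_finsum:
  assumes M: "gm M" and "finite S" "\<And>i. i \<in> S \<Longrightarrow> f i \<in> carrier M"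
  shows "hproj M g (finsum M f S) = finsum M (\<lambda>i. hproj M g (f i)) S"
proof -
  interpret M: module R M by (rule gm_module[OF M])
  show ?thesis using assms(2,3)
  proof (induction S rule: finite_induct)
    case empty
    show ?case using hproj_homogeneous[OF M hcompD(2)[OF M], of g g] by simp
  next
    case (insert i S)
    have "finsum M f S \<in> carrier M" using insert by (intro M.finsum_closed) auto
    then show ?case using insert hproj_add[OF M] hproj(2)[OF M]
      by (subst (1 2) M.finsum_insert) auto
  qed
qed

text \<open>The degree \<open>g\<close> part of the product of the irrelevant ideal with
  \<open>M\<close>; a basis modulo it is a minimal set of generators in degree
  \<open>g\<close>.\<close>

definition decomposables :: "('a, 'b, 'g) gmodule \<Rightarrow> 'g \<Rightarrow> 'b set"
  where "decomposables M g = lin_span k (scal M)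
    {r \<odot>\<^bsub>M\<^esub> x | r x q. q \<noteq> 0 \<and> r \<in> hcomp R q \<and> x \<in> hcomp M (g - q)}"

lemma decomposables:
  assumes M: "gm M"
  shows "submodule (decomposables M g) k (scal M)" "decomposables M g \<subseteq> hcomp M g"
    "q \<noteq> 0 \<Longrightarrow> r \<in> hcomp R q \<Longrightarrow> x \<in> hcomp M (g - q) \<Longrightarrow> r \<odot>\<^bsub>M\<^esub> x \<in> decomposables M g"
    "submodule H k (scal M) \<Longrightarrow>
      (\<And>r x q. q \<noteq> 0 \<Longrightarrow> r \<in> hcomp R q \<Longrightarrow> x \<in> hcomp M (g - q) \<Longrightarrow> r \<odot>\<^bsub>M\<^esub> x \<in> H) \<Longrightarrow> decomposables M g \<subseteq> H"
proof -
  interpret V: vspace k "scal M" by (rule vspace_scal[OF gm_module[OF M]])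
  let ?S = "\<lambda>g. {r \<odot>\<^bsub>M\<^esub> x | r x q. q \<noteq> 0 \<and> r \<in> hcomp R q \<and> x \<in> hcomp M (g - q)}"
  have S: "?S g \<subseteq> hcomp M g" for g
  proof
    fix y assume "y \<in> ?S g"
    then obtain r x q where "y = r \<odot>\<^bsub>M\<^esub> x" "r \<in> hcomp R q" "x \<in> hcomp M (g - q)" by blast
    then show "y \<in> hcomp M g" using hcompD(5)[OF M, of r q x "g - q"] by simp
  qed
  then have S': "?S g \<subseteq> carrier (scal M)" for g using hcomp_carrier[OF M] by fastforce
  show "submodule (decomposables M g) k (scal M)"
    unfolding decomposables_def by (rule V.lin_span_sub(1)[OF S'])
  show "decomposables M g \<subseteq> hcomp M g"
    unfolding decomposables_def by (rule V.lin_span_least[OF hcomp_sub[OF M] S])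
  show "r \<odot>\<^bsub>M\<^esub> x \<in> decomposables M g" if "q \<noteq> 0" "r \<in> hcomp R q" "x \<in> hcomp M (g - q)"
    using V.lin_span_sub(2)[OF S', of g] that unfolding decomposables_def by blast
  show "decomposables M g \<subseteq> H" if H: "submodule H k (scal M)"
    and *: "\<And>r x q. q \<noteq> 0 \<Longrightarrow> r \<in> hcomp R q \<Longrightarrow> x \<in> hcomp M (g - q) \<Longrightarrow> r \<odot>\<^bsub>M\<^esub> x \<in> H"
  proof -
    have "?S g \<subseteq> H" using * by blast
    then show ?thesis unfolding decomposables_def by (rule V.lin_span_least[OF H])
  qed
qed

text \<open>A cover by a free module whose generators form a basis modulo decomposable elements,
  so that its kernel has no component along generators in its own degree.\<close>

lemma minimal_cover:
  assumes M: "bdf M"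
  obtains f :: "'g \<Rightarrow> nat" and \<pi> where "bounded (supp f)" "\<pi> \<in> gr_maps R (free (fib f) fst) M"
    "\<pi> ` carrier (free (fib f) fst) = carrier M" "\<And>g. f g \<noteq> 0 \<Longrightarrow> g \<in> Supp M"
    "\<And>u z n. z \<in> hcomp (free (fib f) fst) u \<Longrightarrow> \<pi> z = \<zero>\<^bsub>M\<^esub> \<Longrightarrow> z (u, n) = \<zero>\<^bsub>R\<^esub>"
proof -
  note gM = bdfD(1)[OF M] and c = hcompD[OF bdfD(1)[OF M]] and dec = decomposables[OF bdfD(1)[OF M]]
  interpret M: module R M by (rule gm_module[OF gM])
  interpret V: vspace k "scal M" by (rule vspace_scal[OF gm_module[OF gM]])
  have "\<exists>b m. V.rel_basis (decomposables M g) (hcomp M g) b m" for g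
    by (rule V.rel_basis_exists[OF bdfD(3)[OF M] hcomp_sub[OF gM] dec(1,2)])
  then obtain b f where b: "V.rel_basis (decomposables M g) (hcomp M g) (b g) (f g)" for g
    by metis
  have bh: "b g i \<in> hcomp M g" if "i < f g" for g i using b[of g] that by (auto simp: V.rel_basis_def)
  have bdec: "\<exists>s\<in>decomposables M g. \<exists>a\<in>{..<f g} \<rightarrow> carrier k. t = s \<oplus>\<^bsub>M\<^esub> (\<Oplus>\<^bsub>M\<^esub>i\<in>{..<f g}. (a i \<odot>\<^bsub>R\<^esub> \<one>\<^bsub>R\<^esub>) \<odot>\<^bsub>M\<^esub> b g i)"
    if "t \<in> hcomp M g" for g t
    using b[of g] that unfolding V.rel_basis_def scal_finsum by auto
  have bind: "a i = \<zero>\<^bsub>k\<^esub>" if "a \<in> {..<f g} \<rightarrow> carrier k" "i < f g"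
      "(\<Oplus>\<^bsub>M\<^esub>i\<in>{..<f g}. (a i \<odot>\<^bsub>R\<^esub> \<one>\<^bsub>R\<^esub>) \<odot>\<^bsub>M\<^esub> b g i) \<in> decomposables M g" for a g i
    using b[of g] that unfolding V.rel_basis_def scal_finsum by auto
  \<comment> \<open>In a degree outside the support all chosen vectors are zero, so coefficients 1
    would give a relation, against independence.\<close>
  have fS: "g \<in> Supp M" if "f g \<noteq> 0" for g
  proof (rule ccontr)
    assume "g \<notin> Supp M"
    then have "hcomp M g = {\<zero>\<^bsub>M\<^esub>}" by (simp add: Supp_def)
    then have z: "b g i = \<zero>\<^bsub>M\<^esub>" if "i < f g" for i using bh[OF that] by simp
    have "(\<Oplus>\<^bsub>M\<^esub>i\<in>{..<f g}. (\<one>\<^bsub>k\<^esub> \<odot>\<^bsub>R\<^esub> \<one>\<^bsub>R\<^esub>) \<odot>\<^bsub>M\<^esub> b g i) = \<zero>\<^bsub>M\<^esub>"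
      using z by (intro M.add.finprod_one_eqI) auto
    then have "\<one>\<^bsub>k\<^esub> = \<zero>\<^bsub>k\<^esub>" using bind[of "\<lambda>_. \<one>\<^bsub>k\<^esub>" g 0] that V.subD(2)[OF dec(1)[of g]] by auto
    then show False using k.one_not_zero by simp
  qed
  have bs: "bounded (supp f)"
    by (rule Q.bounded_subset[OF bdfD(2)[OF M]]) (use fS in \<open>auto simp: supp_def\<close>)
  let ?F = "free (fib f) fst" and ?gen = "\<lambda>i. b (fst i) (snd i)"
  have gh: "?gen i \<in> hcomp M (fst i)" if "i \<in> fib f" for i using bh that by (auto simp: fib_def)
  have gc: "?gen i \<in> carrier M" if "i \<in> fib f" for i using gh[OF that] c(1) by blast
  obtain \<pi> where \<pi>: "\<pi> \<in> lin_maps R (free_module R (fib f)) M" "\<And>i. i \<in> fib f \<Longrightarrow> \<pi> (free_gen R i) = ?gen i"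
      "\<And>z. z \<in> carrier (free_module R (fib f)) \<Longrightarrow> \<pi> z = (\<Oplus>\<^bsub>M\<^esub>i\<in>{i. z i \<noteq> \<zero>\<^bsub>R\<^esub>}. z i \<odot>\<^bsub>M\<^esub> ?gen i)"
    using free_lift[where X = "fib f" and g = ?gen, OF M.module_axioms gc] by blast
  have \<pi>l: "\<pi> \<in> lin_maps R ?F M" using \<pi>(1) unfolding lin_maps_free(1)[of _ _ fst] .
  interpret p: lin_map R ?F M \<pi> by (rule lin_mapI[OF gm_module[OF gm_free] M.module_axioms \<pi>l])
  have \<pi>sum: "\<pi> z = (\<Oplus>\<^bsub>M\<^esub>i\<in>S. z i \<odot>\<^bsub>M\<^esub> ?gen i)"
    if z: "z \<in> carrier ?F" "finite S" "{i. z i \<noteq> \<zero>\<^bsub>R\<^esub>} \<subseteq> S" "S \<subseteq> fib f" for z S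
  proof -
    have zc: "z i \<in> carrier R" for i using z(1) unfolding free_carrier by blast
    have "\<pi> z = (\<Oplus>\<^bsub>M\<^esub>i\<in>{i. z i \<noteq> \<zero>\<^bsub>R\<^esub>}. z i \<odot>\<^bsub>M\<^esub> ?gen i)"
      using \<pi>(3) z(1) by (simp add: free_gmodule_simps)
    also have "\<dots> = (\<Oplus>\<^bsub>M\<^esub>i\<in>S. z i \<odot>\<^bsub>M\<^esub> ?gen i)"
    proof (rule M.add.finprod_mono_neutral_cong_left[OF z(2,3)])
      have gS: "?gen i \<in> carrier M" if "i \<in> S" for i using gc z(4) that by blast
      show "z i \<odot>\<^bsub>M\<^esub> ?gen i = \<zero>\<^bsub>M\<^esub>" if "i \<in> S - {i. z i \<noteq> \<zero>\<^bsub>R\<^esub>}" for i using gS that by simp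
      show "(\<lambda>i. z i \<odot>\<^bsub>M\<^esub> ?gen i) \<in> S \<rightarrow> carrier M" using gS zc by blast
    qed simp
    finally show ?thesis .
  qed
  have supp: "finite {i. z i \<noteq> \<zero>\<^bsub>R\<^esub>}" "{i. z i \<noteq> \<zero>\<^bsub>R\<^esub>} \<subseteq> fib f" "z i \<in> carrier R" if "z \<in> carrier ?F" for z i
    using that unfolding free_carrier by blast+
  have sumH: "finsum M w S \<in> H" if "submodule H k (scal M)" "finite S" "\<And>i. i \<in> S \<Longrightarrow> w i \<in> H" for H S and w :: "'x \<Rightarrow> _"
    using that(2,3)
  proof (induction S rule: finite_induct)
    case empty
    show ?case using V.subD(2)[OF that(1)] by simp
  next
    case (insert i S)
    have wH: "w j \<in> H" if "j \<in> insert i S" for j using insert.prems that by blast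
    have Hc: "x \<in> carrier M" if "x \<in> H" for x using V.subD(1)[OF \<open>submodule H k (scal M)\<close> that] by simp
    have "finsum M w (insert i S) = w i \<oplus>\<^bsub>M\<^esub> finsum M w S"
      using insert.hyps wH Hc by (intro M.finsum_insert) auto
    moreover have "finsum M w S \<in> H" by (rule insert.IH) (simp add: wH)
    ultimately show ?case using V.subD(3)[OF that(1), of "w i"] wH[of i] by simp
  qed
  have piece: "z i \<odot>\<^bsub>M\<^esub> ?gen i \<in> hcomp M u" if "z \<in> hcomp ?F u" "i \<in> fib f" for z u i
  proof -
    have "z i \<in> hcomp R (u - fst i)" using that(1) unfolding free_carrier(2) by blast
    from hcompD(5)[OF gM this gh[OF that(2)]] show ?thesis by simp
  qed
  have \<pi>g: "\<pi> \<in> gr_maps R ?F M"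
    unfolding gr_maps_def
  proof (intro CollectI conjI allI \<pi>l subsetI)
    fix u y assume "y \<in> \<pi> ` hcomp ?F u"
    then obtain z where z: "z \<in> hcomp ?F u" "y = \<pi> z" by blast
    note zs = supp[OF hcompD(1)[OF gm_free z(1)]]
    have "z i \<odot>\<^bsub>M\<^esub> ?gen i \<in> hcomp M u" if "i \<in> {i. z i \<noteq> \<zero>\<^bsub>R\<^esub>}" for i
      using piece[OF z(1)] zs(2) that by blast
    then show "y \<in> hcomp M u"
      using \<pi>sum[OF hcompD(1)[OF gm_free z(1)] zs(1) subset_refl zs(2)] sumH[OF hcomp_sub[OF gM] zs(1)] z(2) by simp
  qed
  have imk: "submodule (\<pi> ` carrier ?F) k (scal M)"
  proof -
    interpret q: vspace_map k "scal ?F" "scal M" \<pi> by (rule lin_map_scal[OF gm_module[OF gm_free] M.module_axioms \<pi>l])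
    show ?thesis using q.image_sub[OF q.V.carrier_is_submodule] by simp
  qed
  have genim: "?gen i \<in> \<pi> ` carrier ?F" if "i \<in> fib f" for i
    using \<pi>(2)[OF that] free_gen_closed[OF that] by (metis free_gmodule_simps(1) image_eqI)
  have smim: "r \<odot>\<^bsub>M\<^esub> y \<in> \<pi> ` carrier ?F" if ry: "r \<in> carrier R" "y \<in> \<pi> ` carrier ?F" for r y
  proof -
    obtain x where x: "x \<in> carrier ?F" "y = \<pi> x" using ry(2) by blast
    then have "r \<odot>\<^bsub>M\<^esub> y = \<pi> (r \<odot>\<^bsub>?F\<^esub> x)" using ry(1) by simp
    then show ?thesis using p.V.smult_closed[OF ry(1) x(1)] by blast
  qed
  \<comment> \<open>Graded Nakayama, by induction on the number of degrees of the support below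
    \<open>g\<close>: decomposable elements are built from strictly lower degrees, and the chosen
    basis covers the rest.\<close>
  have "t \<in> \<pi> ` carrier ?F" if "t \<in> hcomp M g" for g t
    using that
  proof (induction "card {u \<in> Supp M. le_monoid (Supp R) u g}" arbitrary: g t rule: less_induct)
    case less
    show ?case
    proof (cases "t = \<zero>\<^bsub>M\<^esub>")
      case True
      then show ?thesis using V.subD(2)[OF imk] by simp
    next
      case False
      then have gS: "g \<in> Supp M" using SuppI[OF less.prems] by blast
      have low: "decomposables M g \<subseteq> \<pi> ` carrier ?F"
      proof (rule dec(4)[OF imk])
        fix r x q assume q: "q \<noteq> 0" "r \<in> hcomp R q" "x \<in> hcomp M (g - q)"
        show "r \<odot>\<^bsub>M\<^esub> x \<in> \<pi> ` carrier ?F"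
        proof (cases "r = \<zero>\<^bsub>R\<^esub> \<or> x = \<zero>\<^bsub>M\<^esub>")
          case True
          then have "r \<odot>\<^bsub>M\<^esub> x = \<zero>\<^bsub>M\<^esub>" using carrier_hcomp[OF q(2)] c(1)[OF q(3)] by auto
          then show ?thesis using V.subD(2)[OF imk] by simp
        next
          case False
          then have qQ: "q \<in> Supp R" using SuppI[OF q(2)] by blast
          then have lt: "le_monoid (Supp R) (g - q) g" by (simp add: le_monoid_def)
          have ng: "\<not> le_monoid (Supp R) g (g - q)" using Q.le_antisym[OF lt] q(1) by auto
          have "{u \<in> Supp M. le_monoid (Supp R) u (g - q)} \<subset> {u \<in> Supp M. le_monoid (Supp R) u g}"
            using Q.le_trans[OF _ lt] ng gS Q.le_refl by blast
          then have "card {u \<in> Supp M. le_monoid (Supp R) u (g - q)} < card {u \<in> Supp M. le_monoid (Supp R) u g}"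
            by (rule psubset_card_mono[OF Q.bounded_down_finite[OF bdfD(2)[OF M]]])
          then have "x \<in> \<pi> ` carrier ?F" using less.hyps q(3) by blast
          then show ?thesis by (rule smim[OF carrier_hcomp[OF q(2)]])
        qed
      qed
      obtain s a where sa: "s \<in> decomposables M g" "a \<in> {..<f g} \<rightarrow> carrier k"
          "t = s \<oplus>\<^bsub>M\<^esub> (\<Oplus>\<^bsub>M\<^esub>i\<in>{..<f g}. (a i \<odot>\<^bsub>R\<^esub> \<one>\<^bsub>R\<^esub>) \<odot>\<^bsub>M\<^esub> b g i)" using bdec[OF less.prems] by blast
      have "(a i \<odot>\<^bsub>R\<^esub> \<one>\<^bsub>R\<^esub>) \<odot>\<^bsub>M\<^esub> b g i \<in> \<pi> ` carrier ?F" if "i \<in> {..<f g}" for i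
        using smim[OF _ genim[of "(g, i)"]] sa(2) that by (auto simp: fib_def Pi_iff)
      then have "(\<Oplus>\<^bsub>M\<^esub>i\<in>{..<f g}. (a i \<odot>\<^bsub>R\<^esub> \<one>\<^bsub>R\<^esub>) \<odot>\<^bsub>M\<^esub> b g i) \<in> \<pi> ` carrier ?F"
        by (intro sumH[OF imk]) auto
      then show ?thesis using V.subD(3)[OF imk] low sa(1,3) by (simp add: subset_iff)
    qed
  qed
  then have surj: "\<pi> ` carrier ?F = carrier M"
  proof -
    assume h: "\<And>t g. t \<in> hcomp M g \<Longrightarrow> t \<in> \<pi> ` carrier ?F"
    have "t \<in> \<pi> ` carrier ?F" if "t \<in> carrier M" for t
      using gM that
    proof (induction rule: graded_induct)
      case (add x y)
      then show ?case using V.subD(3)[OF imk] by simp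
    qed (use h V.subD(2)[OF imk] in auto)
    then show ?thesis using p.map_simps(1) by blast
  qed
  have ker: "z (u, n) = \<zero>\<^bsub>R\<^esub>" if z: "z \<in> hcomp ?F u" "\<pi> z = \<zero>\<^bsub>M\<^esub>" for u z n
  proof (cases "n < f u")
    case False
    then show ?thesis using supp(2)[OF hcompD(1)[OF gm_free z(1)]] by (auto simp: fib_def)
  next
    case True
    note zF = hcompD(1)[OF gm_free z(1)]
    \<comment> \<open>The terms of \<pi> z are split into those with generators of degree
      \<open>u\<close> and the others. The second group is decomposable, and the coefficients in the
      first have degree 0, hence are scalars; independence modulo decomposable elements forces these
      scalars to be zero.\<close>
    let ?A = "Pair u ` {..<f u}" and ?B = "{i. z i \<noteq> \<zero>\<^bsub>R\<^esub> \<and> fst i \<noteq> u}"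
    have AB: "finite ?A" "finite ?B" "?A \<inter> ?B = {}" "{i. z i \<noteq> \<zero>\<^bsub>R\<^esub>} \<subseteq> ?A \<union> ?B" "?A \<union> ?B \<subseteq> fib f"
      using supp[OF zF] by (auto simp: fib_def intro: finite_subset)
    have zc: "z i \<in> carrier R" for i by (rule supp(3)[OF zF])
    have wc: "(\<lambda>i. z i \<odot>\<^bsub>M\<^esub> ?gen i) \<in> ?A \<union> ?B \<rightarrow> carrier M" using AB(5) gc zc by auto
    have "\<zero>\<^bsub>M\<^esub> = (\<Oplus>\<^bsub>M\<^esub>i\<in>?A \<union> ?B. z i \<odot>\<^bsub>M\<^esub> ?gen i)"
      using \<pi>sum[OF zF _ AB(4,5)] AB z(2) by simp
    also have "\<dots> = (\<Oplus>\<^bsub>M\<^esub>i\<in>?A. z i \<odot>\<^bsub>M\<^esub> ?gen i) \<oplus>\<^bsub>M\<^esub> (\<Oplus>\<^bsub>M\<^esub>i\<in>?B. z i \<odot>\<^bsub>M\<^esub> ?gen i)"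
      using AB wc by (intro M.finsum_Un_disjoint) auto
    finally have sum0: "\<zero>\<^bsub>M\<^esub> = (\<Oplus>\<^bsub>M\<^esub>i\<in>?A. z i \<odot>\<^bsub>M\<^esub> ?gen i) \<oplus>\<^bsub>M\<^esub> (\<Oplus>\<^bsub>M\<^esub>i\<in>?B. z i \<odot>\<^bsub>M\<^esub> ?gen i)" .
    have B: "(\<Oplus>\<^bsub>M\<^esub>i\<in>?B. z i \<odot>\<^bsub>M\<^esub> ?gen i) \<in> decomposables M u"
    proof (rule sumH[OF dec(1) AB(2)])
      fix i assume i: "i \<in> ?B"
      then have fi: "i \<in> fib f" using AB by blast
      have "z i \<in> hcomp R (u - fst i)" using z(1) unfolding free_carrier(2) by blast
      then show "z i \<odot>\<^bsub>M\<^esub> ?gen i \<in> decomposables M u"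
        using i gh[OF fi] by (intro dec(3)[of "u - fst i"]) auto
    qed
    have "\<forall>m. \<exists>a\<in>carrier k. z (u, m) = a \<odot>\<^bsub>R\<^esub> \<one>\<^bsub>R\<^esub>"
    proof
      fix m
      have "z (u, m) \<in> hcomp R (u - fst (u, m))" using z(1) unfolding free_carrier(2) by blast
      then have "z (u, m) \<in> hcomp R 0" by simp
      then show "\<exists>a\<in>carrier k. z (u, m) = a \<odot>\<^bsub>R\<^esub> \<one>\<^bsub>R\<^esub>" using hcomp_zero_scalar by blast
    qed
    then obtain a where a: "a m \<in> carrier k" "z (u, m) = a m \<odot>\<^bsub>R\<^esub> \<one>\<^bsub>R\<^esub>" for m by metis
    have Aeq: "(\<Oplus>\<^bsub>M\<^esub>i\<in>?A. z i \<odot>\<^bsub>M\<^esub> ?gen i) = (\<Oplus>\<^bsub>M\<^esub>m\<in>{..<f u}. (a m \<odot>\<^bsub>R\<^esub> \<one>\<^bsub>R\<^esub>) \<odot>\<^bsub>M\<^esub> b u m)"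
      using wc a by (subst M.finsum_reindex) (auto simp: inj_on_def)
    have Ac: "(\<Oplus>\<^bsub>M\<^esub>i\<in>?A. z i \<odot>\<^bsub>M\<^esub> ?gen i) \<in> carrier M" using wc by (intro M.finsum_closed) auto
    have "(\<Oplus>\<^bsub>M\<^esub>i\<in>?A. z i \<odot>\<^bsub>M\<^esub> ?gen i) \<in> decomposables M u"
      using V.sub_add_iff[OF dec(1) B Ac[folded restrict_scalars_simps(1)[of R M]]] sum0 V.subD(1,2)[OF dec(1)[of u]] B Ac
      by (simp add: M.a_comm)
    then have "a n = \<zero>\<^bsub>k\<^esub>" unfolding Aeq using bind[of a u n] a(1) True by auto
    then show ?thesis using a(2)[of n] by simp
  qed
  show ?thesis
  proof (rule that[OF bs \<pi>g surj])
    show "g \<in> Supp M" if "f g \<noteq> 0" for g by (rule fS[OF that])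
    show "z (u, n) = \<zero>\<^bsub>R\<^esub>" if "z \<in> hcomp ?F u" "\<pi> z = \<zero>\<^bsub>M\<^esub>" for u z n by (rule ker[OF that])
  qed
qed

text \<open>\<open>gr_free\<close> asks for a basis that is a set of elements of \<open>F\<close>
  indexed by itself. The images of the unit vectors are distinct because 1 is not 0, so the index
  set \<open>I\<close> may be replaced by the set of these images.\<close>

lemma free_gr_free:
  assumes F: "gm F" and \<alpha>: "gr_isomorphism R F (free I d) \<alpha>"
  shows "gr_free R F"
proof -
  interpret dom: domain R by (rule domain)
  define \<psi> where "\<psi> = inv_into (carrier F) \<alpha>"
  have \<psi>: "gr_isomorphism R (free I d) F \<psi>"
    unfolding \<psi>_def by (rule gr_isomorphism_inv[OF \<alpha> gm_module[OF F] gm_module[OF gm_free] hcomp_carrier[OF F]])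
  note \<psi>' = gr_isomorphismD[OF \<psi>]
  define e where "e i = \<psi> (free_gen R i)" for i
  have fg: "free_gen R i \<in> carrier (free I d)" if "i \<in> I" for i
    using free_gen_closed[OF that] by (simp add: free_gmodule_simps)
  have eh: "e i \<in> hcomp F (d i)" if "i \<in> I" for i
    unfolding e_def by (rule gr_mapsD(2)[OF \<psi>'(1) free_gen_hcomp[OF that]])
  have inj: "inj_on e I"
  proof (rule inj_onI)
    fix i j assume ij: "i \<in> I" "j \<in> I" "e i = e j"
    then have "free_gen R i = free_gen R j" using inj_onD[OF \<psi>'(5)] fg unfolding e_def by blast
    then have "free_gen R i i = free_gen R j i" by simp
    then show "i = j" using dom.one_not_zero by (auto simp: free_gen_def split: if_splits)
  qed
  let ?B = "e ` I" and ?\<rho> = "\<lambda>x i. if i \<in> I then x (e i) else \<zero>\<^bsub>R\<^esub>"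
  have Be: "bij_betw e I ?B" using inj by (simp add: bij_betw_def)
  have \<rho>: "?\<rho> \<in> lin_maps R (free_module R ?B) (free_module R I)"
      "bij_betw ?\<rho> (carrier (free_module R ?B)) (carrier (free_module R I))"
    using twist_reindex_map[where N = "regular_module R" and \<beta> = e and I = I and J = ?B and e = "\<lambda>_. 0" and d = "\<lambda>_. 0", OF gm_regular Be]
    unfolding lin_maps_free(1)[of ?B _ "\<lambda>_. 0"] lin_maps_free(2)[of _ I "\<lambda>_. 0"]
      free_gmodule_simps(1)[of ?B "\<lambda>_. 0", symmetric] free_gmodule_simps(1)[of I "\<lambda>_. 0", symmetric] free_gmodule_def
      regular_module_simps(3)
    by (auto simp: gr_maps_def)
  have Bc: "b \<in> carrier F" if "b \<in> ?B" for b using that eh hcompD(1)[OF F] by blast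
  obtain \<theta> where \<theta>: "\<theta> \<in> lin_maps R (free_module R ?B) F" "\<And>b. b \<in> ?B \<Longrightarrow> \<theta> (free_gen R b) = b"
      "\<And>z. z \<in> carrier (free_module R ?B) \<Longrightarrow> \<theta> z = (\<Oplus>\<^bsub>F\<^esub>b\<in>{b. z b \<noteq> \<zero>\<^bsub>R\<^esub>}. z b \<odot>\<^bsub>F\<^esub> b)"
    using free_lift[where X = ?B and g = "\<lambda>b. b", OF gm_module[OF F] Bc] by blast
  have \<psi>l: "\<psi> \<in> lin_maps R (free_module R I) F" using \<psi>'(2) unfolding lin_maps_free(1)[of I _ d] .
  have eq: "\<theta> z = \<psi> (?\<rho> z)" if z: "z \<in> carrier (free_module R ?B)" for z
  proof (rule free_lin_eqI[where f = \<theta> and h = "\<lambda>z. \<psi> (?\<rho> z)", OF gm_module[OF F] \<theta>(1) lin_maps_comp[OF \<rho>(1) \<psi>l] _ z])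
    fix b assume "b \<in> ?B"
    then obtain i where i: "i \<in> I" "b = e i" by blast
    have "?\<rho> (free_gen R b) = free_gen R i" using i inj by (auto simp: free_gen_def fun_eq_iff inj_on_def)
    then show "\<theta> (free_gen R b) = \<psi> (?\<rho> (free_gen R b))" using \<theta>(2)[of b] i by (simp add: e_def)
  qed
  have "bij_betw (\<lambda>z. \<psi> (?\<rho> z)) (carrier (free_module R ?B)) (carrier F)"
    using bij_betw_trans[OF \<rho>(2), of \<psi> "carrier F"] \<psi>'(3) by (simp add: free_gmodule_simps comp_def)
  then have bij: "bij_betw \<theta> (carrier (free_module R ?B)) (carrier F)"
    using bij_betw_cong[of "carrier (free_module R ?B)" \<theta> "\<lambda>z. \<psi> (?\<rho> z)"] eq by simp
  show ?thesis
    unfolding gr_free_def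
  proof (intro exI[of _ ?B] conjI ballI)
    show "?B \<subseteq> (\<Union>g. hcomp F g)" using eh by blast
    fix x assume "x \<in> carrier F"
    then have "x \<in> \<theta> ` carrier (free_module R ?B)" using bij_betw_imp_surj_on[OF bij] by simp
    then obtain z where z: "z \<in> carrier (free_module R ?B)" "\<theta> z = x" by blast
    show "\<exists>!c. c \<in> carrier (free_module R ?B) \<and> x = (\<Oplus>\<^bsub>F\<^esub>b\<in>{b. c b \<noteq> \<zero>\<^bsub>R\<^esub>}. c b \<odot>\<^bsub>F\<^esub> b)"
    proof (rule ex1I[of _ z])
      show "z \<in> carrier (free_module R ?B) \<and> x = (\<Oplus>\<^bsub>F\<^esub>b\<in>{b. z b \<noteq> \<zero>\<^bsub>R\<^esub>}. z b \<odot>\<^bsub>F\<^esub> b)" using z \<theta>(3) by auto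
      fix c assume "c \<in> carrier (free_module R ?B) \<and> x = (\<Oplus>\<^bsub>F\<^esub>b\<in>{b. c b \<noteq> \<zero>\<^bsub>R\<^esub>}. c b \<odot>\<^bsub>F\<^esub> b)"
      then have "c \<in> carrier (free_module R ?B)" "\<theta> c = \<theta> z" using \<theta>(3)[of c] z by auto
      then show "c = z" using bij z(1) by (auto simp: bij_betw_def dest: inj_onD)
    qed
  qed
qed

lemma gr_free_projective:
  assumes F: "gm F" and fr: "gr_free R F"
  shows "projective R F"
proof -
  obtain B where B: "B \<subseteq> (\<Union>g. hcomp F g)"
      "\<forall>x\<in>carrier F. \<exists>!c. c \<in> carrier (free_module R B) \<and> x = (\<Oplus>\<^bsub>F\<^esub>b\<in>{b. c b \<noteq> \<zero>\<^bsub>R\<^esub>}. c b \<odot>\<^bsub>F\<^esub> b)"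
    using fr unfolding gr_free_def by blast
  have Bc: "b \<in> carrier F" if "b \<in> B" for b using that B hcompD(1)[OF F] by blast
  obtain \<theta> where \<theta>: "\<theta> \<in> lin_maps R (free_module R B) F"
      "\<And>z. z \<in> carrier (free_module R B) \<Longrightarrow> \<theta> z = (\<Oplus>\<^bsub>F\<^esub>b\<in>{b. z b \<noteq> \<zero>\<^bsub>R\<^esub>}. z b \<odot>\<^bsub>F\<^esub> b)"
    by (rule free_lift[where X = B and g = "\<lambda>b. b", OF gm_module[OF F] Bc]) (assumption, rule that)
  interpret t: lin_map R "free_module R B" F \<theta> by (rule lin_mapI[OF free_module_module gm_module[OF F] \<theta>(1)])
  have ex1: "\<exists>!c. c \<in> carrier (free_module R B) \<and> x = \<theta> c" if "x \<in> carrier F" for x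
  proof -
    have "c \<in> carrier (free_module R B) \<and> x = \<theta> c \<longleftrightarrow>
        c \<in> carrier (free_module R B) \<and> x = (\<Oplus>\<^bsub>F\<^esub>b\<in>{b. c b \<noteq> \<zero>\<^bsub>R\<^esub>}. c b \<odot>\<^bsub>F\<^esub> b)" for c
      using \<theta>(2) by auto
    then show ?thesis using B(2) that by simp
  qed
  have bij: "bij_betw \<theta> (carrier (free_module R B)) (carrier F)"
    by (rule bij_betwI') (use ex1 t.map_simps(1) in blast)+
  have inv: "inv_into (carrier (free_module R B)) \<theta> \<in> lin_maps R F (free_module R B)"
    by (rule lin_maps_inv[OF free_module_module gm_module[OF F] \<theta>(1) bij])
  have "\<forall>x\<in>carrier F. \<theta> (inv_into (carrier (free_module R B)) \<theta> x) = x"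
    using bij by (auto simp: bij_betw_def f_inv_into_f)
  then show ?thesis unfolding projective_def using gm_module[OF F] inv \<theta>(1) by blast
qed

text \<open>Nakayama: if \<open>s\<close> splits the minimal cover, the kernel is spanned by decomposable elements,
  hence vanishes in each minimal degree of its support.\<close>

lemma projective_free:
  fixes M :: "('a, 'b, 'g) gmodule"
  assumes M: "bdf M" and P: "projective R M"
  obtains f where "bounded (supp f)" "gr_isomorphic R M (free (fib f) fst)"
proof -
  note gM = bdfD(1)[OF M]
  obtain f :: "'g \<Rightarrow> nat" and \<pi> where f: "bounded (supp f)" and \<pi>: "\<pi> \<in> gr_maps R (free (fib f) fst) M"
    and surj: "\<pi> ` carrier (free (fib f) fst) = carrier M"
    and ker: "\<And>u z n. z \<in> hcomp (free (fib f) fst) u \<Longrightarrow> \<pi> z = \<zero>\<^bsub>M\<^esub> \<Longrightarrow> z (u, n) = \<zero>\<^bsub>R\<^esub>"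
    using minimal_cover[OF M] by metis
  let ?F = "free (fib f) fst"
  interpret p: lin_map R ?F M \<pi> by (rule lin_map_gr[OF gm_free gM \<pi>])
  obtain X :: "'b set" and i q where i: "i \<in> lin_maps R M (free_module R X)" and q: "q \<in> lin_maps R (free_module R X) M"
    and qi: "\<forall>x\<in>carrier M. q (i x) = x" using P unfolding projective_def by blast
  \<comment> \<open>The map \<open>q\<close> from the free module is lifted through \<pi> generator
    by generator. Composed with \<open>i\<close> this gives a section of \<pi>, which need not
    respect degrees.\<close>
  have "\<exists>y\<in>carrier ?F. \<pi> y = q (free_gen R x)" if "x \<in> X" for x
  proof -
    have "q (free_gen R x) \<in> carrier M" using q free_gen_closed[OF that] by (auto simp: lin_maps_def)
    then show ?thesis using surj by (metis imageE)
  qed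
  then obtain y where y: "\<And>x. x \<in> X \<Longrightarrow> y x \<in> carrier ?F" "\<And>x. x \<in> X \<Longrightarrow> \<pi> (y x) = q (free_gen R x)" by metis
  obtain h where h: "h \<in> lin_maps R (free_module R X) ?F" "\<And>x. x \<in> X \<Longrightarrow> h (free_gen R x) = y x"
    by (rule free_lift[where X = X and g = y, OF gm_module[OF gm_free] y(1)]) (assumption, rule that)
  define s where "s x = h (i x)" for x
  have s: "s \<in> lin_maps R M ?F" unfolding s_def by (rule lin_maps_comp[OF i h(1)])
  have ps: "\<pi> (s x) = x" if x: "x \<in> carrier M" for x
  proof -
    have ix: "i x \<in> carrier (free_module R X)" using i x by (auto simp: lin_maps_def)
    have "\<pi> (h z) = q z" if "z \<in> carrier (free_module R X)" for z
      by (rule free_lin_eqI[where f = "\<lambda>z. \<pi> (h z)", OF gm_module[OF gM] lin_maps_comp[OF h(1) gr_mapsD(1)[OF \<pi>]] q _ that])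
        (simp add: h(2) y(2))
    then show ?thesis unfolding s_def using ix qi x by simp
  qed
  interpret s: lin_map R M ?F s by (rule lin_mapI[OF gm_module[OF gM] gm_module[OF gm_free] s])
  \<comment> \<open>The projection of the free module onto the kernel of \<pi> along the section; it
    is linear and fixes the kernel, but it need not be graded.\<close>
  define E where "E z = z \<ominus>\<^bsub>?F\<^esub> s (\<pi> z)" for z
  have Ec: "E z \<in> carrier ?F" "\<pi> (E z) = \<zero>\<^bsub>M\<^esub>" if "z \<in> carrier ?F" for z
    using that ps by (simp_all add: E_def a_minus_def p.W.r_neg)
  have El: "E \<in> lin_maps R (free_module R (fib f)) ?F"
    unfolding lin_maps_free(1)[of _ _ fst]
  proof -
    have "E (x \<oplus>\<^bsub>?F\<^esub> y) = E x \<oplus>\<^bsub>?F\<^esub> E y" if "x \<in> carrier ?F" "y \<in> carrier ?F" for x y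
      using that by (simp add: E_def a_minus_def p.V.minus_add p.V.a_ac)
    moreover have "E (r \<odot>\<^bsub>?F\<^esub> x) = r \<odot>\<^bsub>?F\<^esub> E x" if "r \<in> carrier R" "x \<in> carrier ?F" for r x
      using that by (simp add: E_def a_minus_def p.V.smult_r_distr p.V.smult_r_minus)
    ultimately show "E \<in> lin_maps R ?F ?F" using Ec by (auto simp: lin_maps_def)
  qed
  have fgc: "free_gen R i \<in> carrier ?F" if "i \<in> fib f" for i
    using free_gen_closed[OF that] by (simp add: free_gmodule_simps)
  have Esum: "E z = (\<Oplus>\<^bsub>?F\<^esub>i\<in>{i. z i \<noteq> \<zero>\<^bsub>R\<^esub>}. z i \<odot>\<^bsub>?F\<^esub> E (free_gen R i))" if z: "z \<in> carrier ?F" for z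
  proof -
    obtain h' where h': "h' \<in> lin_maps R (free_module R (fib f)) ?F" "\<And>x. x \<in> fib f \<Longrightarrow> h' (free_gen R x) = E (free_gen R x)"
        "\<And>z. z \<in> carrier (free_module R (fib f)) \<Longrightarrow> h' z = (\<Oplus>\<^bsub>?F\<^esub>x\<in>{x. z x \<noteq> \<zero>\<^bsub>R\<^esub>}. z x \<odot>\<^bsub>?F\<^esub> E (free_gen R x))"
      using free_lift[where X = "fib f" and g = "\<lambda>i. E (free_gen R i)", OF gm_module[OF gm_free] Ec(1)[OF fgc]] by blast
    have z': "z \<in> carrier (free_module R (fib f))" using z by (simp add: free_gmodule_simps)
    show ?thesis
      using free_lin_eqI[OF gm_module[OF gm_free] El h'(1) _ z'] h'(2,3) z' by simp
  qed
  \<comment> \<open>The degrees in which the kernel is nonzero. If there were any, one with the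
    fewest kernel degrees below it would be minimal.\<close>
  define K where "K = {u. \<exists>z\<in>hcomp ?F u. \<pi> z = \<zero>\<^bsub>M\<^esub> \<and> z \<noteq> \<zero>\<^bsub>?F\<^esub>}"
  have bF: "bdf ?F" by (rule bdf_free(1)[OF graded_index_fib(1)[OF f]])
  have KS: "K \<subseteq> Supp ?F"
  proof
    fix u assume "u \<in> K"
    then obtain z where "z \<in> hcomp ?F u" "z \<noteq> \<zero>\<^bsub>?F\<^esub>" by (auto simp: K_def)
    then show "u \<in> Supp ?F" by (rule SuppI)
  qed
  have "K = {}"
  proof (rule ccontr)
    assume "K \<noteq> {}"
    then obtain g where g: "g \<in> K" by blast
    define L where "L = (\<lambda>u. {v \<in> K. le_monoid (Supp R) v u})"
    have finL: "finite (L u)" for u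
      unfolding L_def by (rule finite_subset[OF _ Q.bounded_down_finite[OF bdfD(2)[OF bF]]]) (use KS in auto)
    obtain u where u: "u \<in> K" "\<And>v. v \<in> K \<Longrightarrow> card (L u) \<le> card (L v)"
      using ex_has_least_nat[of "\<lambda>u. u \<in> K" g "\<lambda>u. card (L u)"] g by blast
    have min: "v \<notin> K" if "le_monoid (Supp R) v u" "v \<noteq> u" for v
    proof
      assume v: "v \<in> K"
      have "L v \<subseteq> L u" using Q.le_trans[OF _ that(1)] by (auto simp: L_def)
      moreover have "u \<in> L u" "u \<notin> L v" using u(1) Q.le_refl Q.le_antisym[OF that(1)] that(2) by (auto simp: L_def)
      ultimately have "L v \<subset> L u" by blast
      from psubset_card_mono[OF finL this] show False using u(2)[OF v] by simp
    qed
    obtain z where z: "z \<in> hcomp ?F u" "\<pi> z = \<zero>\<^bsub>M\<^esub>" "z \<noteq> \<zero>\<^bsub>?F\<^esub>" using u(1) by (auto simp: K_def)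
    have zF: "z \<in> carrier ?F" using hcompD(1)[OF gm_free z(1)] .
    have zs: "finite {i. z i \<noteq> \<zero>\<^bsub>R\<^esub>}" "{i. z i \<noteq> \<zero>\<^bsub>R\<^esub>} \<subseteq> fib f" "\<And>i. z i \<in> carrier R" using zF by (auto simp: free_carrier)
    \<comment> \<open>The coefficient \<open>z i\<close> has degree \<open>u - fst i\<close>, so
      only the component of \<open>E (free_gen R i)\<close> in degree \<open>fst i\<close> reaches
      degree \<open>u\<close>. That component is a kernel element, and minimality of the cover makes
      \<open>fst i\<close> strictly smaller than \<open>u\<close>, where the kernel
      vanishes.\<close>
    have part: "hproj ?F u (z i \<odot>\<^bsub>?F\<^esub> E (free_gen R i)) = \<zero>\<^bsub>?F\<^esub>" if i: "z i \<noteq> \<zero>\<^bsub>R\<^esub>" for i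
    proof -
      have ifib: "i \<in> fib f" using zs(2) i by blast
      have zi: "z i \<in> hcomp R (u - fst i)" using z(1) unfolding free_carrier(2) by blast
      have ne: "fst i \<noteq> u" using ker[OF z(1,2), of "snd i"] i by auto
      have "le_monoid (Supp R) (fst i) u" unfolding le_monoid_def by (rule SuppI[OF zi i])
      then have nK: "fst i \<notin> K" using min ne by blast
      let ?w = "hproj ?F (fst i) (E (free_gen R i))"
      have "\<pi> ?w = hproj M (fst i) (\<pi> (E (free_gen R i)))"
        using hproj_map[OF gm_free gM \<pi> Ec(1)[OF fgc[OF ifib]]] by simp
      also have "\<dots> = \<zero>\<^bsub>M\<^esub>" using Ec(2)[OF fgc[OF ifib]] hproj_homogeneous[OF gM hcompD(2)[OF gM], of "fst i" "fst i"] by simp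
      finally have "?w = \<zero>\<^bsub>?F\<^esub>" using nK hproj(1)[OF gm_free Ec(1)[OF fgc[OF ifib]]] unfolding K_def by blast
      moreover have "hproj ?F u (z i \<odot>\<^bsub>?F\<^esub> E (free_gen R i)) = z i \<odot>\<^bsub>?F\<^esub> ?w"
        using hproj_smult[OF gm_free Ec(1)[OF fgc[OF ifib]] zi, of "fst i"] by simp
      ultimately show ?thesis using zs(3)[of i] p.V.smult_r_null by simp
    qed
    have "E z = z" using z(2) zF s.map_zero by (simp add: E_def a_minus_def)
    then have "z = hproj ?F u (E z)" using hproj_homogeneous[OF gm_free z(1), of u] by simp
    also have "\<dots> = (\<Oplus>\<^bsub>?F\<^esub>i\<in>{i. z i \<noteq> \<zero>\<^bsub>R\<^esub>}. hproj ?F u (z i \<odot>\<^bsub>?F\<^esub> E (free_gen R i)))"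
      unfolding Esum[OF zF]
      by (rule hproj_finsum[OF gm_free zs(1)]) (use zs Ec(1)[OF fgc] in \<open>auto simp: subset_iff intro!: p.V.smult_closed\<close>)
    also have "\<dots> = \<zero>\<^bsub>?F\<^esub>" using part by (intro p.V.add.finprod_one_eqI) auto
    finally show False using z(3) by simp
  qed
  have "inj_on \<pi> (carrier ?F)"
  proof (rule p.inj_onI_kernel)
    fix z assume z: "z \<in> carrier ?F" "\<pi> z = \<zero>\<^bsub>M\<^esub>"
    show "z = \<zero>\<^bsub>?F\<^esub>"
    proof (rule hproj_zero_imp[OF gm_free z(1)])
      fix u
      have "\<pi> (hproj ?F u z) = \<zero>\<^bsub>M\<^esub>"
        using hproj_map[OF gm_free gM \<pi> z(1), of u] z(2) hproj_homogeneous[OF gM hcompD(2)[OF gM], of u u] by simp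
      then show "hproj ?F u z = \<zero>\<^bsub>?F\<^esub>" using \<open>K = {}\<close> hproj(1)[OF gm_free z(1)] unfolding K_def by blast
    qed
  qed
  then have "gr_isomorphic R ?F M" unfolding gr_isomorphic_def using \<pi> surj by (auto simp: bij_betw_def)
  then show ?thesis using that f gr_isomorphic_sym gm_free gM by blast
qed

end

section \<open>Minimal syzygies and the alternating sum of their ranks\<close>

context pdcf
begin

abbreviation "hR \<equiv> hilb (regular_module R)"

lemma ses_hilb: "ses R L M N f h \<Longrightarrow> bdf L \<Longrightarrow> bdf M \<Longrightarrow> bdf N \<Longrightarrow> hilb M = hilb L + hilb N"
  by (rule hilb_short_exact[OF ses_short_exact])

text \<open>One step of a minimal resolution. The last clause records that every degree of the
  syzygy lies strictly above a degree of the module; the local finiteness of the resolution rests on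
  this growth.\<close>

definition syzygy_step ::
    "('a, 'b, 'g) gmodule \<Rightarrow> ('a, 'c, 'g) gmodule \<Rightarrow> ('g \<Rightarrow> nat) \<Rightarrow> ('d \<Rightarrow> 'c) \<Rightarrow> ('c \<Rightarrow> 'b) \<Rightarrow> ('a, 'd, 'g) gmodule \<Rightarrow> bool"
  where "syzygy_step N F f \<iota> \<pi> N' \<longleftrightarrow> bdf F \<and> bdf N' \<and> bounded (supp f) \<and> gr_isomorphic R F (free (fib f) fst) \<and>
    ses R N' F N \<iota> \<pi> \<and> supp f \<subseteq> Supp N \<and> (\<forall>h\<in>Supp N'. \<exists>q\<in>Supp R. q \<noteq> 0 \<and> h - q \<in> Supp N)"

text \<open>Both the cover and its kernel are moved to the universal carrier type, so that the step
  can be iterated at a fixed type.\<close>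

lemma syzygy_step_exists:
  fixes N :: "('k, 'a, 'g) umodule"
  assumes N: "bdf N"
  shows "\<exists>(F :: ('k, 'a, 'g) umodule) f \<iota> \<pi> (N' :: ('k, 'a, 'g) umodule). syzygy_step N F f \<iota> \<pi> N'"
proof -
  note gN = bdfD(1)[OF N]
  obtain f :: "'g \<Rightarrow> nat" and \<pi>0 where f: "bounded (supp f)" and \<pi>0: "\<pi>0 \<in> gr_maps R (free (fib f) fst) N"
    and surj: "\<pi>0 ` carrier (free (fib f) fst) = carrier N" and fS: "\<And>g. f g \<noteq> 0 \<Longrightarrow> g \<in> Supp N"
    and ker: "\<And>u z n. z \<in> hcomp (free (fib f) fst) u \<Longrightarrow> \<pi>0 z = \<zero>\<^bsub>N\<^esub> \<Longrightarrow> z (u, n) = \<zero>\<^bsub>R\<^esub>"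
    using minimal_cover[OF N] by metis
  let ?E = "free (fib f) fst"
  have bE: "bdf ?E" by (rule bdf_free(1)[OF graded_index_fib(1)[OF f]])
  obtain F :: "('k, 'a, 'g) umodule" where F: "bdf F" "gr_isomorphic R ?E F"
    using BDF_representable[OF bE] by blast
  note gF = bdfD(1)[OF F(1)]
  obtain \<alpha> where \<alpha>: "gr_isomorphism R F ?E \<alpha>"
    using gr_isomorphicE[OF gr_isomorphic_sym[OF F(2) gm_free gF] gF gm_free] by blast
  note \<alpha>' = gr_isomorphismD[OF \<alpha>]
  define \<pi> where "\<pi> x = \<pi>0 (\<alpha> x)" for x
  have \<pi>: "\<pi> \<in> gr_maps R F N" unfolding \<pi>_def by (rule gr_maps_comp[OF \<alpha>'(1) \<pi>0])
  have \<pi>s: "\<pi> ` carrier F = carrier N" unfolding \<pi>_def using \<alpha>'(6) surj by (metis image_image)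
  have hk: "homogeneous_submodule R F (a_kernel F N \<pi>)" by (rule kernel_homogeneous[OF gF gN \<pi>])
  define K where "K = sub_gmodule F (a_kernel F N \<pi>)"
  have bK: "bdf K" unfolding K_def by (rule bdf_sub(1)[OF hk F(1)])
  obtain N' :: "('k, 'a, 'g) umodule" where N': "bdf N'" "gr_isomorphic R K N'"
    using BDF_representable[OF bK] by blast
  obtain \<iota> where \<iota>0: "gr_isomorphism R N' K \<iota>"
    using gr_isomorphicE[OF gr_isomorphic_sym[OF N'(2)]] bdfD(1) bK N'(1) by blast
  note \<iota>' = gr_isomorphismD[OF \<iota>0]
  have \<iota>: "\<iota> \<in> gr_maps R N' F"
    using gr_maps_comp[OF \<iota>'(1)[unfolded K_def] sub_gmodule_incl[OF hk gm_module[OF gF]]] .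
  have s: "ses R N' F N \<iota> \<pi>"
    unfolding ses_def using \<iota> \<pi> \<pi>s \<iota>'(5,6) by (simp add: K_def)
  \<comment> \<open>A nonzero kernel element of degree \<open>h\<close> has a nonzero coordinate
    \<open>j\<close>. The generator \<open>j\<close> has a degree of the support of
    \<open>N\<close>, the coordinate has degree \<open>h - fst j\<close> in \<open>Supp R\<close>,
    and minimality of the cover excludes \<open>fst j = h\<close>.\<close>
  have grow: "\<exists>q\<in>Supp R. q \<noteq> 0 \<and> h - q \<in> Supp N" if h: "h \<in> Supp N'" for h
  proof -
    obtain y where y: "y \<in> hcomp N' h" "y \<noteq> \<zero>\<^bsub>N'\<^esub>" using gm_SuppE[OF bdfD(1)[OF N'(1)] h] by blast
    interpret i: lin_map R N' F \<iota> by (rule lin_map_gr[OF bdfD(1)[OF N'(1)] gF \<iota>])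
    interpret a: lin_map R F ?E \<alpha> by (rule lin_map_gr[OF gF gm_free \<alpha>'(1)])
    have yc: "y \<in> carrier N'" using hcompD(1)[OF bdfD(1)[OF N'(1)] y(1)] .
    have i0: "\<iota> y \<noteq> \<zero>\<^bsub>F\<^esub>" using inj_onD[OF \<iota>'(5) _ yc i.V.zero_closed] y(2) i.map_zero by auto
    define z where "z = \<alpha> (\<iota> y)"
    have z: "z \<in> hcomp ?E h" unfolding z_def by (intro gr_mapsD(2)[OF \<alpha>'(1)] gr_mapsD(2)[OF \<iota>] y)
    have z0: "z \<noteq> \<zero>\<^bsub>?E\<^esub>"
      using inj_onD[OF \<alpha>'(5) _ i.map_simps(1)[OF yc] i.W.zero_closed] i0 a.map_zero unfolding z_def by auto
    have "\<iota> y \<in> a_kernel F N \<pi>" using \<iota>'(6) yc by (auto simp: K_def)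
    then have \<pi>z: "\<pi>0 z = \<zero>\<^bsub>N\<^esub>" by (simp add: a_kernel_eq \<pi>_def z_def)
    have "\<exists>j. z j \<noteq> \<zero>\<^bsub>R\<^esub>" using z0 unfolding free_ops by blast
    then obtain j where j: "z j \<noteq> \<zero>\<^bsub>R\<^esub>" by blast
    have "j \<in> fib f" using j hcompD(1)[OF gm_free z] unfolding free_carrier by blast
    then have "fst j \<in> Supp N" by (intro fS) (auto simp: fib_def)
    moreover have "fst j \<noteq> h" using ker[OF z \<pi>z, of "snd j"] j by auto
    moreover have "h - fst j \<in> Supp R" using SuppI[OF _ j] z unfolding free_carrier(2) by blast
    ultimately show ?thesis by (intro bexI[of _ "h - fst j"]) auto
  qed
  have "syzygy_step N F f \<iota> \<pi> N'"
    unfolding syzygy_step_def using F(1) N'(1) f gr_isomorphism_isomorphic[OF \<alpha>] s fS grow by (auto simp: supp_def)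
  then show ?thesis by blast
qed

definition syzygies ::
    "('k, 'a, 'g) umodule \<Rightarrow> (nat \<Rightarrow> ('k, 'a, 'g) umodule) \<Rightarrow> (nat \<Rightarrow> ('k, 'a, 'g) umodule) \<Rightarrow> (nat \<Rightarrow> 'g \<Rightarrow> nat)
      \<Rightarrow> (nat \<Rightarrow> ('g \<times> nat \<Rightarrow> 'k) \<Rightarrow> 'g \<times> nat \<Rightarrow> 'k) \<Rightarrow> (nat \<Rightarrow> ('g \<times> nat \<Rightarrow> 'k) \<Rightarrow> 'g \<times> nat \<Rightarrow> 'k) \<Rightarrow> bool"
  where "syzygies M N F f \<iota> \<pi> \<longleftrightarrow> N 0 = M \<and> (\<forall>i. bdf (N i) \<and> syzygy_step (N i) (F i) (f i) (\<iota> i) (\<pi> i) (N (Suc i)))"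

lemma syzygies_exist:
  assumes "bdf M"
  obtains N F f \<iota> \<pi> where "syzygies M N F f \<iota> \<pi>"
proof -
  have "\<exists>N. \<forall>n. (bdf (N n) \<and> (n = 0 \<longrightarrow> N n = M)) \<and>
      (\<exists>(F :: ('k, 'a, 'g) umodule) f \<iota> \<pi>. syzygy_step (N n) F f \<iota> \<pi> (N (Suc n)))"
  proof (rule dependent_nat_choice)
    show "\<exists>x. bdf x \<and> ((0::nat) = 0 \<longrightarrow> x = M)" using assms by blast
    fix x :: "('k, 'a, 'g) umodule" and n :: nat
    assume "bdf x \<and> (n = 0 \<longrightarrow> x = M)"
    then obtain F :: "('k, 'a, 'g) umodule" and f \<iota> \<pi> and N' :: "('k, 'a, 'g) umodule"
      where s: "syzygy_step x F f \<iota> \<pi> N'" using syzygy_step_exists by blast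
    then have "bdf N'" by (simp add: syzygy_step_def)
    then show "\<exists>y. (bdf y \<and> (Suc n = 0 \<longrightarrow> y = M)) \<and> (\<exists>(F :: ('k, 'a, 'g) umodule) f \<iota> \<pi>. syzygy_step x F f \<iota> \<pi> y)"
      using s by blast
  qed
  then obtain N where N: "\<And>n. bdf (N n)" "N 0 = M"
      "\<forall>n. \<exists>(F :: ('k, 'a, 'g) umodule) f \<iota> \<pi>. syzygy_step (N n) F f \<iota> \<pi> (N (Suc n))" by blast
  from N(3) obtain F f \<iota> \<pi> where "\<forall>n. syzygy_step (N n) (F n :: ('k, 'a, 'g) umodule) (f n) (\<iota> n) (\<pi> n) (N (Suc n))"
    by metis
  then have "syzygies M N F f \<iota> \<pi>" using N(1,2) by (simp add: syzygies_def)
  then show ?thesis by (rule that)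
qed

context
  fixes M N F f \<iota> \<pi>
  assumes syz: "syzygies M N F f \<iota> \<pi>"
begin

lemma syzygiesD:
  "N 0 = M" "bdf (N i)" "bdf (F i)" "bounded (supp (f i))" "gr_isomorphic R (F i) (free (fib (f i)) fst)"
  "ses R (N (Suc i)) (F i) (N i) (\<iota> i) (\<pi> i)" "supp (f i) \<subseteq> Supp (N i)"
  "h \<in> Supp (N (Suc i)) \<Longrightarrow> \<exists>q\<in>Supp R. q \<noteq> 0 \<and> h - q \<in> Supp (N i)"
  using syz by (auto simp: syzygies_def syzygy_step_def)

text \<open>All degrees below \<open>g\<close> that a syzygy of \<open>M\<close> can have. Their
  number bounds the length of a strictly descending chain of such degrees, hence the number of
  syzygies that reach degree \<open>g\<close>.\<close>

definition span_below :: "'g \<Rightarrow> 'g set"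
  where "span_below g = {v \<in> {u + q | u q. u \<in> Supp M \<and> q \<in> Supp R}. le_monoid (Supp R) v g}"

lemma bounded_upset: "bounded {u + q | u q. u \<in> Supp M \<and> q \<in> Supp R}"
  by (rule Q.bounded_plus[OF _ Q.bounded_monoid]) (use syzygiesD(1) bdfD(2)[OF syzygiesD(2)[of 0]] in simp)

lemma finite_span_below: "finite (span_below g)"
  unfolding span_below_def by (rule Q.bounded_down_finite[OF bounded_upset])

text \<open>Passing from the syzygy \<open>Suc i\<close> back to \<open>i\<close> moves
  \<open>h\<close> to a strictly smaller degree \<open>h - q\<close>, and at least \<open>h\<close>
  itself drops out of \<open>span_below\<close>.\<close>

lemma syzygy_height:
  "h \<in> Supp (N i) \<Longrightarrow> h \<in> {u + q | u q. u \<in> Supp M \<and> q \<in> Supp R} \<and> i < card (span_below h)"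
proof (induction i arbitrary: h)
  case 0
  then have "h \<in> Supp M" using syzygiesD(1) by simp
  then have h: "h \<in> {u + q | u q. u \<in> Supp M \<and> q \<in> Supp R}" using Q.zero_mem by force
  then have "h \<in> span_below h" by (simp add: span_below_def Q.le_refl)
  then show ?case using h card_gt_0_iff finite_span_below by blast
next
  case (Suc i)
  then obtain q where q: "q \<in> Supp R" "q \<noteq> 0" "h - q \<in> Supp (N i)" using syzygiesD(8) by blast
  note IH = Suc.IH[OF q(3)]
  then obtain u p where up: "h - q = u + p" "u \<in> Supp M" "p \<in> Supp R" by blast
  have "h = u + (p + q)" using up(1) by (simp add: algebra_simps)
  then have h: "h \<in> {u + q | u q. u \<in> Supp M \<and> q \<in> Supp R}" using up Q.add_mem[OF up(3) q(1)] by blast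
  have lt: "le_monoid (Supp R) (h - q) h" using q by (simp add: le_monoid_def)
  have "h \<notin> span_below (h - q)" using Q.le_antisym[OF lt] q(2) by (auto simp: span_below_def)
  moreover have "h \<in> span_below h" using h by (simp add: span_below_def Q.le_refl)
  moreover have "span_below (h - q) \<subseteq> span_below h" unfolding span_below_def using Q.le_trans[OF _ lt] by blast
  ultimately have "span_below (h - q) \<subset> span_below h" by blast
  from psubset_card_mono[OF finite_span_below this] have "Suc i < card (span_below h)"
    using conjunct2[OF IH] by simp
  with h show ?case by (rule conjI)
qed

lemma syzygy_vanish_at: "card (span_below g) \<le> i \<Longrightarrow> g \<notin> Supp (N i)"
  using syzygy_height[of g i] by auto

lemma card_span_below_mono: "le_monoid (Supp R) g h \<Longrightarrow> card (span_below g) \<le> card (span_below h)"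
  by (rule card_mono[OF finite_span_below]) (auto simp: span_below_def intro: Q.le_trans)

lemma syzygy_vanish:
  assumes "finite U"
  obtains m where "\<And>i g. m \<le> i \<Longrightarrow> g \<in> down_closure (Supp R) U \<Longrightarrow> g \<notin> Supp (N i)"
proof
  fix i g assume i: "Max (insert 0 ((\<lambda>u. card (span_below u)) ` U)) \<le> i" and "g \<in> down_closure (Supp R) U"
  then obtain u where u: "u \<in> U" "le_monoid (Supp R) g u" by (auto simp: down_closure_def)
  have "card (span_below g) \<le> card (span_below u)" by (rule card_span_below_mono[OF u(2)])
  also have "\<dots> \<le> i" using i u(1) assms by simp
  finally show "g \<notin> Supp (N i)" by (rule syzygy_vanish_at)
qed

lemma f_vanish: "card (span_below g) \<le> i \<Longrightarrow> f i g = 0"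
  using syzygy_vanish_at[of g i] syzygiesD(7)[of i] by (auto simp: supp_def)

text \<open>The alternating sum of the ranks in the minimal resolution of the syzygy
  \<open>N i\<close>. All later ranks in degree \<open>g\<close> are zero by
  \<open>f_vanish\<close>; the length of the sum is chosen independent of \<open>i\<close>, so that
  \<open>chi_rec\<close> is a mere shift of the index.\<close>

definition chi :: "nat \<Rightarrow> 'g \<Rightarrow> int"
  where "chi i g = (\<Sum>n<card (span_below g). (-1) ^ n * int (f (i + n) g))"

lemma chi_rec: "chi i = (\<lambda>g. int (f i g)) - chi (Suc i)"
proof
  fix g
  let ?c = "card (span_below g)"
  have "chi i g = (\<Sum>n<Suc ?c. (-1) ^ n * int (f (i + n) g))"
    unfolding chi_def using f_vanish[of g "i + ?c"] by simp
  also have "\<dots> = int (f i g) + (\<Sum>n<?c. (-1) ^ Suc n * int (f (i + Suc n) g))"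
    by (subst sum.lessThan_Suc_shift) simp
  also have "\<dots> = int (f i g) - chi (Suc i) g"
    by (simp add: chi_def sum_negf)
  finally show "chi i g = ((\<lambda>g. int (f i g)) - chi (Suc i)) g" by simp
qed

lemma bounded_chi: "bounded (supp (chi i))"
proof (rule Q.bounded_subset[OF bounded_upset])
  show "supp (chi i) \<subseteq> {u + q | u q. u \<in> Supp M \<and> q \<in> Supp R}"
  proof
    fix g assume "g \<in> supp (chi i)"
    then have "\<exists>n. f (i + n) g \<noteq> 0" unfolding supp_def chi_def
      using sum.neutral[of "{..<card (span_below g)}"] by (metis (mono_tags, lifting) mem_Collect_eq mult_zero_right of_nat_0)
    then obtain n where "f (i + n) g \<noteq> 0" by blast
    then have "g \<in> Supp (N (i + n))" using syzygiesD(7)[of "i + n"] by (auto simp: supp_def)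
    then show "g \<in> {u + q | u q. u \<in> Supp M \<and> q \<in> Supp R}" using syzygy_height by blast
  qed
qed

lemma chi_vanish: "card (span_below g) \<le> i \<Longrightarrow> chi i g = 0"
  unfolding chi_def by (rule sum.neutral) (use f_vanish[of g] in auto)

lemma bounded_f: "bounded (supp (\<lambda>g. int (f i g)))"
  using syzygiesD(4)[of i] by (simp add: supp_def)

lemma bounded_hR: "bounded (supp hR)"
  by (simp add: supp_hilb_regular Q.bounded_monoid)

lemma hilb_F: "hilb (F i) = conv (\<lambda>g. int (f i g)) hR"
  using hilb_iso[OF syzygiesD(5) syzygiesD(3) bdf_free(1)] bdf_free(2) graded_index_fib[OF syzygiesD(4)] by metis

text \<open>The difference of the two sides changes its sign when \<open>i\<close> is increased by
  1, since both sides satisfy the same recursion. For late syzygies both sides vanish in degree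
  \<open>g\<close>, so the difference is zero from the start.\<close>

lemma hilb_syzygy: "hilb (N i) = conv (chi i) hR"
proof
  fix g
  define \<delta> where "\<delta> j = hilb (N j) g - conv (chi j) hR g" for j
  have flip: "\<delta> j = - \<delta> (Suc j)" for j
  proof -
    have "hilb (F j) = hilb (N (Suc j)) + hilb (N j)"
      by (rule ses_hilb[OF syzygiesD(6) syzygiesD(2) syzygiesD(3) syzygiesD(2)])
    moreover have "conv (chi j) hR = conv (\<lambda>g. int (f j g)) hR - conv (chi (Suc j)) hR"
      by (subst chi_rec) (rule Q.conv_diff[OF bounded_f bounded_chi bounded_hR])
    ultimately show ?thesis unfolding \<delta>_def hilb_F by (simp add: fun_eq_iff)
  qed
  have "abs (\<delta> i) = abs (\<delta> (i + n))" for n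
  proof (induction n)
    case (Suc n)
    then show ?case using flip[of "i + n"] by simp
  qed simp
  moreover have "\<delta> (i + card (span_below g)) = 0"
  proof -
    let ?j = "i + card (span_below g)"
    have "hilb (N ?j) g = 0" using hilb_eq_0[OF syzygiesD(2)] syzygy_vanish_at[of g ?j] by simp
    moreover have "conv (chi ?j) hR g = 0"
    proof (rule Q.conv_vanish_on_down_set[where D = "{g}"])
      fix g' v assume g': "g' \<in> {g}" and "hR v \<noteq> 0"
      then have "le_monoid (Supp R) (g' - v) g" using supp_hilb_regular by (auto simp: supp_def le_monoid_def)
      from card_span_below_mono[OF this] show "chi ?j (g' - v) = 0" by (intro chi_vanish) simp
    qed simp
    ultimately show ?thesis by (simp add: \<delta>_def)
  qed
  ultimately have "\<delta> i = 0" by (metis abs_eq_0)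
  then show "hilb (N i) g = conv (chi i) hR g" by (simp add: \<delta>_def)
qed

lemma bounded_Supp_N: "bounded (\<Union>i. Supp (N (a i)))"
  by (rule Q.bounded_subset[OF bounded_upset]) (use syzygy_height in blast)

text \<open>Together with \<open>bounded_Supp_N\<close> this makes the direct sum of infinitely many
  syzygies a BDF module.\<close>

lemma finite_Supp_N: assumes "inj a" shows "finite {i. g \<in> Supp (N (a i))}"
proof (rule finite_subset)
  show "{i. g \<in> Supp (N (a i))} \<subseteq> a -` {..<card (span_below g)}" using syzygy_height by blast
  show "finite (a -` {..<card (span_below g)})" by (rule finite_vimageI[OF _ assms]) simp
qed

text \<open>The short exact sequences are spliced: the differential is the cover of the next syzygy
  followed by its inclusion, and injectivity of the inclusion identifies the kernels.\<close>

lemma syzygy_resolution: "free_resolution k R M F (\<lambda>i x. \<iota> i (\<pi> (Suc i) x))"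
  unfolding free_resolution_def
proof (intro conjI allI)
  note s = syzygiesD(6)[unfolded ses_def]
  have gF: "gm (F i)" and gN: "gm (N i)" for i using bdfD(1) syzygiesD by auto
  show "bdf (F i)" for i by (rule syzygiesD(3))
  show "gr_free R (F i)" for i
  proof -
    obtain \<alpha> where "gr_isomorphism R (F i) (free (fib (f i)) fst) \<alpha>"
      by (rule gr_isomorphicE[OF syzygiesD(5) gF gm_free])
    then show ?thesis by (rule free_gr_free[OF gF])
  qed
  show d: "(\<lambda>x. \<iota> i (\<pi> (Suc i) x)) \<in> gr_maps R (F (Suc i)) (F i)" for i
    using gr_maps_comp s by blast
  have im: "(\<lambda>x. \<iota> i (\<pi> (Suc i) x)) ` carrier (F (Suc i)) = \<iota> i ` carrier (N (Suc i))" for i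
    using s[of "Suc i"] by (metis image_image)
  have ker: "a_kernel (F (Suc i)) (F i) (\<lambda>x. \<iota> i (\<pi> (Suc i) x)) = a_kernel (F (Suc i)) (N (Suc i)) (\<pi> (Suc i))" for i
  proof -
    interpret i: lin_map R "N (Suc i)" "F i" "\<iota> i" using lin_map_gr[OF gN gF] s by blast
    interpret p: lin_map R "F (Suc i)" "N (Suc i)" "\<pi> (Suc i)" using lin_map_gr[OF gF gN] s by blast
    have "\<iota> i y = \<zero>\<^bsub>F i\<^esub> \<longleftrightarrow> y = \<zero>\<^bsub>N (Suc i)\<^esub>" if "y \<in> carrier (N (Suc i))" for y
      using s[of i] that inj_onD[of "\<iota> i" "carrier (N (Suc i))" y "\<zero>\<^bsub>N (Suc i)\<^esub>"] i.map_zero i.V.zero_closed by auto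
    then show ?thesis unfolding a_kernel_eq by auto
  qed
  show "(\<lambda>x. \<iota> (Suc i) (\<pi> (Suc (Suc i)) x)) ` carrier (F (Suc (Suc i))) = a_kernel (F (Suc i)) (F i) (\<lambda>x. \<iota> i (\<pi> (Suc i) x))" for i
    unfolding im ker using s by blast
  show "\<exists>\<epsilon>\<in>gr_maps R (F 0) M. \<epsilon> ` carrier (F 0) = carrier M \<and>
      (\<lambda>x. \<iota> 0 (\<pi> (Suc 0) x)) ` carrier (F 1) = a_kernel (F 0) M \<epsilon>"
    using s[of 0] im[of 0] syzygiesD(1) by (intro bexI[of _ "\<pi> 0"]) auto
qed

end

section \<open>Homology of chain complexes\<close>

definition complex :: "(nat \<Rightarrow> ('a, 'f, 'g) gmodule) \<Rightarrow> (nat \<Rightarrow> 'f \<Rightarrow> 'f) \<Rightarrow> bool"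
  where "complex C d \<longleftrightarrow> (\<forall>i. bdf (C i)) \<and> (\<forall>i. d i \<in> gr_maps R (C (Suc i)) (C i)) \<and>
    (\<forall>i. \<forall>x\<in>carrier (C (Suc (Suc i))). d i (d (Suc i) x) = \<zero>\<^bsub>C i\<^esub>)"

definition cycles :: "(nat \<Rightarrow> ('a, 'f, 'g) gmodule) \<Rightarrow> (nat \<Rightarrow> 'f \<Rightarrow> 'f) \<Rightarrow> nat \<Rightarrow> 'f set"
  where "cycles C d i = (case i of 0 \<Rightarrow> carrier (C 0) | Suc j \<Rightarrow> a_kernel (C i) (C j) (d j))"

definition zdim :: "(nat \<Rightarrow> ('a, 'f, 'g) gmodule) \<Rightarrow> (nat \<Rightarrow> 'f \<Rightarrow> 'f) \<Rightarrow> nat \<Rightarrow> 'g \<Rightarrow> int"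
  where "zdim C d i g = int (dim k (scal (C i)) (hcomp (C i) g \<inter> cycles C d i))"

definition bdim :: "(nat \<Rightarrow> ('a, 'f, 'g) gmodule) \<Rightarrow> (nat \<Rightarrow> 'f \<Rightarrow> 'f) \<Rightarrow> nat \<Rightarrow> 'g \<Rightarrow> int"
  where "bdim C d i g = int (dim k (scal (C i)) (d i ` hcomp (C (Suc i)) g))"

definition hdim :: "(nat \<Rightarrow> ('a, 'f, 'g) gmodule) \<Rightarrow> (nat \<Rightarrow> 'f \<Rightarrow> 'f) \<Rightarrow> nat \<Rightarrow> 'g \<Rightarrow> int"
  where "hdim C d i g = zdim C d i g - bdim C d i g"

text \<open>The quotient is formed with the boundaries inside the cycles, whereas
  \<open>bdim\<close> measures them inside \<open>C i\<close>; the inclusion of the cycles preserves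
  their dimension.\<close>

lemma homology_bdf:
  assumes C: "complex C d"
  shows "bdf (homology C d i)" "hilb (homology C d i) = hdim C d i"
proof -
  have bC: "bdf (C i)" and gC: "gm (C i)" and d: "d i \<in> gr_maps R (C (Suc i)) (C i)"
    and dd: "x \<in> carrier (C (Suc (Suc i))) \<Longrightarrow> d i (d (Suc i) x) = \<zero>\<^bsub>C i\<^esub>" for i x
    using C bdfD(1) unfolding complex_def by auto
  have hz: "homogeneous_submodule R (C i) (cycles C d i)"
    unfolding cycles_def using carrier_homogeneous[OF gC] kernel_homogeneous[OF gC gC d] by (auto split: nat.split)
  let ?Z = "sub_gmodule (C i) (cycles C d i)"
  have bZ: "bdf ?Z" "hilb ?Z g = zdim C d i g" for g
    using bdf_sub[OF hz bC] by (auto simp: zdim_def)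
  have gZ: "gm ?Z" by (rule bdfD(1)[OF bZ(1)])
  have dZ: "d i x \<in> cycles C d i" if "x \<in> carrier (C (Suc i))" for x
    using lin_map.map_simps(1)[OF lin_map_gr[OF gC gC d] that] dd that
    by (auto simp: cycles_def a_kernel_eq split: nat.split)
  have dl: "d i \<in> gr_maps R (C (Suc i)) ?Z"
    using d dZ unfolding gr_maps_def lin_maps_def
    by (auto simp: hcompD(1)[OF gC])
  have hB: "homogeneous_submodule R ?Z (d i ` carrier (C (Suc i)))" by (rule image_homogeneous[OF gC gZ dl])
  have H: "homology C d i = quot_gmodule ?Z (d i ` carrier (C (Suc i)))"
    unfolding homology_def cycles_def ..
  show "bdf (homology C d i)" unfolding H by (rule bdf_quot(1)[OF hB bZ(1)])
  show "hilb (homology C d i) = hdim C d i"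
  proof
    fix g
    have e: "hcomp ?Z g \<inter> d i ` carrier (C (Suc i)) = d i ` hcomp (C (Suc i)) g"
      using image_hcomp[OF gC gZ dl, of g] by blast
    interpret inc: vspace_map k "scal ?Z" "scal (C i)" "\<lambda>x. x"
      by (rule lin_map_scal[OF gm_module[OF gZ] gm_module[OF gC] gr_mapsD(1)[OF sub_gmodule_incl[OF hz gm_module[OF gC]]]])
    interpret D: vspace_map k "scal (C (Suc i))" "scal ?Z" "d i"
      by (rule lin_map_scal[OF gm_module[OF gC] gm_module[OF gZ] gr_mapsD(1)[OF dl]])
    have "dim k (scal (C i)) ((\<lambda>x. x) ` d i ` hcomp (C (Suc i)) g) = dim k (scal ?Z) (d i ` hcomp (C (Suc i)) g)"
      by (rule inc.dim_inj[OF D.dim_rank_nullity(1)[OF bdfD(3)[OF bC]] D.image_sub[OF hcomp_sub[OF gC]]]) simp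
    then have "int (dim k (scal ?Z) (hcomp ?Z g \<inter> d i ` carrier (C (Suc i)))) = bdim C d i g"
      unfolding e bdim_def by simp
    then show "hilb (homology C d i) g = hdim C d i g"
      unfolding H bdf_quot(2)[OF hB bZ(1)] bZ(2) hdim_def by simp
  qed
qed

lemma hdim_nonneg: "complex C d \<Longrightarrow> hdim C d i g \<ge> 0"
  using homology_bdf(2)[of C d i] hilb_nonneg by metis

lemma cycles_hcomp:
  assumes "complex C d"
  shows "hcomp (C 0) g \<inter> cycles C d 0 = hcomp (C 0) g"
    "hcomp (C (Suc i)) g \<inter> cycles C d (Suc i) = {x \<in> hcomp (C (Suc i)) g. d i x = \<zero>\<^bsub>C i\<^esub>}"
proof -
  have "bdf (C i)" for i using assms by (simp add: complex_def)
  note h = hcompD(1)[OF bdfD(1)[OF this]]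
  show "hcomp (C 0) g \<inter> cycles C d 0 = hcomp (C 0) g" using h[of _ 0] by (auto simp: cycles_def)
  show "hcomp (C (Suc i)) g \<inter> cycles C d (Suc i) = {x \<in> hcomp (C (Suc i)) g. d i x = \<zero>\<^bsub>C i\<^esub>}"
    using h[of _ "Suc i"] by (auto simp: cycles_def a_kernel_eq)
qed

lemma zdim_0: "complex C d \<Longrightarrow> zdim C d 0 g = hilb (C 0) g"
  by (simp add: zdim_def cycles_hcomp(1) hilb_def)

lemma complex_rank:
  assumes "complex C d"
  shows "hilb (C (Suc i)) g = bdim C d i g + zdim C d (Suc i) g"
proof -
  have b: "bdf (C i)" for i using assms by (simp add: complex_def)
  interpret D: vspace_map k "scal (C (Suc i))" "scal (C i)" "d i"
    using lin_map_scal[OF gm_module[OF bdfD(1)[OF b]] gm_module[OF bdfD(1)[OF b]] gr_mapsD(1)] assms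
    by (auto simp: complex_def)
  show ?thesis
    using D.dim_rank_nullity(3)[OF bdfD(3)[OF b]] by (simp add: hilb_def bdim_def zdim_def cycles_hcomp(2)[OF assms])
qed

text \<open>The numerical content of the long exact homology sequence when the middle complex is acyclic
  in positive degrees.\<close>

lemma homology_dimension_shift:
  assumes C': "complex C' d'" and C: "complex C d" and C'': "complex C'' d''"
    and ses: "\<And>i. ses R (C' i) (C i) (C'' i) (a i) (b i)"
    and ad: "\<And>i x. x \<in> carrier (C' (Suc i)) \<Longrightarrow> a i (d' i x) = d i (a (Suc i) x)"
    and bd: "\<And>i x. x \<in> carrier (C (Suc i)) \<Longrightarrow> b i (d i x) = d'' i (b (Suc i) x)"
    and acyclic: "\<And>i. d (Suc i) ` carrier (C (Suc (Suc i))) = a_kernel (C (Suc i)) (C i) (d i)"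
  shows "hdim C'' d'' (Suc (Suc i)) g = hdim C' d' (Suc i) g"
    and "hdim C'' d'' 0 g - hdim C'' d'' 1 g = hdim C d 0 g - hdim C' d' 0 g"
proof -
  have B': "bdf (C' i)" and B: "bdf (C i)" and B'': "bdf (C'' i)" for i
    using C' C C'' by (auto simp: complex_def)
  have dg: "d i \<in> gr_maps R (C (Suc i)) (C i)" and dg': "d' i \<in> gr_maps R (C' (Suc i)) (C' i)"
    and dg'': "d'' i \<in> gr_maps R (C'' (Suc i)) (C'' i)" for i
    using C' C C'' by (auto simp: complex_def)
  have ag: "a i \<in> gr_maps R (C' i) (C i)" and bg: "b i \<in> gr_maps R (C i) (C'' i)"
    and ai: "inj_on (a i) (carrier (C' i))" and ex: "a i ` carrier (C' i) = a_kernel (C i) (C'' i) (b i)"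
    and bs: "b i ` carrier (C i) = carrier (C'' i)" for i
    using ses[of i] by (auto simp: ses_def)
  note G' = bdfD(1)[OF B'] and G = bdfD(1)[OF B] and G'' = bdfD(1)[OF B'']
  interpret va: vspace_map k "scal (C' u)" "scal (C u)" "a u" for u
    by (rule lin_map_scal[OF gm_module[OF G'] gm_module[OF G] gr_mapsD(1)[OF ag]])
  interpret vb: vspace_map k "scal (C u)" "scal (C'' u)" "b u" for u
    by (rule lin_map_scal[OF gm_module[OF G] gm_module[OF G''] gr_mapsD(1)[OF bg]])
  interpret vd: vspace_map k "scal (C (Suc u))" "scal (C u)" "d u" for u
    by (rule lin_map_scal[OF gm_module[OF G] gm_module[OF G] gr_mapsD(1)[OF dg]])
  interpret vd'': vspace_map k "scal (C'' (Suc u))" "scal (C'' u)" "d'' u" for u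
    by (rule lin_map_scal[OF gm_module[OF G''] gm_module[OF G''] gr_mapsD(1)[OF dg'']])
  have kerb: "{x \<in> hcomp (C i) g. b i x = \<zero>\<^bsub>scal (C'' i)\<^esub>} = a i ` hcomp (C' i) g" for i
  proof -
    have "{x \<in> hcomp (C i) g. b i x = \<zero>\<^bsub>scal (C'' i)\<^esub>} = a i ` carrier (C' i) \<inter> hcomp (C i) g"
      unfolding ex a_kernel_eq using hcompD(1)[OF G] by auto
    then show ?thesis using image_hcomp[OF G' G ag] by simp
  qed
  have az: "x = \<zero>\<^bsub>C' i\<^esub>" if "x \<in> carrier (C' i)" "a i x = \<zero>\<^bsub>C i\<^esub>" for i x
    using inj_onD[OF ai, of i x "\<zero>\<^bsub>C' i\<^esub>"] that va.map_zero[of i] va.V.zero_closed[of i] by auto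
  have da: "dim k (scal (C i)) (a i ` S) = dim k (scal (C' i)) S"
    if "submodule S k (scal (C' i))" "S \<subseteq> hcomp (C' i) g" for i S
  proof (rule va.dim_inj[OF va.V.fin_dim_mono(1)[OF bdfD(3)[OF B'] that] that(1)])
    fix x assume "x \<in> S" "a i x = \<zero>\<^bsub>scal (C i)\<^esub>"
    then show "x = \<zero>\<^bsub>scal (C' i)\<^esub>" using az[of x i] that(2) hcompD(1)[OF G'] by auto
  qed
  have bh: "b i ` hcomp (C i) g = hcomp (C'' i) g" for i by (rule surj_hcomp[OF G G'' bg bs])
  \<comment> \<open>The dimension of the boundaries of \<open>C\<close> that come from
    \<open>C'\<close>. Modulo the boundaries of \<open>C'\<close> they form the kernel of the map
    from H_i(C') to H_i(C).\<close>
  define t where "t i = int (dim k (scal (C i)) {y \<in> d i ` hcomp (C (Suc i)) g. b i y = \<zero>\<^bsub>C'' i\<^esub>})" for i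
  have t1: "zdim C'' d'' (Suc i) g + hilb (C' (Suc i)) g = t i + zdim C d (Suc i) g" for i
  proof -
    \<comment> \<open>The preimage in \<open>C\<close> of the cycles of \<open>C''\<close>. Its
      dimension is computed twice, by rank and nullity of \<open>b\<close> and of
      \<open>d\<close>.\<close>
    define S where "S = {x \<in> hcomp (C (Suc i)) g. d'' i (b (Suc i) x) = \<zero>\<^bsub>C'' i\<^esub>}"
    have "S = {x \<in> hcomp (C (Suc i)) g. b (Suc i) x \<in> {y \<in> carrier (C'' (Suc i)). d'' i y = \<zero>\<^bsub>C'' i\<^esub>}}"
      using vb.map_simps(1)[of _ "Suc i"] hcompD(1)[OF G] by (auto simp: S_def)
    moreover have "submodule {y \<in> carrier (C'' (Suc i)). d'' i y = \<zero>\<^bsub>C'' i\<^esub>} k (scal (C'' (Suc i)))"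
      using vd''.preimage_sub[OF vb.W.carrier_is_submodule vb.W.sub_zero, of i] by simp
    ultimately have subS: "submodule S k (scal (C (Suc i)))"
      using vb.preimage_sub[OF hcomp_sub[OF G], of "{y \<in> carrier (C'' (Suc i)). d'' i y = \<zero>\<^bsub>C'' i\<^esub>}" "Suc i" g] by simp
    have fS: "fin_dim k (scal (C (Suc i))) S"
      by (rule va.W.fin_dim_mono(1)[OF bdfD(3)[OF B] subS]) (auto simp: S_def)
    have "b (Suc i) ` S = {y \<in> hcomp (C'' (Suc i)) g. d'' i y = \<zero>\<^bsub>C'' i\<^esub>}"
      unfolding S_def bh[of "Suc i", symmetric] by auto
    then have im: "b (Suc i) ` S = hcomp (C'' (Suc i)) g \<inter> cycles C'' d'' (Suc i)"
      by (simp add: cycles_hcomp(2)[OF C''])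
    have "{x \<in> S. b (Suc i) x = \<zero>\<^bsub>scal (C'' (Suc i))\<^esub>} = {x \<in> hcomp (C (Suc i)) g. b (Suc i) x = \<zero>\<^bsub>scal (C'' (Suc i))\<^esub>}"
      using vd''.map_zero[of i] by (auto simp: S_def)
    then have "dim k (scal (C (Suc i))) S = dim k (scal (C'' (Suc i))) (hcomp (C'' (Suc i)) g \<inter> cycles C'' d'' (Suc i))
        + dim k (scal (C' (Suc i))) (hcomp (C' (Suc i)) g)"
      using vb.dim_rank_nullity(3)[OF fS] unfolding im kerb by (simp add: da[OF hcomp_sub[OF G']])
    moreover have "d i ` S = {y \<in> d i ` hcomp (C (Suc i)) g. b i y = \<zero>\<^bsub>C'' i\<^esub>}"
      unfolding S_def using bd hcompD(1)[OF G] by auto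
    moreover have "{x \<in> S. d i x = \<zero>\<^bsub>scal (C i)\<^esub>} = hcomp (C (Suc i)) g \<inter> cycles C d (Suc i)"
      unfolding cycles_hcomp(2)[OF C] S_def using bd[symmetric] hcompD(1)[OF G] vb.map_zero[of i] by auto
    ultimately show ?thesis
      using vd.dim_rank_nullity(3)[OF fS] by (simp add: zdim_def hilb_def t_def)
  qed
  have t2: "bdim C d i g = bdim C'' d'' i g + t i" for i
  proof -
    have f: "fin_dim k (scal (C i)) (d i ` hcomp (C (Suc i)) g)"
      by (rule vd.dim_rank_nullity(1)[OF bdfD(3)[OF B]])
    have "b i ` d i ` hcomp (C (Suc i)) g = (\<lambda>x. d'' i (b (Suc i) x)) ` hcomp (C (Suc i)) g"
      unfolding image_image using bd hcompD(1)[OF G] by (intro image_cong) auto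
    also have "\<dots> = d'' i ` hcomp (C'' (Suc i)) g" unfolding bh[symmetric] image_image ..
    finally show ?thesis
      using vb.dim_rank_nullity(3)[OF f] by (simp add: bdim_def t_def)
  qed
  have exact: "d (Suc i) ` hcomp (C (Suc (Suc i))) g = {x \<in> hcomp (C (Suc i)) g. d i x = \<zero>\<^bsub>C i\<^esub>}" for i
  proof -
    have "d (Suc i) ` hcomp (C (Suc (Suc i))) g = a_kernel (C (Suc i)) (C i) (d i) \<inter> hcomp (C (Suc i)) g"
      using image_hcomp[OF G G dg, of "Suc i" g] acyclic[of i] by simp
    then show ?thesis unfolding a_kernel_eq using hcompD(1)[OF G] by auto
  qed
  \<comment> \<open>As \<open>C\<close> is acyclic in positive degrees, every cycle of
    \<open>C'\<close> becomes a boundary in \<open>C\<close>.\<close>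
  have t3: "t (Suc i) = zdim C' d' (Suc i) g" for i
  proof -
    have "{y \<in> d (Suc i) ` hcomp (C (Suc (Suc i))) g. b (Suc i) y = \<zero>\<^bsub>C'' (Suc i)\<^esub>}
        = {y \<in> a (Suc i) ` hcomp (C' (Suc i)) g. d i y = \<zero>\<^bsub>C i\<^esub>}"
      unfolding exact using kerb[of "Suc i"] by auto
    also have "\<dots> = a (Suc i) ` (hcomp (C' (Suc i)) g \<inter> cycles C' d' (Suc i))"
      unfolding cycles_hcomp(2)[OF C'] using ad[symmetric, of _ i] az[of _ i] hcompD(1)[OF G'] va.map_zero[of i]
        lin_map.map_simps(1)[OF lin_map_gr[OF G' G' dg'], of _ i]
      by (auto simp: image_iff)
    finally show ?thesis
      unfolding t_def zdim_def
      using da[of "hcomp (C' (Suc i)) g \<inter> cycles C' d' (Suc i)" "Suc i"]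
        hcomp_sub_space[OF kernel_homogeneous[OF G' G' dg'[of i]] G', of g]
      by (simp add: cycles_def)
  qed
  have z1: "zdim C d (Suc i) g = bdim C d (Suc i) g" for i
    unfolding zdim_def bdim_def cycles_hcomp(2)[OF C] exact ..
  \<comment> \<open>The first difference is the dimension of the kernel of H_i(C') to H_i(C); the
    bracket is the rank of the map from H_(i+1)(C') to H_(i+1)(C), which is zero by
    \<open>t3\<close>.\<close>
  have tot: "hdim C'' d'' (Suc i) g = t i - bdim C' d' i g - (zdim C' d' (Suc i) g - t (Suc i))" for i
    using t1[of i] t2[of "Suc i"] z1[of i] complex_rank[OF C', of i g] by (simp add: hdim_def)
  show "hdim C'' d'' (Suc (Suc i)) g = hdim C' d' (Suc i) g"
    using tot[of "Suc i"] t3[of i] t3[of "Suc i"] by (simp add: hdim_def)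
  have "hilb (C 0) g = hilb (C' 0) g + hilb (C'' 0) g"
    using ses_hilb[OF ses B' B B''] by (simp add: fun_eq_iff)
  then show "hdim C'' d'' 0 g - hdim C'' d'' 1 g = hdim C d 0 g - hdim C' d' 0 g"
    using tot[of 0] t3[of 0] t2[of 0] by (simp add: hdim_def zdim_0[OF C] zdim_0[OF C'] zdim_0[OF C''])
qed

end

section \<open>Exactness of tensoring with a free module\<close>

context pdcf
begin

lemma exact_transfer:
  assumes \<phi>1: "gr_isomorphism R X1' X1 \<phi>1" and \<phi>2: "gr_isomorphism R X2' X2 \<phi>2" and \<phi>3: "gr_isomorphism R X3' X3 \<phi>3"
    and g3: "gm X3'" "gm X3"
    and f1: "\<And>x. x \<in> carrier X1' \<Longrightarrow> f1' x \<in> carrier X2'" and f2: "\<And>x. x \<in> carrier X2' \<Longrightarrow> f2' x \<in> carrier X3'"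
    and c1: "\<And>x. x \<in> carrier X1' \<Longrightarrow> \<phi>2 (f1' x) = f1 (\<phi>1 x)" and c2: "\<And>x. x \<in> carrier X2' \<Longrightarrow> \<phi>3 (f2' x) = f2 (\<phi>2 x)"
    and ex: "f1 ` carrier X1 = a_kernel X2 X3 f2"
  shows "f1' ` carrier X1' = a_kernel X2' X3' f2'"
proof -
  note p1 = gr_isomorphismD[OF \<phi>1] and p2 = gr_isomorphismD[OF \<phi>2] and p3 = gr_isomorphismD[OF \<phi>3]
  interpret \<phi>3: lin_map R X3' X3 \<phi>3 by (rule lin_map_gr[OF g3 p3(1)])
  have z3: "z = \<zero>\<^bsub>X3'\<^esub> \<longleftrightarrow> \<phi>3 z = \<zero>\<^bsub>X3\<^esub>" if "z \<in> carrier X3'" for z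
    using inj_onD[OF p3(5) _ that \<phi>3.V.zero_closed] \<phi>3.map_zero by auto
  have iff: "y \<in> a_kernel X2' X3' f2' \<longleftrightarrow> \<phi>2 y \<in> f1 ` carrier X1" if y: "y \<in> carrier X2'" for y
    using y z3[OF f2[OF y]] c2[OF y] p2(6) unfolding ex a_kernel_eq by auto
  show ?thesis
  proof
    show "f1' ` carrier X1' \<subseteq> a_kernel X2' X3' f2'"
    proof
      fix y assume "y \<in> f1' ` carrier X1'"
      then obtain x where x: "x \<in> carrier X1'" "y = f1' x" by blast
      have "\<phi>1 x \<in> carrier X1" using x(1) p1(6) by blast
      then show "y \<in> a_kernel X2' X3' f2'" using iff[OF f1[OF x(1)]] c1[OF x(1)] x(2) by simp
    qed
    show "a_kernel X2' X3' f2' \<subseteq> f1' ` carrier X1'"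
    proof
      fix y assume y: "y \<in> a_kernel X2' X3' f2'"
      then have yc: "y \<in> carrier X2'" by (simp add: a_kernel_eq)
      then obtain w where "w \<in> carrier X1" "\<phi>2 y = f1 w" using iff y by blast
      moreover from this obtain x where x: "x \<in> carrier X1'" "w = \<phi>1 x" using p1(6) by blast
      ultimately have "\<phi>2 y = \<phi>2 (f1' x)" using c1 by simp
      then have "y = f1' x" using inj_onD[OF p2(5) _ yc f1[OF x(1)]] by simp
      then show "y \<in> f1' ` carrier X1'" using x(1) by simp
    qed
  qed
qed

lemma ses_transfer:
  assumes \<phi>1: "gr_isomorphism R X1' X1 \<phi>1" and \<phi>2: "gr_isomorphism R X2' X2 \<phi>2" and \<phi>3: "gr_isomorphism R X3' X3 \<phi>3"
    and g3: "gm X3'" "gm X3"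
    and f1: "f1' \<in> gr_maps R X1' X2'" and f2: "f2' \<in> gr_maps R X2' X3'"
    and c1: "\<And>x. x \<in> carrier X1' \<Longrightarrow> \<phi>2 (f1' x) = f1 (\<phi>1 x)" and c2: "\<And>x. x \<in> carrier X2' \<Longrightarrow> \<phi>3 (f2' x) = f2 (\<phi>2 x)"
    and s: "ses R X1 X2 X3 f1 f2"
  shows "ses R X1' X2' X3' f1' f2'"
proof -
  note p1 = gr_isomorphismD[OF \<phi>1] and p2 = gr_isomorphismD[OF \<phi>2] and p3 = gr_isomorphismD[OF \<phi>3]
  have cl: "x \<in> carrier X1' \<Longrightarrow> f1' x \<in> carrier X2'" "y \<in> carrier X2' \<Longrightarrow> f2' y \<in> carrier X3'" for x y
    using f1 f2 by (auto simp: gr_maps_def lin_maps_def)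
  have inj: "inj_on f1 (carrier X1)" and ex: "f1 ` carrier X1 = a_kernel X2 X3 f2" and surj: "f2 ` carrier X2 = carrier X3"
    using s by (auto simp: ses_def)
  have "inj_on f1' (carrier X1')"
  proof (rule inj_onI)
    fix x y assume xy: "x \<in> carrier X1'" "y \<in> carrier X1'" "f1' x = f1' y"
    then have "f1 (\<phi>1 x) = f1 (\<phi>1 y)" using c1 by metis
    moreover have "\<phi>1 x \<in> carrier X1" "\<phi>1 y \<in> carrier X1" using xy p1(6) by auto
    ultimately have "\<phi>1 x = \<phi>1 y" using inj by (auto dest: inj_onD)
    then show "x = y" using inj_onD[OF p1(5) _ xy(1,2)] by simp
  qed
  moreover have "carrier X3' \<subseteq> f2' ` carrier X2'"
  proof
    fix z assume z: "z \<in> carrier X3'"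
    then have "\<phi>3 z \<in> f2 ` carrier X2" using p3(6) surj by auto
    then obtain m where "m \<in> carrier X2" "\<phi>3 z = f2 m" by blast
    moreover from this obtain y where y: "y \<in> carrier X2'" "m = \<phi>2 y" using p2(6) by blast
    ultimately have "\<phi>3 z = \<phi>3 (f2' y)" using c2 by simp
    then have "z = f2' y" using inj_onD[OF p3(5) _ z cl(2)[OF y(1)]] by simp
    then show "z \<in> f2' ` carrier X2'" using y(1) by simp
  qed
  moreover have "f2' ` carrier X2' \<subseteq> carrier X3'" using cl(2) by blast
  ultimately show ?thesis
    unfolding ses_def using f1 f2 exact_transfer[OF \<phi>1 \<phi>2 \<phi>3 g3 cl c1 c2 ex] by blast
qed

lemma gr_maps_shift: "f \<in> gr_maps R M N \<Longrightarrow> f \<in> gr_maps R (shift s M) (shift s N)"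
  by (auto simp: gr_maps_def lin_maps_def)

lemma ses_shift: "ses R L M N f h \<Longrightarrow> ses R (shift s L) (shift s M) (shift s N) f h"
  unfolding ses_def by (auto intro!: gr_maps_shift simp: a_kernel_eq)

text \<open>In the coordinates of \<open>tens_free_left\<close> the tensored sequence becomes a
  direct sum of shifts of the given one, which is exact summand by summand.\<close>

lemma tens_ses:
  assumes F: "gm F" and \<alpha>: "gr_isomorphism R F (free I e) \<alpha>"
    and L: "gm L" and M: "gm M" and N: "gm N" and s: "ses R L M N a b"
  obtains A B where "ses R (tens F L) (tens F M) (tens F N) A B"
    "\<And>x y. x \<in> carrier F \<Longrightarrow> y \<in> carrier L \<Longrightarrow> A (pure_tensor R F L x y) = pure_tensor R F M x (a y)"
    "\<And>x y. x \<in> carrier F \<Longrightarrow> y \<in> carrier M \<Longrightarrow> B (pure_tensor R F M x y) = pure_tensor R F N x (b y)"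
proof -
  note m = gm_module[OF F] gm_module[OF L] gm_module[OF M] gm_module[OF N]
  have a: "a \<in> gr_maps R L M" and b: "b \<in> gr_maps R M N" using s by (auto simp: ses_def)
  interpret a: lin_map R L M a by (rule lin_map_gr[OF L M a])
  interpret b: lin_map R M N b by (rule lin_map_gr[OF M N b])
  obtain A where A: "A \<in> gr_maps R (tens F L) (tens F M)"
      "\<And>x y. x \<in> carrier F \<Longrightarrow> y \<in> carrier L \<Longrightarrow> A (pure_tensor R F L x y) = pure_tensor R F M x (a y)"
    using tensor_right_map[OF F L M a] by blast
  obtain B where B: "B \<in> gr_maps R (tens F M) (tens F N)"
      "\<And>x y. x \<in> carrier F \<Longrightarrow> y \<in> carrier M \<Longrightarrow> B (pure_tensor R F M x y) = pure_tensor R F N x (b y)"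
    using tensor_right_map[OF F M N b] by blast
  obtain \<kappa>1 where \<kappa>1: "gr_isomorphism R (tens F L) (twist L I e) \<kappa>1"
      "\<And>x y. x \<in> carrier F \<Longrightarrow> y \<in> carrier L \<Longrightarrow> \<kappa>1 (pure_tensor R F L x y) = (\<lambda>i. \<alpha> x i \<odot>\<^bsub>L\<^esub> y)"
    using tens_free_left[OF F L \<alpha>] by blast
  obtain \<kappa>2 where \<kappa>2: "gr_isomorphism R (tens F M) (twist M I e) \<kappa>2"
      "\<And>x y. x \<in> carrier F \<Longrightarrow> y \<in> carrier M \<Longrightarrow> \<kappa>2 (pure_tensor R F M x y) = (\<lambda>i. \<alpha> x i \<odot>\<^bsub>M\<^esub> y)"
    using tens_free_left[OF F M \<alpha>] by blast
  obtain \<kappa>3 where \<kappa>3: "gr_isomorphism R (tens F N) (twist N I e) \<kappa>3"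
      "\<And>x y. x \<in> carrier F \<Longrightarrow> y \<in> carrier N \<Longrightarrow> \<kappa>3 (pure_tensor R F N x y) = (\<lambda>i. \<alpha> x i \<odot>\<^bsub>N\<^esub> y)"
    using tens_free_left[OF F N \<alpha>] by blast
  have \<alpha>R: "\<alpha> x i \<in> carrier R" if "x \<in> carrier F" for x i
  proof -
    have "\<alpha> x \<in> carrier (free I e)" using gr_isomorphismD(6)[OF \<alpha>] that by blast
    then show ?thesis unfolding free_carrier by blast
  qed
  have c1: "\<kappa>2 (A t) = (\<lambda>i. a (\<kappa>1 t i))" if "t \<in> carrier (tens F L)" for t
  proof (rule tensor_lin_eqI[where f = "\<lambda>t. \<kappa>2 (A t)" and h = "\<lambda>t i. a (\<kappa>1 t i)", OF m(1,2) gm_module[OF gm_twist[OF M]]])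
    show "(\<lambda>t. \<kappa>2 (A t)) \<in> lin_maps R (tensor_module R F L) (twist M I e)"
      using lin_maps_comp[OF gr_mapsD(1)[OF A(1)] gr_isomorphismD(2)[OF \<kappa>2(1)]] by (simp add: lin_maps_tens)
    have "(\<lambda>x i. a (x i)) \<in> gr_maps R (twist L I e) (twist M I e)"
      by (intro gsum_map_gr gm_shift L M gr_maps_shift a)
    from lin_maps_comp[OF gr_isomorphismD(2)[OF \<kappa>1(1)] gr_mapsD(1)[OF this]]
    show "(\<lambda>t i. a (\<kappa>1 t i)) \<in> lin_maps R (tensor_module R F L) (twist M I e)" by (simp add: lin_maps_tens)
    show "\<kappa>2 (A (pure_tensor R F L x y)) = (\<lambda>i. a (\<kappa>1 (pure_tensor R F L x y) i))" if "x \<in> carrier F" "y \<in> carrier L" for x y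
      using that \<alpha>R by (simp add: A(2) \<kappa>1(2) \<kappa>2(2))
    show "t \<in> carrier (tensor_module R F L)" using that by (simp add: tensor_gmodule_simps)
  qed
  have c2: "\<kappa>3 (B t) = (\<lambda>i. b (\<kappa>2 t i))" if "t \<in> carrier (tens F M)" for t
  proof (rule tensor_lin_eqI[where f = "\<lambda>t. \<kappa>3 (B t)" and h = "\<lambda>t i. b (\<kappa>2 t i)", OF m(1,3) gm_module[OF gm_twist[OF N]]])
    show "(\<lambda>t. \<kappa>3 (B t)) \<in> lin_maps R (tensor_module R F M) (twist N I e)"
      using lin_maps_comp[OF gr_mapsD(1)[OF B(1)] gr_isomorphismD(2)[OF \<kappa>3(1)]] by (simp add: lin_maps_tens)
    have "(\<lambda>x i. b (x i)) \<in> gr_maps R (twist M I e) (twist N I e)"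
      by (intro gsum_map_gr gm_shift M N gr_maps_shift b)
    from lin_maps_comp[OF gr_isomorphismD(2)[OF \<kappa>2(1)] gr_mapsD(1)[OF this]]
    show "(\<lambda>t i. b (\<kappa>2 t i)) \<in> lin_maps R (tensor_module R F M) (twist N I e)" by (simp add: lin_maps_tens)
    show "\<kappa>3 (B (pure_tensor R F M x y)) = (\<lambda>i. b (\<kappa>2 (pure_tensor R F M x y) i))" if "x \<in> carrier F" "y \<in> carrier M" for x y
      using that \<alpha>R by (simp add: B(2) \<kappa>2(2) \<kappa>3(2))
    show "t \<in> carrier (tensor_module R F M)" using that by (simp add: tensor_gmodule_simps)
  qed
  have st: "ses R (twist L I e) (twist M I e) (twist N I e) (\<lambda>x i. a (x i)) (\<lambda>x i. b (x i))"
    by (rule gsum_ses) (intro gm_shift L M N ses_shift s)+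
  have gN: "gm (tens F N)"
    by (rule gm_iso[OF \<kappa>3(1) tens_module[OF m(1,4)] hcomp_tens(2)[OF F N] gm_twist[OF N]])
  have "ses R (tens F L) (tens F M) (tens F N) A B"
    by (rule ses_transfer[OF \<kappa>1(1) \<kappa>2(1) \<kappa>3(1) gN gm_twist[OF N] A(1) B(1) c1 c2 st])
  then show ?thesis using that A(2) B(2) by blast
qed

lemma tens_coords_commute:
  assumes X: "gm X" and Y: "gm Y" and G: "gm G" and p: "p \<in> gr_maps R X Y" and \<beta>: "gr_isomorphism R G (free J e) \<beta>"
    and \<kappa>: "\<kappa> \<in> lin_maps R (tens X G) (twist X J e)" "\<And>x y. x \<in> carrier X \<Longrightarrow> y \<in> carrier G \<Longrightarrow> \<kappa> (pure_tensor R X G x y) = (\<lambda>i. \<beta> y i \<odot>\<^bsub>X\<^esub> x)"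
    and \<kappa>': "\<kappa>' \<in> lin_maps R (tens Y G) (twist Y J e)" "\<And>x y. x \<in> carrier Y \<Longrightarrow> y \<in> carrier G \<Longrightarrow> \<kappa>' (pure_tensor R Y G x y) = (\<lambda>i. \<beta> y i \<odot>\<^bsub>Y\<^esub> x)"
    and t: "t \<in> carrier (tens X G)"
  shows "\<kappa>' (tensor_map R X Y G p t) = (\<lambda>i. p (\<kappa> t i))"
proof (rule tensor_lin_eqI[where f = "\<lambda>t. \<kappa>' (tensor_map R X Y G p t)" and h = "\<lambda>t i. p (\<kappa> t i)",
      OF gm_module[OF X] gm_module[OF G] gm_module[OF gm_twist[OF Y]]])
  interpret p: lin_map R X Y p by (rule lin_map_gr[OF X Y p])
  note tm = tensor_map[OF gm_module[OF X] gm_module[OF Y] gm_module[OF G] gr_mapsD(1)[OF p]]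
  show "(\<lambda>t. \<kappa>' (tensor_map R X Y G p t)) \<in> lin_maps R (tensor_module R X G) (twist Y J e)"
    using lin_maps_comp[OF tm(1)] \<kappa>'(1) by (simp add: lin_maps_tens)
  have "(\<lambda>x i. p (x i)) \<in> gr_maps R (twist X J e) (twist Y J e)"
    by (intro gsum_map_gr gm_shift X Y gr_maps_shift p)
  from lin_maps_comp[OF \<kappa>(1) gr_mapsD(1)[OF this]]
  show "(\<lambda>t i. p (\<kappa> t i)) \<in> lin_maps R (tensor_module R X G) (twist Y J e)" by (simp add: lin_maps_tens)
  have \<beta>R: "\<beta> y i \<in> carrier R" if "y \<in> carrier G" for y i
  proof -
    have "\<beta> y \<in> carrier (free J e)" using gr_isomorphismD(6)[OF \<beta>] that by blast
    then show ?thesis unfolding free_carrier by blast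
  qed
  show "\<kappa>' (tensor_map R X Y G p (pure_tensor R X G x y)) = (\<lambda>i. p (\<kappa> (pure_tensor R X G x y) i))"
    if "x \<in> carrier X" "y \<in> carrier G" for x y
    using that \<beta>R by (simp add: tm(2) \<kappa>(2) \<kappa>'(2))
  show "t \<in> carrier (tensor_module R X G)" using t by (simp add: tensor_gmodule_simps)
qed

lemma gm_tens_free_right:
  assumes F: "gm F" and N: "gm N" and \<alpha>: "gr_isomorphism R F (free I d) \<alpha>"
  shows "gm (tens N F)"
proof -
  obtain \<kappa> where \<kappa>: "gr_isomorphism R (tens N F) (twist N I d) \<kappa>" using tens_free_right[OF F N \<alpha>] by blast
  show ?thesis by (rule gm_iso[OF \<kappa> tens_module[OF gm_module[OF N] gm_module[OF F]] hcomp_tens(2)[OF N F] gm_twist[OF N]])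
qed

text \<open>The same argument with the free factor on the right, for the middle exactness and the
  surjectivity that a resolution provides.\<close>

lemma tens_free_exact:
  assumes X: "gm X" and Y: "gm Y" and Z: "gm Z" and G: "gm G" and \<beta>: "gr_isomorphism R G (free J e) \<beta>"
    and p: "p \<in> gr_maps R X Y" and q: "q \<in> gr_maps R Y Z" and ex: "p ` carrier X = a_kernel Y Z q"
  shows "tensor_map R X Y G p ` carrier (tens X G) = a_kernel (tens Y G) (tens Z G) (tensor_map R Y Z G q)"
    and "q ` carrier Y = carrier Z \<Longrightarrow> tensor_map R Y Z G q ` carrier (tens Y G) = carrier (tens Z G)"
proof -
  obtain \<kappa>1 where \<kappa>1: "gr_isomorphism R (tens X G) (twist X J e) \<kappa>1"
      "\<And>x y. x \<in> carrier X \<Longrightarrow> y \<in> carrier G \<Longrightarrow> \<kappa>1 (pure_tensor R X G x y) = (\<lambda>i. \<beta> y i \<odot>\<^bsub>X\<^esub> x)"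
    using tens_free_right[OF G X \<beta>] by metis
  obtain \<kappa>2 where \<kappa>2: "gr_isomorphism R (tens Y G) (twist Y J e) \<kappa>2"
      "\<And>x y. x \<in> carrier Y \<Longrightarrow> y \<in> carrier G \<Longrightarrow> \<kappa>2 (pure_tensor R Y G x y) = (\<lambda>i. \<beta> y i \<odot>\<^bsub>Y\<^esub> x)"
    using tens_free_right[OF G Y \<beta>] by metis
  obtain \<kappa>3 where \<kappa>3: "gr_isomorphism R (tens Z G) (twist Z J e) \<kappa>3"
      "\<And>x y. x \<in> carrier Z \<Longrightarrow> y \<in> carrier G \<Longrightarrow> \<kappa>3 (pure_tensor R Z G x y) = (\<lambda>i. \<beta> y i \<odot>\<^bsub>Z\<^esub> x)"
    using tens_free_right[OF G Z \<beta>] by metis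
  note d1 = gr_isomorphismD[OF \<kappa>1(1)] and d2 = gr_isomorphismD[OF \<kappa>2(1)] and d3 = gr_isomorphismD[OF \<kappa>3(1)]
  have P: "tensor_map R X Y G p \<in> gr_maps R (tens X G) (tens Y G)" by (rule tensor_map_gr[OF X Y G p])
  have Q: "tensor_map R Y Z G q \<in> gr_maps R (tens Y G) (tens Z G)" by (rule tensor_map_gr[OF Y Z G q])
  have cl: "x \<in> carrier (tens X G) \<Longrightarrow> tensor_map R X Y G p x \<in> carrier (tens Y G)"
      "y \<in> carrier (tens Y G) \<Longrightarrow> tensor_map R Y Z G q y \<in> carrier (tens Z G)" for x y
    using P Q by (auto simp: gr_maps_def lin_maps_def)
  have c1: "\<kappa>2 (tensor_map R X Y G p t) = (\<lambda>i. p (\<kappa>1 t i))" if "t \<in> carrier (tens X G)" for t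
    by (rule tens_coords_commute[OF X Y G p \<beta> d1(2) _ d2(2) _ that]) (simp_all add: \<kappa>1(2) \<kappa>2(2))
  have c2: "\<kappa>3 (tensor_map R Y Z G q t) = (\<lambda>i. q (\<kappa>2 t i))" if "t \<in> carrier (tens Y G)" for t
    by (rule tens_coords_commute[OF Y Z G q \<beta> d2(2) _ d3(2) _ that]) (simp_all add: \<kappa>2(2) \<kappa>3(2))
  have im: "(\<lambda>x i. p (x i)) ` carrier (twist X J e) = {y \<in> carrier (twist Y J e). \<forall>i. y i \<in> p ` carrier X}"
    using gsum_map_image[where \<phi> = "\<lambda>_. p" and I = J, OF gm_shift[OF X] gm_shift[OF Y] gr_maps_shift[OF p]] by simp
  have K: "(\<lambda>x i. p (x i)) ` carrier (twist X J e) = a_kernel (twist Y J e) (twist Z J e) (\<lambda>x i. q (x i))"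
    unfolding im ex by (auto simp: a_kernel_eq fun_eq_iff dest: gsum_memD(1))
  show "tensor_map R X Y G p ` carrier (tens X G) = a_kernel (tens Y G) (tens Z G) (tensor_map R Y Z G q)"
    by (rule exact_transfer[OF \<kappa>1(1) \<kappa>2(1) \<kappa>3(1) gm_tens_free_right[OF G Z \<beta>] gm_twist[OF Z] cl c1 c2 K])
  show "tensor_map R Y Z G q ` carrier (tens Y G) = carrier (tens Z G)" if surj: "q ` carrier Y = carrier Z"
  proof
    show "tensor_map R Y Z G q ` carrier (tens Y G) \<subseteq> carrier (tens Z G)" using cl(2) by blast
    have im2: "(\<lambda>x i. q (x i)) ` carrier (twist Y J e) = {y \<in> carrier (twist Z J e). \<forall>i. y i \<in> q ` carrier Y}"
      using gsum_map_image[where \<phi> = "\<lambda>_. q" and I = J, OF gm_shift[OF Y] gm_shift[OF Z] gr_maps_shift[OF q]] by simp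
    show "carrier (tens Z G) \<subseteq> tensor_map R Y Z G q ` carrier (tens Y G)"
    proof
      fix z assume z: "z \<in> carrier (tens Z G)"
      then have zc: "\<kappa>3 z \<in> carrier (twist Z J e)" using d3(6) by blast
      then have "\<forall>i. \<kappa>3 z i \<in> q ` carrier Y" unfolding surj using gsum_memD(1)[OF zc] by simp
      with zc have "\<kappa>3 z \<in> (\<lambda>x i. q (x i)) ` carrier (twist Y J e)" unfolding im2 by blast
      then obtain w where "w \<in> carrier (twist Y J e)" "\<kappa>3 z = (\<lambda>i. q (w i))" by blast
      moreover from this obtain y where y: "y \<in> carrier (tens Y G)" "w = \<kappa>2 y" using d2(6) by blast
      ultimately have "\<kappa>3 z = \<kappa>3 (tensor_map R Y Z G q y)" using c2[OF y(1)] by simp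
      then have "z = tensor_map R Y Z G q y" using inj_onD[OF d3(5) _ z cl(2)[OF y(1)]] by simp
      then show "z \<in> tensor_map R Y Z G q ` carrier (tens Y G)" using y(1) by simp
    qed
  qed
qed

section \<open>An arbitrary free resolution of \<open>M\<close>, tensored with a variable second
  factor\<close>

context
  fixes M :: "('a, 'm, 'g) gmodule" and F :: "nat \<Rightarrow> ('a, 'f, 'g) gmodule" and d \<epsilon> f \<alpha>
  assumes M: "bdf M" and F: "\<And>j. bdf (F j)" and f: "\<And>j. bounded (supp (f j))"
    and \<alpha>: "\<And>j. gr_isomorphism R (F j) (free (fib (f j)) fst) (\<alpha> j)"
    and d: "\<And>j. d j \<in> gr_maps R (F (Suc j)) (F j)"
    and dex: "\<And>j. d (Suc j) ` carrier (F (Suc (Suc j))) = a_kernel (F (Suc j)) (F j) (d j)"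
    and \<epsilon>: "\<epsilon> \<in> gr_maps R (F 0) M" and \<epsilon>s: "\<epsilon> ` carrier (F 0) = carrier M"
    and \<epsilon>ex: "d 0 ` carrier (F 1) = a_kernel (F 0) M \<epsilon>"
begin

text \<open>\<open>N\<close> is a parameter because one resolution of \<open>M\<close> is tensored
  with all syzygies of the second factor and with their free covers.\<close>

definition TC :: "('a, 'n, 'g) gmodule \<Rightarrow> nat \<Rightarrow> ('a, ('f \<times> 'n \<Rightarrow> 'a) set, 'g) gmodule"
  where "TC N j = tens (F j) N"

definition TD :: "('a, 'n, 'g) gmodule \<Rightarrow> nat \<Rightarrow> ('f \<times> 'n \<Rightarrow> 'a) set \<Rightarrow> ('f \<times> 'n \<Rightarrow> 'a) set"
  where "TD N j = tensor_map R (F (Suc j)) (F j) N (d j)"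

lemma gF: "gm (F j)" and gM: "gm M"
  using bdfD(1) F M by auto

lemma TD_pure: "gm N \<Longrightarrow> x \<in> carrier (F (Suc j)) \<Longrightarrow> y \<in> carrier N \<Longrightarrow>
    TD N j (pure_tensor R (F (Suc j)) N x y) = pure_tensor R (F j) N (d j x) y"
  unfolding TD_def by (rule tensor_map(2)[OF gm_module[OF gF] gm_module[OF gF] gm_module gr_mapsD(1)[OF d]])

lemma TD_gr: "gm N \<Longrightarrow> TD N j \<in> gr_maps R (TC N (Suc j)) (TC N j)"
  unfolding TD_def TC_def by (rule tensor_map_gr[OF gF gF _ d])

lemma pure_zero_left: "gm X \<Longrightarrow> gm N \<Longrightarrow> y \<in> carrier N \<Longrightarrow> pure_tensor R X N \<zero>\<^bsub>X\<^esub> y = \<zero>\<^bsub>tens X N\<^esub>"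
  and pure_zero_right: "gm X \<Longrightarrow> gm N \<Longrightarrow> x \<in> carrier X \<Longrightarrow> pure_tensor R X N x \<zero>\<^bsub>N\<^esub> = \<zero>\<^bsub>tens X N\<^esub>"
proof -
  assume g: "gm X" "gm N"
  note m = gm_module[OF g(1)] gm_module[OF g(2)]
  interpret T: module R "tensor_module R X N" by (rule tensor_module[OF m])
  interpret X: module R X by (rule m)
  interpret N: module R N by (rule m)
  note b = bilinearD(4,5)[OF pure_bilinear[OF m]]
  show "pure_tensor R X N \<zero>\<^bsub>X\<^esub> y = \<zero>\<^bsub>tens X N\<^esub>" if y: "y \<in> carrier N"
    using b(1)[of "\<zero>\<^bsub>R\<^esub>" "\<zero>\<^bsub>X\<^esub>" y] y pure_closed[OF m X.zero_closed y] by (simp add: tensor_gmodule_simps)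
  show "pure_tensor R X N x \<zero>\<^bsub>N\<^esub> = \<zero>\<^bsub>tens X N\<^esub>" if x: "x \<in> carrier X"
    using b(2)[of "\<zero>\<^bsub>R\<^esub>" x "\<zero>\<^bsub>N\<^esub>"] x pure_closed[OF m x N.zero_closed] by (simp add: tensor_gmodule_simps)
qed

lemma bdf_TC:
  assumes "bdf N" shows "bdf (TC N j)"
  unfolding TC_def by (rule bdf_tens_free(1)[OF gF assms \<alpha> graded_index_fib(1)[OF f]])

lemma TD_TD:
  assumes N: "gm N" and t: "t \<in> carrier (TC N (Suc (Suc j)))"
  shows "TD N j (TD N (Suc j) t) = \<zero>\<^bsub>TC N j\<^esub>"
proof (rule tensor_lin_eqI[where f = "\<lambda>t. TD N j (TD N (Suc j) t)" and h = "\<lambda>t. \<zero>\<^bsub>TC N j\<^esub>",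
      OF gm_module[OF gF[of "Suc (Suc j)"]] gm_module[OF N]])
  have mT: "module R (TC N i)" for i unfolding TC_def by (rule tens_module[OF gm_module[OF gF] gm_module[OF N]])
  then show "module R (TC N j)" .
  interpret T: module R "TC N j" by (rule mT)
  show "(\<lambda>t. TD N j (TD N (Suc j) t)) \<in> lin_maps R (tensor_module R (F (Suc (Suc j))) N) (TC N j)"
    using lin_maps_comp[OF gr_mapsD(1)[OF TD_gr[OF N]] gr_mapsD(1)[OF TD_gr[OF N]], of j]
    by (simp add: TC_def lin_maps_tens)
  show "(\<lambda>t. \<zero>\<^bsub>TC N j\<^esub>) \<in> lin_maps R (tensor_module R (F (Suc (Suc j))) N) (TC N j)"
    by (auto simp: lin_maps_def)
  show "t \<in> carrier (tensor_module R (F (Suc (Suc j))) N)" using t by (simp add: TC_def tensor_gmodule_simps)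
  fix x y assume x: "x \<in> carrier (F (Suc (Suc j)))" and y: "y \<in> carrier N"
  have "d (Suc j) x \<in> a_kernel (F (Suc j)) (F j) (d j)" using x dex by blast
  then have "d (Suc j) x \<in> carrier (F (Suc j))" "d j (d (Suc j) x) = \<zero>\<^bsub>F j\<^esub>" by (auto simp: a_kernel_eq)
  then show "TD N j (TD N (Suc j) (pure_tensor R (F (Suc (Suc j))) N x y)) = \<zero>\<^bsub>TC N j\<^esub>"
    using x y TD_pure[OF N] pure_zero_left[OF gF N y] by (simp add: TC_def)
qed

lemma complex_T: "bdf N \<Longrightarrow> complex (TC N) (TD N)"
  unfolding complex_def using bdf_TC TD_gr TD_TD bdfD(1) by blast

text \<open>A free second factor preserves the exactness of the resolution in positive degrees: the
  higher Tor modules vanish.\<close>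

lemma T_acyclic:
  assumes G: "gm G" and \<beta>: "gr_isomorphism R G (free J e) \<beta>"
  shows "TD G (Suc j) ` carrier (TC G (Suc (Suc j))) = a_kernel (TC G (Suc j)) (TC G j) (TD G j)"
  unfolding TC_def TD_def by (rule tens_free_exact(1)[OF gF gF gF G \<beta> d d dex])

text \<open>By right exactness the augmentation identifies the homology in position 0 with M
  \<otimes> G, which is a direct sum of shifts of \<open>M\<close>.\<close>

lemma T_hdim_0:
  assumes G: "bdf G" and \<beta>: "gr_isomorphism R G (free J e) \<beta>" and J: "graded_index J e"
  shows "hdim (TC G) (TD G) 0 g = conv (rank J e) (hilb M) g"
proof -
  note gG = bdfD(1)[OF G]
  have ex: "TD G 0 ` carrier (TC G 1) = a_kernel (TC G 0) (tens M G) (tensor_map R (F 0) M G \<epsilon>)"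
    unfolding TC_def TD_def using tens_free_exact(1)[OF gF gF gM gG \<beta> d \<epsilon>] \<epsilon>ex by simp
  have surj: "tensor_map R (F 0) M G \<epsilon> ` carrier (TC G 0) = carrier (tens M G)"
    unfolding TC_def by (rule tens_free_exact(2)[OF gF gF gM gG \<beta> d \<epsilon> _ \<epsilon>s]) (use \<epsilon>ex in simp)
  have E: "tensor_map R (F 0) M G \<epsilon> \<in> gr_maps R (TC G 0) (tens M G)"
    unfolding TC_def by (rule tensor_map_gr[OF gF gM gG \<epsilon>])
  obtain \<kappa> where \<kappa>: "gr_isomorphism R (tens M G) (twist M J e) \<kappa>" using tens_free_right[OF gG gM \<beta>] by blast
  note b = bdf_iso[OF \<kappa> tens_module[OF gm_module[OF gM] gm_module[OF gG]] hcomp_tens(2)[OF gM gG] bdf_twist(1)[OF M J]]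
  have bT: "bdf (TC G j)" for j by (rule bdf_TC[OF G])
  note gT = bdfD(1)[OF bT] and gMG = bdfD(1)[OF b(1)]
  interpret E: vspace_map k "scal (TC G 0)" "scal (tens M G)" "tensor_map R (F 0) M G \<epsilon>"
    by (rule lin_map_scal[OF gm_module[OF gT] gm_module[OF gMG] gr_mapsD(1)[OF E]])
  have "{x \<in> hcomp (TC G 0) g. tensor_map R (F 0) M G \<epsilon> x = \<zero>\<^bsub>tens M G\<^esub>} = TD G 0 ` carrier (TC G 1) \<inter> hcomp (TC G 0) g"
    unfolding ex a_kernel_eq using hcompD(1)[OF gT] by auto
  also have "\<dots> = TD G 0 ` hcomp (TC G 1) g"
    using image_hcomp[OF gT gT TD_gr[OF gG, where j = 0], where g = g] by simp
  finally have ker: "{x \<in> hcomp (TC G 0) g. tensor_map R (F 0) M G \<epsilon> x = \<zero>\<^bsub>tens M G\<^esub>} = TD G 0 ` hcomp (TC G 1) g" .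
  have "hilb (TC G 0) g = hilb (tens M G) g + bdim (TC G) (TD G) 0 g"
    using E.dim_rank_nullity(3)[OF bdfD(3)[OF bT[of 0]], of g] surj_hcomp[OF gT gMG E surj, of g]
    by (simp add: hilb_def bdim_def ker)
  then show ?thesis
    using b(2) bdf_twist(2)[OF M J] by (simp add: hdim_def zdim_0[OF complex_T[OF G]])
qed

text \<open>\<open>F 0\<close> may have degrees outside the support of \<open>M\<close>. An element
  \<open>x\<close> of such a degree is killed by the augmentation, so \<open>x\<close> is a boundary
  d w and x \<otimes> y is the image of w \<otimes> y. Hence only sums of degrees of
  \<open>M\<close> and \<open>N\<close> survive in homology, which avoids any appeal to a grading on
  M \<otimes> N.\<close>

lemma T_hdim_0_vanish:
  assumes N: "bdf N" and disj: "\<And>a. a \<in> Supp M \<Longrightarrow> g - a \<notin> Supp N"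
  shows "hdim (TC N) (TD N) 0 g = 0"
proof -
  note gN = bdfD(1)[OF N]
  have bT: "bdf (TC N j)" for j by (rule bdf_TC[OF N])
  note gT = bdfD(1)[OF bT]
  interpret D: vspace_map k "scal (TC N 1)" "scal (TC N 0)" "TD N 0"
    using lin_map_scal[OF gm_module[OF gT] gm_module[OF gT] gr_mapsD(1)[OF TD_gr[OF gN]], of 0] by simp
  interpret dd: lin_map R "F 1" "F 0" "d 0" using lin_map_gr[OF gF gF d, of 0] by simp
  have im: "submodule (TD N 0 ` carrier (TC N 1)) k (scal (TC N 0))"
    using D.image_sub[OF D.V.carrier_is_submodule] by simp
  have "hcomp (TC N 0) g \<subseteq> TD N 0 ` carrier (TC N 1)"
    unfolding TC_def[of N 0]
  proof (rule hcomp_tens(4)[OF gF gN im[unfolded TC_def[of N 0]]])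
    fix x y p q assume x: "x \<in> hcomp (F 0) p" and y: "y \<in> hcomp N q" and g: "p + q = g"
    note xc = hcompD(1)[OF gF x] and yc = hcompD(1)[OF gN y]
    show "pure_tensor R (F 0) N x y \<in> TD N 0 ` carrier (TC N 1)"
    proof (cases "y = \<zero>\<^bsub>N\<^esub>")
      case True
      then have "pure_tensor R (F 0) N x y = \<zero>\<^bsub>TC N 0\<^esub>" using pure_zero_right[OF gF gN xc] by (simp add: TC_def)
      then show ?thesis using D.W.subD(2)[OF im] by simp
    next
      case False
      then have "q \<in> Supp N" using SuppI[OF y] by blast
      then have "g - p \<in> Supp N" using g by (metis add_diff_cancel_left')
      then have "p \<notin> Supp M" using disj by blast
      then have "\<epsilon> x = \<zero>\<^bsub>M\<^esub>" using gr_mapsD(2)[OF \<epsilon> x] by (simp add: Supp_def)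
      then have "x \<in> a_kernel (F 0) M \<epsilon>" using xc by (simp add: a_kernel_eq)
      then obtain w where w: "w \<in> carrier (F 1)" "x = d 0 w" using \<epsilon>ex by blast
      have "pure_tensor R (F 1) N w y \<in> carrier (TC N 1)"
        using pure_closed[OF gm_module[OF gF] gm_module[OF gN] w(1) yc] by (simp add: TC_def tensor_gmodule_simps)
      moreover have "TD N 0 (pure_tensor R (F 1) N w y) = pure_tensor R (F 0) N x y"
        using TD_pure[OF gN, of w 0 y] w yc by simp
      ultimately show ?thesis by (metis image_eqI)
    qed
  qed
  then have "hcomp (TC N 0) g = TD N 0 ` carrier (TC N 1) \<inter> hcomp (TC N 0) g" by blast
  also have "\<dots> = TD N 0 ` hcomp (TC N 1) g"
    using image_hcomp[OF gT gT TD_gr[OF gN, where j = 0], where g = g] by simp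
  finally show ?thesis
    by (simp add: hdim_def zdim_0[OF complex_T[OF N]] bdim_def hilb_def)
qed

text \<open>Tensoring the short exact sequence with the terms of the resolution gives a short exact
  sequence of complexes whose middle complex is acyclic in positive degrees, \<open>G\<close> being
  free.\<close>

lemma T_shift:
  assumes N': "bdf N'" and G: "bdf G" and N: "bdf N" and s: "ses R N' G N a b"
    and \<beta>: "gr_isomorphism R G (free J e) \<beta>" and J: "graded_index J e"
  shows "hdim (TC N) (TD N) (Suc (Suc j)) g = hdim (TC N') (TD N') (Suc j) g"
    and "hdim (TC N) (TD N) 0 g - hdim (TC N) (TD N) 1 g = conv (rank J e) (hilb M) g - hdim (TC N') (TD N') 0 g"
proof -
  note g' = bdfD(1)[OF N'] and gG = bdfD(1)[OF G] and gN = bdfD(1)[OF N]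
  have a: "a \<in> gr_maps R N' G" and b: "b \<in> gr_maps R G N" using s by (auto simp: ses_def)
  have "\<exists>A B. ses R (TC N' j) (TC G j) (TC N j) A B \<and>
      (\<forall>x y. x \<in> carrier (F j) \<longrightarrow> y \<in> carrier N' \<longrightarrow> A (pure_tensor R (F j) N' x y) = pure_tensor R (F j) G x (a y)) \<and>
      (\<forall>x y. x \<in> carrier (F j) \<longrightarrow> y \<in> carrier G \<longrightarrow> B (pure_tensor R (F j) G x y) = pure_tensor R (F j) N x (b y))" for j
    unfolding TC_def by (rule tens_ses[OF gF \<alpha> g' gG gN s]) blast
  then obtain A B where AB: "\<And>j. ses R (TC N' j) (TC G j) (TC N j) (A j) (B j)"
      and Ap: "\<And>j x y. x \<in> carrier (F j) \<Longrightarrow> y \<in> carrier N' \<Longrightarrow> A j (pure_tensor R (F j) N' x y) = pure_tensor R (F j) G x (a y)"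
      and Bp: "\<And>j x y. x \<in> carrier (F j) \<Longrightarrow> y \<in> carrier G \<Longrightarrow> B j (pure_tensor R (F j) G x y) = pure_tensor R (F j) N x (b y)"
    by metis
  have Al: "A j \<in> lin_maps R (TC N' j) (TC G j)" and Bl: "B j \<in> lin_maps R (TC G j) (TC N j)" for j
    using AB[of j] gr_mapsD(1) by (auto simp: ses_def)
  have mT: "gm X \<Longrightarrow> module R (TC X j)" for X :: "('a, 'x, 'g) gmodule" and j
    unfolding TC_def by (rule tens_module[OF gm_module[OF gF] gm_module])
  have dc: "d j x \<in> carrier (F j)" if "x \<in> carrier (F (Suc j))" for x j
    using gr_mapsD(1)[OF d[of j]] that by (auto simp: lin_maps_def)
  have ac: "a y \<in> carrier G" if "y \<in> carrier N'" for y using gr_mapsD(1)[OF a] that by (auto simp: lin_maps_def)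
  have bc: "b y \<in> carrier N" if "y \<in> carrier G" for y using gr_mapsD(1)[OF b] that by (auto simp: lin_maps_def)
  have ad: "A j (TD N' j t) = TD G j (A (Suc j) t)" if t: "t \<in> carrier (TC N' (Suc j))" for j t
  proof (rule tensor_lin_eqI[where f = "\<lambda>t. A j (TD N' j t)" and h = "\<lambda>t. TD G j (A (Suc j) t)",
        OF gm_module[OF gF[of "Suc j"]] gm_module[OF g'] mT[OF gG]])
    show "(\<lambda>t. A j (TD N' j t)) \<in> lin_maps R (tensor_module R (F (Suc j)) N') (TC G j)"
      using lin_maps_comp[OF gr_mapsD(1)[OF TD_gr[OF g']] Al] by (simp add: TC_def lin_maps_tens)
    show "(\<lambda>t. TD G j (A (Suc j) t)) \<in> lin_maps R (tensor_module R (F (Suc j)) N') (TC G j)"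
      using lin_maps_comp[OF Al gr_mapsD(1)[OF TD_gr[OF gG]]] by (simp add: TC_def lin_maps_tens)
    show "t \<in> carrier (tensor_module R (F (Suc j)) N')" using t by (simp add: TC_def tensor_gmodule_simps)
  qed (simp add: TD_pure[OF g'] TD_pure[OF gG] Ap dc ac)
  have bd: "B j (TD G j t) = TD N j (B (Suc j) t)" if t: "t \<in> carrier (TC G (Suc j))" for j t
  proof (rule tensor_lin_eqI[where f = "\<lambda>t. B j (TD G j t)" and h = "\<lambda>t. TD N j (B (Suc j) t)",
        OF gm_module[OF gF[of "Suc j"]] gm_module[OF gG] mT[OF gN]])
    show "(\<lambda>t. B j (TD G j t)) \<in> lin_maps R (tensor_module R (F (Suc j)) G) (TC N j)"
      using lin_maps_comp[OF gr_mapsD(1)[OF TD_gr[OF gG]] Bl] by (simp add: TC_def lin_maps_tens)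
    show "(\<lambda>t. TD N j (B (Suc j) t)) \<in> lin_maps R (tensor_module R (F (Suc j)) G) (TC N j)"
      using lin_maps_comp[OF Bl gr_mapsD(1)[OF TD_gr[OF gN]]] by (simp add: TC_def lin_maps_tens)
    show "t \<in> carrier (tensor_module R (F (Suc j)) G)" using t by (simp add: TC_def tensor_gmodule_simps)
  qed (simp add: TD_pure[OF gN] TD_pure[OF gG] Bp dc bc)
  note sh = homology_dimension_shift[where C' = "TC N'" and d' = "TD N'" and C = "TC G" and d = "TD G"
      and C'' = "TC N" and d'' = "TD N" and a = A and b = B, OF complex_T[OF N'] complex_T[OF G] complex_T[OF N] AB ad bd T_acyclic[OF gG \<beta>]]
  show "hdim (TC N) (TD N) (Suc (Suc j)) g = hdim (TC N') (TD N') (Suc j) g" by (rule sh(1))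
  show "hdim (TC N) (TD N) 0 g - hdim (TC N) (TD N) 1 g = conv (rank J e) (hilb M) g - hdim (TC N') (TD N') 0 g"
    using sh(2)[of g] T_hdim_0[OF G \<beta> J] by simp
qed

text \<open>Induction along the minimal syzygies of \<open>N\<close> shifts Tor_(j+1)(M, N) to Tor_1
  of \<open>M\<close> with the syzygy number \<open>j\<close>. Below \<open>U\<close> these vanish
  for large \<open>j\<close>, and the alternating sum telescopes to the one that defines the Euler
  characteristic.\<close>

lemma T_euler:
  fixes N :: "('k, 'a, 'g) umodule"
  assumes N: "bdf N" and \<chi>: "bounded (supp \<chi>)" "hilb N = conv \<chi> hR" and U: "finite U"
  obtains n where "\<And>g j. g \<in> down_closure (Supp R) U \<Longrightarrow> n \<le> j \<Longrightarrow> hdim (TC N) (TD N) j g = 0"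
    "\<And>g. g \<in> down_closure (Supp R) U \<Longrightarrow> (\<Sum>j<n. (-1) ^ j * hdim (TC N) (TD N) j g) = conv \<chi> (hilb M) g"
proof -
  obtain Ns G u \<iota> \<pi> where syz: "syzygies N Ns G u \<iota> \<pi>" using syzygies_exist[OF N] by blast
  note S = syzygiesD[OF syz]
  note hs = hilb_syzygy[OF syz] and cb = bounded_chi[OF syz]
  define c where "c = chi N u"
  \<comment> \<open>By cancellation of \<open>hR\<close>, the given function is the explicit
    alternating sum of ranks of the chosen syzygies.\<close>
  have \<chi>c: "\<chi> = c 0"
  proof
    fix g
    have "conv hR (\<chi> - c 0) = 0"
      unfolding conv_comm[of hR] using Q.conv_diff[OF \<chi>(1) cb[of 0] bounded_hR[OF syz]] \<chi>(2) hs[of 0] S(1) by (simp add: c_def)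
    then have "(\<chi> - c 0) g = 0"
      using Q.conv_cancel_on_down_set[of hR "\<chi> - c 0" UNIV g] supp_hilb_regular hilb_regular_zero
        Q.bounded_diff[OF \<chi>(1) cb[of 0]] by (simp add: c_def)
    then show "\<chi> g = c 0 g" by simp
  qed
  \<comment> \<open>Write N_i for the syzygies of \<open>N\<close> and G_i for their free covers:
    \<open>h i j\<close> is the dimension of Tor_j(M, N_i), and \<open>w i\<close> is the Hilbert
    function of M \<otimes> G_i.\<close>
  define h where "h i j g = hdim (TC (Ns i)) (TD (Ns i)) j g" for i j g
  define w where "w i g = conv (\<lambda>g. int (u i g)) (hilb M) g" for i g
  have rk: "rank (fib (u i)) fst = (\<lambda>g. int (u i g))" for i by (rule graded_index_fib(2)[OF S(4)])
  have gG: "gm (G i)" for i by (rule bdfD(1)[OF S(3)])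
  have sh: "h i (Suc (Suc j)) g = h (Suc i) (Suc j) g" "h i 0 g - h i 1 g = w i g - h (Suc i) 0 g" for i j g
  proof -
    obtain \<beta> where \<beta>: "gr_isomorphism R (G i) (free (fib (u i)) fst) \<beta>"
      by (rule gr_isomorphicE[OF S(5) gG gm_free])
    note t = T_shift[OF S(2) S(3) S(2) S(6) \<beta> graded_index_fib(1)[OF S(4)]]
    show "h i (Suc (Suc j)) g = h (Suc i) (Suc j) g" unfolding h_def by (rule t(1))
    show "h i 0 g - h i 1 g = w i g - h (Suc i) 0 g"
      using t(2)[of g] unfolding h_def w_def rk by simp
  qed
  have hn: "h i j g \<ge> 0" for i j g unfolding h_def by (rule hdim_nonneg[OF complex_T[OF S(2)]])
  obtain P where P: "finite P" "\<And>a. a \<in> Supp M \<Longrightarrow> \<exists>p\<in>P. le_monoid (Supp R) p a"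
    using bdfD(2)[OF M] unfolding finitely_bounded_below_def by blast
  \<comment> \<open>The bounds \<open>P\<close> of the support of \<open>M\<close> are subtracted,
    so that \<open>g - a\<close> stays below \<open>U'\<close> for every \<open>g\<close> below
    \<open>U\<close> and every degree \<open>a\<close> of \<open>M\<close>.\<close>
  define U' where "U' = (\<lambda>(u, p). u - p) ` (U \<times> P)"
  have "finite U'" using U P(1) by (simp add: U'_def)
  then obtain m where m: "\<And>i g. m \<le> i \<Longrightarrow> g \<in> down_closure (Supp R) U' \<Longrightarrow> g \<notin> Supp (Ns i)"
    using syzygy_vanish[OF syz] by blast
  have low: "g - a \<in> down_closure (Supp R) U'" if g: "g \<in> down_closure (Supp R) U" and a: "a \<in> Supp M" for g a
  proof -
    obtain v where v: "v \<in> U" "v - g \<in> Supp R" using g by (auto simp: down_closure_def le_monoid_def)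
    obtain p where p: "p \<in> P" "a - p \<in> Supp R" using P(2)[OF a] by (auto simp: le_monoid_def)
    have "v - p - (g - a) \<in> Supp R" using Q.add_mem[OF v(2) p(2)] by (simp add: algebra_simps)
    moreover have "v - p \<in> U'" unfolding U'_def using v(1) p(1) by (intro image_eqI[of _ _ "(v, p)"]) simp_all
    ultimately show ?thesis by (auto simp: down_closure_def le_monoid_def)
  qed
  have uv: "u i (g - a) = 0" if "m \<le> i" "g \<in> down_closure (Supp R) U" "a \<in> Supp M" for i g a
    using m[OF that(1) low[OF that(2,3)]] S(7)[of i] by (auto simp: supp_def)
  have cv: "c i (g - a) = 0" if "m \<le> i" "g \<in> down_closure (Supp R) U" "a \<in> Supp M" for i g a
    unfolding c_def chi_def[OF syz] using uv that by (intro sum.neutral) simp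
  have Ma: "a \<in> Supp M" if "hilb M a \<noteq> 0" for a using hilb_eq_0[OF M] that by blast
  have cM: "conv (c i) (hilb M) g = 0" and wM: "w i g = 0"
    if "m \<le> i" "g \<in> down_closure (Supp R) U" for i g
  proof -
    show "conv (c i) (hilb M) g = 0"
      by (rule Q.conv_vanish_on_down_set[OF _ that(2)]) (rule cv[OF that(1)], assumption, rule Ma)
    have "conv (\<lambda>g. int (u i g)) (hilb M) g = 0"
    proof (rule Q.conv_vanish_on_down_set[OF _ that(2)])
      fix g v assume "g \<in> down_closure (Supp R) U" "hilb M v \<noteq> 0"
      then show "int (u i (g - v)) = 0" using uv[OF that(1) _ Ma] by simp
    qed
    then show "w i g = 0" by (simp add: w_def)
  qed
  have h0: "h i 0 g = 0" if "m \<le> i" "g \<in> down_closure (Supp R) U" for i g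
    unfolding h_def by (rule T_hdim_0_vanish[OF S(2)]) (rule m[OF that(1) low[OF that(2)]])
  \<comment> \<open>The low-degree relation expresses Tor_1 through Tor_0 of two consecutive
    syzygies and \<open>w i\<close>, all of which vanish.\<close>
  have h1: "h i 1 g = 0" if "m \<le> i" "g \<in> down_closure (Supp R) U" for i g
    using sh(2)[of i g] h0[OF that] h0[OF le_SucI[OF that(1)] that(2)] wM[OF that] by simp
  have hs1: "h i (Suc j) g = h (i + j) 1 g" for i j g
  proof (induction j arbitrary: i)
    case (Suc j)
    then show ?case using sh(1)[of i j g] by simp
  qed simp
  have csum: "conv (c 0) (hilb M) g = (\<Sum>i<n. (-1) ^ i * w i g) + (-1) ^ n * conv (c n) (hilb M) g" for n g
  proof (induction n)
    case (Suc n)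
    have "conv (c n) (hilb M) = conv (\<lambda>g. int (u n g)) (hilb M) - conv (c (Suc n)) (hilb M)"
      unfolding c_def
      by (subst chi_rec[OF syz]) (rule Q.conv_diff[OF bounded_f[OF syz] cb], use bdfD(2)[OF M] supp_hilb[OF M] in simp)
    then have e: "conv (c (Suc n)) (hilb M) g = w n g - conv (c n) (hilb M) g" by (simp add: w_def)
    show ?case unfolding Suc e by (simp add: algebra_simps)
  qed simp
  \<comment> \<open>By the low-degree relation each new Tor_1 cancels the previous remainder. One
    more Tor term than terms of \<open>w\<close> is needed, and Tor_0 of the syzygy number
    \<open>n\<close> is left over.\<close>
  have hsum: "(\<Sum>j<Suc n. (-1) ^ j * h 0 j g) = (\<Sum>i<n. (-1) ^ i * w i g) + (-1) ^ n * h n 0 g" for n g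
  proof (induction n)
    case (Suc n)
    have e: "h 0 (Suc n) g = h n 0 g + h (Suc n) 0 g - w n g" using hs1[of 0 n g] sh(2)[of n g] by simp
    show ?case unfolding sum.lessThan_Suc[of _ "Suc n"] Suc e by (simp add: algebra_simps)
  qed simp
  show ?thesis
  proof (rule that[of "Suc m"])
    fix g assume g: "g \<in> down_closure (Supp R) U"
    show "hdim (TC N) (TD N) j g = 0" if "Suc m \<le> j" for j
    proof -
      obtain i where i: "j = Suc i" "m \<le> i" using \<open>Suc m \<le> j\<close> by (cases j) auto
      have "h 0 j g = 0" using hs1[of 0 i g] h1[OF i(2) g] i(1) by simp
      then show ?thesis by (simp add: h_def S(1))
    qed
    show "(\<Sum>j<Suc m. (-1) ^ j * hdim (TC N) (TD N) j g) = conv \<chi> (hilb M) g"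
      using hsum[of g m] csum[of g m] h0[OF order_refl g] cM[OF order_refl g] by (simp add: \<chi>c h_def S(1))
  qed
qed

end

end

section \<open>The Euler characteristic of a BDF module\<close>

context pdcf
begin

text \<open>Characterised by deconvolution instead of a resolution, so that it depends on the
  Hilbert function alone, at any carrier type. For a free module it is the rank function, in general
  the alternating sum of the ranks of a minimal resolution.\<close>

definition chr :: "('a, 'b, 'g) gmodule \<Rightarrow> 'g \<Rightarrow> int"
  where "chr M = (SOME c. bounded (supp c) \<and> hilb M = conv c hR)"

lemma bounded_supp_hR: "bounded (supp hR)"
  by (simp add: supp_hilb_regular Q.bounded_monoid)

text \<open>The local form of cancellation; a down-closed set such as (-\<infinity>, U] determines
  the function on that set.\<close>

lemma conv_hR_cancel_on:
  assumes "bounded (supp c)" "bounded (supp c')" "\<And>g h. h \<in> D \<Longrightarrow> le_monoid (Supp R) g h \<Longrightarrow> g \<in> D"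
    "\<And>g. g \<in> D \<Longrightarrow> conv c hR g = conv c' hR g" "g \<in> D"
  shows "c g = c' g"
proof -
  have "(c - c') g = 0"
  proof (rule Q.conv_cancel_on_down_set[where H = hR and D = D])
    show "conv hR (c - c') g = 0" if "g \<in> D" for g
      unfolding conv_comm[of hR] Q.conv_diff[OF assms(1,2) bounded_supp_hR] using assms(4)[OF that] by simp
    show "bounded (supp (c - c'))" by (rule Q.bounded_diff[OF assms(1,2)])
    show "g \<in> D" if "h \<in> D" "le_monoid (Supp R) g h" for g h by (rule assms(3)[OF that])
  qed (use supp_hilb_regular hilb_regular_zero assms(5) in auto)
  then show ?thesis by simp
qed

lemma conv_hR_cancel:
  assumes "bounded (supp c)" "bounded (supp c')" "conv c hR = conv c' hR"
  shows "c = c'"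
  using conv_hR_cancel_on[OF assms(1,2), of UNIV] assms(3) by auto

lemma chr_eqI: "bounded (supp c) \<Longrightarrow> hilb M = conv c hR \<Longrightarrow> chr M = c"
  unfolding chr_def by (rule some_equality) (auto intro: conv_hR_cancel)

lemma chr_spec:
  assumes "bdf M"
  shows "bounded (supp (chr M))" "hilb M = conv (chr M) hR"
proof -
  obtain M' :: "('k, 'a, 'g) umodule" where M': "bdf M'" "gr_isomorphic R M M'"
    using BDF_representable[OF assms] by blast
  obtain N F f \<iota> \<pi> where syz: "syzygies M' N F f \<iota> \<pi>" using syzygies_exist[OF M'(1)] by blast
  have "hilb M = conv (chi M' f 0) hR"
    using hilb_iso[OF M'(2) assms M'(1)] hilb_syzygy[OF syz, of 0] syzygiesD(1)[OF syz] by simp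
  then have "\<exists>c. bounded (supp c) \<and> hilb M = conv c hR" using bounded_chi[OF syz] by blast
  from someI_ex[OF this] show "bounded (supp (chr M))" "hilb M = conv (chr M) hR"
    unfolding chr_def by blast+
qed

lemma chr_hilb: "bdf M \<Longrightarrow> bdf N \<Longrightarrow> hilb M = hilb N \<Longrightarrow> chr M = chr N"
  by (simp add: chr_def)

lemma chr_add:
  assumes "bdf L" "bdf M" "bdf N" "hilb M = hilb L + hilb N"
  shows "chr M = chr L + chr N"
proof (rule chr_eqI)
  note s = chr_spec[OF assms(1)] chr_spec[OF assms(3)]
  show "bounded (supp (chr L + chr N))" by (rule Q.bounded_add[OF s(1,3)])
  show "hilb M = conv (chr L + chr N) hR"
    unfolding Q.conv_add[OF s(1,3) bounded_supp_hR] using assms(4) s(2,4) by simp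
qed

lemma chr_regular: "chr (regular_module R) = unit_fun"
proof (rule chr_eqI)
  have "supp unit_fun = {0 :: 'g}" by (auto simp: supp_def unit_fun_def)
  then show "bounded (supp (unit_fun :: 'g \<Rightarrow> int))" by (simp add: Q.bounded_finite)
qed (simp add: conv_unit)

lemma chr_vanish_on:
  assumes "bdf M" "\<And>g h. h \<in> D \<Longrightarrow> le_monoid (Supp R) g h \<Longrightarrow> g \<in> D" "\<And>g. g \<in> D \<Longrightarrow> hilb M g = 0" "g \<in> D"
  shows "chr M g = 0"
proof -
  have "bounded (supp (0 :: 'g \<Rightarrow> int))" by (simp add: supp_def Q.bounded_finite)
  from conv_hR_cancel_on[OF chr_spec(1)[OF assms(1)] this assms(2) _ assms(4)] show ?thesis
    using assms(3) chr_spec(2)[OF assms(1)] by (simp add: conv_zero)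
qed

lemma down_closure_down: "h \<in> down_closure (Supp R) U \<Longrightarrow> le_monoid (Supp R) g h \<Longrightarrow> g \<in> down_closure (Supp R) U"
  unfolding down_closure_def using Q.le_trans by blast

section \<open>The alternating sum of the Tor modules\<close>

text \<open>The pair chosen in the definition of \<open>Tor\<close> is a resolution because the
  spliced minimal one exists. Its terms are \<open>gr_free\<close>, hence projective, hence by
  \<open>projective_free\<close> isomorphic to standard free modules.\<close>

lemma Tor_resolution:
  fixes M :: "('k, 'a, 'g) umodule"
  assumes M: "bdf M"
  obtains F :: "nat \<Rightarrow> ('k, 'a, 'g) umodule" and d f \<alpha> \<epsilon>
  where "\<And>j. bdf (F j)" "\<And>j. bounded (supp (f j))" "\<And>j. gr_isomorphism R (F j) (free (fib (f j)) fst) (\<alpha> j)"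
    "\<And>j. d j \<in> gr_maps R (F (Suc j)) (F j)"
    "\<And>j. d (Suc j) ` carrier (F (Suc (Suc j))) = a_kernel (F (Suc j)) (F j) (d j)"
    "\<epsilon> \<in> gr_maps R (F 0) M" "\<epsilon> ` carrier (F 0) = carrier M" "d 0 ` carrier (F 1) = a_kernel (F 0) M \<epsilon>"
    "(SOME (F :: nat \<Rightarrow> ('k, 'a, 'g) umodule, d). free_resolution k R M F d) = (F, d)"
proof -
  obtain F d where Fd: "(SOME (F :: nat \<Rightarrow> ('k, 'a, 'g) umodule, d). free_resolution k R M F d) = (F, d)"
    by (rule prod.exhaust)
  obtain N F' f \<iota> \<pi> where syz: "syzygies M N F' f \<iota> \<pi>" using syzygies_exist[OF M] by blast
  have "\<exists>p. case p of (F :: nat \<Rightarrow> ('k, 'a, 'g) umodule, d) \<Rightarrow> free_resolution k R M F d"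
    using syzygy_resolution[OF syz] by blast
  from someI_ex[OF this] have r: "free_resolution k R M F d" unfolding Fd by simp
  have F: "bdf (F j)" and fr: "gr_free R (F j)" for j using r by (auto simp: free_resolution_def)
  have "\<exists>f \<alpha>. bounded (supp (f :: 'g \<Rightarrow> nat)) \<and> gr_isomorphism R (F j) (free (fib f) fst) \<alpha>" for j
  proof -
    obtain f :: "'g \<Rightarrow> nat" where f: "bounded (supp f)" "gr_isomorphic R (F j) (free (fib f) fst)"
      using projective_free[OF F gr_free_projective[OF bdfD(1)[OF F] fr]] by blast
    show ?thesis using gr_isomorphicE[OF f(2) bdfD(1)[OF F] gm_free] f(1) by blast
  qed
  then obtain f \<alpha> where f\<alpha>: "\<And>j. bounded (supp (f j :: 'g \<Rightarrow> nat))" "\<And>j. gr_isomorphism R (F j) (free (fib (f j)) fst) (\<alpha> j)"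
    by metis
  obtain \<epsilon> where \<epsilon>: "\<epsilon> \<in> gr_maps R (F 0) M" "\<epsilon> ` carrier (F 0) = carrier M" "d 0 ` carrier (F 1) = a_kernel (F 0) M \<epsilon>"
    using r unfolding free_resolution_def by (elim conjE bexE) (rule that)
  have d: "d j \<in> gr_maps R (F (Suc j)) (F j)"
    and dex: "d (Suc j) ` carrier (F (Suc (Suc j))) = a_kernel (F (Suc j)) (F j) (d j)" for j
    using r unfolding free_resolution_def by simp_all
  show ?thesis by (rule that[OF F f\<alpha> d dex \<epsilon> Fd])
qed

lemma Tor_euler:
  fixes M N :: "('k, 'a, 'g) umodule"
  assumes M: "bdf M" and N: "bdf N"
  shows "bdf (Tor k R i M N)"
    and "finite U \<Longrightarrow> \<exists>n. \<forall>g\<in>down_closure (Supp R) U. (\<forall>j\<ge>n. chr (Tor k R j M N) g = 0) \<and>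
      (\<Sum>j<n. (-1) ^ j * chr (Tor k R j M N) g) = conv (chr M) (chr N) g"
proof -
  obtain F :: "nat \<Rightarrow> ('k, 'a, 'g) umodule" and d f \<alpha> \<epsilon>
    where r: "\<And>j. bdf (F j)" "\<And>j. bounded (supp (f j))" "\<And>j. gr_isomorphism R (F j) (free (fib (f j)) fst) (\<alpha> j)"
      "\<And>j. d j \<in> gr_maps R (F (Suc j)) (F j)"
      "\<And>j. d (Suc j) ` carrier (F (Suc (Suc j))) = a_kernel (F (Suc j)) (F j) (d j)"
      "\<epsilon> \<in> gr_maps R (F 0) M" "\<epsilon> ` carrier (F 0) = carrier M" "d 0 ` carrier (F 1) = a_kernel (F 0) M \<epsilon>"
      "(SOME (F :: nat \<Rightarrow> ('k, 'a, 'g) umodule, d). free_resolution k R M F d) = (F, d)"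
    by (rule Tor_resolution[OF M]) (rule that; assumption)
  note ctx = M r(1-8)
  have Tor: "Tor k R j M N = homology (TC F N) (TD F d N) j" for j
  proof -
    have "TC F N = (\<lambda>j. tens (F j) N)" "TD F d N = (\<lambda>j. tensor_map R (F (Suc j)) (F j) N (d j))"
      by (intro ext, rule TC_def[OF ctx]) (intro ext, rule TD_def[OF ctx, THEN fun_cong])
    then show ?thesis unfolding Tor_def r(9) by simp
  qed
  note H = homology_bdf[OF complex_T[OF ctx N], folded Tor]
  show bT: "bdf (Tor k R j M N)" for j by (rule H(1))
  show "\<exists>n. \<forall>g\<in>down_closure (Supp R) U. (\<forall>j\<ge>n. chr (Tor k R j M N) g = 0) \<and>
      (\<Sum>j<n. (-1) ^ j * chr (Tor k R j M N) g) = conv (chr M) (chr N) g" if U: "finite U"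
  proof -
    let ?D = "down_closure (Supp R) U"
    note cM = chr_spec[OF M] and cN = chr_spec[OF N] and cT = chr_spec[OF bT]
    obtain n where n: "\<And>g j. g \<in> ?D \<Longrightarrow> n \<le> j \<Longrightarrow> hilb (Tor k R j M N) g = 0"
        "\<And>g. g \<in> ?D \<Longrightarrow> (\<Sum>j<n. (-1) ^ j * hilb (Tor k R j M N) g) = conv (chr N) (hilb M) g"
      using T_euler[OF ctx N cN U] unfolding H(2)[symmetric] by blast
    \<comment> \<open>Partial sums of Euler characteristics. Convolution with \<open>hR\<close>
      turns them into partial sums of Hilbert functions of Tor modules, which are known below
      \<open>U\<close>; cancellation on that down-closed set gives the values of \<open>s n\<close>
      there.\<close>
    define s where "s = (\<lambda>n g. \<Sum>j<n. (-1) ^ j * chr (Tor k R j M N) g)"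
    have bs: "bounded (supp (s m)) \<and> conv (s m) hR = (\<lambda>g. \<Sum>j<m. (-1) ^ j * hilb (Tor k R j M N) g)" for m
    proof (induction m)
      case 0
      have e: "s 0 = 0" by (auto simp: s_def)
      show ?case unfolding e conv_zero by (simp add: supp_def Q.bounded_finite fun_eq_iff)
    next
      case (Suc m)
      show ?case
      proof (cases "even m")
        case True
        then have e: "s (Suc m) = s m + chr (Tor k R m M N)" by (auto simp: s_def)
        have "conv (s m + chr (Tor k R m M N)) hR = (\<lambda>g. \<Sum>j<Suc m. (-1) ^ j * hilb (Tor k R j M N) g)"
          unfolding Q.conv_add[OF conjunct1[OF Suc] cT(1) bounded_supp_hR] conjunct2[OF Suc] cT(2)[symmetric]
          using True by (simp add: fun_eq_iff)
        with Q.bounded_add[OF conjunct1[OF Suc] cT(1)] show ?thesis unfolding e by (rule conjI)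
      next
        case False
        then have e: "s (Suc m) = s m - chr (Tor k R m M N)" by (auto simp: s_def)
        have "conv (s m - chr (Tor k R m M N)) hR = (\<lambda>g. \<Sum>j<Suc m. (-1) ^ j * hilb (Tor k R j M N) g)"
          unfolding Q.conv_diff[OF conjunct1[OF Suc] cT(1) bounded_supp_hR] conjunct2[OF Suc] cT(2)[symmetric]
          using False by (simp add: fun_eq_iff)
        with Q.bounded_diff[OF conjunct1[OF Suc] cT(1)] show ?thesis unfolding e by (rule conjI)
      qed
    qed
    have "chr (Tor k R j M N) g = 0" if "g \<in> ?D" "n \<le> j" for g j
      by (rule chr_vanish_on[OF bT down_closure_down n(1)[OF _ that(2)] that(1)])
    moreover have "s n g = conv (chr M) (chr N) g" if "g \<in> ?D" for g
    proof (rule conv_hR_cancel_on[OF _ _ down_closure_down _ that])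
      show "bounded (supp (s n))" using bs by blast
      show "bounded (supp (conv (chr M) (chr N)))" by (rule Q.bounded_conv[OF cM(1) cN(1)])
      fix g assume "g \<in> ?D"
      then have "conv (s n) hR g = conv (chr N) (hilb M) g" using bs[of n] n(2) by simp
      also have "\<dots> = conv (conv (chr N) (chr M)) hR g"
        unfolding cM(2) Q.conv_assoc[OF cN(1) cM(1) bounded_supp_hR] ..
      finally show "conv (s n) hR g = conv (conv (chr M) (chr N)) hR g" by (simp add: conv_comm)
    qed
    ultimately show ?thesis unfolding s_def by blast
  qed
qed

section \<open>Projective BDF modules\<close>

abbreviation "pfree M \<equiv> bdf M \<and> projective R M"

lemma pfreeI:
  assumes M: "bdf M" and iso: "gr_isomorphism R M (free I d) \<alpha>"
  shows "pfree M"
  using M gr_free_projective[OF bdfD(1)[OF M] free_gr_free[OF bdfD(1)[OF M] iso]] by blast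

lemma pfreeE:
  assumes "pfree M"
  obtains u \<alpha> where "bounded (supp u)" "gr_isomorphism R M (free (fib u) fst) \<alpha>" "chr M = (\<lambda>g. int (u g))"
proof -
  have M: "bdf M" "projective R M" using assms by auto
  obtain u where u: "bounded (supp u)" "gr_isomorphic R M (free (fib u) fst)"
    using projective_free[OF M] by blast
  note gi = graded_index_fib[OF u(1)]
  have "hilb M = conv (\<lambda>g. int (u g)) hR"
    using hilb_iso[OF u(2) M(1) bdf_free(1)[OF gi(1)]] bdf_free(2)[OF gi(1)] gi(2) by simp
  then have "chr M = (\<lambda>g. int (u g))" using u(1) by (intro chr_eqI) (simp_all add: supp_def)
  then show ?thesis using gr_isomorphicE[OF u(2) bdfD(1)[OF M(1)] gm_free] that u(1) by blast
qed

lemma pfree_iso: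
  assumes M: "pfree M" and N: "bdf N" and iso: "gr_isomorphic R N M"
  shows "pfree N"
proof -
  obtain u \<alpha> where u: "gr_isomorphism R M (free (fib u) fst) \<alpha>" using pfreeE[OF M] by blast
  obtain \<beta> where "gr_isomorphism R N M \<beta>" by (rule gr_isomorphicE[OF iso bdfD(1)[OF N] bdfD(1)[OF conjunct1[OF M]]])
  from pfreeI[OF N gr_isomorphism_comp[OF this u]] show ?thesis .
qed

text \<open>For projective modules \<open>chr\<close> is the rank function, and modules with the
  same rank function are isomorphic to the same standard free module.\<close>

lemma pfree_eq:
  assumes M: "pfree M" and N: "pfree N" and eq: "chr M = chr N"
  shows "gr_isomorphic R M N"
proof -
  obtain u \<alpha> where u: "gr_isomorphism R M (free (fib u) fst) \<alpha>" "chr M = (\<lambda>g. int (u g))" using pfreeE[OF M] by blast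
  obtain v \<beta> where v: "gr_isomorphism R N (free (fib v) fst) \<beta>" "chr N = (\<lambda>g. int (v g))" using pfreeE[OF N] by blast
  have "u = v" using u(2) v(2) eq by (auto simp: fun_eq_iff)
  moreover have g: "gm M" "gm N" using M N bdfD(1) by auto
  moreover have "gr_isomorphic R (free (fib v) fst) N"
    by (rule gr_isomorphic_sym[OF gr_isomorphism_isomorphic[OF v(1)] g(2) gm_free])
  ultimately show ?thesis
    using gr_isomorphic_trans[OF gr_isomorphism_isomorphic[OF u(1)] _ g(1) gm_free g(2)] by blast
qed

text \<open>Exactly the Euler characteristics of projective BDF modules, by \<open>pfree_chr\<close>
  and \<open>pfree_exists\<close>.\<close>

definition pos :: "('g \<Rightarrow> int) set"
  where "pos = {c. bounded (supp c) \<and> (\<forall>g. 0 \<le> c g)}"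

lemma pfree_chr: "pfree M \<Longrightarrow> chr M \<in> pos"
  using chr_spec(1)[of M] by (auto simp: pos_def elim!: pfreeE)

lemma pfree_exists:
  assumes c: "c \<in> pos"
  obtains M :: "('k, 'a, 'g) umodule" where "pfree M" "chr M = c"
proof -
  define u where "u g = nat (c g)" for g
  have ic: "(\<lambda>g. int (u g)) = c" using c by (auto simp: u_def pos_def)
  have "supp u = supp c" unfolding ic[symmetric] by (simp add: supp_def)
  then have bu: "bounded (supp u)" using c by (simp add: pos_def)
  note gi = graded_index_fib[OF bu]
  obtain M :: "('k, 'a, 'g) umodule" where M: "bdf M" "gr_isomorphic R (free (fib u) fst) M"
    using BDF_representable[OF bdf_free(1)[OF gi(1)]] by blast
  have "pfree M"
    using gr_isomorphicE[OF gr_isomorphic_sym[OF M(2) gm_free bdfD(1)[OF M(1)]] bdfD(1)[OF M(1)] gm_free] pfreeI[OF M(1)] by metis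
  moreover have "chr M = c"
  proof (rule chr_eqI)
    show "hilb M = conv c hR"
      using hilb_iso[OF M(2) bdf_free(1)[OF gi(1)] M(1)] bdf_free(2)[OF gi(1)] gi(2) ic by simp
  qed (use c in \<open>simp add: pos_def\<close>)
  ultimately show ?thesis by (rule that)
qed

lemma sum_module:
  assumes M: "module R M" and N: "module R N"
  shows "module R (sum_gmodule M N)"
proof -
  interpret M: module R M by (rule M)
  interpret N: module R N by (rule N)
  show ?thesis
  proof (rule moduleI)
    show "abelian_group (sum_gmodule M N)"
    proof (rule abelian_groupI)
      fix x assume "x \<in> carrier (sum_gmodule M N)"
      then show "\<exists>y\<in>carrier (sum_gmodule M N). y \<oplus>\<^bsub>sum_gmodule M N\<^esub> x = \<zero>\<^bsub>sum_gmodule M N\<^esub>"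
        by (intro bexI[of _ "(\<ominus>\<^bsub>M\<^esub> fst x, \<ominus>\<^bsub>N\<^esub> snd x)"]) (auto simp: sum_gmodule_def M.l_neg N.l_neg)
    qed (auto simp: sum_gmodule_def M.a_ac N.a_ac)
  qed (auto simp: sum_gmodule_def A.M_cring M.smult_l_distr N.smult_l_distr M.smult_r_distr N.smult_r_distr M.smult_assoc1 N.smult_assoc1)
qed

lemma sum_pair_map:
  assumes f: "gr_isomorphism R M M' f" and h: "gr_isomorphism R N N' h"
  shows "gr_isomorphism R (sum_gmodule M N) (sum_gmodule M' N') (\<lambda>(x, y). (f x, h y))"
proof (rule gr_isomorphismI)
  note f' = gr_isomorphismD[OF f] and h' = gr_isomorphismD[OF h]
  have eq: "(\<lambda>(x, y). (f x, h y)) = map_prod f h" by auto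
  show "(\<lambda>(x, y). (f x, h y)) \<in> lin_maps R (sum_gmodule M N) (sum_gmodule M' N')"
    using f'(2) h'(2) by (auto simp: lin_maps_def sum_gmodule_def)
  show "bij_betw (\<lambda>(x, y). (f x, h y)) (carrier (sum_gmodule M N)) (carrier (sum_gmodule M' N'))"
    using bij_betw_map_prod[OF f'(3) h'(3)] unfolding eq by (simp add: sum_gmodule_def)
  show "(\<lambda>(x, y). (f x, h y)) ` hcomp (sum_gmodule M N) g = hcomp (sum_gmodule M' N') g" for g
    using f'(4)[of g] h'(4)[of g] unfolding eq by (simp add: sum_gmodule_def map_prod_surj_on)
qed

lemma sum_ses:
  assumes "gm M" "gm N"
  shows "ses R M (sum_gmodule M N) N (\<lambda>x. (x, \<zero>\<^bsub>N\<^esub>)) snd"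
proof -
  interpret M: module R M by (rule gm_module[OF assms(1)])
  interpret N: module R N by (rule gm_module[OF assms(2)])
  show ?thesis
    unfolding ses_def gr_maps_def lin_maps_def
    by (auto simp: sum_gmodule_def a_kernel_eq inj_on_def hcompD(2)[OF assms(2)] image_iff intro!: M.zero_closed bexI[of _ "(\<zero>\<^bsub>M\<^esub>, _)"])
qed

lemma sum_pfree:
  assumes M: "pfree M" and N: "pfree N"
  shows "pfree (sum_gmodule M N)" "chr (sum_gmodule M N) = chr M + chr N"
proof -
  have gM: "gm M" "gm N" using M N bdfD(1) by auto
  obtain u \<alpha> where u: "bounded (supp u)" "gr_isomorphism R M (free (fib u) fst) \<alpha>" using pfreeE[OF M] by blast
  obtain v \<beta> where v: "bounded (supp v)" "gr_isomorphism R N (free (fib v) fst) \<beta>" using pfreeE[OF N] by blast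
  note iso = gr_isomorphism_comp[OF sum_pair_map[OF u(2) v(2)] sum_iso]
  have bdf: "bdf (sum_gmodule M N)"
  proof (rule bdf_iso(1)[OF iso])
    show "module R (sum_gmodule M N)" by (rule sum_module[OF gm_module[OF gM(1)] gm_module[OF gM(2)]])
    show "hcomp (sum_gmodule M N) g \<subseteq> carrier (sum_gmodule M N)" for g
      using hcompD(1)[OF gM(1)] hcompD(1)[OF gM(2)] by (auto simp: sum_gmodule_def)
    show "bdf (free (fib u <+> fib v) (case_sum fst fst))"
      by (rule bdf_free(1)[OF graded_index_Plus(1)[OF graded_index_fib(1)[OF u(1)] graded_index_fib(1)[OF v(1)]]])
  qed
  show "pfree (sum_gmodule M N)" by (rule pfreeI[OF bdf iso])
  show "chr (sum_gmodule M N) = chr M + chr N"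
    using M N bdf by (intro chr_add ses_hilb[OF sum_ses[OF gM]]) auto
qed

lemma shift_0: "shift 0 M = (M :: ('a, 'b, 'g) gmodule)"
  by (cases M) (simp add: shift_def)

lemma gr_isomorphism_shift: "gr_isomorphism R M N f \<Longrightarrow> gr_isomorphism R (shift s M) (shift s N) f"
  unfolding gr_isomorphism_def using gr_maps_shift by auto

lemma gsum_pfree:
  assumes "bdf (gsum I M)" "\<And>i. gm (M i)" "\<And>i. gr_isomorphism R (M i) (shift (s i) (free (J i) (d i))) (\<alpha> i)"
  shows "pfree (gsum I M)"
proof -
  let ?T = "gsum I (\<lambda>i. shift (s i) (free (J i) (d i)))" and ?S = "free (Sigma I J) (\<lambda>(i, j). s i + d i j)"
  have gT: "gm ?T" by (intro gm_gsum gm_shift gm_free)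
  have "gr_isomorphism R ?T ?S (inv_into (carrier ?S) curry)"
    by (rule gr_isomorphism_inv[OF curry_iso gm_module[OF gm_free] gm_module[OF gT] hcomp_carrier[OF gm_free]])
  with gsum_iso[where M = M and N = "\<lambda>i. shift (s i) (free (J i) (d i))", OF assms(2) gm_shift[OF gm_free] assms(3)]
  have "gr_isomorphism R (gsum I M) ?S (\<lambda>x. inv_into (carrier ?S) curry (\<lambda>i. \<alpha> i (x i)))"
    by (rule gr_isomorphism_comp)
  from pfreeI[OF assms(1) this] show ?thesis .
qed

text \<open>With \<open>M\<close> free the tensor product is a direct sum of shifts of
  \<open>N\<close>, which is free by currying; associativity of convolution yields its Euler
  characteristic.\<close>

lemma tens_pfree:
  assumes M: "pfree M" and N: "pfree N"
  shows "pfree (tens M N)" "chr (tens M N) = conv (chr M) (chr N)"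
proof -
  have bN: "bdf N" and gM: "gm M" "gm N" using M N bdfD(1) by auto
  obtain u \<alpha> where u: "bounded (supp u)" "gr_isomorphism R M (free (fib u) fst) \<alpha>" "chr M = (\<lambda>g. int (u g))" using pfreeE[OF M] by blast
  obtain v \<beta> where v: "bounded (supp v)" "gr_isomorphism R N (free (fib v) fst) \<beta>" using pfreeE[OF N] by blast
  note gi = graded_index_fib[OF u(1)]
  note b = bdf_tens_free[OF gM(1) bN u(2) gi(1)]
  obtain \<kappa> where \<kappa>: "gr_isomorphism R (tens M N) (twist N (fib u) fst) \<kappa>" using tens_free_left[OF gM u(2)] by blast
  have tw: "pfree (twist N (fib u) fst)"
    by (rule gsum_pfree[OF bdf_twist(1)[OF bN gi(1)] gm_shift[OF gM(2)] gr_isomorphism_shift[OF v(2)]])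
  show "pfree (tens M N)"
    by (rule pfree_iso[OF tw b(1) gr_isomorphism_isomorphic[OF \<kappa>]])
  note cM = chr_spec(1)[of M] and cN = chr_spec[OF bN]
  show "chr (tens M N) = conv (chr M) (chr N)"
  proof (rule chr_eqI)
    show "bounded (supp (conv (chr M) (chr N)))" using M by (intro Q.bounded_conv cM cN) auto
    show "hilb (tens M N) = conv (conv (chr M) (chr N)) hR"
      unfolding b(2) gi(2) using M cN(2) Q.conv_assoc[OF cM cN(1) bounded_supp_hR] u(3) by simp
  qed
qed

lemma pfree_regular: "pfree (regular_module R)"
  by (rule pfreeI[OF bdf_regular regular_iso])

lemma pfree_zero: "pfree (zero_gmodule :: ('a, unit, 'g) gmodule)" "chr (zero_gmodule :: ('a, unit, 'g) gmodule) = 0"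
proof -
  let ?Z = "zero_gmodule :: ('a, unit, 'g) gmodule"
  have gi: "graded_index {} (\<lambda>_. 0 :: 'g)" by (simp add: graded_index_def Q.bounded_finite)
  have m: "module R ?Z"
  proof (rule moduleI)
    show "abelian_group ?Z" by (rule abelian_groupI) (auto simp: zero_gmodule_def)
  qed (auto simp: zero_gmodule_def A.M_cring)
  have h: "hcomp ?Z g \<subseteq> carrier ?Z" for g by (simp add: zero_gmodule_def)
  note b = bdf_iso[OF zero_iso m h bdf_free(1)[OF gi]]
  show "pfree ?Z" by (rule pfreeI[OF b(1) zero_iso])
  show "chr ?Z = 0"
  proof (rule chr_eqI)
    have "hilb ?Z = 0"
      using hilb_eq_0[OF b(1)] by (auto simp: Supp_def zero_gmodule_def)
    then show "hilb ?Z = conv 0 hR" by (simp add: conv_zero)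
  qed (simp add: supp_def Q.bounded_finite)
qed

end

section \<open>The Grothendieck group of BDF modules\<close>

context pdcf
begin

abbreviation "FG \<equiv> free_on_classes k R"
abbreviation "ER \<equiv> exact_relations k R"
abbreviation "GG \<equiv> G_BDF k R"
abbreviation "ic M \<equiv> iso_class k R M"
abbreviation "gc M \<equiv> G_class k R M"

definition bdf_classes :: "('k, 'a, 'g) umodule set set"
  where "bdf_classes = {iso_class k R M | M :: ('k, 'a, 'g) umodule. BDF k R M}"

text \<open>A class contains only modules over the universal carrier type, but by representability
  it is never empty, so equal classes share a member.\<close>

lemma ic_eq_iff:
  assumes M: "bdf M" and N: "bdf N"
  shows "ic M = ic N \<longleftrightarrow> gr_isomorphic R M N"
proof
  note g = bdfD(1)[OF M] bdfD(1)[OF N]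
  assume eq: "ic M = ic N"
  obtain M' :: "('k, 'a, 'g) umodule" where M': "bdf M'" "gr_isomorphic R M M'" using BDF_representable[OF M] by blast
  then have "M' \<in> ic N" unfolding eq[symmetric] by (simp add: iso_class_def)
  then have "gr_isomorphic R N M'" by (simp add: iso_class_def)
  then show "gr_isomorphic R M N"
    using gr_isomorphic_trans[OF M'(2) gr_isomorphic_sym] g bdfD(1)[OF M'(1)] by blast
next
  note g = bdfD(1)[OF M] bdfD(1)[OF N]
  assume iso: "gr_isomorphic R M N"
  show "ic M = ic N"
    unfolding iso_class_def
    using gr_isomorphic_trans[OF iso _ g(1,2)] gr_isomorphic_trans[OF gr_isomorphic_sym[OF iso g] _ g(2,1)] bdfD(1) by blast
qed

lemma ic_rep:
  assumes "bdf M"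
  obtains M' :: "('k, 'a, 'g) umodule" where "bdf M'" "ic M = ic M'" "gr_isomorphic R M M'"
  using BDF_representable[OF assms] ic_eq_iff[OF assms] by metis

lemma ic_classes: "bdf M \<Longrightarrow> ic M \<in> bdf_classes"
  unfolding bdf_classes_def using ic_rep by blast

lemma FG_eq: "FG = free_Abelian_group bdf_classes"
  by (simp add: free_on_classes_def bdf_classes_def)

lemma FG_simps: "x \<in> carrier FG \<longleftrightarrow> Poly_Mapping.keys x \<subseteq> bdf_classes" "x \<otimes>\<^bsub>FG\<^esub> y = x + y" "\<one>\<^bsub>FG\<^esub> = 0"
  by (simp_all add: FG_eq)

interpretation FG: comm_group FG
  unfolding FG_eq by (rule abelian_free_Abelian_group)

lemma FG_diff: "x \<in> carrier FG \<Longrightarrow> y \<in> carrier FG \<Longrightarrow> x - y \<in> carrier FG"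
  using keys_diff[of x y] unfolding FG_simps by blast

lemma frag_ic: "bdf M \<Longrightarrow> frag_of (ic M) \<in> carrier FG"
  by (simp add: FG_simps ic_classes)

lemma ER_subgroup: "subgroup ER FG"
  unfolding exact_relations_def
proof (rule FG.generate_is_subgroup, clarify)
  fix L M N :: "('k, 'a, 'g) umodule"
  assume "bdf L" "bdf M" "bdf N"
  then show "frag_of (ic L) - frag_of (ic M) + frag_of (ic N) \<in> carrier FG"
    using FG.m_closed[OF FG_diff] frag_ic unfolding FG_simps(2) by blast
qed

interpretation E: normal ER FG
  by (rule FG.subgroup_imp_normal[OF ER_subgroup])

lemma GG_comm: "comm_group GG"
  unfolding G_BDF_def by (rule FG.abelian_FactGroup[OF ER_subgroup])

interpretation GG: comm_group GG
  by (rule GG_comm)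

lemma carrier_GG: "carrier GG = (\<lambda>x. ER #>\<^bsub>FG\<^esub> x) ` carrier FG"
  unfolding G_BDF_def by (rule carrier_FactGroup)

lemma coset_mult: "x \<in> carrier FG \<Longrightarrow> y \<in> carrier FG \<Longrightarrow> (ER #>\<^bsub>FG\<^esub> x) \<otimes>\<^bsub>GG\<^esub> (ER #>\<^bsub>FG\<^esub> y) = ER #>\<^bsub>FG\<^esub> (x + y)"
  using E.rcos_sum[of x y] by (simp add: G_BDF_def FG_simps)

lemma coset_closed: "x \<in> carrier FG \<Longrightarrow> ER #>\<^bsub>FG\<^esub> x \<in> carrier GG"
  by (simp add: carrier_GG)

lemma gc_closed: "bdf M \<Longrightarrow> gc M \<in> carrier GG"
  unfolding G_class_def by (rule coset_closed[OF frag_ic])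

lemma gc_iso: "bdf M \<Longrightarrow> bdf N \<Longrightarrow> gr_isomorphic R M N \<Longrightarrow> gc M = gc N"
  using ic_eq_iff[of M N] by (simp add: G_class_def)

text \<open>The relations of \<open>G\<close> quantify over modules of the universal carrier type
  only. This moves an exact sequence with arbitrary carriers to representatives there, which
  kernels, tensor products and infinite sums require.\<close>

lemma ses_reps:
  assumes s: "ses R L M N f h" and L: "bdf L" and M: "bdf M" and N: "bdf N"
    and L': "bdf L'" "gr_isomorphic R L L'" and M': "bdf M'" "gr_isomorphic R M M'" and N': "bdf N'" "gr_isomorphic R N N'"
  shows "gr_short_exact R L' M' N'"
proof -
  note g = bdfD(1)[OF L] bdfD(1)[OF M] bdfD(1)[OF N] bdfD(1)[OF L'(1)] bdfD(1)[OF M'(1)] bdfD(1)[OF N'(1)]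
  obtain \<phi>1 where \<phi>1: "gr_isomorphism R L' L \<phi>1"
    by (rule gr_isomorphicE[OF gr_isomorphic_sym[OF L'(2) g(1,4)] g(4,1)])
  obtain \<phi>2 where \<phi>2: "gr_isomorphism R M' M \<phi>2"
    by (rule gr_isomorphicE[OF gr_isomorphic_sym[OF M'(2) g(2,5)] g(5,2)])
  obtain \<phi>3 where \<phi>3: "gr_isomorphism R N' N \<phi>3"
    by (rule gr_isomorphicE[OF gr_isomorphic_sym[OF N'(2) g(3,6)] g(6,3)])
  note p1 = gr_isomorphismD[OF \<phi>1] and p2 = gr_isomorphismD[OF \<phi>2] and p3 = gr_isomorphismD[OF \<phi>3]
  note i2 = gr_isomorphismD[OF gr_isomorphism_inv[OF \<phi>2 gm_module[OF g(5)] gm_module[OF g(2)] hcomp_carrier[OF g(5)]]]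
  note i3 = gr_isomorphismD[OF gr_isomorphism_inv[OF \<phi>3 gm_module[OF g(6)] gm_module[OF g(3)] hcomp_carrier[OF g(6)]]]
  have f: "f \<in> gr_maps R L M" and h: "h \<in> gr_maps R M N" using s by (auto simp: ses_def)
  define f' where "f' x = inv_into (carrier M') \<phi>2 (f (\<phi>1 x))" for x
  define h' where "h' x = inv_into (carrier N') \<phi>3 (h (\<phi>2 x))" for x
  have fc: "f x \<in> carrier M" if "x \<in> carrier L" for x using f that by (auto simp: gr_maps_def lin_maps_def)
  have hc: "h x \<in> carrier N" if "x \<in> carrier M" for x using h that by (auto simp: gr_maps_def lin_maps_def)
  have "ses R L' M' N' f' h'"
  proof (rule ses_transfer[OF \<phi>1 \<phi>2 \<phi>3 g(6,3) _ _ _ _ s])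
    show "f' \<in> gr_maps R L' M'"
      unfolding f'_def by (rule gr_maps_comp[OF gr_maps_comp[OF p1(1) f] i2(1)])
    show "h' \<in> gr_maps R M' N'"
      unfolding h'_def by (rule gr_maps_comp[OF gr_maps_comp[OF p2(1) h] i3(1)])
    show "\<phi>2 (f' x) = f (\<phi>1 x)" if "x \<in> carrier L'" for x
    proof -
      have "f (\<phi>1 x) \<in> \<phi>2 ` carrier M'" unfolding p2(6) using fc p1(6) that by blast
      then show ?thesis unfolding f'_def by (rule f_inv_into_f)
    qed
    show "\<phi>3 (h' x) = h (\<phi>2 x)" if "x \<in> carrier M'" for x
    proof -
      have "h (\<phi>2 x) \<in> \<phi>3 ` carrier N'" unfolding p3(6) using hc p2(6) that by blast
      then show ?thesis unfolding h'_def by (rule f_inv_into_f)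
    qed
  qed
  then show ?thesis by (rule ses_short_exact)
qed

lemma gc_ses:
  assumes s: "ses R L M N f h" and L: "bdf L" and M: "bdf M" and N: "bdf N"
  shows "gc M = gc L \<otimes>\<^bsub>GG\<^esub> gc N"
proof -
  obtain L' :: "('k, 'a, 'g) umodule" where L': "bdf L'" "ic L = ic L'" "gr_isomorphic R L L'" by (rule ic_rep[OF L])
  obtain M' :: "('k, 'a, 'g) umodule" where M': "bdf M'" "ic M = ic M'" "gr_isomorphic R M M'" by (rule ic_rep[OF M])
  obtain N' :: "('k, 'a, 'g) umodule" where N': "bdf N'" "ic N = ic N'" "gr_isomorphic R N N'" by (rule ic_rep[OF N])
  have "gr_short_exact R L' M' N'"
    by (rule ses_reps[OF s L M N L'(1,3) M'(1,3) N'(1,3)])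
  then have "frag_of (ic L) - frag_of (ic M) + frag_of (ic N) \<in> ER"
    unfolding exact_relations_def L'(2) M'(2) N'(2) using L'(1) M'(1) N'(1) by (intro generate.incl) blast
  moreover have "frag_of (ic L) + frag_of (ic N) = (frag_of (ic L) - frag_of (ic M) + frag_of (ic N)) \<otimes>\<^bsub>FG\<^esub> frag_of (ic M)"
    by (simp add: FG_simps)
  ultimately have "frag_of (ic L) + frag_of (ic N) \<in> ER #>\<^bsub>FG\<^esub> frag_of (ic M)"
    unfolding r_coset_def by blast
  then have "ER #>\<^bsub>FG\<^esub> frag_of (ic M) = ER #>\<^bsub>FG\<^esub> (frag_of (ic L) + frag_of (ic N))"
    by (rule FG.repr_independence[OF _ frag_ic[OF M] ER_subgroup])
  then show ?thesis using coset_mult[OF frag_ic[OF L] frag_ic[OF N]] by (simp add: G_class_def)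
qed

section \<open>The Euler characteristic on the Grothendieck group \<open>G\<close>\<close>

definition chc :: "('k, 'a, 'g) umodule set \<Rightarrow> 'g \<Rightarrow> int"
  where "chc c = chr (SOME M. M \<in> c)"

lemma chr_iso: "bdf M \<Longrightarrow> bdf N \<Longrightarrow> gr_isomorphic R M N \<Longrightarrow> chr M = chr N"
  by (intro chr_hilb hilb_iso)

lemma chc_ic: assumes "bdf M" shows "chc (ic M) = chr M"
proof -
  obtain M' :: "('k, 'a, 'g) umodule" where "bdf M'" "gr_isomorphic R M M'" using ic_rep[OF assms] by blast
  then have "M' \<in> ic M" by (simp add: iso_class_def)
  then have "(SOME M'. M' \<in> ic M) \<in> ic M" by (rule someI)
  then have "bdf (SOME M'. M' \<in> ic M)" "gr_isomorphic R M (SOME M'. M' \<in> ic M)"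
    by (simp_all add: iso_class_def)
  from chr_iso[OF assms this] show ?thesis unfolding chc_def by simp
qed

definition chi_hom :: "(('k, 'a, 'g) umodule set \<Rightarrow>\<^sub>0 int) \<Rightarrow> 'g \<Rightarrow> int"
  where "chi_hom = (SOME H. (\<forall>x\<in>carrier FG. \<forall>y\<in>carrier FG. H (x + y) = H x + H y) \<and> (\<forall>c\<in>bdf_classes. H (frag_of c) = chc c))"

lemma chi_hom:
  "x \<in> carrier FG \<Longrightarrow> y \<in> carrier FG \<Longrightarrow> chi_hom (x + y) = chi_hom x + chi_hom y"
  "bdf M \<Longrightarrow> chi_hom (frag_of (ic M)) = chr M"
proof -
  \<comment> \<open>The additive group of integer functions, written as a multiplicative record to
    fit the universal property of the free abelian group.\<close>
  let ?B = "\<lparr>carrier = UNIV :: ('g \<Rightarrow> int) set, monoid.mult = (+), one = 0\<rparr>"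
  interpret B: comm_group ?B
  proof (rule comm_groupI)
    fix x assume "x \<in> carrier ?B"
    then show "\<exists>y\<in>carrier ?B. y \<otimes>\<^bsub>?B\<^esub> x = \<one>\<^bsub>?B\<^esub>" by (intro bexI[of _ "- x"]) simp_all
  qed (simp_all add: add.assoc add.commute)
  obtain H where "H \<in> hom (free_Abelian_group bdf_classes) ?B" "\<And>c. c \<in> bdf_classes \<Longrightarrow> H (frag_of c) = chc c"
    using B.free_Abelian_group_universal[of chc bdf_classes] by auto
  then have "\<exists>H. (\<forall>x\<in>carrier FG. \<forall>y\<in>carrier FG. H (x + y) = H x + H y) \<and> (\<forall>c\<in>bdf_classes. H (frag_of c) = chc c)"
    by (intro exI[of _ H]) (simp add: hom_def FG_eq)
  from someI_ex[OF this]
  have "(\<forall>x\<in>carrier FG. \<forall>y\<in>carrier FG. chi_hom (x + y) = chi_hom x + chi_hom y) \<and> (\<forall>c\<in>bdf_classes. chi_hom (frag_of c) = chc c)"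
    unfolding chi_hom_def .
  then show "x \<in> carrier FG \<Longrightarrow> y \<in> carrier FG \<Longrightarrow> chi_hom (x + y) = chi_hom x + chi_hom y"
    "bdf M \<Longrightarrow> chi_hom (frag_of (ic M)) = chr M"
    by (auto simp: ic_classes chc_ic)
qed

text \<open>Hilbert functions add along short exact sequences, hence so does \<open>chr\<close>, and
  the kernel of \<open>chi_hom\<close> contains all generators of the relations.\<close>

lemma chi_hom_ER: "x \<in> ER \<Longrightarrow> chi_hom x = 0"
proof -
  have z: "chi_hom 0 = 0" using chi_hom(1)[of 0 0] by (simp add: FG_simps)
  have sub: "subgroup {x \<in> carrier FG. chi_hom x = 0} FG"
  proof (rule FG.subgroupI)
    show "{x \<in> carrier FG. chi_hom x = 0} \<noteq> {}" using z by (auto simp: FG_simps intro!: exI[of _ 0])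
    fix x assume "x \<in> {x \<in> carrier FG. chi_hom x = 0}"
    then have x: "x \<in> carrier FG" "chi_hom x = 0" by auto
    have i: "inv\<^bsub>FG\<^esub> x = - x" using x(1) unfolding FG_eq by simp
    have "chi_hom (x + - x) = chi_hom x + chi_hom (- x)" using chi_hom(1)[OF x(1) FG.inv_closed[OF x(1)]] unfolding i .
    then show "inv\<^bsub>FG\<^esub> x \<in> {x \<in> carrier FG. chi_hom x = 0}" using x z FG.inv_closed[OF x(1)] unfolding i by simp
  next
    fix x y assume "x \<in> {x \<in> carrier FG. chi_hom x = 0}" "y \<in> {x \<in> carrier FG. chi_hom x = 0}"
    then show "x \<otimes>\<^bsub>FG\<^esub> y \<in> {x \<in> carrier FG. chi_hom x = 0}"
      using FG.m_closed[of x y] chi_hom(1)[of x y] unfolding FG_simps(2) by simp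
  qed auto
  have "ER \<subseteq> {x \<in> carrier FG. chi_hom x = 0}"
    unfolding exact_relations_def
  proof (rule FG.generate_subgroup_incl[OF _ sub], clarify)
    fix L M N :: "('k, 'a, 'g) umodule"
    assume b: "bdf L" "bdf M" "bdf N" and s: "gr_short_exact R L M N"
    let ?z = "frag_of (ic L) - frag_of (ic M) + frag_of (ic N)"
    have z: "?z \<in> carrier FG"
      using FG.m_closed[OF FG_diff[OF frag_ic[OF b(1)] frag_ic[OF b(2)]] frag_ic[OF b(3)]] unfolding FG_simps(2) .
    have "chi_hom (?z + frag_of (ic M)) = chi_hom (frag_of (ic L) + frag_of (ic N))" by simp
    then have "chi_hom ?z + chr M = chr L + chr N"
      using chi_hom(1)[OF z frag_ic[OF b(2)]] chi_hom(1)[OF frag_ic[OF b(1)] frag_ic[OF b(3)]]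
      by (simp add: chi_hom(2) b)
    then show "?z \<in> carrier FG \<and> chi_hom ?z = 0"
      using z chr_add[OF b hilb_short_exact[OF s b]] by simp
  qed
  then show "x \<in> ER \<Longrightarrow> chi_hom x = 0" by blast
qed

text \<open>\<open>chi_hom\<close> is constant on every coset of the relations, so its image there
  is a singleton.\<close>

definition chG :: "(('k, 'a, 'g) umodule set \<Rightarrow>\<^sub>0 int) set \<Rightarrow> 'g \<Rightarrow> int"
  where "chG X = the_elem (chi_hom ` X)"

lemma chG_coset: assumes x: "x \<in> carrier FG" shows "chG (ER #>\<^bsub>FG\<^esub> x) = chi_hom x"
proof -
  have "chi_hom (e + x) = chi_hom x" if "e \<in> ER" for e
    using chi_hom(1)[OF _ x, of e] E.subset that chi_hom_ER[OF that] by auto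
  moreover have "0 \<in> ER" using E.one_closed by (simp add: FG_simps)
  ultimately have "chi_hom ` (ER #>\<^bsub>FG\<^esub> x) = {chi_hom x}" unfolding r_coset_def FG_simps(2) by (auto simp: image_iff)
  then show ?thesis by (simp add: chG_def)
qed

lemma chG_mult: "X \<in> carrier GG \<Longrightarrow> Y \<in> carrier GG \<Longrightarrow> chG (X \<otimes>\<^bsub>GG\<^esub> Y) = chG X + chG Y"
  using FG.m_closed unfolding carrier_GG FG_simps(2) by (auto simp: coset_mult chG_coset chi_hom(1))

lemma chG_gc: "bdf M \<Longrightarrow> chG (gc M) = chr M"
  by (simp add: G_class_def chG_coset frag_ic chi_hom(2))

lemma chG_one: "chG \<one>\<^bsub>GG\<^esub> = 0"
  using chG_mult[OF GG.one_closed GG.one_closed] by simp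

lemma chG_inv: "X \<in> carrier GG \<Longrightarrow> chG (inv\<^bsub>GG\<^esub> X) = - chG X"
  using chG_mult[of X "inv\<^bsub>GG\<^esub> X"] chG_one by (simp add: eq_neg_iff_add_eq_0 add.commute)

lemma pfree_rep:
  assumes P: "pfree P"
  obtains P' :: "('k, 'a, 'g) umodule" where "pfree P'" "gc P' = gc P" "chr P' = chr P"
proof -
  obtain P' :: "('k, 'a, 'g) umodule" where P': "bdf P'" "ic P = ic P'" "gr_isomorphic R P P'"
    using ic_rep[OF conjunct1[OF P]] by blast
  have "gr_isomorphic R P' P" by (rule gr_isomorphic_sym[OF P'(3)]) (use P P'(1) bdfD(1) in auto)
  then show ?thesis using that[of P'] pfree_iso[OF P P'(1)] gc_iso[OF P'(1)] chr_iso[OF P'(1)] P by blast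
qed

text \<open>Splits the initial summand off an infinite direct sum; the remaining sum is reindexed by
  the successor, as the swindle requires.\<close>

lemma gsum_shift_ses:
  fixes Z :: "nat \<Rightarrow> ('a, 'b, 'g) gmodule"
  assumes Z: "\<And>i. gm (Z i)"
  shows "ses R (gsum UNIV (\<lambda>i. Z (Suc i))) (gsum UNIV Z) (Z 0)
    (\<lambda>x i. (case i of 0 \<Rightarrow> \<zero>\<^bsub>Z 0\<^esub> | Suc j \<Rightarrow> x j)) (\<lambda>x. x 0)"
proof -
  interpret Z: module R "Z i" for i by (rule gm_module[OF Z])
  let ?X = "gsum UNIV (\<lambda>i. Z (Suc i))" and ?Y = "gsum UNIV Z"
  let ?s = "\<lambda>x i. (case i of 0 \<Rightarrow> \<zero>\<^bsub>Z 0\<^esub> | Suc j \<Rightarrow> x j)"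
  have zh: "\<zero>\<^bsub>Z i\<^esub> \<in> hcomp (Z i) g" for i g by (rule hcompD(2)[OF Z])
  have sc: "?s x \<in> carrier ?Y" if "x \<in> carrier ?X" for x
  proof (rule gsum_memI[where S = "Suc ` {i. x i \<noteq> \<zero>\<^bsub>Z (Suc i)\<^esub>}"])
    show "finite (Suc ` {i. x i \<noteq> \<zero>\<^bsub>Z (Suc i)\<^esub>})" using gsum_memD(2)[OF that] by simp
    show "?s x i \<in> carrier (Z i)" for i using gsum_memD(1)[OF that] by (cases i) auto
    show "i \<in> Suc ` {i. x i \<noteq> \<zero>\<^bsub>Z (Suc i)\<^esub>}" if "?s x i \<noteq> \<zero>\<^bsub>Z i\<^esub>" for i using that by (cases i) auto
  qed simp
  have s: "?s \<in> gr_maps R ?X ?Y"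
    unfolding gr_maps_def lin_maps_def
  proof (intro CollectI conjI ballI allI funcsetI subsetI)
    show "?s x \<in> carrier ?Y" if "x \<in> carrier ?X" for x by (rule sc[OF that])
    show "?s (x \<oplus>\<^bsub>?X\<^esub> y) = ?s x \<oplus>\<^bsub>?Y\<^esub> ?s y" for x y by (auto simp: fun_eq_iff split: nat.split)
    show "?s (r \<odot>\<^bsub>?X\<^esub> x) = r \<odot>\<^bsub>?Y\<^esub> ?s x" if "r \<in> carrier R" for r x using that by (auto simp: fun_eq_iff split: nat.split)
    fix g y assume "y \<in> ?s ` hcomp ?X g"
    then obtain x where x: "x \<in> hcomp ?X g" "y = ?s x" by blast
    show "y \<in> hcomp ?Y g"
      using sc[OF hcomp_gsum_mem(1)[OF x(1)]] hcomp_gsum_mem(2)[OF x(1)] zh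
      by (simp add: gsum_simps(2) x(2) split: nat.split)
  qed
  have e: "(\<lambda>x. x 0) \<in> gr_maps R ?Y (Z 0)"
    using gsum_eval_lin[of 0 R UNIV Z] hcomp_gsum_mem(2)[of _ UNIV Z] by (auto simp: gr_maps_def)
  have "inj_on ?s (carrier ?X)"
    by (rule inj_onI) (metis (no_types, lifting) ext nat.case(2))
  moreover have "?s ` carrier ?X = a_kernel ?Y (Z 0) (\<lambda>x. x 0)"
  proof
    show "?s ` carrier ?X \<subseteq> a_kernel ?Y (Z 0) (\<lambda>x. x 0)" using sc by (auto simp: a_kernel_eq)
    show "a_kernel ?Y (Z 0) (\<lambda>x. x 0) \<subseteq> ?s ` carrier ?X"
    proof
      fix y assume "y \<in> a_kernel ?Y (Z 0) (\<lambda>x. x 0)"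
      then have y: "y \<in> carrier ?Y" "y 0 = \<zero>\<^bsub>Z 0\<^esub>" by (auto simp: a_kernel_eq)
      have "(\<lambda>i. y (Suc i)) \<in> carrier ?X"
      proof (rule gsum_memI[where S = "{i. y (Suc i) \<noteq> \<zero>\<^bsub>Z (Suc i)\<^esub>}"])
        show "finite {i. y (Suc i) \<noteq> \<zero>\<^bsub>Z (Suc i)\<^esub>}"
          using finite_vimageI[OF gsum_memD(2)[OF y(1)], of Suc] by (simp add: vimage_def)
      qed (use gsum_memD(1)[OF y(1)] in auto)
      moreover have "y = ?s (\<lambda>i. y (Suc i))" using y(2) by (auto simp: fun_eq_iff split: nat.split)
      ultimately show "y \<in> ?s ` carrier ?X" by blast
    qed
  qed
  moreover have "(\<lambda>x. x 0) ` carrier ?Y = carrier (Z 0)"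
  proof
    show "(\<lambda>x. x 0) ` carrier ?Y \<subseteq> carrier (Z 0)"
    proof
      fix z assume "z \<in> (\<lambda>x. x 0) ` carrier ?Y"
      then obtain x where "x \<in> carrier ?Y" "z = x 0" by blast
      then show "z \<in> carrier (Z 0)" using gsum_memD(1)[of x UNIV Z 0] by simp
    qed
    show "carrier (Z 0) \<subseteq> (\<lambda>x. x 0) ` carrier ?Y"
    proof
      fix z assume "z \<in> carrier (Z 0)"
      then have "gsingle Z 0 z \<in> carrier ?Y" by (intro gsingle_mem[where M = Z, OF gm_module[OF Z]]) simp_all
      then show "z \<in> (\<lambda>x. x 0) ` carrier ?Y" by (intro image_eqI[of _ _ "gsingle Z 0 z"]) simp_all
    qed
  qed
  ultimately show ?thesis unfolding ses_def using s e by blast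
qed

text \<open>An Eilenberg swindle: sorting the terms of a free resolution by parity replaces the infinite
  alternating sum of their classes by a difference of two.\<close>

lemma class_resolution:
  fixes M :: "('k, 'a, 'g) umodule"
  assumes M: "bdf M"
  obtains E O' :: "('k, 'a, 'g) umodule" where "pfree E" "pfree O'" "gc M \<otimes>\<^bsub>GG\<^esub> gc O' = gc E"
proof -
  obtain N F f \<iota> \<pi> where syz: "syzygies M N F f \<iota> \<pi>" using syzygies_exist[OF M] by blast
  note S = syzygiesD[OF syz]
  have gN: "gm (N i)" and gF: "gm (F i)" for i using S(2,3) bdfD(1) by auto
  have bN: "bdf (gsum UNIV (\<lambda>i. N (a i)))" if "inj a" for a :: "nat \<Rightarrow> nat"
    by (rule bdf_gsum(1)[OF S(2) bounded_Supp_N[OF syz]]) (use finite_Supp_N[OF syz that] in simp)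
  \<comment> \<open>The supports of the free terms are controlled by additivity of Hilbert
    functions, so sums of free terms are as locally finite as sums of syzygies.\<close>
  have SF: "Supp (F i) \<subseteq> Supp (N i) \<union> Supp (N (Suc i))" for i
  proof
    fix g assume "g \<in> Supp (F i)"
    then have "hilb (N (Suc i)) g + hilb (N i) g \<noteq> 0"
      using hilb_eq_0[OF S(3), of i g] ses_hilb[OF S(6) S(2) S(3) S(2), of i] by simp
    then have "hilb (N (Suc i)) g \<noteq> 0 \<or> hilb (N i) g \<noteq> 0" by auto
    then show "g \<in> Supp (N i) \<union> Supp (N (Suc i))" by (simp add: hilb_eq_0[OF S(2)] disj_commute)
  qed
  have bF: "bdf (gsum UNIV (\<lambda>i. F (a i)))" if a: "inj a" for a :: "nat \<Rightarrow> nat"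
  proof (rule bdf_gsum(1)[OF S(3)])
    have sa: "inj (\<lambda>i. Suc (a i))" using a by (auto simp: inj_on_def)
    show "bounded (\<Union>i. Supp (F (a i)))"
      by (rule Q.bounded_subset[OF Q.bounded_Un[OF bounded_Supp_N[OF syz, of a] bounded_Supp_N[OF syz, of "\<lambda>i. Suc (a i)"]]])
        (use SF in blast)
    show "finite {i \<in> UNIV. g \<in> Supp (F (a i))}" for g
    proof (rule finite_subset)
      show "{i \<in> UNIV. g \<in> Supp (F (a i))} \<subseteq> {i. g \<in> Supp (N (a i))} \<union> {i. g \<in> Supp (N (Suc (a i)))}"
        using SF by blast
      show "finite ({i. g \<in> Supp (N (a i))} \<union> {i. g \<in> Supp (N (Suc (a i)))})"
        by (rule finite_UnI[OF finite_Supp_N[OF syz a] finite_Supp_N[OF syz sa]])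
    qed
  qed
  have "\<exists>\<alpha>. gr_isomorphism R (F i) (free (fib (f i)) fst) \<alpha>" for i
    using gr_isomorphicE[OF S(5) gF gm_free] by metis
  then obtain \<alpha> where \<alpha>: "\<And>i. gr_isomorphism R (F i) (free (fib (f i)) fst) (\<alpha> i)" by metis
  have pF: "pfree (gsum UNIV (\<lambda>i. F (a i)))" if "inj a" for a :: "nat \<Rightarrow> nat"
    by (rule gsum_pfree[where s = "\<lambda>_. 0" and J = "\<lambda>i. fib (f (a i))" and d = "\<lambda>_. fst" and \<alpha> = "\<lambda>i. \<alpha> (a i)", OF bF[OF that] gF])
      (simp add: shift_0 \<alpha>)
  have inj: "inj (\<lambda>i. 2 * i :: nat)" "inj (\<lambda>i. Suc (2 * i))" "inj (\<lambda>i. 2 * Suc i)" by (auto simp: inj_on_def)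
  let ?E = "gsum UNIV (\<lambda>i. F (2 * i))" and ?O = "gsum UNIV (\<lambda>i. F (Suc (2 * i)))"
  let ?X = "gsum UNIV (\<lambda>i. N (2 * i))" and ?Y = "gsum UNIV (\<lambda>i. N (Suc (2 * i)))" and ?X' = "gsum UNIV (\<lambda>i. N (2 * Suc i))"
  note b = bN[OF inj(1)] bN[OF inj(2)] bN[OF inj(3)] and c = gc_closed[OF bN[OF inj(1)]] gc_closed[OF bN[OF inj(2)]] gc_closed[OF bN[OF inj(3)]]
  \<comment> \<open>Let X and Y be the sums of the even and the odd syzygies, and X' the sum of the
    even ones from 2 on. The covers give E = Y + X and O = X' + Y, and splitting off
    \<open>M\<close> gives X = X' + M; hence M + O = E.\<close>
  have 1: "gc ?E = gc ?Y \<otimes>\<^bsub>GG\<^esub> gc ?X"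
    by (rule gc_ses[OF gsum_ses[OF gN gF gN S(6)] b(2) bF[OF inj(1)] b(1)])
  have e: "2 * Suc i = Suc (Suc (2 * i))" for i by simp
  have 2: "gc ?O = gc ?X' \<otimes>\<^bsub>GG\<^esub> gc ?Y"
    unfolding e by (rule gc_ses[OF gsum_ses[OF gN gF gN S(6)] b(3)[unfolded e] bF[OF inj(2)] b(2)])
  have 3: "gc ?X = gc ?X' \<otimes>\<^bsub>GG\<^esub> gc M"
    using gc_ses[OF gsum_shift_ses[of "\<lambda>i. N (2 * i)", OF gN] b(3,1)] S(1) M by simp
  have "gc M \<otimes>\<^bsub>GG\<^esub> gc ?O = gc ?E"
    unfolding 1 2 3 using c gc_closed[OF M] by (simp add: GG.m_ac)
  moreover obtain E :: "('k, 'a, 'g) umodule" where "pfree E" "gc E = gc ?E" by (rule pfree_rep[OF pF[OF inj(1)]])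
  moreover obtain O' :: "('k, 'a, 'g) umodule" where "pfree O'" "gc O' = gc ?O" by (rule pfree_rep[OF pF[OF inj(2)]])
  ultimately show ?thesis using that by metis
qed

lemma gc_sum: "pfree P \<Longrightarrow> pfree P' \<Longrightarrow> gc (sum_gmodule P P') = gc P \<otimes>\<^bsub>GG\<^esub> gc P'"
  by (rule gc_ses[OF sum_ses]) (auto simp: bdfD(1) sum_pfree(1))

text \<open>Classes of modules generate \<open>G\<close>, each is a difference of classes of
  projectives by \<open>class_resolution\<close>, and such differences are closed under subtraction
  by taking direct sums.\<close>

lemma GG_difference:
  assumes "x \<in> carrier GG"
  shows "\<exists>(P :: ('k, 'a, 'g) umodule) (P' :: ('k, 'a, 'g) umodule). pfree P \<and> pfree P' \<and> x \<otimes>\<^bsub>GG\<^esub> gc P' = gc P"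
proof -
  let ?q = "\<lambda>c. ER #>\<^bsub>FG\<^esub> c"
  obtain c where c: "c \<in> carrier FG" "x = ?q c" using assms by (auto simp: carrier_GG)
  have "Poly_Mapping.keys c \<subseteq> bdf_classes" using c(1) by (simp add: FG_simps)
  then have "c \<in> carrier FG \<and> (\<exists>(P :: ('k, 'a, 'g) umodule) (P' :: ('k, 'a, 'g) umodule). pfree P \<and> pfree P' \<and> ?q c \<otimes>\<^bsub>GG\<^esub> gc P' = gc P)"
  proof (induction c rule: frag_induction)
    case zero
    obtain P :: "('k, 'a, 'g) umodule" where P: "pfree P" using pfree_rep[OF pfree_regular] by blast
    have "?q 0 = \<one>\<^bsub>GG\<^esub>" using FG.coset_join2[OF FG.one_closed ER_subgroup E.one_closed] by (simp add: FG_simps G_BDF_def)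
    then have "?q 0 \<otimes>\<^bsub>GG\<^esub> gc P = gc P" using gc_closed[OF conjunct1[OF P]] by simp
    moreover have "(0 :: ('k, 'a, 'g) umodule set \<Rightarrow>\<^sub>0 int) \<in> carrier FG" by (simp add: FG_simps)
    ultimately show ?case using P by (intro conjI exI[of _ P]) simp_all
  next
    case (one z)
    then obtain M :: "('k, 'a, 'g) umodule" where M: "bdf M" "z = ic M" by (auto simp: bdf_classes_def)
    obtain E O' :: "('k, 'a, 'g) umodule" where "pfree E" "pfree O'" "gc M \<otimes>\<^bsub>GG\<^esub> gc O' = gc E"
      by (rule class_resolution[OF M(1)])
    then show ?case using frag_ic[OF M(1)] unfolding M(2) G_class_def by blast
  next
    case (diff a b)
    then obtain P P' T T' :: "('k, 'a, 'g) umodule" where P: "pfree P" "pfree P'" "?q a \<otimes>\<^bsub>GG\<^esub> gc P' = gc P"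
      and T: "pfree T" "pfree T'" "?q b \<otimes>\<^bsub>GG\<^esub> gc T' = gc T" by blast
    have a: "a \<in> carrier FG" and b: "b \<in> carrier FG" using diff by auto
    note ab = FG_diff[OF a b]
    note cl = gc_closed[OF conjunct1[OF P(1)]] gc_closed[OF conjunct1[OF P(2)]] gc_closed[OF conjunct1[OF T(1)]] gc_closed[OF conjunct1[OF T(2)]]
      coset_closed[OF a] coset_closed[OF b] coset_closed[OF ab]
    obtain Y :: "('k, 'a, 'g) umodule" where Y: "pfree Y" "gc Y = gc (sum_gmodule P T')"
      by (rule pfree_rep[OF sum_pfree(1)[OF P(1) T(2)]])
    obtain Y' :: "('k, 'a, 'g) umodule" where Y': "pfree Y'" "gc Y' = gc (sum_gmodule P' T)"
      by (rule pfree_rep[OF sum_pfree(1)[OF P(2) T(1)]])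
    have qa: "?q a = ?q (a - b) \<otimes>\<^bsub>GG\<^esub> ?q b" using coset_mult[OF ab b] by simp
    have "?q (a - b) \<otimes>\<^bsub>GG\<^esub> gc Y' = gc Y"
      unfolding Y Y' gc_sum[OF P(1) T(2)] gc_sum[OF P(2) T(1)] P(3)[symmetric] T(3)[symmetric] qa
      using cl by (simp add: GG.m_ac)
    then show ?case using ab Y(1) Y'(1) by blast
  qed
  then show ?thesis using c(2) by blast
qed

text \<open>Both elements are written as differences of projectives. Equality of Euler
  characteristics makes the cross sums isomorphic, and the common summands cancel in the
  group.\<close>

lemma chG_inj:
  assumes x: "x \<in> carrier GG" and y: "y \<in> carrier GG" and eq: "chG x = chG y"
  shows "x = y"
proof -
  obtain P P' :: "('k, 'a, 'g) umodule" where P: "pfree P" "pfree P'" "x \<otimes>\<^bsub>GG\<^esub> gc P' = gc P" using GG_difference[OF x] by blast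
  obtain T T' :: "('k, 'a, 'g) umodule" where T: "pfree T" "pfree T'" "y \<otimes>\<^bsub>GG\<^esub> gc T' = gc T" using GG_difference[OF y] by blast
  note cl = gc_closed[OF conjunct1[OF P(1)]] gc_closed[OF conjunct1[OF P(2)]] gc_closed[OF conjunct1[OF T(1)]] gc_closed[OF conjunct1[OF T(2)]]
  have "chr P = chG x + chr P'"
    using chG_mult[OF x cl(2)] unfolding P(3) by (simp add: chG_gc P)
  moreover have "chr T = chG y + chr T'"
    using chG_mult[OF y cl(4)] unfolding T(3) by (simp add: chG_gc T)
  ultimately have "chr (sum_gmodule P T') = chr (sum_gmodule T P')"
    using eq by (simp add: sum_pfree(2) P T algebra_simps)
  then have "gc (sum_gmodule P T') = gc (sum_gmodule T P')"
    using pfree_eq[OF sum_pfree(1)[OF P(1) T(2)] sum_pfree(1)[OF T(1) P(2)]] gc_iso sum_pfree(1) P T by blast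
  then have "gc P \<otimes>\<^bsub>GG\<^esub> gc T' = gc T \<otimes>\<^bsub>GG\<^esub> gc P'"
    unfolding gc_sum[OF P(1) T(2)] gc_sum[OF T(1) P(2)] .
  then have "x \<otimes>\<^bsub>GG\<^esub> (gc P' \<otimes>\<^bsub>GG\<^esub> gc T') = y \<otimes>\<^bsub>GG\<^esub> (gc P' \<otimes>\<^bsub>GG\<^esub> gc T')"
    unfolding P(3)[symmetric] T(3)[symmetric] using x y cl by (simp add: GG.m_ac)
  then show ?thesis using x y cl by simp
qed

lemma chG_bounded:
  assumes x: "x \<in> carrier GG" shows "bounded (supp (chG x))"
proof -
  obtain P P' :: "('k, 'a, 'g) umodule" where P: "pfree P" "pfree P'" "x \<otimes>\<^bsub>GG\<^esub> gc P' = gc P" using GG_difference[OF x] by blast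
  have "chr P = chG x + chr P'"
    using chG_mult[OF x gc_closed[OF conjunct1[OF P(2)]]] unfolding P(3) by (simp add: chG_gc P)
  then have "chG x = chr P - chr P'" by simp
  then show ?thesis using Q.bounded_diff chr_spec(1) P by metis
qed

lemma split_pos:
  assumes "bounded (supp w)"
  shows "(\<lambda>g. max 0 (w g)) \<in> pos" "(\<lambda>g. max 0 (- w g)) \<in> pos"
    "w = (\<lambda>g. max 0 (w g)) - (\<lambda>g. max 0 (- w g))"
proof -
  have "supp (\<lambda>g. max 0 (w g)) \<subseteq> supp w" "supp (\<lambda>g. max 0 (- w g)) \<subseteq> supp w" by (auto simp: supp_def max_def split: if_splits)
  then show "(\<lambda>g. max 0 (w g)) \<in> pos" "(\<lambda>g. max 0 (- w g)) \<in> pos"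
    using Q.bounded_subset[OF assms] by (auto simp: pos_def)
qed (auto simp: fun_eq_iff)

text \<open>The positive and negative parts of \<open>w\<close> are used, not an arbitrary
  difference, so that both Euler characteristics vanish wherever \<open>w\<close> does;
  \<open>Z_subgroup_iff\<close> depends on this.\<close>

lemma chG_split:
  assumes w: "bounded (supp w)"
  obtains P P' :: "('k, 'a, 'g) umodule" where "pfree P" "pfree P'" "chr P = (\<lambda>g. max 0 (w g))" "chr P' = (\<lambda>g. max 0 (- w g))"
    "chG (gc P \<otimes>\<^bsub>GG\<^esub> inv\<^bsub>GG\<^esub> gc P') = w"
proof -
  note s = split_pos[OF w]
  obtain P :: "('k, 'a, 'g) umodule" where P: "pfree P" "chr P = (\<lambda>g. max 0 (w g))" by (rule pfree_exists[OF s(1)])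
  obtain P' :: "('k, 'a, 'g) umodule" where P': "pfree P'" "chr P' = (\<lambda>g. max 0 (- w g))" by (rule pfree_exists[OF s(2)])
  have c: "gc P \<in> carrier GG" "gc P' \<in> carrier GG" using gc_closed P P' by auto
  have "chG (gc P \<otimes>\<^bsub>GG\<^esub> inv\<^bsub>GG\<^esub> gc P') = chr P - chr P'"
    using chG_mult[OF c(1) GG.inv_closed[OF c(2)]] chG_inv[OF c(2)] by (simp add: chG_gc P(1) P'(1))
  also have "\<dots> = w" unfolding P(2) P'(2) by (rule s(3)[symmetric])
  finally show ?thesis using that P P' by blast
qed

end

section \<open>The ring of Euler characteristics\<close>

context pdcf
begin

text \<open>A ring of formal series with exponents bounded below. Both \<open>K\<close> and
  \<open>G\<close> are images of it, so the ring axioms are verified once.\<close>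

definition euler_ring :: "('g \<Rightarrow> int) ring"
  where "euler_ring = \<lparr>carrier = {w. bounded (supp w)}, monoid.mult = conv, one = unit_fun, ring.zero = 0, add = (+)\<rparr>"

lemma euler_ring_simps [simp]:
  "w \<in> carrier euler_ring \<longleftrightarrow> bounded (supp w)" "w \<otimes>\<^bsub>euler_ring\<^esub> z = conv w z" "w \<oplus>\<^bsub>euler_ring\<^esub> z = w + z"
  "\<one>\<^bsub>euler_ring\<^esub> = unit_fun" "\<zero>\<^bsub>euler_ring\<^esub> = 0"
  by (simp_all add: euler_ring_def)

lemma unit_fun_pos: "unit_fun \<in> pos"
proof -
  have "supp unit_fun = {0 :: 'g}" by (auto simp: supp_def unit_fun_def)
  then show ?thesis by (simp add: pos_def Q.bounded_finite) (simp add: unit_fun_def)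
qed

lemma bounded_zero: "bounded (supp (0 :: 'g \<Rightarrow> int))"
  by (simp add: supp_def Q.bounded_finite)

lemma euler_ring_cring: "cring euler_ring"
proof (rule cringI)
  show "abelian_group euler_ring"
  proof (rule abelian_groupI)
    fix w assume w: "w \<in> carrier euler_ring"
    show "\<exists>z\<in>carrier euler_ring. z \<oplus>\<^bsub>euler_ring\<^esub> w = \<zero>\<^bsub>euler_ring\<^esub>"
      using w by (intro bexI[of _ "- w"]) (simp_all add: Q.supp_uminus)
  qed (simp_all add: Q.bounded_add add.assoc add.commute bounded_zero)
  show "comm_monoid euler_ring"
    by (rule comm_monoidI)
      (use unit_fun_pos in \<open>auto simp: Q.bounded_conv Q.conv_assoc conv_unit pos_def intro: conv_comm\<close>)
  show "(w \<oplus>\<^bsub>euler_ring\<^esub> z) \<otimes>\<^bsub>euler_ring\<^esub> t = w \<otimes>\<^bsub>euler_ring\<^esub> t \<oplus>\<^bsub>euler_ring\<^esub> z \<otimes>\<^bsub>euler_ring\<^esub> t"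
    if "w \<in> carrier euler_ring" "z \<in> carrier euler_ring" "t \<in> carrier euler_ring" for w z t
    using that by (simp add: Q.conv_add)
qed

lemma pos_add: "u \<in> pos \<Longrightarrow> v \<in> pos \<Longrightarrow> u + v \<in> pos"
  by (simp add: pos_def Q.bounded_add)

lemma pos_conv: "u \<in> pos \<Longrightarrow> v \<in> pos \<Longrightarrow> conv u v \<in> pos"
  by (auto simp: pos_def Q.bounded_conv) (auto simp: conv_def intro!: sum_nonneg)

lemma pos_zero: "0 \<in> pos"
  by (simp add: pos_def bounded_zero)

lemma pos_diff_bounded: "u \<in> pos \<Longrightarrow> v \<in> pos \<Longrightarrow> bounded (supp (u - v))"
  by (simp add: pos_def Q.bounded_diff)

section \<open>The ring of projective modules\<close>

abbreviation "PS \<equiv> proj_semiring k R"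

definition pcl :: "('g \<Rightarrow> int) \<Rightarrow> ('k, 'a, 'g) umodule set"
  where "pcl u = {F. pfree F \<and> chr F = u}"

lemma pcl_ic:
  assumes F: "pfree F" shows "ic F = pcl (chr F)"
proof (intro equalityI subsetI)
  note bF = conjunct1[OF F]
  fix F' :: "('k, 'a, 'g) umodule"
  show "F' \<in> pcl (chr F)" if "F' \<in> ic F"
  proof -
    have F': "bdf F'" "gr_isomorphic R F F'" using that by (auto simp: iso_class_def)
    have "pfree F'" by (rule pfree_iso[OF F F'(1) gr_isomorphic_sym[OF F'(2) bdfD(1)[OF bF] bdfD(1)[OF F'(1)]]])
    then show ?thesis using chr_iso[OF bF F'] by (simp add: pcl_def)
  qed
  show "F' \<in> ic F" if "F' \<in> pcl (chr F)"
    using that pfree_eq[OF F, of F'] by (simp add: pcl_def iso_class_def)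
qed

lemma pcl_nonempty: "u \<in> pos \<Longrightarrow> pcl u \<noteq> {}"
  using pfree_exists[of u] by (auto simp: pcl_def)

lemma pcl_inj: "u \<in> pos \<Longrightarrow> pcl u = pcl v \<Longrightarrow> u = v"
  using pcl_nonempty[of u] by (auto simp: pcl_def)

lemma PS_carrier: "carrier PS = pcl ` pos"
proof -
  have "carrier PS = {ic F | F :: ('k, 'a, 'g) umodule. pfree F}" by (simp add: proj_semiring_def)
  also have "\<dots> = pcl ` pos"
  proof (intro equalityI subsetI)
    fix c assume "c \<in> {ic F | F :: ('k, 'a, 'g) umodule. pfree F}"
    then obtain F :: "('k, 'a, 'g) umodule" where "pfree F" "c = ic F" by blast
    then show "c \<in> pcl ` pos" using pcl_ic[of F] pfree_chr[of F] by simp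
  next
    fix c assume "c \<in> pcl ` pos"
    then obtain u where u: "u \<in> pos" "c = pcl u" by blast
    obtain F :: "('k, 'a, 'g) umodule" where "pfree F" "chr F = u" by (rule pfree_exists[OF u(1)])
    then show "c \<in> {ic F | F :: ('k, 'a, 'g) umodule. pfree F}" using pcl_ic[of F] u(2) by blast
  qed
  finally show ?thesis .
qed

lemma PS_ops:
  "u \<in> pos \<Longrightarrow> v \<in> pos \<Longrightarrow> pcl u \<oplus>\<^bsub>PS\<^esub> pcl v = pcl (u + v)"
  "u \<in> pos \<Longrightarrow> v \<in> pos \<Longrightarrow> pcl u \<otimes>\<^bsub>PS\<^esub> pcl v = pcl (conv u v)"
  "\<one>\<^bsub>PS\<^esub> = pcl unit_fun" "\<zero>\<^bsub>PS\<^esub> = pcl 0"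
proof -
  have s: "ic (sum_gmodule F F') = pcl (u + v)" "ic (tens F F') = pcl (conv u v)" if "F \<in> pcl u" "F' \<in> pcl v" for F F' u v
  proof -
    have p: "pfree F" "pfree F'" "chr F = u" "chr F' = v" using that by (auto simp: pcl_def)
    show "ic (sum_gmodule F F') = pcl (u + v)" using pcl_ic[OF sum_pfree(1)[OF p(1,2)]] sum_pfree(2)[OF p(1,2)] p(3,4) by simp
    show "ic (tens F F') = pcl (conv u v)" using pcl_ic[OF tens_pfree(1)[OF p(1,2)]] tens_pfree(2)[OF p(1,2)] p(3,4) by simp
  qed
  show "pcl u \<oplus>\<^bsub>PS\<^esub> pcl v = pcl (u + v)" "pcl u \<otimes>\<^bsub>PS\<^esub> pcl v = pcl (conv u v)" if "u \<in> pos" "v \<in> pos"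
    using pcl_nonempty that by (auto simp: proj_semiring_def s)
  show "\<one>\<^bsub>PS\<^esub> = pcl unit_fun" using pcl_ic[OF pfree_regular] by (simp add: proj_semiring_def chr_regular)
  show "\<zero>\<^bsub>PS\<^esub> = pcl 0" using pcl_ic[OF pfree_zero(1)] by (simp add: proj_semiring_def pfree_zero(2))
qed

text \<open>The class of the formal difference \<open>w\<close> in the group completion: all pairs
  of classes of projectives whose Euler characteristics differ by \<open>w\<close>.\<close>

definition kcl :: "('g \<Rightarrow> int) \<Rightarrow> (('k, 'a, 'g) umodule set \<times> ('k, 'a, 'g) umodule set) set"
  where "kcl w = {(pcl a, pcl b) | a b. a \<in> pos \<and> b \<in> pos \<and> a - b = w}"

lemma kclE:
  assumes "p \<in> kcl w"
  obtains a b where "p = (pcl a, pcl b)" "a \<in> pos" "b \<in> pos" "a - b = w"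
  using assms unfolding kcl_def by blast

text \<open>Addition of integer functions is cancellative, so the auxiliary summand in the
  completion relation can be removed.\<close>

lemma completion_rel_iff:
  assumes "a \<in> pos" "b \<in> pos" "c \<in> pos" "d \<in> pos"
  shows "((pcl a, pcl b), (pcl c, pcl d)) \<in> completion_rel PS \<longleftrightarrow> a - b = c - d"
proof -
  have "pcl a \<oplus>\<^bsub>PS\<^esub> pcl d \<oplus>\<^bsub>PS\<^esub> pcl e = pcl c \<oplus>\<^bsub>PS\<^esub> pcl b \<oplus>\<^bsub>PS\<^esub> pcl e \<longleftrightarrow> a + d + e = c + b + e" if "e \<in> pos" for e
    using assms that pcl_inj[of "a + d + e" "c + b + e"] by (auto simp: PS_ops pos_add)
  moreover have "a + d + e = c + b + e \<longleftrightarrow> a - b = c - d" for e by (auto simp: algebra_simps)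
  ultimately show ?thesis
    using assms pos_zero unfolding completion_rel_def PS_carrier by auto
qed

lemma completion_class:
  assumes "a \<in> pos" "b \<in> pos"
  shows "completion_rel PS `` {(pcl a, pcl b)} = kcl (a - b)"
proof (intro equalityI subsetI)
  fix p assume p: "p \<in> completion_rel PS `` {(pcl a, pcl b)}"
  then obtain c d where "p = (pcl c, pcl d)" "c \<in> pos" "d \<in> pos"
    unfolding completion_rel_def PS_carrier by blast
  then show "p \<in> kcl (a - b)" using p completion_rel_iff[OF assms, of c d] by (auto simp: kcl_def)
next
  fix p assume "p \<in> kcl (a - b)"
  then obtain c d where "p = (pcl c, pcl d)" "c \<in> pos" "d \<in> pos" "c - d = a - b" by (auto simp: kcl_def)
  then show "p \<in> completion_rel PS `` {(pcl a, pcl b)}" using completion_rel_iff[OF assms, of c d] by simp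
qed

lemma kcl_nonempty:
  assumes "bounded (supp w)" shows "kcl w \<noteq> {}"
proof -
  note s = split_pos[OF assms]
  have "(pcl (\<lambda>g. max 0 (w g)), pcl (\<lambda>g. max 0 (- w g))) \<in> kcl w"
    unfolding kcl_def mem_Collect_eq
    by (rule exI[of _ "\<lambda>g. max 0 (w g)"], rule exI[of _ "\<lambda>g. max 0 (- w g)"], intro conjI refl s(1,2) s(3)[symmetric])
  then show ?thesis by blast
qed

lemma kcl_inj:
  assumes "bounded (supp w)" "kcl w = kcl z" shows "w = z"
proof -
  obtain p where p: "p \<in> kcl w" using kcl_nonempty[OF assms(1)] by blast
  obtain a b where ab: "p = (pcl a, pcl b)" "a \<in> pos" "b \<in> pos" "a - b = w" by (rule kclE[OF p])
  obtain c d where cd: "p = (pcl c, pcl d)" "c \<in> pos" "d \<in> pos" "c - d = z" by (rule kclE[OF p[unfolded assms(2)]])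
  have "a = c" "b = d" using ab(1) cd(1) pcl_inj[OF ab(2)] pcl_inj[OF ab(3)] by auto
  then show ?thesis using ab(4) cd(4) by simp
qed

lemma K_carrier: "carrier (K_BDF k R) = kcl ` carrier euler_ring"
proof -
  have "carrier (K_BDF k R) = {completion_rel PS `` {(pcl a, pcl b)} | a b. a \<in> pos \<and> b \<in> pos}"
    unfolding K_BDF_def group_completion_def Let_def Equiv_Relations.quotient_def PS_carrier by auto
  also have "\<dots> = kcl ` carrier euler_ring"
  proof (intro equalityI subsetI)
    fix X assume "X \<in> {completion_rel PS `` {(pcl a, pcl b)} | a b. a \<in> pos \<and> b \<in> pos}"
    then obtain a b where "a \<in> pos" "b \<in> pos" "X = kcl (a - b)" using completion_class by blast
    then show "X \<in> kcl ` carrier euler_ring" using pos_diff_bounded by simp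
  next
    fix X assume "X \<in> kcl ` carrier euler_ring"
    then obtain w where w: "bounded (supp w)" "X = kcl w" by auto
    note s = split_pos[OF w(1)]
    have "X = completion_rel PS `` {(pcl (\<lambda>g. max 0 (w g)), pcl (\<lambda>g. max 0 (- w g)))}"
      unfolding completion_class[OF s(1,2)] s(3)[symmetric] by (rule w(2))
    then show "X \<in> {completion_rel PS `` {(pcl a, pcl b)} | a b. a \<in> pos \<and> b \<in> pos}" using s(1,2) by blast
  qed
  finally show ?thesis .
qed

lemma K_class_kcl: "pfree F \<Longrightarrow> K_class k R F = kcl (chr F)"
  unfolding K_class_def PS_ops pcl_ic using completion_class[OF pfree_chr pos_zero] by simp

text \<open>The operations are unions over all representatives; every pair of representatives
  contributes the same class, so each union collapses to it.\<close>

lemma K_ops: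
  assumes w: "bounded (supp w)" and z: "bounded (supp z)"
  shows "kcl w \<oplus>\<^bsub>K_BDF k R\<^esub> kcl z = kcl (w + z)" "kcl w \<otimes>\<^bsub>K_BDF k R\<^esub> kcl z = kcl (conv w z)"
proof -
  have "completion_rel PS `` {(fst p \<oplus>\<^bsub>PS\<^esub> fst q, snd p \<oplus>\<^bsub>PS\<^esub> snd q)} = kcl (w + z) \<and>
      completion_rel PS `` {(fst p \<otimes>\<^bsub>PS\<^esub> fst q \<oplus>\<^bsub>PS\<^esub> snd p \<otimes>\<^bsub>PS\<^esub> snd q, fst p \<otimes>\<^bsub>PS\<^esub> snd q \<oplus>\<^bsub>PS\<^esub> snd p \<otimes>\<^bsub>PS\<^esub> fst q)} = kcl (conv w z)"
    if pq: "p \<in> kcl w" "q \<in> kcl z" for p q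
  proof -
    obtain a b where p: "p = (pcl a, pcl b)" and ab: "a \<in> pos" "b \<in> pos" "a - b = w" by (rule kclE[OF pq(1)])
    obtain c d where q: "q = (pcl c, pcl d)" and cd: "c \<in> pos" "d \<in> pos" "c - d = z" by (rule kclE[OF pq(2)])
    note pp = ab(1,2) cd(1,2) pos_add pos_conv
    have bd: "bounded (supp a)" "bounded (supp b)" "bounded (supp c)" "bounded (supp d)" using ab cd by (auto simp: pos_def)
    have "a + c - (b + d) = w + z" unfolding ab(3)[symmetric] cd(3)[symmetric] by (simp add: algebra_simps)
    then have 1: "completion_rel PS `` {(pcl a \<oplus>\<^bsub>PS\<^esub> pcl c, pcl b \<oplus>\<^bsub>PS\<^esub> pcl d)} = kcl (w + z)"
      by (simp add: PS_ops pp completion_class)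
    have "conv w z = conv a z - conv b z" unfolding ab(3)[symmetric] by (rule Q.conv_diff[OF bd(1,2) assms(2)])
    also have "conv a z = conv a c - conv a d" unfolding cd(3)[symmetric] conv_comm[of a] by (rule Q.conv_diff[OF bd(3,4,1)])
    also have "conv b z = conv b c - conv b d" unfolding cd(3)[symmetric] conv_comm[of b] by (rule Q.conv_diff[OF bd(3,4,2)])
    finally have "conv a c + conv b d - (conv a d + conv b c) = conv w z" by (simp add: fun_eq_iff)
    then have 2: "completion_rel PS `` {(pcl a \<otimes>\<^bsub>PS\<^esub> pcl c \<oplus>\<^bsub>PS\<^esub> pcl b \<otimes>\<^bsub>PS\<^esub> pcl d, pcl a \<otimes>\<^bsub>PS\<^esub> pcl d \<oplus>\<^bsub>PS\<^esub> pcl b \<otimes>\<^bsub>PS\<^esub> pcl c)} = kcl (conv w z)"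
      by (simp add: PS_ops pp completion_class)
    show ?thesis unfolding p q using 1 2 by simp
  qed
  note e = this
  show "kcl w \<oplus>\<^bsub>K_BDF k R\<^esub> kcl z = kcl (w + z)"
    unfolding K_BDF_def group_completion_def Let_def ring.simps monoid.simps ring_record_simps
    by (rule SUP_eq_const[OF kcl_nonempty[OF w]], unfold case_prod_unfold, rule SUP_eq_const[OF kcl_nonempty[OF z]])
      (use e in simp)
  show "kcl w \<otimes>\<^bsub>K_BDF k R\<^esub> kcl z = kcl (conv w z)"
    unfolding K_BDF_def group_completion_def Let_def ring.simps monoid.simps ring_record_simps
    by (rule SUP_eq_const[OF kcl_nonempty[OF w]], unfold case_prod_unfold, rule SUP_eq_const[OF kcl_nonempty[OF z]])
      (use e in simp)
qed

lemma K_one_zero: "\<one>\<^bsub>K_BDF k R\<^esub> = kcl unit_fun" "\<zero>\<^bsub>K_BDF k R\<^esub> = kcl 0"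
  using completion_class[OF unit_fun_pos pos_zero] completion_class[OF pos_zero pos_zero]
  by (simp_all add: K_BDF_def group_completion_def Let_def PS_ops)

lemma kcl_iso: "kcl \<in> ring_iso euler_ring (K_BDF k R)"
proof -
  have "inj_on kcl (carrier euler_ring)" by (rule inj_onI) (use kcl_inj in simp)
  then show ?thesis
    unfolding ring_iso_def ring_hom_def by (auto simp: bij_betw_def K_carrier K_ops K_one_zero)
qed

lemma cring_transfer:
  assumes "cring A" "h \<in> ring_iso A B" "h \<zero>\<^bsub>A\<^esub> = \<zero>\<^bsub>B\<^esub>"
  shows "cring (B :: ('x, 'y) ring_scheme)"
  using cring.ring_iso_imp_img_cring[OF assms(1,2)] assms(3) by simp

lemma K_cring: "cring (K_BDF k R)"
  by (rule cring_transfer[OF euler_ring_cring kcl_iso]) (simp add: K_one_zero)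

section \<open>The Serre product\<close>

interpretation GG: comm_group GG
  by (rule GG_comm)

text \<open>The inverse of \<open>chG\<close>: surjectivity comes from \<open>chG_split\<close>,
  uniqueness of the choice from \<open>chG_inj\<close>.\<close>

definition gcl :: "('g \<Rightarrow> int) \<Rightarrow> (('k, 'a, 'g) umodule set \<Rightarrow>\<^sub>0 int) set"
  where "gcl w = (SOME x. x \<in> carrier GG \<and> chG x = w)"

lemma gcl:
  assumes "bounded (supp w)"
  shows "gcl w \<in> carrier GG" "chG (gcl w) = w"
proof -
  obtain P P' :: "('k, 'a, 'g) umodule" where "pfree P" "pfree P'" "chG (gc P \<otimes>\<^bsub>GG\<^esub> inv\<^bsub>GG\<^esub> gc P') = w"
    using chG_split[OF assms] by blast
  then have "\<exists>x. x \<in> carrier GG \<and> chG x = w"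
    by (intro exI[of _ "gc P \<otimes>\<^bsub>GG\<^esub> inv\<^bsub>GG\<^esub> gc P'"]) (simp add: gc_closed)
  from someI_ex[OF this] show "gcl w \<in> carrier GG" "chG (gcl w) = w" unfolding gcl_def by blast+
qed

lemma gcl_chG: "x \<in> carrier GG \<Longrightarrow> gcl (chG x) = x"
  using gcl[OF chG_bounded] chG_inj by blast

lemma gcl_gc: "bdf M \<Longrightarrow> gcl (chr M) = gc M"
  using gcl_chG[OF gc_closed] chG_gc by metis

lemma gcl_add: "bounded (supp w) \<Longrightarrow> bounded (supp z) \<Longrightarrow> gcl (w + z) = gcl w \<otimes>\<^bsub>GG\<^esub> gcl z"
  using gcl_chG[of "gcl w \<otimes>\<^bsub>GG\<^esub> gcl z"] by (simp add: gcl chG_mult)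

text \<open>Convolution transported to \<open>G\<close>. The restrictions to the carrier make it
  extensional, as \<open>serre_product\<close> demands.\<close>

definition smult_G ::
    "(('k, 'a, 'g) umodule set \<Rightarrow>\<^sub>0 int) set \<Rightarrow> (('k, 'a, 'g) umodule set \<Rightarrow>\<^sub>0 int) set
      \<Rightarrow> (('k, 'a, 'g) umodule set \<Rightarrow>\<^sub>0 int) set"
  where "smult_G = (\<lambda>x\<in>carrier GG. \<lambda>y\<in>carrier GG. gcl (conv (chG x) (chG y)))"

lemma smult_G: "x \<in> carrier GG \<Longrightarrow> y \<in> carrier GG \<Longrightarrow> smult_G x y = gcl (conv (chG x) (chG y))"
  by (simp add: smult_G_def)

lemma gcl_iso: "gcl \<in> ring_iso euler_ring (G_ring k R smult_G)"
proof -
  have "bij_betw gcl (carrier euler_ring) (carrier GG)"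
    by (rule bij_betw_byWitness[where f' = chG]) (auto simp: gcl gcl_chG chG_bounded)
  moreover have "gcl unit_fun = gc (regular_module R)"
    using gcl_gc[OF bdf_regular] by (simp add: chr_regular)
  ultimately show ?thesis
    unfolding ring_iso_def ring_hom_def by (auto simp: G_ring_def gcl gcl_add smult_G)
qed

lemma gcl_zero: "gcl 0 = \<one>\<^bsub>GG\<^esub>"
  using gcl_chG[OF GG.one_closed] chG_one by simp

lemma G_cring: "cring (G_ring k R smult_G)"
  by (rule cring_transfer[OF euler_ring_cring gcl_iso]) (simp add: G_ring_def gcl_zero)

text \<open>A module without degrees below \<open>U\<close> has Euler characteristic zero there, by
  cancellation on a down-closed set. Conversely the positive and negative parts of
  \<open>chG x\<close> are realised by projectives, and convolution with \<open>hR\<close> only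
  moves degrees upwards, so these have no degrees below \<open>U\<close>.\<close>

lemma Z_subgroup_iff:
  assumes x: "x \<in> carrier GG"
  shows "x \<in> Z_subgroup k R U \<longleftrightarrow> (\<forall>g\<in>down_closure (Supp R) U. chG x g = 0)"
proof
  let ?D = "down_closure (Supp R) U"
  let ?H = "{x \<in> carrier GG. \<forall>g\<in>?D. chG x g = 0}"
  let ?gens = "{gc M | M :: ('k, 'a, 'g) umodule. bdf M \<and> Supp M \<inter> ?D = {}}"
  have "subgroup ?H GG"
    by (rule GG.subgroupI) (auto simp: chG_inv chG_mult chG_one intro!: exI[of _ "\<one>\<^bsub>GG\<^esub>"])
  moreover have "?gens \<subseteq> ?H"
  proof clarify
    fix M :: "('k, 'a, 'g) umodule" assume M: "bdf M" "Supp M \<inter> ?D = {}"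
    have "chr M g = 0" if "g \<in> ?D" for g
      by (rule chr_vanish_on[OF M(1) down_closure_down _ that]) (use M hilb_eq_0[OF M(1)] in auto)
    then show "gc M \<in> carrier GG \<and> (\<forall>g\<in>?D. chG (gc M) g = 0)" using M(1) by (simp add: gc_closed chG_gc)
  qed
  ultimately have "Z_subgroup k R U \<subseteq> ?H"
    unfolding Z_subgroup_def by (intro GG.generate_subgroup_incl)
  then show "x \<in> Z_subgroup k R U \<Longrightarrow> \<forall>g\<in>?D. chG x g = 0" by blast
  assume 0: "\<forall>g\<in>?D. chG x g = 0"
  obtain P P' :: "('k, 'a, 'g) umodule" where P: "pfree P" "pfree P'"
      "chr P = (\<lambda>g. max 0 (chG x g))" "chr P' = (\<lambda>g. max 0 (- chG x g))" "chG (gc P \<otimes>\<^bsub>GG\<^esub> inv\<^bsub>GG\<^esub> gc P') = chG x"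
    by (rule chG_split[OF chG_bounded[OF x]])
  have disj: "Supp M \<inter> ?D = {}" if M: "bdf M" and z: "\<And>g. g \<in> ?D \<Longrightarrow> chr M g = 0" for M :: "('k, 'a, 'g) umodule"
  proof -
    have "hilb M g = 0" if g: "g \<in> ?D" for g
      unfolding chr_spec(2)[OF M]
    proof (rule Q.conv_vanish_on_down_set[OF _ g])
      fix g v assume "g \<in> ?D" "hR v \<noteq> 0"
      then have "le_monoid (Supp R) (g - v) g" using supp_hilb_regular by (auto simp: supp_def le_monoid_def)
      from down_closure_down[OF \<open>g \<in> ?D\<close> this] show "chr M (g - v) = 0" by (rule z)
    qed
    then show ?thesis using hilb_eq_0[OF M] by blast
  qed
  have "gc P \<in> ?gens" "gc P' \<in> ?gens" using P(1,2) disj[of P] disj[of P'] 0 by (auto simp: P(3,4))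
  then have "gc P \<otimes>\<^bsub>GG\<^esub> inv\<^bsub>GG\<^esub> gc P' \<in> Z_subgroup k R U"
    unfolding Z_subgroup_def by (intro generate.eng generate.incl generate.inv)
  moreover have "gc P \<otimes>\<^bsub>GG\<^esub> inv\<^bsub>GG\<^esub> gc P' = x"
    by (rule chG_inj[OF _ x P(5)]) (simp add: gc_closed P(1,2))
  ultimately show "x \<in> Z_subgroup k R U" by simp
qed

lemma chG_finprod:
  assumes "finite C" "\<And>i. x i \<in> carrier GG"
  shows "finprod GG x C \<in> carrier GG" "chG (finprod GG x C) g = (\<Sum>i\<in>C. chG (x i) g)"
proof -
  have x: "x \<in> A \<rightarrow> carrier GG" for A using assms(2) by blast
  show "finprod GG x C \<in> carrier GG" by (rule GG.finprod_closed[OF x])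
  show "chG (finprod GG x C) g = (\<Sum>i\<in>C. chG (x i) g)"
    using assms(1) by (induction C rule: finite_induct)
      (simp_all add: chG_one GG.finprod_insert[OF _ _ x assms(2)] chG_mult assms(2) GG.finprod_closed[OF x])
qed

text \<open>Convergence becomes agreement of the finite partial sums with the limit on each set
  (-\<infinity>, U], from some finite stage on.\<close>

lemma Z_sums_iff:
  assumes x: "\<And>i. x i \<in> carrier GG" and s: "s \<in> carrier GG"
  shows "Z_sums k R x UNIV s \<longleftrightarrow> (\<forall>U. finite U \<longrightarrow> (\<exists>B. finite B \<and> (\<forall>C. finite C \<and> B \<subseteq> C \<longrightarrow>
    (\<forall>g\<in>down_closure (Supp R) U. chG s g = (\<Sum>i\<in>C. chG (x i) g)))))"
proof -
  have "s \<otimes>\<^bsub>GG\<^esub> inv\<^bsub>GG\<^esub> (finprod GG x C) \<in> Z_subgroup k R U \<longleftrightarrow>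
      (\<forall>g\<in>down_closure (Supp R) U. chG s g = (\<Sum>i\<in>C. chG (x i) g))" if "finite C" for C U
    using chG_finprod[of C x, OF that x] s by (simp add: Z_subgroup_iff chG_mult chG_inv)
  then show ?thesis unfolding Z_sums_def by auto
qed

lemma serre_term:
  fixes M N :: "('k, 'a, 'g) umodule"
  assumes M: "bdf M" and N: "bdf N"
  shows "serre_term k R M N i \<in> carrier GG" "chG (serre_term k R M N i) g = (-1) ^ i * chr (Tor k R i M N) g"
proof -
  note T = Tor_euler(1)[OF M N, of i]
  note c = gc_closed[OF T]
  show "serre_term k R M N i \<in> carrier GG" unfolding serre_term_def by (rule GG.int_pow_closed[OF c])
  show "chG (serre_term k R M N i) g = (-1) ^ i * chr (Tor k R i M N) g"
    using c by (cases "even i") (simp_all add: serre_term_def GG.int_pow_neg chG_inv chG_gc[OF T])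
qed

text \<open>The sum converges since beyond some index no Tor module contributes below
  \<open>U\<close>. Its limit is unique because the sets (-\<infinity>, U] with a single point
  \<open>U\<close> already separate functions.\<close>

lemma serre_sum:
  fixes M N :: "('k, 'a, 'g) umodule"
  assumes M: "bdf M" and N: "bdf N" and s: "s \<in> carrier GG"
  shows "Z_sums k R (serre_term k R M N) UNIV s \<longleftrightarrow> s = smult_G (gc M) (gc N)"
proof -
  let ?t = "\<lambda>j g. (-1) ^ j * chr (Tor k R j M N) g" and ?c = "conv (chr M) (chr N)"
  have euler: "\<exists>n. \<forall>C. finite C \<and> {..<n} \<subseteq> C \<longrightarrow> (\<forall>g\<in>down_closure (Supp R) U. (\<Sum>j\<in>C. ?t j g) = ?c g)"
    if U: "finite U" for U
  proof -
    obtain n where n: "\<And>g j. g \<in> down_closure (Supp R) U \<Longrightarrow> n \<le> j \<Longrightarrow> chr (Tor k R j M N) g = 0"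
        "\<And>g. g \<in> down_closure (Supp R) U \<Longrightarrow> (\<Sum>j<n. ?t j g) = ?c g"
      using Tor_euler(2)[OF M N U] by blast
    have "(\<Sum>j\<in>C. ?t j g) = ?c g" if "finite C" "{..<n} \<subseteq> C" "g \<in> down_closure (Supp R) U" for C g
    proof -
      have "(\<Sum>j\<in>C. ?t j g) = (\<Sum>j<n. ?t j g)"
        using that n(1) by (intro sum.mono_neutral_right) auto
      then show ?thesis using n(2)[OF that(3)] by simp
    qed
    then show ?thesis by blast
  qed
  have g: "gc M \<in> carrier GG" "gc N \<in> carrier GG" by (rule gc_closed[OF M], rule gc_closed[OF N])
  have bc: "bounded (supp ?c)" by (rule Q.bounded_conv[OF chr_spec(1)[OF M] chr_spec(1)[OF N]])
  have "s = smult_G (gc M) (gc N) \<longleftrightarrow> chG s = ?c"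
    unfolding smult_G[OF g] chG_gc[OF M] chG_gc[OF N] by (metis gcl(2)[OF bc] gcl_chG[OF s])
  moreover have "Z_sums k R (serre_term k R M N) UNIV s \<longleftrightarrow> chG s = ?c"
    unfolding Z_sums_iff[of "serre_term k R M N", OF serre_term(1)[OF M N] s] serre_term(2)[OF M N]
  proof
    assume L: "\<forall>U. finite U \<longrightarrow> (\<exists>B. finite B \<and> (\<forall>C. finite C \<and> B \<subseteq> C \<longrightarrow> (\<forall>g\<in>down_closure (Supp R) U. chG s g = (\<Sum>j\<in>C. ?t j g))))"
    show "chG s = ?c"
    proof
      fix g
      have gD: "g \<in> down_closure (Supp R) {g}" by (simp add: down_closure_def Q.le_refl)
      have fin: "finite {g}" by simp
      obtain B where B: "finite B"
          "\<forall>C. finite C \<and> B \<subseteq> C \<longrightarrow> (\<forall>h\<in>down_closure (Supp R) {g}. chG s h = (\<Sum>j\<in>C. ?t j h))"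
        using L[rule_format, OF fin] by (elim exE conjE)
      obtain n where n: "\<forall>C. finite C \<and> {..<n} \<subseteq> C \<longrightarrow> (\<forall>h\<in>down_closure (Supp R) {g}. (\<Sum>j\<in>C. ?t j h) = ?c h)"
        using euler[OF fin] by (elim exE)
      \<comment> \<open>One index set beyond both finite stages: the stage supplied by the assumed
        limit and the stage supplied by the Euler formula.\<close>
      have C: "finite (B \<union> {..<n})" "B \<subseteq> B \<union> {..<n}" "{..<n} \<subseteq> B \<union> {..<n}" using B(1) by auto
      show "chG s g = ?c g"
        using B(2)[rule_format, OF conjI[OF C(1,2)] gD] n[rule_format, OF conjI[OF C(1,3)] gD] by simp
    qed
  next
    assume c: "chG s = ?c"
    show "\<forall>U. finite U \<longrightarrow> (\<exists>B. finite B \<and> (\<forall>C. finite C \<and> B \<subseteq> C \<longrightarrow> (\<forall>g\<in>down_closure (Supp R) U. chG s g = (\<Sum>j\<in>C. ?t j g))))"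
    proof (intro allI impI)
      fix U :: "'g set" assume "finite U"
      then obtain n where "\<forall>C. finite C \<and> {..<n} \<subseteq> C \<longrightarrow> (\<forall>g\<in>down_closure (Supp R) U. (\<Sum>j\<in>C. ?t j g) = ?c g)"
        using euler by blast
      then show "\<exists>B. finite B \<and> (\<forall>C. finite C \<and> B \<subseteq> C \<longrightarrow> (\<forall>g\<in>down_closure (Supp R) U. chG s g = (\<Sum>j\<in>C. ?t j g)))"
        unfolding c by (intro exI[of _ "{..<n}"]) simp
    qed
  qed
  ultimately show ?thesis by blast
qed

lemma serre_product_smult_G: "serre_product k R smult_G"
  unfolding serre_product_def Let_def
proof (intro conjI ballI allI impI)
  have b: "x \<in> carrier GG \<Longrightarrow> bounded (supp (chG x))" for x by (rule chG_bounded)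
  have cl: "smult_G x y \<in> carrier GG" if "x \<in> carrier GG" "y \<in> carrier GG" for x y
    using that by (simp add: smult_G gcl b Q.bounded_conv)
  show "smult_G \<in> carrier GG \<rightarrow>\<^sub>E carrier GG \<rightarrow>\<^sub>E carrier GG"
    using cl by (auto simp: smult_G_def)
  fix x y z assume c: "x \<in> carrier GG" "y \<in> carrier GG" "z \<in> carrier GG"
  show "smult_G (x \<otimes>\<^bsub>GG\<^esub> y) z = smult_G x z \<otimes>\<^bsub>GG\<^esub> smult_G y z"
    using c by (simp add: smult_G chG_mult Q.conv_add gcl_add b Q.bounded_conv)
  have "conv (chG x) (chG y + chG z) = conv (chG x) (chG y) + conv (chG x) (chG z)"
    using c Q.conv_add[OF b b b, of y z x] by (simp add: conv_comm)
  then show "smult_G x (y \<otimes>\<^bsub>GG\<^esub> z) = smult_G x y \<otimes>\<^bsub>GG\<^esub> smult_G x z"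
    using c by (simp add: smult_G chG_mult gcl_add b Q.bounded_conv)
next
  fix M N :: "('k, 'a, 'g) umodule" and s
  assume "bdf M \<and> bdf N" "s \<in> carrier GG"
  then show "Z_sums k R (serre_term k R M N) UNIV s \<longleftrightarrow> s = smult_G (gc M) (gc N)"
    using serre_sum by blast
qed

text \<open>The limits prescribe the product on classes of modules. Every element of
  \<open>G\<close> is a difference of such classes, so biadditivity extends the agreement to one
  argument at a time.\<close>

lemma serre_product_unique:
  assumes m: "serre_product k R m" and m': "serre_product k R m'"
  shows "m = m'"
proof -
  have E: "n \<in> carrier GG \<rightarrow>\<^sub>E carrier GG \<rightarrow>\<^sub>E carrier GG"
    and add: "\<And>x y z. x \<in> carrier GG \<Longrightarrow> y \<in> carrier GG \<Longrightarrow> z \<in> carrier GG \<Longrightarrow> n (x \<otimes>\<^bsub>GG\<^esub> y) z = n x z \<otimes>\<^bsub>GG\<^esub> n y z"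
      "\<And>x y z. x \<in> carrier GG \<Longrightarrow> y \<in> carrier GG \<Longrightarrow> z \<in> carrier GG \<Longrightarrow> n x (y \<otimes>\<^bsub>GG\<^esub> z) = n x y \<otimes>\<^bsub>GG\<^esub> n x z"
    and lim: "\<And>(M :: ('k, 'a, 'g) umodule) (N :: ('k, 'a, 'g) umodule) s. bdf M \<Longrightarrow> bdf N \<Longrightarrow> s \<in> carrier GG \<Longrightarrow>
      Z_sums k R (serre_term k R M N) UNIV s \<longleftrightarrow> s = n (gc M) (gc N)"
    if "serre_product k R n" for n
    using that unfolding serre_product_def Let_def by blast+
  have cl: "n x y \<in> carrier GG" if "serre_product k R n" "x \<in> carrier GG" "y \<in> carrier GG" for n x y
    using E[OF that(1)] that(2,3) by (auto simp: PiE_def Pi_def)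
  have gen: "m (gc M) (gc N) = m' (gc M) (gc N)" if "bdf M" "bdf N" for M N :: "('k, 'a, 'g) umodule"
    using lim[OF m that] lim[OF m' that] cl[OF m gc_closed gc_closed] that by blast
  have left: "m x (gc N) = m' x (gc N)" if x: "x \<in> carrier GG" and N: "bdf N" for x and N :: "('k, 'a, 'g) umodule"
  proof -
    obtain P P' :: "('k, 'a, 'g) umodule" where P: "pfree P" "pfree P'" "x \<otimes>\<^bsub>GG\<^esub> gc P' = gc P" using GG_difference[OF x] by blast
    have c: "gc P' \<in> carrier GG" "gc N \<in> carrier GG" using P N gc_closed by auto
    have "m x (gc N) \<otimes>\<^bsub>GG\<^esub> m (gc P') (gc N) = m' x (gc N) \<otimes>\<^bsub>GG\<^esub> m' (gc P') (gc N)"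
      using add(1)[OF m x c] add(1)[OF m' x c] gen[of P N] P N by simp
    then show ?thesis using gen[of P' N] P(2) N cl[OF m] cl[OF m'] x c by simp
  qed
  have "m x y = m' x y" if x: "x \<in> carrier GG" and y: "y \<in> carrier GG" for x y
  proof -
    obtain P P' :: "('k, 'a, 'g) umodule" where P: "pfree P" "pfree P'" "y \<otimes>\<^bsub>GG\<^esub> gc P' = gc P" using GG_difference[OF y] by blast
    have c: "gc P' \<in> carrier GG" using P gc_closed by auto
    have "m x y \<otimes>\<^bsub>GG\<^esub> m x (gc P') = m' x y \<otimes>\<^bsub>GG\<^esub> m' x (gc P')"
      using add(2)[OF m x y c] add(2)[OF m' x y c] left[OF x, of P] P by simp
    then show ?thesis using left[OF x, of P'] P(2) cl[OF m] cl[OF m'] x y c by simp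
  qed
  then have "m x = m' x" if "x \<in> carrier GG" for x
    using PiE_ext[OF PiE_mem[OF E[OF m] that] PiE_mem[OF E[OF m'] that]] that by blast
  then show ?thesis
    by (rule PiE_ext[OF E[OF m] E[OF m']])
qed

text \<open>The two identifications with \<open>euler_ring\<close> are composed; the class of a
  projective module passes through its Euler characteristic on both sides.\<close>

lemma K_G_iso:
  "\<exists>\<phi>. \<phi> \<in> iso (add_monoid (K_BDF k R)) (add_monoid (G_ring k R smult_G)) \<and>
    (\<forall>F :: ('k, 'a, 'g) umodule. bdf F \<and> projective R F \<longrightarrow> \<phi> (K_class k R F) = gc F) \<and>
    \<phi> \<in> ring_hom (K_BDF k R) (G_ring k R smult_G)"
proof -
  interpret W: cring euler_ring by (rule euler_ring_cring)
  define \<phi> where "\<phi> = gcl \<circ> inv_into (carrier euler_ring) kcl"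
  have \<phi>: "\<phi> \<in> ring_iso (K_BDF k R) (G_ring k R smult_G)"
    unfolding \<phi>_def by (rule ring_iso_set_trans[OF ring_iso_set_sym[OF W.ring_axioms kcl_iso] gcl_iso])
  have "\<phi> (K_class k R F) = gc F" if F: "pfree F" for F :: "('k, 'a, 'g) umodule"
  proof -
    have "inj_on kcl (carrier euler_ring)" using kcl_iso by (simp add: ring_iso_def bij_betw_def)
    then have "inv_into (carrier euler_ring) kcl (kcl (chr F)) = chr F"
      using chr_spec(1)[of F] F by simp
    then show ?thesis unfolding \<phi>_def K_class_kcl[OF F] comp_def using gcl_gc[of F] F by simp
  qed
  moreover have "\<phi> \<in> iso (add_monoid (K_BDF k R)) (add_monoid (G_ring k R smult_G))"
    using \<phi> by (auto simp: ring_iso_def ring_hom_def iso_def hom_def)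
  moreover have "\<phi> \<in> ring_hom (K_BDF k R) (G_ring k R smult_G)" using \<phi> by (simp add: ring_iso_def)
  ultimately show ?thesis by blast
qed

end

theorem corollary7:
  fixes k :: "'k ring"
    and R :: "('k, 'a, 'g::ab_group_add) gmodule"
    and r :: "nat \<Rightarrow> 'a"
  assumes "field k"
    and "PDCF k R"
    and "domain R"
    and "regular_sequence R r"
    and "\<forall>i. \<exists>g. r i \<in> hcomp R g"
    and "Idl\<^bsub>R\<^esub> (range r) = irrelevant_ideal k R"
  shows "\<exists>m. serre_product k R m \<and>
    (\<forall>m'. serre_product k R m' \<longrightarrow> m' = m) \<and>
    cring (G_ring k R m) \<and>
    cring (K_BDF k R) \<and>
    (\<exists>\<phi>. \<phi> \<in> iso (add_monoid (K_BDF k R)) (add_monoid (G_ring k R m)) \<and>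
      (\<forall>F :: ('k, 'a, 'g) umodule. BDF k R F \<and> projective R F \<longrightarrow>
        \<phi> (K_class k R F) = G_class k R F) \<and>
      \<phi> \<in> ring_hom (K_BDF k R) (G_ring k R m))"
proof -
  interpret pdcf k R by (rule pdcf.intro[OF assms(1-3)])
  show ?thesis
    using serre_product_smult_G serre_product_unique G_cring K_cring K_G_iso by blast
qed

end
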